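(* Let $c>0$. Let $T>0$ and let $(\rho^E,u^E)$ be the smooth solution on $[0,T]\times\overline\Omega$ of the compressible Euler system $$\partial_t\rho^E+\operatorname{div}(\rho^E u^E)=0,\qquad \partial_t(\rho^E u^E)+\operatorname{div}(\rho^E u^E\otimes u^E)+\nabla_x p(\rho^E)=0,\qquad u^E\cdot n|_{\partial\Omega}=0,$$ associated with smooth compatible initial data $(\rho^E_0,u^E_0)$ such that $0<\inf_\Omega\rho^E_0$ and $\sup_\Omega\rho^E_0<\infty$, with $0<\inf_{(0,T)\times\Omega}\rho^E$ and $\sup_{(0,T)\times\Omega}\rho^E<\infty$. For every $\varepsilon\in(0,1)$ let $(\rho_0,u_0)=(\rho_0^\varepsilon,u_0^\varepsilon)$ be initial data such that $\rho_0\ge 0$, $\rho_0\in L^\gamma(\Omega)$, $\rho_0|u_0|^2\in L^1(\Omega)$, and let $(\rho,u)=(\rho^\varepsilon,u^\varepsilon)$ be an associated finite energy weak solution on $[0,T]$ of the compressible Navier-Stokes system with scaling factor $\varepsilon$ and no-slip condition (as defined in the context). Assume that $$\|\rho_0-\rho^E_0\|_{L^\gamma(\Omega)}+\int_\Omega\rho_0|u_0-u^E_0|^2\,dx\to0\quad\text{when }\varepsilon\to0,$$ and moreover that $$\varepsilon\int_{(0,T)\times\Gamma_{c\varepsilon}}\Big(\frac{\rho|u|^2}{d_\Omega^2}+\frac{\rho^2(u\cdot n)^2}{d_\Omega^2}+|\nabla_x u|^2\Big)\,dx\,dt\to0\quad\text{when }\varepsilon\to0.$$ Then $$\sup_{t\in(0,T)}\Big(\|\rho-\rho^E\|_{L^\gamma(\Omega)}+\int_\Omega\rho|u-u^E|^2\,dx\Big)(t)\to0\quad\text{when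 }\varepsilon\to0.$$
   Context: $\Omega\subset\mathbb{R}^3$ is a bounded regular (smooth) domain, and $n$ is the unit outward normal on $\partial\Omega$. $d_\Omega(x):=\operatorname{dist}(x,\partial\Omega)$ and $\Gamma_\delta:=\{x\in\Omega: d_\Omega(x)<\delta\}$. For $\delta$ small enough, $d_\Omega$ is smooth near the boundary, and in $\Gamma_\delta$ the vector $n$ denotes the extension of the normal given by $n=-\nabla d_\Omega$. The pressure is $p(\rho)=\rho^\gamma$ with a fixed $\gamma>\frac32$. The viscosity coefficients are fixed constants $\mu>0$, $\eta\ge0$, and $$\mathbb{S}(\nabla_x u):=\mu\Big(\nabla_x u+(\nabla_x u)^T-\tfrac23(\operatorname{div}u)\operatorname{Id}\Big)+\eta(\operatorname{div}u)\operatorname{Id},$$ where $\nabla_x u$ is the Jacobian matrix of $u$. The compressible Navier-Stokes system is $$\partial_t\rho+\operatorname{div}(\rho u)=0,\qquad \partial_t(\rho u)+\operatorname{div}(\rho u\otimes u)+\nabla_x p(\rho)=\varepsilon\operatorname{div}\mathbb{S}(\nabla_x u),$$ with no-slip condition $u|_{\partial\Omega}=0$ and initial conditions $\rho|_{t=0}=\rho_0$, $(\rho u)|_{t=0}=\rho_0u_0$. Energy: $\mathcal{E}(\rho,u):=\int_\Omega\big(\frac12\rho|u|^2+H(\rho)\big)dx$ with $H(\rho):=\frac{\rho^\gamma}{\gamma-1}$. Finite energy weak solution (no-slip). Given $(\rho_0,u_0)$ with $\rho_0\ge0$, $\rho_0\in L^\gamma(\Omega)$, $\rho_0|u_0|^2\in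 L^1(\Omega)$, let $q_0:=\rho_0u_0\in L^{\frac{2\gamma}{\gamma+1}}(\Omega)$. A pair $(\rho,u)$, with $\rho\ge 0$, is a finite energy weak solution on $[0,T]$ associated to $(\rho_0,u_0)$ if: (i) $\rho\in C_w([0,T];L^\gamma(\Omega))$, $\rho u\in C_w([0,T];L^{\frac{2\gamma}{\gamma+1}}(\Omega))$, $u\in L^2(0,T;H^1_0(\Omega))$, $\rho|u|^2\in C_w([0,T];L^1(\Omega))$ ($C_w$ means continuous in time for the weak topology); (ii) $\int_\Omega\rho(T,\cdot)\phi(T,\cdot)dx-\int_\Omega\rho_0\phi(0,\cdot)dx=\int_0^T\int_\Omega(\rho\,\partial_t\phi+\rho u\cdot\nabla_x\phi)\,dx\,dt$ for all $\phi\in C^\infty_c([0,T]\times\overline\Omega;\mathbb{R})$; (iii) $\int_\Omega\rho(T,\cdot)u(T,\cdot)\cdot\phi(T,\cdot)dx-\int_\Omega q_0\cdot\phi(0,\cdot)dx=\int_0^T\int_\Omega\big(\rho u\cdot\partial_t\phi+\rho u\otimes u:\nabla_x\phi+p(\rho)\operatorname{div}\phi-\varepsilon\mathbb{S}(\nabla_xu):\nabla_x\phi\big)dx\,dt$ for all $\phi\in C^\infty_c([0,T]\times\Omega;\mathbb{R}^3)$; (iv) for almost every $\tau\in[0,T]$, $\mathcal{E}(\rho(\tau,\cdot),u(\tau,\cdot))+\varepsilon\int_0^\tau\int_\Omega\mathbb{S}(\nabla_xu):\nabla_xu\,dx\,dt\le\mathcal{E}(\rho_0,u_0)$. "Compatible"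 initial data for Euler means that the data satisfy the conditions on $\partial\Omega$ that are necessary for the existence of a smooth solution up to $t=0$. *)

theory Defs
  imports "HOL-Analysis.Analysis" "HOL-Library.Landau_Symbols"
begin

text \<open>\<open>Ck_on k U f\<close> is meant for open \<open>U\<close>.\<close>

primrec Ck_on ::
  "nat \<Rightarrow> 'a::real_normed_vector set \<Rightarrow> ('a \<Rightarrow> 'b::real_normed_vector) \<Rightarrow> bool" where
  "Ck_on 0 U f \<longleftrightarrow> continuous_on U f"
| "Ck_on (Suc k) U f \<longleftrightarrow>
     (\<forall>x\<in>U. f differentiable (at x)) \<and>
     (\<forall>v. Ck_on k U (\<lambda>x. frechet_derivative f (at x) v))"

text \<open>On a set that need not be open, smooth means: restriction of a smooth function on an
  open neighbourhood. On the closure of a domain this is smoothness up to the boundary.\<close>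

definition smooth_on :: "'a::real_normed_vector set \<Rightarrow> ('a \<Rightarrow> 'b::real_normed_vector) \<Rightarrow> bool" where
  "smooth_on S f \<longleftrightarrow>
     (\<exists>U g. open U \<and> S \<subseteq> U \<and> (\<forall>k. Ck_on k U g) \<and> (\<forall>x\<in>S. g x = f x))"

definition grad :: "(real^3 \<Rightarrow> real) \<Rightarrow> real^3 \<Rightarrow> real^3" where
  "grad f x = (\<chi> j. frechet_derivative f (at x) (axis j 1))"

definition divergence :: "(real^3 \<Rightarrow> real^3) \<Rightarrow> real^3 \<Rightarrow> real" where
  "divergence v x = trace (jacobian v (at x))"

definition tensor_div :: "(real^3 \<Rightarrow> real^3^3) \<Rightarrow> real^3 \<Rightarrow> real^3" where
  "tensor_div F x = (\<chi> i. divergence (\<lambda>y. F y $ i) x)"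

definition outer :: "real^3 \<Rightarrow> real^3 \<Rightarrow> real^3^3" where
  "outer a b = (\<chi> i j. a $ i * b $ j)"

definition local_defining_function ::
  "(real^3) set \<Rightarrow> (real^3) set \<Rightarrow> (real^3 \<Rightarrow> real) \<Rightarrow> bool" where
  "local_defining_function \<Omega> U g \<longleftrightarrow>
     open U \<and> smooth_on U g \<and> (\<forall>x\<in>U. grad g x \<noteq> 0) \<and> \<Omega> \<inter> U = {x\<in>U. g x < 0}"

definition smooth_bounded_domain :: "(real^3) set \<Rightarrow> bool" where
  "smooth_bounded_domain \<Omega> \<longleftrightarrow>
     open \<Omega> \<and> connected \<Omega> \<and> \<Omega> \<noteq> {} \<and> bounded \<Omega> \<and>
     (\<forall>p\<in>frontier \<Omega>. \<exists>U g. p \<in> U \<and> local_defining_function \<Omega> U g)"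

definition outward_normal :: "(real^3) set \<Rightarrow> real^3 \<Rightarrow> real^3" where
  "outward_normal \<Omega> p =
     (THE \<nu>. \<exists>U g. p \<in> U \<and> local_defining_function \<Omega> U g \<and> \<nu> = sgn (grad g p))"

definition bdist :: "(real^3) set \<Rightarrow> real^3 \<Rightarrow> real" where
  "bdist \<Omega> x = infdist x (frontier \<Omega>)"

definition boundary_layer :: "(real^3) set \<Rightarrow> real \<Rightarrow> (real^3) set" where
  "boundary_layer \<Omega> \<delta> = {x\<in>\<Omega>. bdist \<Omega> x < \<delta>}"

text \<open>The extension of the normal to a thin boundary layer; it has no meaning away from
  the region where the distance function is differentiable.\<close>

definition normal_ext :: "(real^3) set \<Rightarrow> real^3 \<Rightarrow> real^3" where
  "normal_ext \<Omega> x = - grad (bdist \<Omega>) x"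

definition in_Lp ::
  "real \<Rightarrow> 'a::euclidean_space set \<Rightarrow> ('a \<Rightarrow> 'b::euclidean_space) \<Rightarrow> bool" where
  "in_Lp p S f \<longleftrightarrow>
     f \<in> borel_measurable (lebesgue_on S) \<and>
     integrable (lebesgue_on S) (\<lambda>x. norm (f x) powr p)"

definition Lp_norm ::
  "real \<Rightarrow> 'a::euclidean_space set \<Rightarrow> ('a \<Rightarrow> 'b::euclidean_space) \<Rightarrow> real" where
  "Lp_norm p S f = (LINT x|lebesgue_on S. norm (f x) powr p) powr (1 / p)"

text \<open>Continuous linear functionals on the space of \<open>p\<close>-integrable functions. The bound
  makes them insensitive to changes on null sets.\<close>

definition Lp_functional ::
  "real \<Rightarrow> 'a::euclidean_space set \<Rightarrow> (('a \<Rightarrow> 'b::euclidean_space) \<Rightarrow> real) \<Rightarrow> bool" where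
  "Lp_functional p S l \<longleftrightarrow>
     (\<forall>f g. in_Lp p S f \<longrightarrow> in_Lp p S g \<longrightarrow> l (\<lambda>x. f x + g x) = l f + l g) \<and>
     (\<forall>a f. in_Lp p S f \<longrightarrow> l (\<lambda>x. a *\<^sub>R f x) = a * l f) \<and>
     (\<exists>C. \<forall>f. in_Lp p S f \<longrightarrow> \<bar>l f\<bar> \<le> C * Lp_norm p S f)"

definition weakly_continuous_Lp ::
  "real \<Rightarrow> real \<Rightarrow> 'a::euclidean_space set \<Rightarrow> (real \<Rightarrow> 'a \<Rightarrow> 'b::euclidean_space) \<Rightarrow> bool" where
  "weakly_continuous_Lp p T S f \<longleftrightarrow>
     (\<forall>t\<in>{0..T}. in_Lp p S (f t)) \<and>
     (\<forall>l. Lp_functional p S l \<longrightarrow> continuous_on {0..T} (\<lambda>t. l (f t)))"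

definition test_function ::
  "'a::euclidean_space set \<Rightarrow> ('a \<Rightarrow> 'b::euclidean_space) \<Rightarrow> bool" where
  "test_function S \<phi> \<longleftrightarrow>
     smooth_on S \<phi> \<and> (\<exists>K. compact K \<and> K \<subseteq> S \<and> (\<forall>x\<in>S - K. \<phi> x = 0))"

text \<open>\<open>G $ i $ j\<close> is the weak partial derivative of \<open>v $ i\<close> in direction \<open>j\<close>, the layout of
  \<open>jacobian\<close>.\<close>

definition weak_jacobian ::
  "(real^3) set \<Rightarrow> (real^3 \<Rightarrow> real^3) \<Rightarrow> (real^3 \<Rightarrow> real^3^3) \<Rightarrow> bool" where
  "weak_jacobian \<Omega> v G \<longleftrightarrow>
     (\<forall>K. compact K \<and> K \<subseteq> \<Omega> \<longrightarrow>
        integrable (lebesgue_on K) v \<and> integrable (lebesgue_on K) G) \<and>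
     (\<forall>\<psi> i j. test_function \<Omega> \<psi> \<longrightarrow>
        (LINT x|lebesgue_on \<Omega>. v x $ i * grad \<psi> x $ j) =
        - (LINT x|lebesgue_on \<Omega>. G x $ i $ j * \<psi> x))"

text \<open>\<open>v\<close> belongs to the closure of the test functions in the Sobolev space of square
  integrable fields with square integrable weak Jacobian, and \<open>G\<close> is its weak Jacobian.\<close>

definition H10_with_jacobian ::
  "(real^3) set \<Rightarrow> (real^3 \<Rightarrow> real^3) \<Rightarrow> (real^3 \<Rightarrow> real^3^3) \<Rightarrow> bool" where
  "H10_with_jacobian \<Omega> v G \<longleftrightarrow>
     in_Lp 2 \<Omega> v \<and> in_Lp 2 \<Omega> G \<and> weak_jacobian \<Omega> v G \<and>
     (\<exists>\<phi>. (\<forall>n. test_function \<Omega> (\<phi> n)) \<and>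
        (\<lambda>n. Lp_norm 2 \<Omega> (\<lambda>x. \<phi> n x - v x)) \<longlonglongrightarrow> 0 \<and>
        (\<lambda>n. Lp_norm 2 \<Omega> (\<lambda>x. jacobian (\<phi> n) (at x) - G x)) \<longlonglongrightarrow> 0)"

text \<open>Membership in \<open>L\<^sup>2(0,T;H\<^sup>1\<^sub>0(\<Omega>))\<close>, together with a jointly measurable version of the
  spatial weak Jacobian.\<close>

definition L2_H10_with_jacobian ::
  "real \<Rightarrow> (real^3) set \<Rightarrow> (real \<Rightarrow> real^3 \<Rightarrow> real^3) \<Rightarrow> (real \<Rightarrow> real^3 \<Rightarrow> real^3^3) \<Rightarrow> bool" where
  "L2_H10_with_jacobian T \<Omega> u G \<longleftrightarrow>
     in_Lp 2 ({0<..<T} \<times> \<Omega>) (\<lambda>(t, x). u t x) \<and>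
     in_Lp 2 ({0<..<T} \<times> \<Omega>) (\<lambda>(t, x). G t x) \<and>
     (AE t in lebesgue_on {0<..<T}. H10_with_jacobian \<Omega> (u t) (G t))"

definition in_L2_H10 :: "real \<Rightarrow> (real^3) set \<Rightarrow> (real \<Rightarrow> real^3 \<Rightarrow> real^3) \<Rightarrow> bool" where
  "in_L2_H10 T \<Omega> u \<longleftrightarrow> (\<exists>G. L2_H10_with_jacobian T \<Omega> u G)"

text \<open>The spatial Jacobian of such a field, unique up to null sets of \<open>(0,T) \<times> \<Omega>\<close>.\<close>

definition nabla_x ::
  "real \<Rightarrow> (real^3) set \<Rightarrow> (real \<Rightarrow> real^3 \<Rightarrow> real^3) \<Rightarrow> real \<Rightarrow> real^3 \<Rightarrow> real^3^3" where
  "nabla_x T \<Omega> u = (SOME G. L2_H10_with_jacobian T \<Omega> u G)"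

definition pressure :: "real \<Rightarrow> real \<Rightarrow> real" where
  "pressure \<gamma> r = r powr \<gamma>"

definition stress :: "real \<Rightarrow> real \<Rightarrow> real^3^3 \<Rightarrow> real^3^3" where
  "stress \<mu> \<eta> A =
     \<mu> *\<^sub>R (A + transpose A - (2/3 * trace A) *\<^sub>R mat 1) + (\<eta> * trace A) *\<^sub>R mat 1"

definition energy ::
  "real \<Rightarrow> (real^3) set \<Rightarrow> (real^3 \<Rightarrow> real) \<Rightarrow> (real^3 \<Rightarrow> real^3) \<Rightarrow> real" where
  "energy \<gamma> \<Omega> r v =
     (LINT x|lebesgue_on \<Omega>. 1/2 * r x * (norm (v x))\<^sup>2 + r x powr \<gamma> / (\<gamma> - 1))"

definition finite_energy_data ::
  "real \<Rightarrow> (real^3) set \<Rightarrow> (real^3 \<Rightarrow> real) \<Rightarrow> (real^3 \<Rightarrow> real^3) \<Rightarrow> bool" where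
  "finite_energy_data \<gamma> \<Omega> \<rho>0 u0 \<longleftrightarrow>
     (AE x in lebesgue_on \<Omega>. 0 \<le> \<rho>0 x) \<and>
     in_Lp \<gamma> \<Omega> \<rho>0 \<and>
     u0 \<in> borel_measurable (lebesgue_on \<Omega>) \<and>
     in_Lp 1 \<Omega> (\<lambda>x. \<rho>0 x * (norm (u0 x))\<^sup>2) \<and>
     in_Lp (2 * \<gamma> / (\<gamma> + 1)) \<Omega> (\<lambda>x. \<rho>0 x *\<^sub>R u0 x)"

text \<open>Double contraction of matrices is the inner product of \<^typ>\<open>real^3^3\<close>. The test functions
  in the continuity equation need no support condition, since \<open>[0,T] \<times> closure \<Omega>\<close> is compact.\<close>

definition finite_energy_weak_solution ::
  "real \<Rightarrow> real \<Rightarrow> real \<Rightarrow> real \<Rightarrow> real \<Rightarrow> (real^3) set \<Rightarrow>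
   (real^3 \<Rightarrow> real) \<Rightarrow> (real^3 \<Rightarrow> real^3) \<Rightarrow>
   (real \<Rightarrow> real^3 \<Rightarrow> real) \<Rightarrow> (real \<Rightarrow> real^3 \<Rightarrow> real^3) \<Rightarrow> bool" where
  "finite_energy_weak_solution \<gamma> \<mu> \<eta> \<epsilon> T \<Omega> \<rho>0 u0 \<rho> u \<longleftrightarrow>
     (\<forall>t\<in>{0..T}. AE x in lebesgue_on \<Omega>. 0 \<le> \<rho> t x) \<and>
     (\<lambda>(t, x). \<rho> t x) \<in> borel_measurable (lebesgue_on ({0<..<T} \<times> \<Omega>)) \<and>
     weakly_continuous_Lp \<gamma> T \<Omega> \<rho> \<and>
     weakly_continuous_Lp (2 * \<gamma> / (\<gamma> + 1)) T \<Omega> (\<lambda>t x. \<rho> t x *\<^sub>R u t x) \<and>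
     in_L2_H10 T \<Omega> u \<and>
     weakly_continuous_Lp 1 T \<Omega> (\<lambda>t x. \<rho> t x * (norm (u t x))\<^sup>2) \<and>
     (\<forall>\<phi> :: real \<Rightarrow> real^3 \<Rightarrow> real.
        smooth_on ({0..T} \<times> closure \<Omega>) (\<lambda>(t, x). \<phi> t x) \<longrightarrow>
        (LINT x|lebesgue_on \<Omega>. \<rho> T x * \<phi> T x) - (LINT x|lebesgue_on \<Omega>. \<rho>0 x * \<phi> 0 x) =
        (LINT (t, x)|lebesgue_on ({0<..<T} \<times> \<Omega>).
           \<rho> t x * vector_derivative (\<lambda>s. \<phi> s x) (at t) +
           (\<rho> t x *\<^sub>R u t x) \<bullet> grad (\<phi> t) x)) \<and>
     (\<forall>\<phi> :: real \<Rightarrow> real^3 \<Rightarrow> real^3.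
        test_function ({0..T} \<times> \<Omega>) (\<lambda>(t, x). \<phi> t x) \<longrightarrow>
        (LINT x|lebesgue_on \<Omega>. (\<rho> T x *\<^sub>R u T x) \<bullet> \<phi> T x) -
        (LINT x|lebesgue_on \<Omega>. (\<rho>0 x *\<^sub>R u0 x) \<bullet> \<phi> 0 x) =
        (LINT (t, x)|lebesgue_on ({0<..<T} \<times> \<Omega>).
           (\<rho> t x *\<^sub>R u t x) \<bullet> vector_derivative (\<lambda>s. \<phi> s x) (at t) +
           (\<rho> t x *\<^sub>R outer (u t x) (u t x)) \<bullet> jacobian (\<phi> t) (at x) +
           pressure \<gamma> (\<rho> t x) * divergence (\<phi> t) x -
           \<epsilon> * (stress \<mu> \<eta> (nabla_x T \<Omega> u t x) \<bullet> jacobian (\<phi> t) (at x)))) \<and>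
     (AE \<tau> in lebesgue_on {0..T}.
        energy \<gamma> \<Omega> (\<rho> \<tau>) (u \<tau>) +
        \<epsilon> * (LINT (t, x)|lebesgue_on ({0<..<\<tau>} \<times> \<Omega>).
               stress \<mu> \<eta> (nabla_x T \<Omega> u t x) \<bullet> nabla_x T \<Omega> u t x)
        \<le> energy \<gamma> \<Omega> \<rho>0 u0)"

definition mass_residual ::
  "(real \<Rightarrow> real^3 \<Rightarrow> real) \<Rightarrow> (real \<Rightarrow> real^3 \<Rightarrow> real^3) \<Rightarrow> real \<Rightarrow> real^3 \<Rightarrow> real" where
  "mass_residual \<rho> u t x =
     vector_derivative (\<lambda>s. \<rho> s x) (at t) + divergence (\<lambda>y. \<rho> t y *\<^sub>R u t y) x"

definition momentum_residual ::
  "real \<Rightarrow> (real \<Rightarrow> real^3 \<Rightarrow> real) \<Rightarrow> (real \<Rightarrow> real^3 \<Rightarrow> real^3) \<Rightarrow> real \<Rightarrow> real^3 \<Rightarrow> real^3" where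
  "momentum_residual \<gamma> \<rho> u t x =
     vector_derivative (\<lambda>s. \<rho> s x *\<^sub>R u s x) (at t) +
     tensor_div (\<lambda>y. \<rho> t y *\<^sub>R outer (u t y) (u t y)) x +
     grad (\<lambda>y. pressure \<gamma> (\<rho> t y)) x"

text \<open>The equations are imposed at interior points, where two-sided derivatives make sense;
  smoothness up to the boundary extends them to \<open>[0,T] \<times> closure \<Omega>\<close>.\<close>

definition smooth_euler_solution ::
  "real \<Rightarrow> real \<Rightarrow> (real^3) set \<Rightarrow>
   (real \<Rightarrow> real^3 \<Rightarrow> real) \<Rightarrow> (real \<Rightarrow> real^3 \<Rightarrow> real^3) \<Rightarrow> bool" where
  "smooth_euler_solution \<gamma> T \<Omega> \<rho> u \<longleftrightarrow>
     smooth_on ({0..T} \<times> closure \<Omega>) (\<lambda>(t, x). \<rho> t x) \<and>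
     smooth_on ({0..T} \<times> closure \<Omega>) (\<lambda>(t, x). u t x) \<and>
     (\<forall>t\<in>{0<..<T}. \<forall>x\<in>\<Omega>. mass_residual \<rho> u t x = 0) \<and>
     (\<forall>t\<in>{0<..<T}. \<forall>x\<in>\<Omega>. momentum_residual \<gamma> \<rho> u t x = 0) \<and>
     (\<forall>t\<in>{0..T}. \<forall>x\<in>frontier \<Omega>. u t x \<bullet> outward_normal \<Omega> x = 0)"

text \<open>Compatibility to every order: when the time derivatives at \<open>t = 0\<close> are computed from the
  data by differentiating the equations, \<open>u \<bullet> n\<close> vanishes on the boundary with all of them.
  A smooth pair starting from the data whose residuals are \<open>O(t^k)\<close> has the computed time
  derivatives up to order \<open>k\<close> (for positive density), and vanishing of the derivatives of
  \<open>u \<bullet> n\<close> up to order \<open>k\<close> is the bound \<open>O(t^(k+1))\<close>.\<close>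

definition euler_compatible ::
  "real \<Rightarrow> (real^3) set \<Rightarrow> (real^3 \<Rightarrow> real) \<Rightarrow> (real^3 \<Rightarrow> real^3) \<Rightarrow> bool" where
  "euler_compatible \<gamma> \<Omega> \<rho>0 u0 \<longleftrightarrow>
     (\<forall>k. \<exists>\<tau>>0. \<exists>\<rho> u.
        smooth_on ({0..\<tau>} \<times> closure \<Omega>) (\<lambda>(t, x). \<rho> t x) \<and>
        smooth_on ({0..\<tau>} \<times> closure \<Omega>) (\<lambda>(t, x). u t x) \<and>
        (\<forall>x\<in>closure \<Omega>. \<rho> 0 x = \<rho>0 x \<and> u 0 x = u0 x) \<and>
        (\<forall>x\<in>\<Omega>. (\<lambda>t. mass_residual \<rho> u t x) \<in> O[at_right 0](\<lambda>t. t ^ k)) \<and>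
        (\<forall>x\<in>\<Omega>. (\<lambda>t. norm (momentum_residual \<gamma> \<rho> u t x)) \<in> O[at_right 0](\<lambda>t. t ^ k)) \<and>
        (\<forall>x\<in>frontier \<Omega>.
           (\<lambda>t. u t x \<bullet> outward_normal \<Omega> x) \<in> O[at_right 0](\<lambda>t. t ^ (k + 1))))"

lemma smooth_euler_solution_compatible:
  assumes sol: "smooth_euler_solution \<gamma> T \<Omega> \<rho> u" and T: "T > 0"
    and init: "\<And>x. x \<in> closure \<Omega> \<Longrightarrow> \<rho> 0 x = \<rho>0 x \<and> u 0 x = u0 x"
  shows "euler_compatible \<gamma> \<Omega> \<rho>0 u0"
proof -
  have ev: "eventually (\<lambda>t. t \<in> {0<..<T}) (at_right 0)"
    using T by (simp add: eventually_at_right_field) (use T in blast)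
  have O: "f \<in> O[at_right 0](g)" if "\<And>t. t \<in> {0<..<T} \<Longrightarrow> f t = 0" for f g :: "real \<Rightarrow> real"
  proof -
    have "eventually (\<lambda>t. f t = 0) (at_right 0)"
      using ev by eventually_elim (use that in auto)
    then show ?thesis
      by (subst landau_o.big.in_cong[where g = "\<lambda>_. 0"]) auto
  qed
  show ?thesis
    unfolding euler_compatible_def
    apply (intro allI exI[of _ T] conjI exI[of _ \<rho>] exI[of _ u] ballI O)
    using sol init T unfolding smooth_euler_solution_def by auto
qed

end

theory Submission
  imports Defs "HOL-Computational_Algebra.Polynomial"
begin

text \<open>The relative energy of a weak solution with respect to the Euler flow is controlled by testing
  the momentum equation with a multiple \<open>\<theta>(t) \<xi>(x) V(t, x)\<close> of the Euler velocity, where \<open>\<xi>\<close> vanishes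
  near the boundary and equals one outside a layer whose thickness is a multiple of the
  viscosity. Since \<open>V\<close> is tangential at the boundary and \<open>\<xi>\<close> is a function of a smooth boundary
  defining function, the gradient of \<open>\<xi>\<close> is of the order of the inverse viscosity but \<open>V \<bullet> \<nabla>\<xi>\<close> stays bounded.
  The terms that see the cutoff are therefore bounded by the dissipation in the layer and by the kinetic
  energy there divided by the square of the distance, both of which vanish in the limit by
  hypothesis. The remaining terms form a Gronwall inequality, used with the integrating factor in
  \<open>\<theta>\<close>. It holds for every time because the relative energy is lower semicontinuous.\<close>

subsection \<open>Smooth functions\<close>

text \<open>The obstacle is a mismatch at the boundary: \<open>u\<close> vanishes there while
  \<open>V\<close> is only tangential, and the momentum equation admits only test fields with
  compact support. A cutoff at distance of order \<nu> balances its two costs. Convection costs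
  \<rho>|u|^2/\<nu> in the layer, at most c^2 \<nu> \<rho>|u|^2/d^2 because d < c \<nu> there. The
  viscous term pairs \<nu> times the stress with a gradient of order 1/\<nu> on a set of volume
  O(\<nu>); Young's inequality with a free small parameter \<open>a\<close> bounds it by the layer
  dissipation over \<open>a\<close> plus a multiple of \<open>a\<close>. The distance function is
  smooth only near the boundary. Its place is taken by a finite sum of local defining functions and
  bumps that keeps what the cutoff needs: a lower bound by the distance, a normal gradient at the
  boundary, and sublevel sets of volume O(\<delta>). The energy inequality holds at almost every
  time and is not differentiated in time, so the energy enters integrated against -\<theta>'. Since
  |a - r|^\<gamma> and the relative internal energy have different orders near a = r, passing
  between them leaves arbitrarily small additive errors.\<close>

lemma frechet_derivative_eqI:
  "(f has_derivative D) (at x) \<Longrightarrow> frechet_derivative f (at x) = D"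
  using frechet_derivative_at by metis

lemma Ck_on_subset: "Ck_on k U f \<Longrightarrow> V \<subseteq> U \<Longrightarrow> Ck_on k V f"
proof (induction k arbitrary: f)
  case 0
  then show ?case using continuous_on_subset[of U f V] by simp
qed auto

lemma Ck_on_cong:
  assumes "open U" "Ck_on k U f" "\<And>x. x \<in> U \<Longrightarrow> f x = g x"
  shows "Ck_on k U g"
  using assms(2,3)
proof (induction k arbitrary: f g)
  case 0
  then show ?case using continuous_on_cong by (metis Ck_on.simps(1))
next
  case (Suc k)
  have D: "(g has_derivative frechet_derivative f (at x)) (at x)" if "x \<in> U" for x
  proof (rule has_derivative_transform_within_open[OF _ assms(1) that])
    show "(f has_derivative frechet_derivative f (at x)) (at x)"
      using Suc.prems that by (simp add: frechet_derivative_works[symmetric])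
  qed (use Suc.prems in auto)
  show ?case
  proof (simp, intro conjI ballI allI)
    show "g differentiable (at x)" if "x \<in> U" for x
      using D[OF that] by (auto simp: differentiable_def)
    show "Ck_on k U (\<lambda>x. frechet_derivative g (at x) v)" for v
      by (rule Suc.IH[of "\<lambda>x. frechet_derivative f (at x) v"])
        (use Suc.prems in \<open>auto simp: frechet_derivative_eqI[OF D]\<close>)
  qed
qed

lemma Ck_on_SucI:
  assumes "open U" "\<And>x. x \<in> U \<Longrightarrow> (f has_derivative D x) (at x)" "\<And>v. Ck_on k U (\<lambda>x. D x v)"
  shows "Ck_on (Suc k) U f"
proof (simp, intro conjI ballI allI)
  show "f differentiable (at x)" if "x \<in> U" for x
    using assms(2)[OF that] by (auto simp: differentiable_def)
  show "Ck_on k U (\<lambda>x. frechet_derivative f (at x) v)" for v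
    by (rule Ck_on_cong[OF assms(1) assms(3)[of v]]) (simp add: frechet_derivative_eqI[OF assms(2)])
qed

lemma Ck_on_SucD: "Ck_on (Suc k) U f \<Longrightarrow> Ck_on k U f"
proof (induction k arbitrary: f)
  case 0
  then show ?case
    by (auto intro!: continuous_at_imp_continuous_on differentiable_imp_continuous_within)
qed auto

lemma Ck_on_Suc_has_derivative:
  "Ck_on (Suc k) U f \<Longrightarrow> x \<in> U \<Longrightarrow> (f has_derivative frechet_derivative f (at x)) (at x)"
  by (auto simp: frechet_derivative_works)

lemma Ck_on_const: "Ck_on k U (\<lambda>x. c)"
  by (induction k arbitrary: c) (auto simp: frechet_derivative_eqI[OF has_derivative_const])

lemma Ck_on_linear:
  assumes "bounded_linear L" shows "Ck_on k U L"
proof (cases k)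
  case 0
  then show ?thesis using assms by (simp add: linear_continuous_on)
next
  case (Suc m)
  have L: "(L has_derivative L) (at x)" for x
    using assms by (rule bounded_linear_imp_has_derivative)
  show ?thesis
    using Suc L by (auto simp: differentiable_def frechet_derivative_eqI[OF L] Ck_on_const)
qed

lemma Ck_on_add:
  assumes "open U" "Ck_on k U f" "Ck_on k U g"
  shows "Ck_on k U (\<lambda>x. f x + g x)"
  using assms(2,3)
proof (induction k arbitrary: f g)
  case (Suc k)
  note f = Ck_on_Suc_has_derivative[OF Suc.prems(1)] and g = Ck_on_Suc_has_derivative[OF Suc.prems(2)]
  show ?case
    by (rule Ck_on_SucI[OF assms(1)], rule has_derivative_add, erule f, erule g)
      (use Suc in auto)
qed (auto intro: continuous_on_add)

lemma Ck_on_bilinear: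
  assumes bil: "bounded_bilinear pr" and U: "open U" and "Ck_on k U f" "Ck_on k U g"
  shows "Ck_on k U (\<lambda>x. pr (f x) (g x))"
  using assms(3,4)
proof (induction k arbitrary: f g)
  case 0
  then show ?case by (simp add: bounded_bilinear.continuous_on[OF bil])
next
  case (Suc k)
  note f = Ck_on_Suc_has_derivative[OF Suc.prems(1)] and g = Ck_on_Suc_has_derivative[OF Suc.prems(2)]
  show ?case
    by (rule Ck_on_SucI[OF U], rule bounded_bilinear.FDERIV[OF bil], erule f, erule g)
      (use Suc Ck_on_SucD[OF Suc.prems(1)] Ck_on_SucD[OF Suc.prems(2)] in
        \<open>auto intro!: Ck_on_add[OF U]\<close>)
qed

text \<open>As the inner function is real-valued, the derivative of \<open>h\<close> at
  \<open>f x\<close> is a multiple of its value in direction 1. The derivative of the composite is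
  then a product of two functions of one order less, and the induction closes with
  \<open>Ck_on_bilinear\<close>. A vector-valued inner function would require differentiating in a
  varying direction.\<close>

lemma Ck_on_compose_real:
  fixes h :: "real \<Rightarrow> 'b::real_normed_vector" and f :: "'a::real_normed_vector \<Rightarrow> real"
  assumes U: "open U" and V: "f ` U \<subseteq> V" and "Ck_on k V h" "Ck_on k U f"
  shows "Ck_on k U (\<lambda>x. h (f x))"
  using assms(3,4)
proof (induction k arbitrary: h)
  case 0
  then show ?case using V
    by (auto intro: continuous_on_compose2)
next
  case (Suc k)
  note f = Ck_on_Suc_has_derivative[OF Suc.prems(2)]
  have D: "((\<lambda>x. h (f x)) has_derivative
      (\<lambda>v. frechet_derivative f (at x) v *\<^sub>R frechet_derivative h (at (f x)) 1)) (at x)"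
    if "x \<in> U" for x
  proof -
    have h: "(h has_derivative frechet_derivative h (at (f x))) (at (f x))"
      using Ck_on_Suc_has_derivative[OF Suc.prems(1)] that V by auto
    have eq: "(\<lambda>v. frechet_derivative h (at (f x)) (frechet_derivative f (at x) v)) =
      (\<lambda>v. frechet_derivative f (at x) v *\<^sub>R frechet_derivative h (at (f x)) 1)"
    proof
      fix v show "frechet_derivative h (at (f x)) (frechet_derivative f (at x) v) =
          frechet_derivative f (at x) v *\<^sub>R frechet_derivative h (at (f x)) 1"
        using linear_scale[OF has_derivative_linear[OF h], of "frechet_derivative f (at x) v" 1]
        by simp
    qed
    show ?thesis
      unfolding eq[symmetric] by (rule has_derivative_compose[OF f[OF that] h])
  qed
  show ?case
    by (rule Ck_on_SucI[OF U D], assumption, rule Ck_on_bilinear[OF bounded_bilinear_scaleR U])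
      (use Suc Ck_on_SucD[OF Suc.prems(2)] in auto)
qed

text \<open>A linear inner map turns the direction \<open>v\<close> into the fixed direction
  \<open>L v\<close>, as the induction over directional derivatives needs.\<close>

lemma Ck_on_compose_linear:
  assumes L: "bounded_linear L" and U: "open U" and V: "L ` U \<subseteq> V" and "Ck_on k V f"
  shows "Ck_on k U (\<lambda>x. f (L x))"
  using assms(4)
proof (induction k arbitrary: f)
  case 0
  then show ?case using V linear_continuous_on[OF L]
    by (auto intro: continuous_on_compose2)
next
  case (Suc k)
  have "Ck_on k U (\<lambda>x. frechet_derivative f (at (L x)) (L v))" for v
    using Suc.IH[of "\<lambda>x. frechet_derivative f (at x) (L v)"] Suc.prems by simp
  moreover have "((\<lambda>x. f (L x)) has_derivative (\<lambda>v. frechet_derivative f (at (L x)) (L v))) (at x)"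
    if "x \<in> U" for x
    using has_derivative_compose[OF bounded_linear_imp_has_derivative[OF L]
        Ck_on_Suc_has_derivative[OF Suc.prems]] V that by auto
  ultimately show ?case
    by (intro Ck_on_SucI[OF U])
qed

lemma Ck_on_Un:
  assumes "open U" "open V" "Ck_on k U f" "Ck_on k V f"
  shows "Ck_on k (U \<union> V) f"
  using assms(3,4)
proof (induction k arbitrary: f)
  case 0
  then show ?case by (simp add: continuous_on_open_Un assms(1,2))
qed auto

text \<open>Smoothness of the function itself on an open set. \<open>smooth_on\<close> only asserts
  that some extension is smooth and says nothing about derivatives of the function itself at points
  that are not interior; on open sets the two notions agree.\<close>

definition smooth_in :: "'a::real_normed_vector set \<Rightarrow> ('a \<Rightarrow> 'b::real_normed_vector) \<Rightarrow> bool" where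
  "smooth_in U f \<longleftrightarrow> open U \<and> (\<forall>k. Ck_on k U f)"

lemma smooth_in_open: "smooth_in U f \<Longrightarrow> open U"
  by (simp add: smooth_in_def)

lemma smooth_in_imp_smooth_on:
  "smooth_in U f \<Longrightarrow> S \<subseteq> U \<Longrightarrow> smooth_on S f"
  by (auto simp: smooth_in_def smooth_on_def)

lemma smooth_onE:
  assumes "smooth_on S f"
  obtains U g where "smooth_in U g" "S \<subseteq> U" "\<And>x. x \<in> S \<Longrightarrow> g x = f x"
  using assms by (auto simp: smooth_on_def smooth_in_def)

lemma smooth_in_subset: "smooth_in U f \<Longrightarrow> open V \<Longrightarrow> V \<subseteq> U \<Longrightarrow> smooth_in V f"
  unfolding smooth_in_def using Ck_on_subset[of _ U f V] by blast

lemma smooth_in_cong: "smooth_in U f \<Longrightarrow> (\<And>x. x \<in> U \<Longrightarrow> f x = g x) \<Longrightarrow> smooth_in U g"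
  unfolding smooth_in_def using Ck_on_cong[of U _ f g] by blast

lemma smooth_on_open_imp_smooth_in: "open U \<Longrightarrow> smooth_on U f \<Longrightarrow> smooth_in U f"
  by (metis smooth_onE smooth_in_cong smooth_in_subset)

lemma smooth_in_const: "open U \<Longrightarrow> smooth_in U (\<lambda>x. c)"
  by (simp add: smooth_in_def Ck_on_const)

lemma smooth_in_linear: "open U \<Longrightarrow> bounded_linear f \<Longrightarrow> smooth_in U f"
  by (simp add: smooth_in_def Ck_on_linear)

lemma smooth_in_add: "smooth_in U f \<Longrightarrow> smooth_in U g \<Longrightarrow> smooth_in U (\<lambda>x. f x + g x)"
  by (simp add: smooth_in_def Ck_on_add)

lemma smooth_in_bilinear:
  "bounded_bilinear pr \<Longrightarrow> smooth_in U f \<Longrightarrow> smooth_in U g \<Longrightarrow> smooth_in U (\<lambda>x. pr (f x) (g x))"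
  by (simp add: smooth_in_def Ck_on_bilinear)

lemmas smooth_in_scaleR = smooth_in_bilinear[OF bounded_bilinear_scaleR]
lemmas smooth_in_inner = smooth_in_bilinear[OF bounded_bilinear_inner]

lemma smooth_in_mult:
  fixes f g :: "'a::real_normed_vector \<Rightarrow> real"
  shows "smooth_in U f \<Longrightarrow> smooth_in U g \<Longrightarrow> smooth_in U (\<lambda>x. f x * g x)"
  by (rule smooth_in_bilinear[OF bounded_bilinear_mult])

lemma smooth_in_cmult:
  fixes f :: "'a::real_normed_vector \<Rightarrow> real"
  shows "smooth_in U f \<Longrightarrow> smooth_in U (\<lambda>x. a * f x)"
  by (rule smooth_in_mult[OF smooth_in_const]) (rule smooth_in_open)

lemma smooth_in_diff:
  fixes f g :: "'a::real_normed_vector \<Rightarrow> real"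
  assumes "smooth_in U f" "smooth_in U g" shows "smooth_in U (\<lambda>x. f x - g x)"
  using smooth_in_add[OF assms(1) smooth_in_cmult[OF assms(2), of "-1"]] by simp

lemma smooth_in_sum:
  assumes "open U" "\<And>i. i \<in> I \<Longrightarrow> smooth_in U (f i)"
  shows "smooth_in U (\<lambda>x. \<Sum>i\<in>I. f i x)"
  using assms(2)
  by (induction I rule: infinite_finite_induct)
    (simp_all add: smooth_in_add smooth_in_const[OF assms(1)])

lemma smooth_in_compose_real:
  fixes f :: "'a::real_normed_vector \<Rightarrow> real"
  shows "smooth_in V h \<Longrightarrow> smooth_in U f \<Longrightarrow> f ` U \<subseteq> V \<Longrightarrow> smooth_in U (\<lambda>x. h (f x))"
  unfolding smooth_in_def using Ck_on_compose_real[of U f V _ h] by blast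

lemma smooth_in_compose_linear:
  "bounded_linear L \<Longrightarrow> smooth_in V f \<Longrightarrow> open U \<Longrightarrow> L ` U \<subseteq> V \<Longrightarrow> smooth_in U (\<lambda>x. f (L x))"
  unfolding smooth_in_def using Ck_on_compose_linear[of L U V _ f] by blast

lemma smooth_in_Un: "smooth_in U f \<Longrightarrow> smooth_in V f \<Longrightarrow> smooth_in (U \<union> V) f"
  unfolding smooth_in_def using Ck_on_Un[of U V _ f] by blast

lemma smooth_in_has_derivative:
  "smooth_in U f \<Longrightarrow> x \<in> U \<Longrightarrow> (f has_derivative frechet_derivative f (at x)) (at x)"
  unfolding smooth_in_def using Ck_on_Suc_has_derivative[of 0 U f x] by blast

lemma smooth_in_frechet_derivative:
  "smooth_in U f \<Longrightarrow> smooth_in U (\<lambda>x. frechet_derivative f (at x) v)"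
  unfolding smooth_in_def using Ck_on.simps(2)[of _ U f] by blast

lemma smooth_in_continuous_on: "smooth_in U f \<Longrightarrow> S \<subseteq> U \<Longrightarrow> continuous_on S f"
  unfolding smooth_in_def using Ck_on.simps(1)[of U f] continuous_on_subset[of U f S] by blast

text \<open>Every derivative of a member of \<open>S\<close> is again represented by a member, so
  the induction on the order never leaves \<open>S\<close>. Smoothness is thereby reduced to one
  differentiation rule for a suitable family.\<close>

lemma smooth_in_realI:
  fixes f :: "real \<Rightarrow> real"
  assumes U: "open U" and "f \<in> S"
    and S: "\<And>f. f \<in> S \<Longrightarrow> \<exists>g\<in>S. \<forall>x\<in>U. (f has_real_derivative g x) (at x)"
  shows "smooth_in U f"
proof -
  have "Ck_on k U f" if "f \<in> S" for k f
    using that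
  proof (induction k arbitrary: f)
    case 0
    then obtain g where "\<And>x. x \<in> U \<Longrightarrow> (f has_real_derivative g x) (at x)"
      using S[OF 0] by blast
    then show ?case
      by (simp, intro continuous_at_imp_continuous_on ballI) (rule DERIV_isCont)
  next
    case (Suc k)
    then obtain g where g: "g \<in> S" "\<And>x. x \<in> U \<Longrightarrow> (f has_derivative (*) (g x)) (at x)"
      using S unfolding has_field_derivative_def by blast
    show ?case
      by (rule Ck_on_SucI[OF U g(2)], assumption, rule Ck_on_bilinear[OF bounded_bilinear_mult U])
        (use g Suc.IH in \<open>auto intro: Ck_on_const\<close>)
  qed
  then show ?thesis using assms by (simp add: smooth_in_def)
qed

lemma smooth_in_exp: "smooth_in UNIV (exp :: real \<Rightarrow> real)"
  by (rule smooth_in_realI[of _ _ "{exp}"]) (auto intro: DERIV_exp)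

lemma smooth_in_powr: "smooth_in {0<..} (\<lambda>x::real. x powr a)"
proof (rule smooth_in_realI[of _ _ "{\<lambda>x. c * x powr a | c a. True}"])
  show "(\<lambda>x. x powr a) \<in> {\<lambda>x. c * x powr a | c a. True}"
    by (intro CollectI exI[of _ 1] exI[of _ a]) auto
  fix f :: "real \<Rightarrow> real" assume "f \<in> {\<lambda>x. c * x powr a | c a. True}"
  then obtain c a where f: "f = (\<lambda>x. c * x powr a)" by auto
  have "(f has_real_derivative (c * a) * x powr (a - 1)) (at x)" if "x \<in> {0<..}" for x
    using that DERIV_cmult[OF has_real_derivative_powr[of x a], of c] by (simp add: f mult.assoc)
  then show "\<exists>g\<in>{\<lambda>x. c * x powr a | c a. True}. \<forall>x\<in>{0<..}. (f has_real_derivative g x) (at x)"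
    by (intro bexI[of _ "\<lambda>x. c * a * x powr (a - 1)"] ballI CollectI exI conjI refl) simp_all
qed auto

section \<open>A smooth step built from exp(-1/x)\<close>

lemma poly_exp_minus_tendsto_0: "((\<lambda>x. poly p x * exp (- x)) \<longlongrightarrow> (0::real)) at_top"
proof -
  have "((\<lambda>x. \<Sum>i\<le>degree p. coeff p i * (x ^ i / exp x)) \<longlongrightarrow> (\<Sum>i\<le>degree p. coeff p i * 0)) at_top"
    by (rule tendsto_sum, rule tendsto_mult_left, rule tendsto_power_div_exp_0)
  moreover have "(\<lambda>x. poly p x * exp (- x)) = (\<lambda>x. \<Sum>i\<le>degree p. coeff p i * (x ^ i / exp x))"
    by (rule ext) (simp add: poly_altdef sum_distrib_right exp_minus divide_inverse mult.assoc)
  ultimately show ?thesis by simp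
qed

text \<open>All derivatives of exp(-1/x), extended by zero, have this shape. The polynomial
  parameter makes the family closed under differentiation, as \<open>smooth_in_realI\<close>
  asks.\<close>

definition flat_fun :: "real poly \<Rightarrow> real \<Rightarrow> real" where
  "flat_fun p x = (if 0 < x then poly p (inverse x) * exp (- inverse x) else 0)"

text \<open>Differentiating p(1/x) exp(-1/x) for positive x produces the factor x^(-2) and the
  polynomial p - p'; multiplication by \<open>[:0,0,1:]\<close> records this factor as X^2. At the
  origin exponential decay beats every polynomial in 1/x.\<close>

lemma flat_fun_DERIV:
  "(flat_fun p has_real_derivative flat_fun ([:0,0,1:] * (p - pderiv p)) x) (at x)"
proof -
  consider "x < 0" | "x = 0" | "0 < x" by linarith
  then show ?thesis
  proof cases
    case 1
    have "((\<lambda>_. 0) has_real_derivative 0) (at x)" by simp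
    then have "(flat_fun p has_real_derivative 0) (at x)"
      by (rule has_field_derivative_transform_within_open[of _ _ _ "{..<0}"])
        (use 1 in \<open>auto simp: flat_fun_def\<close>)
    then show ?thesis using 1 by (simp add: flat_fun_def)
  next
    case 3
    have "((\<lambda>x. poly p (inverse x) * exp (- inverse x)) has_real_derivative
        flat_fun ([:0,0,1:] * (p - pderiv p)) x) (at x)"
    proof -
      have i: "(inverse has_real_derivative - (inverse x ^ 2)) (at x)"
        using DERIV_inverse[of x] 3 by (simp add: numeral_2_eq_2)
      have "((\<lambda>x. poly p (inverse x) * exp (- inverse x)) has_real_derivative
          poly (pderiv p) (inverse x) * - (inverse x ^ 2) * exp (- inverse x) +
          exp (- inverse x) * - (- (inverse x ^ 2)) * poly p (inverse x)) (at x)"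
        by (intro DERIV_mult DERIV_chain2[OF poly_DERIV i] DERIV_fun_exp DERIV_minus i)
      then show ?thesis
        using 3 by (simp add: flat_fun_def power2_eq_square algebra_simps)
    qed
    then show ?thesis
      by (rule has_field_derivative_transform_within_open[of _ _ _ "{0<..}"])
        (use 3 in \<open>auto simp: flat_fun_def\<close>)
  next
    case 2
    \<comment> \<open>From the right, the difference quotient at 0 is again of the form q(1/h)
      exp(-1/h), with q = X p.\<close>
    have "((\<lambda>h. poly ([:0,1:] * p) (inverse h) * exp (- inverse h)) \<longlongrightarrow> 0) (at_right 0)"
      using poly_exp_minus_tendsto_0 filterlim_inverse_at_top_right by (rule filterlim_compose)
    then have r: "((\<lambda>h. flat_fun p h / h) \<longlongrightarrow> 0) (at_right 0)"
      by (rule Lim_transform_eventually)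
        (auto simp: eventually_at_right_field flat_fun_def field_simps intro!: exI[of _ 1])
    have l: "((\<lambda>h. flat_fun p h / h) \<longlongrightarrow> 0) (at_left 0)"
      by (rule Lim_transform_eventually[OF tendsto_const])
        (auto simp: eventually_at_left_field flat_fun_def intro!: exI[of _ "-1"])
    have "((\<lambda>h. flat_fun p h / h) \<longlongrightarrow> 0) (at 0)"
      using l r by (simp add: filterlim_at_split)
    then show ?thesis using 2 by (simp add: DERIV_def flat_fun_def)
  qed
qed

lemma smooth_in_flat_fun: "smooth_in UNIV (flat_fun p)"
  by (rule smooth_in_realI[of _ _ "range flat_fun"]) (auto intro: flat_fun_DERIV)

lemma smooth_step:
  obtains \<zeta> :: "real \<Rightarrow> real" where "smooth_in UNIV \<zeta>" "mono \<zeta>" "\<And>x. 0 \<le> \<zeta> x" "\<And>x. \<zeta> x \<le> 1"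
    "\<And>x. x \<le> 1 \<Longrightarrow> \<zeta> x = 0" "\<And>x. 2 \<le> x \<Longrightarrow> \<zeta> x = 1"
proof -
  define s where "s = flat_fun 1"
  have s: "smooth_in UNIV s" by (simp add: s_def smooth_in_flat_fun)
  have s_nonneg: "0 \<le> s x" for x by (simp add: s_def flat_fun_def)
  have s_0: "s x = 0 \<longleftrightarrow> x \<le> 0" for x by (simp add: s_def flat_fun_def)
  have s_mono: "s x \<le> s y" if "x \<le> y" for x y using that
    by (auto simp: s_def flat_fun_def le_imp_inverse_le)
  \<comment> \<open>The arguments x - 1 and 2 - x are never both nonpositive, so this denominator
    has no zero.\<close>
  define den where "den x = s (x - 1) + s (2 - x)" for x
  have den: "0 < den x" for x
    using s_nonneg[of "x - 1"] s_nonneg[of "2 - x"] s_0[of "x - 1"] s_0[of "2 - x"]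
    unfolding den_def by linarith
  \<comment> \<open>Writing the quotient with exponent -1 reduces its smoothness to that of powers
    and products.\<close>
  define \<zeta> where "\<zeta> x = s (x - 1) * den x powr -1" for x
  have \<zeta>: "\<zeta> x = s (x - 1) / den x" for x
    using den[of x] by (simp add: \<zeta>_def powr_minus powr_one divide_inverse)
  have l: "smooth_in UNIV (\<lambda>x::real. x - 1)" "smooth_in UNIV (\<lambda>x::real. 2 - x)"
    by (intro smooth_in_diff smooth_in_const smooth_in_linear bounded_linear_ident open_UNIV)+
  have sl: "smooth_in UNIV (\<lambda>x. s (x - 1))" "smooth_in UNIV (\<lambda>x. s (2 - x))"
    by (rule smooth_in_compose_real[OF s], rule l, simp)+
  have "smooth_in UNIV den" unfolding den_def[abs_def] using sl by (rule smooth_in_add)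
  then have "smooth_in UNIV (\<lambda>x. den x powr -1)"
    by (rule smooth_in_compose_real[OF smooth_in_powr]) (use den in auto)
  then have "smooth_in UNIV \<zeta>"
    unfolding \<zeta>_def[abs_def] by (rule smooth_in_mult[OF sl(1)])
  moreover have "mono \<zeta>"
  proof (rule monoI)
    fix x y :: real assume xy: "x \<le> y"
    have "s (x - 1) * s (2 - y) \<le> s (y - 1) * s (2 - x)"
      by (intro mult_mono s_mono s_nonneg) (use xy in auto)
    then have "s (x - 1) * den y \<le> s (y - 1) * den x" by (simp add: den_def algebra_simps)
    then show "\<zeta> x \<le> \<zeta> y" unfolding \<zeta>
      using den[of x] den[of y] by (simp add: pos_divide_le_eq pos_le_divide_eq)
  qed
  moreover have "0 \<le> \<zeta> x" "\<zeta> x \<le> 1" for x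
    using den[of x] s_nonneg[of "x-1"] s_nonneg[of "2-x"] by (auto simp: \<zeta> den_def)
  moreover have "\<zeta> x = 0" if "x \<le> 1" for x using that s_0 by (simp add: \<zeta>)
  moreover have "\<zeta> x = 1" if "2 \<le> x" for x
    using that s_0[of "2 - x"] den[of x] by (simp add: \<zeta> den_def)
  ultimately show thesis by (rule that)
qed

subsection \<open>A smooth boundary function\<close>

lemma frechet_derivative_eq_grad:
  assumes "g differentiable (at x)"
  shows "frechet_derivative g (at x) v = grad g x \<bullet> v"
proof -
  have lin: "linear (frechet_derivative g (at x))"
    using assms frechet_derivative_works has_derivative_linear by blast
  have "frechet_derivative g (at x) v = frechet_derivative g (at x) (\<Sum>j\<in>UNIV. v $ j *\<^sub>R axis j 1)"
    using basis_expansion[of v] by (simp add: scalar_mult_eq_scaleR)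
  also have "\<dots> = (\<Sum>j\<in>UNIV. v $ j * frechet_derivative g (at x) (axis j 1))"
    by (simp add: linear_sum[OF lin] linear_scale[OF lin])
  finally show ?thesis by (simp add: grad_def inner_vec_def mult.commute)
qed

lemma has_real_derivative_along:
  fixes g :: "'a::real_normed_vector \<Rightarrow> real"
  assumes "(g has_derivative D) (at (p + t *\<^sub>R v))"
  shows "((\<lambda>t. g (p + t *\<^sub>R v)) has_real_derivative D v) (at t)"
proof -
  have "((\<lambda>t. p + t *\<^sub>R v) has_derivative (\<lambda>s. s *\<^sub>R v)) (at t)"
    by (auto intro!: derivative_eq_intros)
  from has_derivative_compose[OF this assms]
  have "((\<lambda>t. g (p + t *\<^sub>R v)) has_derivative (\<lambda>s. D (s *\<^sub>R v))) (at t)" .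
  moreover have "(\<lambda>s. D (s *\<^sub>R v)) = (*) (D v)"
    using linear_scale[OF has_derivative_linear[OF assms]] by (auto simp: mult.commute)
  ultimately show ?thesis by (simp add: has_field_derivative_def)
qed

lemma local_defining_function_smooth_in:
  "local_defining_function \<Omega> U g \<Longrightarrow> smooth_in U g"
  unfolding local_defining_function_def using smooth_on_open_imp_smooth_in by blast

text \<open>A frontier point is not in the open set, so \<open>g p\<close> is not negative; were it
  positive, a neighbourhood of \<open>p\<close> would miss \<open>\<Omega>\<close>.\<close>

lemma local_defining_function_zero:
  assumes "open \<Omega>" "p \<in> frontier \<Omega>" "p \<in> U" "local_defining_function \<Omega> U g"
  shows "g p = 0"
proof (rule ccontr)
  assume "g p \<noteq> 0"
  moreover have "\<not> g p < 0"
    using assms by (auto simp: local_defining_function_def frontier_def interior_open)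
  ultimately have pos: "g p > 0" by simp
  have "open (U \<inter> g -` {0<..})"
    using assms(4) smooth_in_continuous_on[OF local_defining_function_smooth_in[OF assms(4)] subset_refl]
    by (intro continuous_open_preimage) (auto simp: local_defining_function_def)
  moreover have "p \<in> U \<inter> g -` {0<..}" using pos assms(3) by simp
  moreover have "p \<in> closure \<Omega>" using assms(2) by (simp add: frontier_def)
  ultimately have "(U \<inter> g -` {0<..}) \<inter> \<Omega> \<noteq> {}"
    using open_Int_closure_eq_empty[of "U \<inter> g -` {0<..}" \<Omega>] by blast
  then obtain x where "x \<in> U" "x \<in> \<Omega>" "0 < g x" by auto
  moreover have "x \<in> \<Omega> \<inter> U \<longleftrightarrow> x \<in> {x\<in>U. g x < 0}"
    using assms(4) by (simp add: local_defining_function_def)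
  ultimately show False by simp
qed

text \<open>If the unit normals a and b differed, a short step from \<open>p\<close> in direction b
  - a would decrease \<open>g\<close> and increase \<open>h\<close> to first order. Both vanish at
  \<open>p\<close>, so the new point would lie inside \<open>\<Omega>\<close> according to
  \<open>g\<close> and outside according to \<open>h\<close>. This makes the description in
  \<open>outward_normal\<close> unambiguous.\<close>

lemma sgn_grad_unique:
  assumes \<Omega>: "open \<Omega>" and p: "p \<in> frontier \<Omega>"
    and U: "p \<in> U" "local_defining_function \<Omega> U g"
    and V: "p \<in> V" "local_defining_function \<Omega> V h"
  shows "sgn (grad g p) = sgn (grad h p)"
proof (rule ccontr)
  define a where "a = sgn (grad g p)"
  define b where "b = sgn (grad h p)"
  assume "sgn (grad g p) \<noteq> sgn (grad h p)"
  then have ne: "a \<noteq> b" by (simp add: a_def b_def)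
  have gne: "grad g p \<noteq> 0" "grad h p \<noteq> 0"
    using U V by (auto simp: local_defining_function_def)
  then have unit: "norm a = 1" "norm b = 1" by (auto simp: a_def b_def norm_sgn)
  have "0 < (norm (a - b))\<^sup>2" using ne by simp
  also have "\<dots> = 2 - 2 * (a \<bullet> b)"
    using unit by (simp add: power2_norm_eq_inner inner_diff inner_commute norm_eq_1)
  finally have ab: "a \<bullet> b < 1" by simp
  note g = smooth_in_has_derivative[OF local_defining_function_smooth_in[OF U(2)] U(1)]
  note h = smooth_in_has_derivative[OF local_defining_function_smooth_in[OF V(2)] V(1)]
  have ga: "grad g p = norm (grad g p) *\<^sub>R a" and hb: "grad h p = norm (grad h p) *\<^sub>R b"
    using gne by (auto simp: a_def b_def sgn_div_norm)
  have "frechet_derivative g (at p) (b - a) = norm (grad g p) * (a \<bullet> b - 1)"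
    using g unit by (subst frechet_derivative_eq_grad)
      (auto simp: differentiable_def, subst ga, simp add: inner_diff norm_eq_1 algebra_simps)
  then have gneg: "frechet_derivative g (at p) (b - a) < 0"
    using gne ab by (simp add: mult_less_0_iff)
  have "frechet_derivative h (at p) (b - a) = norm (grad h p) * (1 - a \<bullet> b)"
    using h unit by (subst frechet_derivative_eq_grad)
      (auto simp: differentiable_def, subst hb, simp add: inner_diff norm_eq_1 inner_commute algebra_simps)
  then have hpos: "0 < frechet_derivative h (at p) (b - a)"
    using gne ab by simp
  from g have "((\<lambda>t. g (p + t *\<^sub>R (b - a))) has_real_derivative frechet_derivative g (at p) (b - a)) (at 0)"
    by (intro has_real_derivative_along) simp
  from DERIV_neg_dec_right[OF this gneg] obtain d1 where d1: "d1 > 0" "\<And>t. 0 < t \<Longrightarrow> t < d1 \<Longrightarrow> g (p + t *\<^sub>R (b - a)) < g p"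
    by auto
  from h have "((\<lambda>t. h (p + t *\<^sub>R (b - a))) has_real_derivative frechet_derivative h (at p) (b - a)) (at 0)"
    by (intro has_real_derivative_along) simp
  from DERIV_pos_inc_right[OF this hpos] obtain d2 where d2: "d2 > 0" "\<And>t. 0 < t \<Longrightarrow> t < d2 \<Longrightarrow> h p < h (p + t *\<^sub>R (b - a))"
    by auto
  have "open (U \<inter> V)" using U V by (auto simp: local_defining_function_def)
  then obtain r where r: "r > 0" "ball p r \<subseteq> U \<inter> V"
    using U V by (meson IntI open_contains_ball)
  define m where "m = min (min d1 d2) (r / norm (b - a))"
  define t where "t = m / 2"
  have nba: "norm (b - a) > 0" using ne by simp
  then have m: "0 < m" "m \<le> d1" "m \<le> d2" "m \<le> r / norm (b - a)"
    using d1(1) d2(1) r(1) by (auto simp: m_def)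
  then have "m * norm (b - a) \<le> r" using nba by (simp add: pos_le_divide_eq)
  then have t: "0 < t" "t < d1" "t < d2" "t * norm (b - a) < r"
    using m r(1) by (auto simp: t_def)
  have "dist p (p + t *\<^sub>R (b - a)) < r" using t by (simp add: dist_norm)
  then have q: "p + t *\<^sub>R (b - a) \<in> U" "p + t *\<^sub>R (b - a) \<in> V" using r(2) by auto
  have "g (p + t *\<^sub>R (b - a)) < 0" "0 < h (p + t *\<^sub>R (b - a))"
    using d1(2)[of t] d2(2)[of t] t local_defining_function_zero[OF \<Omega> p U]
      local_defining_function_zero[OF \<Omega> p V] by auto
  moreover have "y \<in> \<Omega> \<longleftrightarrow> g y < 0" "y \<in> \<Omega> \<longleftrightarrow> h y < 0" if "y \<in> U" "y \<in> V" for y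
    using that U(2) V(2) by (auto simp: local_defining_function_def)
  ultimately show False using q by (metis less_asym)
qed

lemma outward_normal_eq:
  assumes "open \<Omega>" "p \<in> frontier \<Omega>" "p \<in> U" "local_defining_function \<Omega> U g"
  shows "outward_normal \<Omega> p = sgn (grad g p)"
  unfolding outward_normal_def
  by (rule the_equality) (use assms sgn_grad_unique[OF assms(1,2)] in blast)+

text \<open>Along the segment, g(x + t a) - \<kappa> t has nonnegative derivative; convexity of
  \<open>B\<close> keeps the segment where the slope is controlled.\<close>

lemma increase_along:
  fixes g :: "'a::real_normed_vector \<Rightarrow> real"
  assumes C: "convex B" and "\<And>y. y \<in> B \<Longrightarrow> (g has_derivative D y) (at y)" and "\<And>y. y \<in> B \<Longrightarrow> \<kappa> \<le> D y a"
    and x: "x \<in> B" "x + h *\<^sub>R a \<in> B" and h: "0 \<le> h"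
  shows "g x + \<kappa> * h \<le> g (x + h *\<^sub>R a)"
proof -
  have "g (x + 0 *\<^sub>R a) - \<kappa> * 0 \<le> g (x + h *\<^sub>R a) - \<kappa> * h"
  proof (rule DERIV_nonneg_imp_nondecreasing[OF h])
    fix t assume t: "0 \<le> t" "t \<le> h"
    have "x + t *\<^sub>R a \<in> B"
    proof (cases "h = 0")
      case False
      then have "x + t *\<^sub>R a = (1 - t / h) *\<^sub>R x + (t / h) *\<^sub>R (x + h *\<^sub>R a)"
        by (simp add: algebra_simps)
      also have "\<dots> \<in> B" by (rule convexD_alt[OF C x]) (use t False in \<open>auto simp: field_simps\<close>)
      finally show ?thesis .
    qed (use t x in auto)
    then have "((\<lambda>t. g (x + t *\<^sub>R a) - \<kappa> * t) has_real_derivative D (x + t *\<^sub>R a) a - \<kappa>) (at t)"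
      "0 \<le> D (x + t *\<^sub>R a) a - \<kappa>"
      using assms(2,3) by (auto intro!: derivative_eq_intros has_real_derivative_along)
    then show "\<exists>y. ((\<lambda>t. g (x + t *\<^sub>R a) - \<kappa> * t) has_real_derivative y) (at t) \<and> 0 \<le> y"
      by blast
  qed
  then show ?thesis by simp
qed

text \<open>About \<open>1 / h\<close> disjoint translates of \<open>S\<close> fit into a fixed ball.\<close>

lemma measure_le_if_disjoint_translates:
  fixes S :: "'a::euclidean_space set"
  assumes S: "S \<in> sets lebesgue" "S \<subseteq> ball p s" and a: "norm a \<le> 1" and h: "0 < h"
    and dis: "\<And>x y j. x \<in> S \<Longrightarrow> y \<in> S \<Longrightarrow> j \<ge> (1::nat) \<Longrightarrow> x \<noteq> y + (real j * h) *\<^sub>R a"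
  shows "measure lebesgue S \<le> 2 * measure lebesgue (ball p (s + 1)) * h"
proof -
  define m where "m = measure lebesgue (ball p (s + 1))"
  have Sm: "S \<in> lmeasurable"
    using S bounded_subset[OF bounded_ball] by (blast intro: bounded_set_imp_lmeasurable)
  show ?thesis
  proof (cases "h \<le> 1")
    case False
    have "measure lebesgue S \<le> m"
      unfolding m_def using S Sm by (intro measure_mono_fmeasurable) auto
    also have "m \<le> 2 * m * h"
      using False mult_left_mono[of 1 "2 * h" m] by (simp add: m_def mult.assoc mult.left_commute)
    finally show ?thesis by (simp add: m_def)
  next
    case True
    define N where "N = nat \<lfloor>1 / h\<rfloor>"
    have "1 \<le> 1 / h" using True h by simp
    then have "1 \<le> \<lfloor>1 / h\<rfloor>" by (simp add: le_floor_iff)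
    moreover from this have "real N = of_int \<lfloor>1 / h\<rfloor>"
      unfolding N_def by (intro of_nat_nat) linarith
    \<comment> \<open>Since 1/h is at least 1, its integer part is at least half of it, whence the
      factor 2. The other inequality keeps every translate within distance 1 of
      \<open>S\<close>.\<close>
    ultimately have N: "1 / h \<le> 2 * real N" "real N \<le> 1 / h" by linarith+
    define F where "F k = (+) ((real k * h) *\<^sub>R a) ` S" for k :: nat
    have F: "F k \<in> lmeasurable" "measure lebesgue (F k) = measure lebesgue S" for k
      unfolding F_def using Sm by (auto simp: measurable_translation measure_translation)
    have "disjnt (F i) (F j)" if "i < j" for i j
    proof -
      have "(real i * h) *\<^sub>R a + x \<noteq> (real j * h) *\<^sub>R a + y" if "x \<in> S" "y \<in> S" for x y
      proof
        assume "(real i * h) *\<^sub>R a + x = (real j * h) *\<^sub>R a + y"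
        then have "x = y + ((real j * h) *\<^sub>R a - (real i * h) *\<^sub>R a)"
          by (simp add: algebra_simps)
        then have eq: "x = y + (real (j - i) * h) *\<^sub>R a"
          using \<open>i < j\<close> by (simp add: of_nat_diff algebra_simps)
        have "1 \<le> j - i" using \<open>i < j\<close> by simp
        from dis[OF that this] eq show False by (rule notE)
      qed
      then show ?thesis unfolding F_def disjnt_def by auto
    qed
    then have pw: "pairwise (\<lambda>i j. disjnt (F i) (F j)) {..<N}"
      unfolding pairwise_def by (metis disjnt_sym linorder_neqE_nat)
    have "real N * measure lebesgue S = (\<Sum>k<N. measure lebesgue (F k))"
      by (simp add: F)
    also have "\<dots> = measure lebesgue (\<Union>k<N. F k)"
      by (rule measure_UNION'[symmetric]) (use F pw in auto)
    also have "\<dots> \<le> m"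
      unfolding m_def
    proof (rule measure_mono_fmeasurable)
      show "(\<Union>k<N. F k) \<subseteq> ball p (s + 1)"
      proof clarify
        fix k y assume k: "k < N" "y \<in> F k"
        then obtain x where x: "x \<in> S" "y = (real k * h) *\<^sub>R a + x" by (auto simp: F_def)
        have "real k * h \<le> real N * h" using k h by simp
        also have "\<dots> \<le> 1" using N(2) h by (simp add: field_simps)
        finally have "norm ((real k * h) *\<^sub>R a) \<le> 1 * 1"
          using h a unfolding norm_scaleR by (intro mult_mono) auto
        moreover have "dist p x < s" using x S by auto
        ultimately show "y \<in> ball p (s + 1)"
          using x norm_triangle_ineq4[of "p - x" "(real k * h) *\<^sub>R a"]
          by (auto simp: dist_norm algebra_simps)
      qed
    qed (use F in auto)
    finally have *: "real N * measure lebesgue S \<le> m" .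
    have "measure lebesgue S = (1 / h) * measure lebesgue S * h" using h by simp
    also have "\<dots> \<le> (2 * real N) * measure lebesgue S * h"
      using N h by (intro mult_right_mono) auto
    also have "\<dots> \<le> 2 * m * h" using * h by simp
    finally show ?thesis by (simp add: m_def)
  qed
qed

lemma smooth_bump:
  fixes p :: "'a::euclidean_space"
  assumes "0 < s"
  obtains \<beta> :: "'a \<Rightarrow> real" where "smooth_in UNIV \<beta>" "\<And>x. 0 \<le> \<beta> x"
    "\<And>x. x \<in> ball p s \<Longrightarrow> \<beta> x = 1" "\<And>x. x \<notin> cball p (3/2 * s) \<Longrightarrow> \<beta> x = 0"
proof -
  obtain \<zeta> :: "real \<Rightarrow> real" where \<zeta>: "smooth_in UNIV \<zeta>" "\<And>x. 0 \<le> \<zeta> x" "\<And>x. \<zeta> x \<le> 1"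
    "\<And>x. x \<le> 1 \<Longrightarrow> \<zeta> x = 0" "\<And>x. 2 \<le> x \<Longrightarrow> \<zeta> x = 1"
    using smooth_step by metis
  \<comment> \<open>The squared distance is smooth at the centre too. Outside the larger ball it is
    at least 9/4, beyond the point 2 where \<open>\<zeta>\<close> has reached one.\<close>
  define q where "q x = (1 / s\<^sup>2) * ((x + - p) \<bullet> (x + - p))" for x
  have q: "q x = (dist p x / s)\<^sup>2" for x
    by (simp add: q_def dist_norm norm_minus_commute power_divide dot_square_norm)
  have lin: "smooth_in UNIV (\<lambda>x. x + - p)"
    by (intro smooth_in_add smooth_in_const smooth_in_linear bounded_linear_ident open_UNIV)
  have "smooth_in UNIV q"
    unfolding q_def[abs_def] by (rule smooth_in_cmult, rule smooth_in_inner[OF lin lin])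
  then have \<zeta>q: "smooth_in UNIV (\<lambda>x. \<zeta> (q x))"
    by (rule smooth_in_compose_real[OF \<zeta>(1)]) simp
  show thesis
  proof (rule that)
    show "smooth_in UNIV (\<lambda>x. 1 - \<zeta> (q x))"
      by (rule smooth_in_diff[OF smooth_in_const \<zeta>q]) simp
    show "0 \<le> 1 - \<zeta> (q x)" for x using \<zeta>(3)[of "q x"] by simp
    show "1 - \<zeta> (q x) = 1" if "x \<in> ball p s" for x
    proof -
      have "q x \<le> 1\<^sup>2" unfolding q using that assms by (intro power_mono) auto
      then show ?thesis using \<zeta>(4) by simp
    qed
    show "1 - \<zeta> (q x) = 0" if "x \<notin> cball p (3/2 * s)" for x
    proof -
      have "(3/2)\<^sup>2 \<le> q x" unfolding q using that assms by (intro power_mono) (auto simp: field_simps)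
      then show ?thesis using \<zeta>(5)[of "q x"] by (simp add: power2_eq_square)
    qed
  qed
qed

lemma frechet_derivative_zero_open:
  assumes "open A" "x \<in> A" "\<And>y. y \<in> A \<Longrightarrow> f y = 0"
  shows "frechet_derivative f (at x) v = 0"
proof -
  have "((\<lambda>_. 0) has_derivative (\<lambda>_. 0)) (at x)" by simp
  then have "(f has_derivative (\<lambda>_. 0)) (at x)"
    by (rule has_derivative_transform_within_open[OF _ assms(1,2)]) (use assms(3) in auto)
  then show ?thesis by (simp add: frechet_derivative_eqI)
qed

text \<open>A smooth substitute for a multiple of the distance to the boundary. Only the lower bound
  by the distance and the volume of the sublevel sets are tied to \<open>B\<close>; the other
  requirements are global, so that local pieces can be added. The condition on tangential vectors
  says that the gradient is normal at the boundary, which makes the derivative along an impermeable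
  flow vanish there.\<close>

definition boundary_function ::
  "(real^3) set \<Rightarrow> (real^3) set \<Rightarrow> real \<Rightarrow> real \<Rightarrow> (real^3 \<Rightarrow> real) \<Rightarrow> bool" where
  "boundary_function \<Omega> B b C G \<longleftrightarrow>
     0 < b \<and> smooth_in UNIV G \<and> (\<forall>x\<in>\<Omega>. 0 \<le> G x) \<and> (\<forall>x\<in>\<Omega> \<inter> B. b * bdist \<Omega> x \<le> G x) \<and>
     (\<forall>x\<in>frontier \<Omega>. G x = 0 \<and> (\<forall>v. v \<bullet> outward_normal \<Omega> x = 0 \<longrightarrow> frechet_derivative G (at x) v = 0)) \<and>
     (\<forall>\<delta>>0. measure lebesgue {x\<in>\<Omega> \<inter> B. G x < \<delta>} \<le> C * \<delta>)"

text \<open>Away from the boundary a bump will do. It equals one on the ball, so its sublevel sets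
  there are empty for \<delta> at most 1, and it vanishes near the boundary together with its
  derivative.\<close>

lemma boundary_function_interior:
  assumes \<Omega>: "open \<Omega>" and p: "p \<in> \<Omega>"
  obtains s G b C where "0 < s" "boundary_function \<Omega> (ball p s) b C G"
proof -
  obtain r where r: "0 < r" "ball p r \<subseteq> \<Omega>" using assms by (meson open_contains_ball)
  define s where "s = r / 2"
  have s: "0 < s" "3/2 * s < r" using r by (auto simp: s_def)
  obtain \<beta> :: "real^3 \<Rightarrow> real" where \<beta>: "smooth_in UNIV \<beta>" "\<And>x. 0 \<le> \<beta> x"
    "\<And>x. x \<in> ball p s \<Longrightarrow> \<beta> x = 1" "\<And>x. x \<notin> cball p (3/2 * s) \<Longrightarrow> \<beta> x = 0"
    using smooth_bump[OF s(1)] by metis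
  define m where "m = measure lebesgue (ball p s)"
  \<comment> \<open>Within the ball the distance to the frontier exceeds its value at
    \<open>p\<close> by at most \<open>s\<close>, so \<open>b\<close> times it stays below one, the
    value of the bump.\<close>
  define b where "b = 1 / (infdist p (frontier \<Omega>) + s)"
  have pos: "0 < infdist p (frontier \<Omega>) + s" using s infdist_nonneg[of p] by (simp add: add_nonneg_pos)
  have "boundary_function \<Omega> (ball p s) b m \<beta>"
    unfolding boundary_function_def
  proof (intro conjI ballI allI impI)
    show "0 < b" using pos by (simp add: b_def)
    show "b * bdist \<Omega> x \<le> \<beta> x" if "x \<in> \<Omega> \<inter> ball p s" for x
    proof -
      have "infdist x (frontier \<Omega>) \<le> infdist p (frontier \<Omega>) + dist x p" by (rule infdist_triangle)
      also have "\<dots> \<le> infdist p (frontier \<Omega>) + s" using that by (simp add: dist_commute)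
      finally show ?thesis using \<beta>(3) that pos by (simp add: bdist_def b_def field_simps)
    qed
    fix x assume "x \<in> frontier \<Omega>"
    then have "x \<notin> ball p r" using \<Omega> r by (auto simp: frontier_def interior_open)
    then have "x \<notin> cball p (3/2 * s)" using s by auto
    then have "x \<in> - cball p (3/2 * s)" by simp
    then show "\<beta> x = 0" "frechet_derivative \<beta> (at x) v = 0" for v
      using frechet_derivative_zero_open[of "- cball p (3/2 * s)" x \<beta>] \<beta>(4)
      by (auto simp: open_Compl)
  next
    fix \<delta> :: real assume "0 < \<delta>"
    show "measure lebesgue {x \<in> \<Omega> \<inter> ball p s. \<beta> x < \<delta>} \<le> m * \<delta>"
    proof (cases "\<delta> \<le> 1")
      case True
      then have e: "{x \<in> \<Omega> \<inter> ball p s. \<beta> x < \<delta>} = {}" using \<beta>(3) by force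
      show ?thesis unfolding e using \<open>0 < \<delta>\<close> by (simp add: m_def)
    next
      case False
      have "open (\<Omega> \<inter> ball p s \<inter> \<beta> -` {..<\<delta>})"
        by (intro continuous_open_preimage smooth_in_continuous_on[OF \<beta>(1)] open_Int \<Omega>) auto
      moreover have "\<Omega> \<inter> ball p s \<inter> \<beta> -` {..<\<delta>} = {x \<in> \<Omega> \<inter> ball p s. \<beta> x < \<delta>}" by auto
      ultimately have "measure lebesgue {x \<in> \<Omega> \<inter> ball p s. \<beta> x < \<delta>} \<le> m"
        unfolding m_def by (intro measure_mono_fmeasurable) auto
      also have "m \<le> m * \<delta>" using False by (simp add: m_def mult_le_cancel_left1)
      finally show ?thesis .
    qed
  qed (use \<beta> in auto)
  then show thesis using that s by blast
qed

text \<open>The segment from \<open>x\<close> to \<open>y\<close> has to cross the frontier, at a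
  point no farther from \<open>x\<close> than \<open>y\<close>.\<close>

lemma bdist_le_of_exit:
  assumes "x \<in> \<Omega>" "y \<notin> \<Omega>"
  shows "bdist \<Omega> x \<le> dist x y"
proof -
  have "closed_segment x y \<inter> frontier \<Omega> \<noteq> {}"
    using assms by (intro connected_Int_frontier) auto
  then obtain z where z: "z \<in> closed_segment x y" "z \<in> frontier \<Omega>" by blast
  have "bdist \<Omega> x \<le> dist x z" unfolding bdist_def by (rule infdist_le[OF z(2)])
  also have "\<dots> \<le> dist x y" using dist_in_closed_segment[OF z(1)] by (simp add: dist_commute)
  finally show ?thesis .
qed

text \<open>Near the boundary take -g with a bump factor, extended by zero. In the direction
  \<open>a\<close> of the gradient at \<open>p\<close>, \<open>g\<close> grows at rate at least
  \<kappa> on a small ball. Hence the line from x in direction \<open>a\<close> leaves the domain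
  within distance -g(x)/\<kappa>, unless \<open>p\<close> itself is closer, which gives the lower
  bound; and the set where -g < \<delta> has thickness at most \<delta>/\<kappa> along
  \<open>a\<close>, which gives the volume.\<close>

lemma boundary_function_frontier:
  assumes \<Omega>: "open \<Omega>" and p: "p \<in> frontier \<Omega>" and U: "p \<in> U" "local_defining_function \<Omega> U g"
  obtains s G b C where "0 < s" "boundary_function \<Omega> (ball p s) b C G"
proof -
  have g: "smooth_in U g" by (rule local_defining_function_smooth_in[OF U(2)])
  have oU: "open U" and gneg: "\<And>x. x \<in> U \<Longrightarrow> x \<in> \<Omega> \<longleftrightarrow> g x < 0"
    using U(2) by (auto simp: local_defining_function_def)
  define a where "a = sgn (grad g p)"
  \<comment> \<open>Half the slope at \<open>p\<close>: by continuity the slope in direction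
    \<open>a\<close> stays above it on a neighbourhood.\<close>
  define \<kappa> where "\<kappa> = norm (grad g p) / 2"
  have ne: "grad g p \<noteq> 0" using U by (auto simp: local_defining_function_def)
  then have \<kappa>: "0 < \<kappa>" and a: "norm a = 1" by (auto simp: \<kappa>_def a_def norm_sgn)
  define D where "D x = frechet_derivative g (at x)" for x
  have D: "(g has_derivative D x) (at x)" if "x \<in> U" for x
    unfolding D_def by (rule smooth_in_has_derivative[OF g that])
  have Dgrad: "D x v = grad g x \<bullet> v" if "x \<in> U" for x v
    unfolding D_def using D[OF that] by (intro frechet_derivative_eq_grad) (auto simp: differentiable_def)
  have "grad g p \<bullet> a = 2 * \<kappa>"
    using ne by (simp add: \<kappa>_def a_def sgn_div_norm dot_square_norm power2_eq_square)
  then have "\<kappa> < D p a" using Dgrad[OF U(1)] \<kappa> by simp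
  then have pA: "p \<in> U \<inter> (\<lambda>x. D x a) -` {\<kappa><..}" using U(1) by simp
  have "open (U \<inter> (\<lambda>x. D x a) -` {\<kappa><..})"
    unfolding D_def
    by (intro continuous_open_preimage smooth_in_continuous_on[OF smooth_in_frechet_derivative[OF g]] oU) auto
  then obtain r where r: "0 < r" "ball p r \<subseteq> U \<inter> (\<lambda>x. D x a) -` {\<kappa><..}"
    using pA by (rule openE)
  \<comment> \<open>This leaves room in the ball of radius \<open>r\<close> both for the support of
    the bump and for steps shorter than \<open>s\<close> from points of the small ball.\<close>
  define s where "s = r / 2"
  have s: "0 < s" "3/2 * s < r" "2 * s = r" using r by (auto simp: s_def)
  have inc: "g x + \<kappa> * h \<le> g (x + h *\<^sub>R a)" if "x \<in> ball p r" "x + h *\<^sub>R a \<in> ball p r" "0 \<le> h" for x h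
  proof (rule increase_along[where B = "ball p r" and D = D])
    show "(g has_derivative D y) (at y)" "\<kappa> \<le> D y a" if "y \<in> ball p r" for y
      using D that r(2) by (auto dest!: subsetD)
  qed (use that in auto)
  obtain \<beta> :: "real^3 \<Rightarrow> real" where \<beta>: "smooth_in UNIV \<beta>" "\<And>x. 0 \<le> \<beta> x"
    "\<And>x. x \<in> ball p s \<Longrightarrow> \<beta> x = 1" "\<And>x. x \<notin> cball p (3/2 * s) \<Longrightarrow> \<beta> x = 0"
    using smooth_bump[OF s(1)] by metis
  define G where "G x = (if x \<in> U then - 1 * (\<beta> x * g x) else 0)" for x
  define K where "K = cball p (3/2 * s)"
  have KU: "K \<subseteq> U" using r s by (force simp: K_def)
  have G0: "G x = 0" if "x \<in> - K" for x using that \<beta>(4) by (auto simp: G_def K_def)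
  have sU: "smooth_in U (\<lambda>x. - 1 * (\<beta> x * g x))"
    by (intro smooth_in_cmult smooth_in_mult g smooth_in_subset[OF \<beta>(1)] oU) auto
  have "smooth_in U G" by (rule smooth_in_cong[OF sU]) (simp add: G_def)
  moreover have "smooth_in (- K) G"
    by (rule smooth_in_cong[OF smooth_in_const[of _ 0]]) (use G0 in \<open>auto simp: K_def open_Compl\<close>)
  ultimately have "smooth_in (U \<union> - K) G" by (rule smooth_in_Un)
  moreover have "U \<union> - K = UNIV" using KU by auto
  ultimately have sG: "smooth_in UNIV G" by simp
  have Gs: "G x = - g x" if "x \<in> ball p s" for x
    using \<beta>(3)[OF that] that r(2) s by (force simp: G_def)
  define V where "V = measure lebesgue (ball p (s + 1))"
  have "boundary_function \<Omega> (ball p s) \<kappa> (2 * V / \<kappa>) G"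
    unfolding boundary_function_def
  proof (intro conjI ballI allI impI)
    show "0 \<le> G x" if "x \<in> \<Omega>" for x
      using gneg[of x] that \<beta>(2)[of x] by (auto simp: G_def mult_nonneg_nonpos)
    show "\<kappa> * bdist \<Omega> x \<le> G x" if "x \<in> \<Omega> \<inter> ball p s" for x
    proof -
      define t where "t = - g x / \<kappa>"
      have xU: "x \<in> ball p r" "x \<in> U" using that s r by auto
      then have t: "0 < t" using gneg that \<kappa> by (simp add: t_def divide_neg_pos)
      have "bdist \<Omega> x \<le> t"
      \<comment> \<open>A long exit time needs no excursion along \<open>a\<close>: the frontier
        point \<open>p\<close> is itself closer than \<open>s\<close>.\<close>
      proof (cases "t < s")
        case True
        have "x + t *\<^sub>R a \<in> ball p r"
        proof -
          have "dist p (x + t *\<^sub>R a) \<le> dist p x + norm (t *\<^sub>R a)"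
            using norm_triangle_ineq4[of "p - x" "t *\<^sub>R a"] by (simp add: dist_norm algebra_simps)
          also have "\<dots> < s + s" using that True t a by (intro add_strict_mono) auto
          finally show ?thesis using s by simp
        qed
        with inc[OF xU(1), of t] t \<kappa> have "0 \<le> g (x + t *\<^sub>R a)" by (simp add: t_def)
        then have "x + t *\<^sub>R a \<notin> \<Omega>"
          using gneg[of "x + t *\<^sub>R a"] \<open>x + t *\<^sub>R a \<in> ball p r\<close> r(2) by force
        with that have "bdist \<Omega> x \<le> dist x (x + t *\<^sub>R a)" by (intro bdist_le_of_exit) auto
        with t a show ?thesis by (simp add: dist_norm)
      next
        case False
        have "bdist \<Omega> x \<le> dist x p" unfolding bdist_def by (rule infdist_le[OF p])
        then show ?thesis using False that by (simp add: dist_commute)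
      qed
      then show ?thesis using \<kappa> Gs[of x] that by (simp add: t_def field_simps)
    qed
    fix x assume x: "x \<in> frontier \<Omega>"
    show "G x = 0" using local_defining_function_zero[OF \<Omega> x _ U(2)] by (simp add: G_def)
    fix v assume v: "v \<bullet> outward_normal \<Omega> x = 0"
    show "frechet_derivative G (at x) v = 0"
    proof (cases "x \<in> U")
      case False
      then have "x \<in> - K" using KU by auto
      then show ?thesis
        using frechet_derivative_zero_open[of "- K" x G] G0 by (auto simp: K_def open_Compl)
    next
      case True
      have "((\<lambda>x. - 1 * (\<beta> x * g x)) has_derivative
          (\<lambda>v. - 1 * (\<beta> x * D x v + frechet_derivative \<beta> (at x) v * g x))) (at x)"
        by (rule has_derivative_mult_right, rule has_derivative_mult)
          (use D True smooth_in_has_derivative[OF \<beta>(1)] in auto)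
      then have "(G has_derivative
          (\<lambda>v. - 1 * (\<beta> x * D x v + frechet_derivative \<beta> (at x) v * g x))) (at x)"
        by (rule has_derivative_transform_within_open[OF _ oU True]) (simp add: G_def)
      moreover have "D x v = 0"
      proof -
        have "grad g x = norm (grad g x) *\<^sub>R sgn (grad g x)"
          by (cases "grad g x = 0") (auto simp: sgn_div_norm)
        then show ?thesis
          using v Dgrad[OF True] by (metis \<Omega> U(2) True x inner_commute inner_scaleR_left mult_zero_right outward_normal_eq)
      qed
      ultimately show ?thesis
        using local_defining_function_zero[OF \<Omega> x True U(2)] by (simp add: frechet_derivative_eqI)
    qed
  next
    fix \<delta> :: real assume \<delta>: "0 < \<delta>"
    define S where "S = {x \<in> \<Omega> \<inter> ball p s. G x < \<delta>}"
    have "open (\<Omega> \<inter> ball p s \<inter> G -` {..<\<delta>})"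
      by (intro continuous_open_preimage smooth_in_continuous_on[OF sG] open_Int \<Omega>) auto
    moreover have "\<Omega> \<inter> ball p s \<inter> G -` {..<\<delta>} = S" by (auto simp: S_def)
    ultimately have "open S" by simp
    then have Sm: "S \<in> sets lebesgue" by auto
    have "measure lebesgue S \<le> 2 * measure lebesgue (ball p (s + 1)) * (\<delta> / \<kappa>)"
    proof (rule measure_le_if_disjoint_translates[OF Sm])
      show "S \<subseteq> ball p s" by (auto simp: S_def)
      show "x \<noteq> y + (real j * (\<delta> / \<kappa>)) *\<^sub>R a" if "x \<in> S" "y \<in> S" "1 \<le> j" for x y j
      proof
        assume eq: "x = y + (real j * (\<delta> / \<kappa>)) *\<^sub>R a"
        have mem: "x \<in> ball p s" "y \<in> ball p s" "x \<in> \<Omega>" "G y < \<delta>" using that by (auto simp: S_def)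
        then have br: "x \<in> ball p r" "y \<in> ball p r" using s by auto
        \<comment> \<open>Going from y to x raises \<open>g\<close> by at least j \<delta>, but on
          \<open>S\<close> its values lie strictly between -\<delta> and 0.\<close>
        have "g y + \<kappa> * (real j * (\<delta> / \<kappa>)) \<le> g (y + (real j * (\<delta> / \<kappa>)) *\<^sub>R a)"
          by (rule inc) (use br \<delta> \<kappa> eq in auto)
        then have "g y + real j * \<delta> \<le> g x" using \<kappa> eq by simp
        moreover have "1 * \<delta> \<le> real j * \<delta>" using that \<delta> by (intro mult_right_mono) auto
        moreover have "g x < 0" using gneg[of x] mem br r(2) by auto
        moreover have "- g y < \<delta>" using Gs mem by simp
        ultimately show False by simp
      qed
    qed (use a \<kappa> \<delta> in auto)
    then show "measure lebesgue {x \<in> \<Omega> \<inter> ball p s. G x < \<delta>} \<le> 2 * V / \<kappa> * \<delta>"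
      by (simp add: S_def V_def)
  qed (use \<kappa> sG in auto)
  then show thesis using that s by blast
qed

text \<open>By compactness finitely many local functions suffice, and they are added. All are
  nonnegative on the domain, so each is at most the sum: the lower bound survives on every ball of
  the cover, with the smallest factor, and each sublevel set of the sum is covered by those of the
  summands. Boundary values and tangential derivatives add up to zero.\<close>

lemma boundary_function_global:
  assumes \<Omega>: "smooth_bounded_domain \<Omega>"
  obtains \<psi> b C where "boundary_function \<Omega> UNIV b C \<psi>"
proof -
  have op: "open \<Omega>" and ne: "\<Omega> \<noteq> {}" and bd: "bounded \<Omega>"
    using \<Omega> by (auto simp: smooth_bounded_domain_def)
  have "\<forall>p\<in>closure \<Omega>. \<exists>q::real \<times> (real^3 \<Rightarrow> real) \<times> real \<times> real.
      0 < fst q \<and> boundary_function \<Omega> (ball p (fst q)) (fst (snd (snd q))) (snd (snd (snd q))) (fst (snd q))"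
  proof
    fix p assume p: "p \<in> closure \<Omega>"
    obtain s G b C where "0 < s" "boundary_function \<Omega> (ball p s) b C G"
    proof (cases "p \<in> \<Omega>")
      case True
      then show ?thesis using boundary_function_interior[OF op] that by blast
    next
      case False
      then have f: "p \<in> frontier \<Omega>" using p op by (simp add: frontier_def interior_open)
      then obtain U g where "p \<in> U" "local_defining_function \<Omega> U g"
        using \<Omega> unfolding smooth_bounded_domain_def by blast
      then show ?thesis using boundary_function_frontier[OF op f] that by blast
    qed
    then show "\<exists>q::real \<times> (real^3 \<Rightarrow> real) \<times> real \<times> real.
      0 < fst q \<and> boundary_function \<Omega> (ball p (fst q)) (fst (snd (snd q))) (snd (snd (snd q))) (fst (snd q))"
      by (intro exI[of _ "(s, G, b, C)"]) simp
  qed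
  note ex = this
  define q where "q p = (SOME q::real \<times> (real^3 \<Rightarrow> real) \<times> real \<times> real. 0 < fst q \<and>
      boundary_function \<Omega> (ball p (fst q)) (fst (snd (snd q))) (snd (snd (snd q))) (fst (snd q)))" for p
  have q: "0 < fst (q p) \<and>
      boundary_function \<Omega> (ball p (fst (q p))) (fst (snd (snd (q p)))) (snd (snd (snd (q p)))) (fst (snd (q p)))"
    if "p \<in> closure \<Omega>" for p
    unfolding q_def by (rule someI_ex[OF bspec[OF ex that]])
  define s where "s p = fst (q p)" for p
  define G where "G p = fst (snd (q p))" for p
  define b where "b p = fst (snd (snd (q p)))" for p
  define C where "C p = snd (snd (snd (q p)))" for p
  have loc: "0 < s p" "boundary_function \<Omega> (ball p (s p)) (b p) (C p) (G p)" if "p \<in> closure \<Omega>" for p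
    using q[OF that] by (auto simp: s_def G_def b_def C_def)
  have "compact (closure \<Omega>)" using bd by (simp add: compact_closure)
  then obtain F where F: "F \<subseteq> closure \<Omega>" "finite F" "closure \<Omega> \<subseteq> (\<Union>p\<in>F. ball p (s p))"
    by (rule compactE_image[where C = "closure \<Omega>" and f = "\<lambda>p. ball p (s p)"]) (use loc in auto)
  have Fne: "F \<noteq> {}" using F(3) ne closure_subset[of \<Omega>] by blast
  have locF: "boundary_function \<Omega> (ball p (s p)) (b p) (C p) (G p)" if "p \<in> F" for p
    using loc(2) that F(1) by blast
  have bpos: "0 < b p" and sm: "smooth_in UNIV (G p)" if "p \<in> F" for p
    using locF[OF that] unfolding boundary_function_def by blast+
  have nn: "0 \<le> G p x" if "p \<in> F" "x \<in> \<Omega>" for p x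
    using locF[OF that(1)] that(2) unfolding boundary_function_def by blast
  have lb: "b p * bdist \<Omega> x \<le> G p x" if "p \<in> F" "x \<in> \<Omega>" "x \<in> ball p (s p)" for p x
    using locF[OF that(1)] that(2,3) unfolding boundary_function_def by blast
  have fr: "G p x = 0" if "p \<in> F" "x \<in> frontier \<Omega>" for p x
    using locF[OF that(1)] that(2) unfolding boundary_function_def by blast
  have fr': "frechet_derivative (G p) (at x) v = 0"
    if "p \<in> F" "x \<in> frontier \<Omega>" "v \<bullet> outward_normal \<Omega> x = 0" for p x v
    using locF[OF that(1)] that(2,3) unfolding boundary_function_def by blast
  have mb: "measure lebesgue {x\<in>\<Omega> \<inter> ball p (s p). G p x < \<delta>} \<le> C p * \<delta>" if "p \<in> F" "0 < \<delta>" for p \<delta>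
    using locF[OF that(1)] that(2) unfolding boundary_function_def by blast
  define \<psi> where "\<psi> x = (\<Sum>p\<in>F. G p x)" for x
  have G_le: "G p x \<le> \<psi> x" if "p \<in> F" "x \<in> \<Omega>" for p x
    unfolding \<psi>_def using nn that F(2) by (intro member_le_sum) auto
  have der: "(\<psi> has_derivative (\<lambda>v. \<Sum>p\<in>F. frechet_derivative (G p) (at x) v)) (at x)" for x
    unfolding \<psi>_def[abs_def] by (intro has_derivative_sum smooth_in_has_derivative[of UNIV] sm UNIV_I)
  have "boundary_function \<Omega> UNIV (Min (b ` F)) (\<Sum>p\<in>F. C p) \<psi>"
    unfolding boundary_function_def
  proof (intro conjI ballI allI impI)
    show "0 < Min (b ` F)" using F(2) Fne bpos by auto
    show "smooth_in UNIV \<psi>"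
      unfolding \<psi>_def[abs_def] by (intro smooth_in_sum sm open_UNIV)
    show "0 \<le> \<psi> x" if "x \<in> \<Omega>" for x
      unfolding \<psi>_def using that by (intro sum_nonneg nn) auto
    show "Min (b ` F) * bdist \<Omega> x \<le> \<psi> x" if "x \<in> \<Omega> \<inter> UNIV" for x
    proof -
      have "x \<in> closure \<Omega>" using that closure_subset[of \<Omega>] by blast
      then obtain p where p: "p \<in> F" "x \<in> ball p (s p)" using F(3) by blast
      have "Min (b ` F) * bdist \<Omega> x \<le> b p * bdist \<Omega> x"
        using p F(2) by (intro mult_right_mono) (auto simp: bdist_def infdist_nonneg)
      also have "\<dots> \<le> G p x" using lb p that by auto
      also have "\<dots> \<le> \<psi> x" using G_le p that by auto
      finally show ?thesis .
    qed
    fix x assume x: "x \<in> frontier \<Omega>"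
    show "\<psi> x = 0" unfolding \<psi>_def
    proof (rule sum.neutral, rule ballI)
      fix p assume "p \<in> F"
      then show "G p x = 0" using fr x by blast
    qed
    fix v assume v: "v \<bullet> outward_normal \<Omega> x = 0"
    show "frechet_derivative \<psi> (at x) v = 0"
      unfolding frechet_derivative_eqI[OF der]
    proof (rule sum.neutral, rule ballI)
      fix p assume "p \<in> F"
      then show "frechet_derivative (G p) (at x) v = 0" using fr' x v by blast
    qed
  next
    fix \<delta> :: real assume \<delta>: "0 < \<delta>"
    define S where "S p = {x \<in> \<Omega> \<inter> ball p (s p). G p x < \<delta>}" for p
    have Sm: "S p \<in> lmeasurable" if "p \<in> F" for p
    proof -
      have "open (\<Omega> \<inter> ball p (s p) \<inter> G p -` {..<\<delta>})"
        by (intro continuous_open_preimage smooth_in_continuous_on[OF sm[OF that]] open_Int op) auto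
      moreover have "\<Omega> \<inter> ball p (s p) \<inter> G p -` {..<\<delta>} = S p" by (auto simp: S_def)
      ultimately have "open (S p)" by simp
      moreover have "bounded (S p)" using bd by (rule bounded_subset) (auto simp: S_def)
      ultimately show ?thesis by (simp add: bounded_set_imp_lmeasurable)
    qed
    have "{x \<in> \<Omega> \<inter> UNIV. \<psi> x < \<delta>} \<subseteq> (\<Union>p\<in>F. S p)"
    proof
      fix x assume x: "x \<in> {x \<in> \<Omega> \<inter> UNIV. \<psi> x < \<delta>}"
      then have "x \<in> closure \<Omega>" using closure_subset[of \<Omega>] by blast
      then obtain p where p: "p \<in> F" "x \<in> ball p (s p)" using F(3) by blast
      have "G p x \<le> \<psi> x" using G_le[of p x] x p by simp
      then have "x \<in> S p" using x p by (simp add: S_def)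
      then show "x \<in> (\<Union>p\<in>F. S p)" using p(1) by blast
    qed
    moreover have "{x \<in> \<Omega> \<inter> UNIV. \<psi> x < \<delta>} \<in> sets lebesgue"
    proof -
      have "smooth_in UNIV \<psi>"
        unfolding \<psi>_def[abs_def] by (intro smooth_in_sum sm open_UNIV)
      then have "open (\<Omega> \<inter> \<psi> -` {..<\<delta>})"
        by (intro continuous_open_preimage smooth_in_continuous_on[of UNIV] op) auto
      moreover have "{x \<in> \<Omega> \<inter> UNIV. \<psi> x < \<delta>} = \<Omega> \<inter> \<psi> -` {..<\<delta>}" by auto
      ultimately show ?thesis by simp
    qed
    ultimately have "measure lebesgue {x \<in> \<Omega> \<inter> UNIV. \<psi> x < \<delta>} \<le> measure lebesgue (\<Union>p\<in>F. S p)"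
      using Sm F(2) by (intro measure_mono_fmeasurable fmeasurable.finite_UN) auto
    also have "\<dots> \<le> (\<Sum>p\<in>F. measure lebesgue (S p))"
      using Sm F(2) by (intro measure_UNION_le) auto
    also have "\<dots> \<le> (\<Sum>p\<in>F. C p * \<delta>)"
      unfolding S_def using mb \<delta> by (intro sum_mono) auto
    finally show "measure lebesgue {x \<in> \<Omega> \<inter> UNIV. \<psi> x < \<delta>} \<le> (\<Sum>p\<in>F. C p) * \<delta>"
      by (simp add: sum_distrib_right)
  qed
  then show thesis by (rule that)
qed

subsection \<open>The relative internal energy\<close>

text \<open>The Bregman distance H(a) - H(r) - H'(r)(a - r) of the convex function H(s) =
  s^\<gamma>/(\<gamma> - 1); the terms in r alone combine to r^\<gamma>.\<close>

definition rel_H :: "real \<Rightarrow> real \<Rightarrow> real \<Rightarrow> real" where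
  "rel_H \<gamma> a r = a powr \<gamma> / (\<gamma> - 1) - \<gamma> / (\<gamma> - 1) * r powr (\<gamma> - 1) * a + r powr \<gamma>"

lemma rel_H_mult:
  assumes "1 < \<gamma>"
  shows "(\<gamma> - 1) * rel_H \<gamma> a r = a powr \<gamma> - \<gamma> * r powr (\<gamma> - 1) * a + (\<gamma> - 1) * r powr \<gamma>"
proof -
  have *: "k * (x / k - (k + 1) / k * y * a + z) = x - (k + 1) * y * a + k * z"
    if "0 < k" for k x y z :: real
    using that by (simp add: field_simps)
  show ?thesis
    unfolding rel_H_def using *[of "\<gamma> - 1" "a powr \<gamma>" "r powr (\<gamma> - 1)" "r powr \<gamma>"] assms by simp
qed

lemma rel_H_self: "1 < \<gamma> \<Longrightarrow> 0 < r \<Longrightarrow> rel_H \<gamma> r r = 0"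
proof -
  assume *: "1 < \<gamma>" "0 < r"
  have "r powr (\<gamma> - 1) * r = r powr \<gamma>"
    using * by (simp add: powr_mult_base[symmetric] powr_diff)
  then have "(\<gamma> - 1) * rel_H \<gamma> r r = 0"
    unfolding rel_H_mult[OF *(1)] by (simp add: mult.assoc algebra_simps)
  then show ?thesis using * by simp
qed

lemma rel_H_DERIV:
  assumes "1 < \<gamma>" "0 < a"
  shows "((\<lambda>a. rel_H \<gamma> a r) has_real_derivative \<gamma> / (\<gamma> - 1) * (a powr (\<gamma> - 1) - r powr (\<gamma> - 1))) (at a)"
proof -
  have "((\<lambda>a. a powr \<gamma> / (\<gamma> - 1)) has_real_derivative \<gamma> * a powr (\<gamma> - 1) / (\<gamma> - 1)) (at a)"
    using assms by (intro DERIV_cdivide has_real_derivative_powr)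
  from DERIV_add[OF DERIV_diff[OF this DERIV_cmult[OF DERIV_ident, of "\<gamma> / (\<gamma> - 1) * r powr (\<gamma> - 1)"]]
      DERIV_const[of "r powr \<gamma>"]]
  show ?thesis
    unfolding rel_H_def by (simp add: right_diff_distrib)
qed

lemma continuous_on_rel_H:
  assumes "1 < \<gamma>" "\<And>z. z \<in> S \<Longrightarrow> 0 \<le> f z" "\<And>z. z \<in> S \<Longrightarrow> 0 \<le> g z" "continuous_on S f" "continuous_on S g"
  shows "continuous_on S (\<lambda>z. rel_H \<gamma> (f z) (g z))"
  unfolding rel_H_def using assms
  by (intro continuous_intros continuous_on_powr') auto

text \<open>The derivative in \<open>a\<close> has the sign of a - r, so the value zero at a = r is
  a strict minimum. At the endpoint a = 0 continuity suffices.\<close>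

lemma rel_H_pos:
  assumes \<gamma>: "1 < \<gamma>" and r: "0 < r" and a: "0 \<le> a" "a \<noteq> r"
  shows "0 < rel_H \<gamma> a r"
proof -
  have cont: "continuous_on {x..y} (\<lambda>a. rel_H \<gamma> a r)" if "0 \<le> x" for x y
    by (rule continuous_on_rel_H[OF \<gamma>]) (use that r in auto)
  show ?thesis
  proof (cases "a < r")
    case True
    have "rel_H \<gamma> r r < rel_H \<gamma> a r"
    proof (rule DERIV_neg_imp_decreasing_open[OF True])
      fix x assume x: "a < x" "x < r"
      then have "x powr (\<gamma> - 1) < r powr (\<gamma> - 1)" using \<gamma> a by (intro powr_less_mono2) auto
      then have "\<gamma> / (\<gamma> - 1) * (x powr (\<gamma> - 1) - r powr (\<gamma> - 1)) < 0"
        using \<gamma> by (intro mult_pos_neg) auto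
      then show "\<exists>y. ((\<lambda>a. rel_H \<gamma> a r) has_real_derivative y) (at x) \<and> y < 0"
        using rel_H_DERIV[OF \<gamma>, of x r] x a by (intro exI conjI) auto
    qed (rule cont[OF a(1)])
    then show ?thesis using rel_H_self[OF \<gamma> r] by simp
  next
    case False
    then have ra: "r < a" using a by simp
    have "rel_H \<gamma> r r < rel_H \<gamma> a r"
    proof (rule DERIV_pos_imp_increasing_open[OF ra])
      fix x assume x: "r < x" "x < a"
      then have "r powr (\<gamma> - 1) < x powr (\<gamma> - 1)" using \<gamma> r by (intro powr_less_mono2) auto
      then have "0 < \<gamma> / (\<gamma> - 1) * (x powr (\<gamma> - 1) - r powr (\<gamma> - 1))"
        using \<gamma> by (intro mult_pos_pos) auto
      then show "\<exists>y. ((\<lambda>a. rel_H \<gamma> a r) has_real_derivative y) (at x) \<and> 0 < y"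
        using rel_H_DERIV[OF \<gamma>, of x r] x r by (intro exI conjI) auto
    qed (use cont r in auto)
    then show ?thesis using rel_H_self[OF \<gamma> r] by simp
  qed
qed

lemma rel_H_nonneg:
  assumes "1 < \<gamma>" "0 \<le> r" "0 \<le> a"
  shows "0 \<le> rel_H \<gamma> a r"
proof (cases "r = 0 \<or> a = r")
  case True
  then show ?thesis using assms rel_H_self[of \<gamma> r] by (cases "r = 0") (auto simp: rel_H_def)
next
  case False
  then show ?thesis using assms rel_H_pos[of \<gamma> r a] by auto
qed

lemma rel_H_large:
  assumes \<gamma>: "1 < \<gamma>" and M: "0 < M"
  obtains R where "0 < R" "2 * M \<le> R" "\<And>a r. R \<le> a \<Longrightarrow> 0 \<le> r \<Longrightarrow> r \<le> M \<Longrightarrow> a powr \<gamma> \<le> 2 * (\<gamma> - 1) * rel_H \<gamma> a r"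
proof -
  \<comment> \<open>Beyond the second threshold the linear term is at most half of a^\<gamma>; the
    first one later gives |a - r| \<le> a.\<close>
  define R where "R = max (2 * M) ((2 * \<gamma>) powr (1 / (\<gamma> - 1)) * M)"
  have R: "0 < R" "2 * M \<le> R" using M by (auto simp: R_def)
  have "a powr \<gamma> \<le> 2 * (\<gamma> - 1) * rel_H \<gamma> a r" if "R \<le> a" "0 \<le> r" "r \<le> M" for a r
  proof -
    have a: "0 < a" using that R by simp
    have "r powr (\<gamma> - 1) \<le> M powr (\<gamma> - 1)" using that \<gamma> by (intro powr_mono2) auto
    then have "2 * \<gamma> * r powr (\<gamma> - 1) \<le> 2 * \<gamma> * M powr (\<gamma> - 1)" using \<gamma> by simp
    also have "\<dots> = ((2 * \<gamma>) powr (1 / (\<gamma> - 1)) * M) powr (\<gamma> - 1)"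
      using \<gamma> M by (simp add: powr_mult powr_powr)
    also have "\<dots> \<le> a powr (\<gamma> - 1)"
      using that \<gamma> M by (intro powr_mono2) (auto simp: R_def)
    finally have "2 * \<gamma> * r powr (\<gamma> - 1) * a \<le> a powr (\<gamma> - 1) * a"
      using a by (intro mult_right_mono) auto
    also have "\<dots> = a powr \<gamma>" using a by (simp add: powr_diff)
    finally have *: "2 * \<gamma> * r powr (\<gamma> - 1) * a \<le> a powr \<gamma>" .
    have "2 * (\<gamma> - 1) * rel_H \<gamma> a r = 2 * a powr \<gamma> - 2 * \<gamma> * r powr (\<gamma> - 1) * a + 2 * (\<gamma> - 1) * r powr \<gamma>"
      by (simp only: mult.assoc rel_H_mult[OF \<gamma>]) (simp add: algebra_simps)
    moreover have "0 \<le> 2 * (\<gamma> - 1) * r powr \<gamma>" using \<gamma> by simp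
    ultimately show ?thesis using * by simp
  qed
  then show thesis using that R by blast
qed

text \<open>Where f reaches \<delta>, g has no zero, and this part of \<open>K\<close> is compact,
  so g has a positive minimum on it. Both comparisons of \<open>rel_H\<close> with powers follow
  from this without expansions near the diagonal.\<close>

lemma compact_le_small_plus:
  fixes f g :: "'a::metric_space \<Rightarrow> real"
  assumes K: "compact K" and f: "continuous_on K f" and g: "continuous_on K g"
    and g0: "\<And>z. z \<in> K \<Longrightarrow> 0 \<le> g z" and \<delta>: "\<And>z. z \<in> K \<Longrightarrow> g z = 0 \<Longrightarrow> f z < \<delta>"
  obtains C where "0 \<le> C" "\<And>z. z \<in> K \<Longrightarrow> f z \<le> \<delta> + C * g z"
proof -
  define L where "L = K \<inter> f -` {\<delta>..}"
  have "closed L" unfolding L_def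
    using continuous_on_closed_vimage[OF compact_imp_closed[OF K], of f] f by (auto simp: Int_commute)
  then have "compact (K \<inter> L)" by (rule compact_Int_closed[OF K])
  moreover have "K \<inter> L = L" by (auto simp: L_def)
  ultimately have L: "compact L" by simp
  show thesis
  proof (cases "L = {}")
    case True
    then show thesis using that[of 0] by (force simp: L_def)
  next
    case False
    have cont: "continuous_on L f" "continuous_on L g"
      using f g by (auto simp: L_def intro: continuous_on_subset)
    obtain u where u: "u \<in> L" "\<And>z. z \<in> L \<Longrightarrow> g u \<le> g z"
      using continuous_attains_inf[OF L False cont(2)] by auto
    obtain v where v: "v \<in> L" "\<And>z. z \<in> L \<Longrightarrow> f z \<le> f v"
      using continuous_attains_sup[OF L False cont(1)] by auto
    have gu: "0 < g u" using u(1) g0[of u] \<delta>[of u] by (fastforce simp: L_def)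
    define C where "C = max 0 (f v - \<delta>) / g u"
    have "0 \<le> C" using gu by (simp add: C_def)
    moreover have "f z \<le> \<delta> + C * g z" if "z \<in> K" for z
    proof (cases "z \<in> L")
      case True
      have "f z - \<delta> \<le> C * g u" using v(2)[OF True] gu by (simp add: C_def)
      also have "\<dots> \<le> C * g z" using u(2)[OF True] \<open>0 \<le> C\<close> by (rule mult_left_mono)
      finally show ?thesis by simp
    next
      case False
      then have "f z < \<delta>" using that by (auto simp: L_def)
      moreover have "0 \<le> C * g z" using \<open>0 \<le> C\<close> g0[OF that] by simp
      ultimately show ?thesis by simp
    qed
    ultimately show thesis by (rule that)
  qed
qed

text \<open>Near a = r the relative internal energy is quadratic, so for \<gamma> < 2 it cannot
  dominate |a - r|^\<gamma> and an additive error is unavoidable; an arbitrarily small one is enough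
  for limits. Compactness settles bounded a, growth settles large a.\<close>

lemma powr_abs_diff_le_rel_H:
  assumes \<gamma>: "1 < \<gamma>" and m: "0 < m" and M: "m \<le> M" and \<delta>: "0 < \<delta>"
  obtains C where "0 \<le> C" "\<And>a r. 0 \<le> a \<Longrightarrow> m \<le> r \<Longrightarrow> r \<le> M \<Longrightarrow> \<bar>a - r\<bar> powr \<gamma> \<le> \<delta> + C * rel_H \<gamma> a r"
proof -
  have M0: "0 < M" using m M by simp
  obtain R where R: "0 < R" "2 * M \<le> R"
    "\<And>a r. R \<le> a \<Longrightarrow> 0 \<le> r \<Longrightarrow> r \<le> M \<Longrightarrow> a powr \<gamma> \<le> 2 * (\<gamma> - 1) * rel_H \<gamma> a r"
    using rel_H_large[OF \<gamma> M0] by metis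
  define K where "K = {0..R} \<times> {m..M}"
  have K: "compact K" unfolding K_def by (intro compact_Times) auto
  obtain C where C: "0 \<le> C" "\<And>z. z \<in> K \<Longrightarrow> \<bar>fst z - snd z\<bar> powr \<gamma> \<le> \<delta> + C * rel_H \<gamma> (fst z) (snd z)"
  proof (rule compact_le_small_plus[OF K])
    show "continuous_on K (\<lambda>z. \<bar>fst z - snd z\<bar> powr \<gamma>)"
      using \<gamma> by (intro continuous_on_powr' continuous_intros) auto
    show "continuous_on K (\<lambda>z. rel_H \<gamma> (fst z) (snd z))"
      using m by (intro continuous_on_rel_H[OF \<gamma>] continuous_intros) (auto simp: K_def)
    show "0 \<le> rel_H \<gamma> (fst z) (snd z)" if "z \<in> K" for z
      using that m by (intro rel_H_nonneg[OF \<gamma>]) (auto simp: K_def)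
    show "\<bar>fst z - snd z\<bar> powr \<gamma> < \<delta>" if "z \<in> K" "rel_H \<gamma> (fst z) (snd z) = 0" for z
    proof -
      have "fst z = snd z" using that m rel_H_pos[OF \<gamma>, of "snd z" "fst z"] by (force simp: K_def)
      then show ?thesis using \<delta> by simp
    qed
  qed (rule that)
  show thesis
  proof (rule that)
    show "0 \<le> max C (2 * (\<gamma> - 1))" using C by simp
    fix a r :: real assume ar: "0 \<le> a" "m \<le> r" "r \<le> M"
    have H: "0 \<le> rel_H \<gamma> a r" using ar m by (intro rel_H_nonneg[OF \<gamma>]) auto
    show "\<bar>a - r\<bar> powr \<gamma> \<le> \<delta> + max C (2 * (\<gamma> - 1)) * rel_H \<gamma> a r"
    proof (cases "a \<le> R")
      case True
      then have "\<bar>a - r\<bar> powr \<gamma> \<le> \<delta> + C * rel_H \<gamma> a r" using C(2)[of "(a, r)"] ar by (simp add: K_def)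
      also have "\<dots> \<le> \<delta> + max C (2 * (\<gamma> - 1)) * rel_H \<gamma> a r"
        using H by (intro add_left_mono mult_right_mono) auto
      finally show ?thesis .
    next
      case False
      have "\<bar>a - r\<bar> powr \<gamma> \<le> a powr \<gamma>" using False ar R m \<gamma> by (intro powr_mono2) auto
      also have "\<dots> \<le> 2 * (\<gamma> - 1) * rel_H \<gamma> a r" using R(3)[of a r] False ar m by simp
      also have "\<dots> \<le> max C (2 * (\<gamma> - 1)) * rel_H \<gamma> a r" using H by (intro mult_right_mono) auto
      finally show ?thesis using \<delta> by simp
    qed
  qed
qed

text \<open>The converse comparison, whose additive error is forced when \<gamma> > 2. For large a
  both sides grow like a^\<gamma>.\<close>

lemma rel_H_le_powr_abs_diff:
  assumes \<gamma>: "1 < \<gamma>" and m: "0 < m" and M: "m \<le> M" and \<delta>: "0 < \<delta>"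
  obtains C where "0 \<le> C" "\<And>a r. 0 \<le> a \<Longrightarrow> m \<le> r \<Longrightarrow> r \<le> M \<Longrightarrow> rel_H \<gamma> a r \<le> \<delta> + C * \<bar>a - r\<bar> powr \<gamma>"
proof -
  have M0: "0 < M" using m M by simp
  define K where "K = {0..2*M} \<times> {m..M}"
  have K: "compact K" unfolding K_def by (intro compact_Times) auto
  obtain C where C: "0 \<le> C" "\<And>z. z \<in> K \<Longrightarrow> rel_H \<gamma> (fst z) (snd z) \<le> \<delta> + C * \<bar>fst z - snd z\<bar> powr \<gamma>"
  proof (rule compact_le_small_plus[OF K,
        where f = "\<lambda>z. rel_H \<gamma> (fst z) (snd z)" and g = "\<lambda>z. \<bar>fst z - snd z\<bar> powr \<gamma>"])
    show "continuous_on K (\<lambda>z. \<bar>fst z - snd z\<bar> powr \<gamma>)"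
      using \<gamma> by (intro continuous_on_powr' continuous_intros) auto
    show "continuous_on K (\<lambda>z. rel_H \<gamma> (fst z) (snd z))"
      using m by (intro continuous_on_rel_H[OF \<gamma>] continuous_intros) (auto simp: K_def)
    show "rel_H \<gamma> (fst z) (snd z) < \<delta>" if "z \<in> K" "\<bar>fst z - snd z\<bar> powr \<gamma> = 0" for z
      using that m \<delta> rel_H_self[OF \<gamma>, of "snd z"] by (auto simp: K_def)
  qed (auto intro: that)
  define D where "D = (1 / (\<gamma> - 1) + 1) * 2 powr \<gamma>"
  have D: "0 \<le> D" using \<gamma> by (simp add: D_def)
  show thesis
  proof (rule that)
    show "0 \<le> max C D" using C by simp
    fix a r :: real assume ar: "0 \<le> a" "m \<le> r" "r \<le> M"
    show "rel_H \<gamma> a r \<le> \<delta> + max C D * \<bar>a - r\<bar> powr \<gamma>"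
    proof (cases "a \<le> 2 * M")
      case True
      then have "rel_H \<gamma> a r \<le> \<delta> + C * \<bar>a - r\<bar> powr \<gamma>" using C(2)[of "(a, r)"] ar by (simp add: K_def)
      also have "\<dots> \<le> \<delta> + max C D * \<bar>a - r\<bar> powr \<gamma>"
        by (intro add_left_mono mult_right_mono) auto
      finally show ?thesis .
    next
      case False
      have "0 \<le> \<gamma> / (\<gamma> - 1) * r powr (\<gamma> - 1) * a" using ar \<gamma> by simp
      then have "rel_H \<gamma> a r \<le> a powr \<gamma> / (\<gamma> - 1) + r powr \<gamma>" by (simp add: rel_H_def)
      also have "r powr \<gamma> \<le> a powr \<gamma>" using ar False m \<gamma> M0 by (intro powr_mono2) auto
      finally have H: "rel_H \<gamma> a r \<le> (1 / (\<gamma> - 1) + 1) * a powr \<gamma>" by (simp add: algebra_simps)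
      \<comment> \<open>Here a exceeds 2 M, so r is at most half of a and the distance at least half
        of a.\<close>
      have "a powr \<gamma> \<le> (2 * \<bar>a - r\<bar>) powr \<gamma>"
        using ar False \<gamma> M0 by (intro powr_mono2) auto
      also have "(2 * \<bar>a - r\<bar>) powr \<gamma> = 2 powr \<gamma> * \<bar>a - r\<bar> powr \<gamma>" by (simp add: powr_mult)
      finally have "(1 / (\<gamma> - 1) + 1) * a powr \<gamma> \<le> (1 / (\<gamma> - 1) + 1) * (2 powr \<gamma> * \<bar>a - r\<bar> powr \<gamma>)"
        using \<gamma> by (intro mult_left_mono) auto
      with H have "rel_H \<gamma> a r \<le> (1 / (\<gamma> - 1) + 1) * (2 powr \<gamma> * \<bar>a - r\<bar> powr \<gamma>)"
        by linarith
      then have "rel_H \<gamma> a r \<le> D * \<bar>a - r\<bar> powr \<gamma>"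
        by (simp only: D_def mult.assoc)
      also have "\<dots> \<le> max C D * \<bar>a - r\<bar> powr \<gamma>" by (intro mult_right_mono) auto
      finally show ?thesis using \<delta> by simp
    qed
  qed
qed

lemma powr_le_rel_H:
  assumes \<gamma>: "1 < \<gamma>" and M: "0 < M"
  obtains C where "1 \<le> C" "\<And>a r. 0 \<le> a \<Longrightarrow> 0 \<le> r \<Longrightarrow> r \<le> M \<Longrightarrow> a powr \<gamma> \<le> C * (1 + rel_H \<gamma> a r)"
proof -
  obtain R where R: "0 < R" "2 * M \<le> R"
    "\<And>a r. R \<le> a \<Longrightarrow> 0 \<le> r \<Longrightarrow> r \<le> M \<Longrightarrow> a powr \<gamma> \<le> 2 * (\<gamma> - 1) * rel_H \<gamma> a r"
    using rel_H_large[OF assms] by metis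
  define C where "C = 1 + R powr \<gamma> + 2 * (\<gamma> - 1)"
  have "0 \<le> R powr \<gamma>" "0 \<le> 2 * (\<gamma> - 1)" using \<gamma> by auto
  then have C: "1 \<le> C" unfolding C_def by (simp only: add.assoc le_add_same_cancel1 add_nonneg_nonneg)
  show thesis
  proof (rule that[OF C])
    fix a r :: real assume ar: "0 \<le> a" "0 \<le> r" "r \<le> M"
    have H: "0 \<le> rel_H \<gamma> a r" using ar by (intro rel_H_nonneg[OF \<gamma>]) auto
    show "a powr \<gamma> \<le> C * (1 + rel_H \<gamma> a r)"
    proof (cases "a \<le> R")
      case True
      then have "a powr \<gamma> \<le> R powr \<gamma>" using ar \<gamma> by (intro powr_mono2) auto
      also have "\<dots> \<le> C" using \<gamma> by (simp add: C_def)
      also have "\<dots> \<le> C * (1 + rel_H \<gamma> a r)" using C H by (simp add: mult_le_cancel_left1)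
      finally show ?thesis .
    next
      case False
      then have "a powr \<gamma> \<le> 2 * (\<gamma> - 1) * rel_H \<gamma> a r" using R(3)[of a r] ar by simp
      also have "\<dots> \<le> C * (1 + rel_H \<gamma> a r)" using C H \<gamma> by (intro mult_mono) (auto simp: C_def)
      finally show ?thesis .
    qed
  qed
qed

text \<open>A form of Young's inequality: the constant on the right is the threshold at which \<eta>
  a^(\<gamma> - 1) reaches one, so above it the power term alone dominates a.\<close>

lemma le_small_powr:
  fixes a :: real
  assumes "1 < \<gamma>" "0 < \<eta>" "0 \<le> a"
  shows "a \<le> \<eta> * a powr \<gamma> + \<eta> powr (- 1 / (\<gamma> - 1))"
proof (cases "a \<le> \<eta> powr (- 1 / (\<gamma> - 1))")
  case True
  moreover have "0 \<le> \<eta> * a powr \<gamma>" using assms by simp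
  ultimately show ?thesis by simp
next
  case False
  then have a: "0 < a" using assms powr_gt_zero[of \<eta>] by (smt (verit))
  have "(\<eta> powr (- 1 / (\<gamma> - 1))) powr (\<gamma> - 1) = \<eta> powr (- 1)"
    unfolding powr_powr using assms by simp
  then have "\<eta> * (\<eta> powr (- 1 / (\<gamma> - 1))) powr (\<gamma> - 1) = 1"
    using assms by (simp add: powr_minus_divide)
  moreover have "(\<eta> powr (- 1 / (\<gamma> - 1))) powr (\<gamma> - 1) \<le> a powr (\<gamma> - 1)"
    using False assms by (intro powr_mono2) auto
  ultimately have "1 \<le> \<eta> * a powr (\<gamma> - 1)" using assms by (metis mult_left_mono less_imp_le)
  then have "a \<le> \<eta> * a powr (\<gamma> - 1) * a" using a by (simp add: mult_le_cancel_right1)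
  also have "\<dots> = \<eta> * a powr \<gamma>" using a by (simp add: powr_diff)
  finally show ?thesis using powr_gt_zero[of \<eta> "- 1 / (\<gamma> - 1)"] assms by linarith
qed

subsection \<open>Integration on product domains\<close>

lemma AE_lebesgue_pair:
  fixes P :: "'a::euclidean_space \<times> 'b::euclidean_space \<Rightarrow> bool"
  assumes "AE z in lebesgue. P z"
  shows "AE x in lebesgue. AE y in lebesgue. P (x, y)"
proof -
  have "AE z in lborel \<Otimes>\<^sub>M lborel. P z"
    unfolding lborel_prod using assms by (simp add: AE_completion_iff)
  then have "AE x in lborel. AE y in lborel. P (x, y)" by (rule lborel_pair.AE_pair)
  then show ?thesis by (simp add: AE_completion_iff)
qed

text \<open>Tonelli's theorem is applied to a Borel function that agrees almost everywhere. Almost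
  every section of the exceptional null set is null, so the iterated integral does not notice the
  replacement.\<close>

lemma nn_integral_lebesgue_pair:
  fixes f :: "'a::euclidean_space \<times> 'b::euclidean_space \<Rightarrow> ennreal"
  assumes f: "f \<in> borel_measurable lebesgue"
  shows "(\<integral>\<^sup>+z. f z \<partial>lebesgue) = (\<integral>\<^sup>+x. \<integral>\<^sup>+y. f (x, y) \<partial>lebesgue \<partial>lebesgue)"
proof -
  obtain f' where f': "f' \<in> borel_measurable lborel" "AE z in lborel. f z = f' z"
    using completion_ex_borel_measurable[OF f] by blast
  have AE: "AE z in lebesgue. f z = f' z" using f'(2) by (rule AE_completion)
  have f'p: "f' \<in> borel_measurable (lborel \<Otimes>\<^sub>M lborel)" using f'(1) by (simp add: lborel_prod)
  have sec: "(\<lambda>y. f' (x, y)) \<in> borel_measurable lborel" for x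
    using measurable_compose[OF measurable_Pair1' f'p] by auto
  have "(\<integral>\<^sup>+z. f z \<partial>lebesgue) = (\<integral>\<^sup>+z. f' z \<partial>lebesgue)" by (rule nn_integral_cong_AE[OF AE])
  also have "\<dots> = (\<integral>\<^sup>+z. f' z \<partial>lborel)" using f'(1) by (simp add: nn_integral_completion)
  also have "\<dots> = (\<integral>\<^sup>+x. \<integral>\<^sup>+y. f' (x, y) \<partial>lborel \<partial>lborel)"
    using lborel.nn_integral_fst[OF f'p] by (simp add: lborel_prod)
  also have "\<dots> = (\<integral>\<^sup>+x. \<integral>\<^sup>+y. f' (x, y) \<partial>lebesgue \<partial>lborel)"
    using sec by (simp add: nn_integral_completion)
  also have "\<dots> = (\<integral>\<^sup>+x. \<integral>\<^sup>+y. f' (x, y) \<partial>lebesgue \<partial>lebesgue)"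
  proof -
    have "(\<lambda>x. \<integral>\<^sup>+y. f' (x, y) \<partial>lborel) \<in> borel_measurable lborel"
      by (rule lborel.borel_measurable_nn_integral_fst[OF f'p])
    then show ?thesis using sec by (simp add: nn_integral_completion)
  qed
  also have "\<dots> = (\<integral>\<^sup>+x. \<integral>\<^sup>+y. f (x, y) \<partial>lebesgue \<partial>lebesgue)"
    by (rule nn_integral_cong_AE) (use AE_lebesgue_pair[OF AE] in \<open>auto elim!: eventually_mono intro!: nn_integral_cong_AE\<close>)
  finally show ?thesis .
qed

lemma nn_integral_lebesgue_on_Times:
  fixes f :: "'a::euclidean_space \<times> 'b::euclidean_space \<Rightarrow> ennreal"
  assumes A: "open A" and B: "open B" and f: "f \<in> borel_measurable (lebesgue_on (A \<times> B))"
  shows "(\<integral>\<^sup>+z. f z \<partial>lebesgue_on (A \<times> B)) = (\<integral>\<^sup>+x. \<integral>\<^sup>+y. f (x, y) \<partial>lebesgue_on B \<partial>lebesgue_on A)"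
proof -
  have S: "A \<times> B \<in> sets lebesgue" "A \<in> sets lebesgue" "B \<in> sets lebesgue"
    using A B by (auto simp: open_Times)
  have m: "(\<lambda>z. f z * indicator (A \<times> B) z) \<in> borel_measurable lebesgue"
    using f S by (simp add: borel_measurable_restrict_space_iff_ennreal)
  have "(\<integral>\<^sup>+z. f z \<partial>lebesgue_on (A \<times> B)) = (\<integral>\<^sup>+z. f z * indicator (A \<times> B) z \<partial>lebesgue)"
    using S by (simp add: nn_integral_restrict_space)
  also have "\<dots> = (\<integral>\<^sup>+x. \<integral>\<^sup>+y. f (x, y) * indicator (A \<times> B) (x, y) \<partial>lebesgue \<partial>lebesgue)"
    by (rule nn_integral_lebesgue_pair[OF m])
  also have "\<dots> = (\<integral>\<^sup>+x. (\<integral>\<^sup>+y. f (x, y) * indicator B y \<partial>lebesgue) * indicator A x \<partial>lebesgue)"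
    by (intro nn_integral_cong) (auto simp: indicator_def)
  finally show ?thesis using S by (simp add: nn_integral_restrict_space)
qed

text \<open>Passing from almost every slice to almost every point relies on joint measurability: by
  Tonelli the integral of the negative part is zero. This converts the sign condition on the
  density, given time by time, into one on the cylinder.\<close>

lemma AE_lebesgue_on_TimesI:
  fixes f :: "'a::euclidean_space \<times> 'b::euclidean_space \<Rightarrow> real"
  assumes A: "open A" and B: "open B" and f: "f \<in> borel_measurable (lebesgue_on (A \<times> B))"
    and P: "AE x in lebesgue_on A. AE y in lebesgue_on B. 0 \<le> f (x, y)"
  shows "AE z in lebesgue_on (A \<times> B). 0 \<le> f z"
proof -
  have m: "(\<lambda>z. ennreal (- f z)) \<in> borel_measurable (lebesgue_on (A \<times> B))" using f by measurable
  have "(\<integral>\<^sup>+z. ennreal (- f z) \<partial>lebesgue_on (A \<times> B)) =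
      (\<integral>\<^sup>+x. \<integral>\<^sup>+y. ennreal (- f (x, y)) \<partial>lebesgue_on B \<partial>lebesgue_on A)"
    by (rule nn_integral_lebesgue_on_Times[OF A B m])
  also have "\<dots> = (\<integral>\<^sup>+x. 0 \<partial>lebesgue_on A)"
  proof (rule nn_integral_cong_AE, use P in eventually_elim)
    case (elim x)
    have "(\<integral>\<^sup>+y. ennreal (- f (x, y)) \<partial>lebesgue_on B) = (\<integral>\<^sup>+y. 0 \<partial>lebesgue_on B)"
      by (rule nn_integral_cong_AE, use elim in eventually_elim) (simp add: ennreal_neg)
    then show ?case by simp
  qed
  finally have "AE z in lebesgue_on (A \<times> B). ennreal (- f z) = 0"
    using m by (simp add: nn_integral_0_iff_AE)
  then show ?thesis by eventually_elim (auto simp: ennreal_eq_0_iff)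
qed

lemma Fubini_continuous:
  fixes f :: "'a::euclidean_space \<times> 'b::euclidean_space \<Rightarrow> real"
  assumes A: "open A" "bounded A" and B: "open B" "bounded B"
    and f: "continuous_on (A \<times> B) f" and K: "\<And>z. z \<in> A \<times> B \<Longrightarrow> \<bar>f z\<bar> \<le> K"
  shows "integrable (lebesgue_on (A \<times> B)) f"
    and "(LINT z|lebesgue_on (A \<times> B). f z) = (LINT x|lebesgue_on A. LINT y|lebesgue_on B. f (x, y))"
    and "(LINT z|lebesgue_on (A \<times> B). f z) = (LINT y|lebesgue_on B. LINT x|lebesgue_on A. f (x, y))"
proof -
  have S: "A \<times> B \<in> sets lebesgue" "A \<in> sets lebesgue" "B \<in> sets lebesgue"
    using A B by (auto simp: open_Times)
  define g where "g z = indicator (A \<times> B) z *\<^sub>R f z" for z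
  have gm: "g \<in> borel_measurable borel" unfolding g_def
    by (rule borel_measurable_continuous_on_indicator) (use A B f in \<open>auto simp: open_Times\<close>)
  have ABm: "emeasure lborel (A \<times> B) < \<infinity>"
    using A B by (intro emeasure_bounded_finite bounded_Times)
  have g: "integrable lborel g"
    by (rule integrableI_bounded_set[where A = "A \<times> B" and B = K])
      (use gm K A B ABm in \<open>auto simp: g_def open_Times\<close>)
  have gp: "integrable (lborel \<Otimes>\<^sub>M lborel) g" using g by (simp add: lborel_prod)
  have "integrable lebesgue g" using g gm by (simp add: integrable_completion)
  then show "integrable (lebesgue_on (A \<times> B)) f"
    unfolding g_def using S by (simp add: integrable_restrict_space)
  have "(LINT z|lebesgue_on (A \<times> B). f z) = (LINT z|lebesgue. g z)"
    unfolding g_def using S by (simp add: integral_restrict_space)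
  also have "\<dots> = (LINT z|lborel. g z)" using gm by (simp add: integral_completion)
  finally have eq: "(LINT z|lebesgue_on (A \<times> B). f z) = integral\<^sup>L (lborel \<Otimes>\<^sub>M lborel) g"
    by (simp add: lborel_prod)
  have gpm: "g \<in> borel_measurable (lborel \<Otimes>\<^sub>M lborel)" using gm by (simp add: lborel_prod)
  have s1: "(\<lambda>y. g (x, y)) \<in> borel_measurable lborel" for x
    using measurable_compose[OF measurable_Pair1' gpm] by auto
  have s2: "(\<lambda>x. g (x, y)) \<in> borel_measurable lborel" for y
    using measurable_compose[OF measurable_Pair2' gpm] by auto
  have i1: "(LINT y|lborel. g (x, y)) = indicator A x *\<^sub>R (LINT y|lebesgue_on B. f (x, y))" for x
  proof -
    have "(LINT y|lborel. g (x, y)) = (LINT y|lebesgue. g (x, y))"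
      using s1 by (simp add: integral_completion)
    also have "\<dots> = indicator A x *\<^sub>R (LINT y|lebesgue. indicator B y *\<^sub>R f (x, y))"
      by (auto simp: g_def indicator_def cong: if_cong)
    finally show ?thesis using S by (simp add: integral_restrict_space)
  qed
  have i2: "(LINT x|lborel. g (x, y)) = indicator B y *\<^sub>R (LINT x|lebesgue_on A. f (x, y))" for y
  proof -
    have "(LINT x|lborel. g (x, y)) = (LINT x|lebesgue. g (x, y))"
      using s2 by (simp add: integral_completion)
    also have "\<dots> = indicator B y *\<^sub>R (LINT x|lebesgue. indicator A x *\<^sub>R f (x, y))"
      by (auto simp: g_def indicator_def cong: if_cong)
    finally show ?thesis using S by (simp add: integral_restrict_space)
  qed
  have m1: "(\<lambda>x. LINT y|lborel. g (x, y)) \<in> borel_measurable lborel"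
    by (rule lborel.borel_measurable_lebesgue_integral) (simp add: gpm)
  have m2: "(\<lambda>y. LINT x|lborel. g (x, y)) \<in> borel_measurable lborel"
    using lborel_pair.integrable_snd[of "\<lambda>x y. g (x, y)"] gp by auto
  have "(LINT z|lebesgue_on (A \<times> B). f z) = (LINT x|lborel. LINT y|lborel. g (x, y))"
    unfolding eq using lborel_pair.integral_fst'[OF gp] by simp
  also have "\<dots> = (LINT x|lebesgue. LINT y|lborel. g (x, y))" using m1 by (simp add: integral_completion)
  finally show "(LINT z|lebesgue_on (A \<times> B). f z) = (LINT x|lebesgue_on A. LINT y|lebesgue_on B. f (x, y))"
    unfolding i1 using S by (simp add: integral_restrict_space)
  have "(LINT z|lebesgue_on (A \<times> B). f z) = (LINT y|lborel. LINT x|lborel. g (x, y))"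
    unfolding eq using lborel_pair.integral_snd[of "\<lambda>x y. g (x, y)"] gp by simp
  also have "\<dots> = (LINT y|lebesgue. LINT x|lborel. g (x, y))" using m2 by (simp add: integral_completion)
  finally show "(LINT z|lebesgue_on (A \<times> B). f z) = (LINT y|lebesgue_on B. LINT x|lebesgue_on A. f (x, y))"
    unfolding i2 using S by (simp add: integral_restrict_space)
qed

lemma LINT_FTC:
  fixes g :: "real \<Rightarrow> real"
  assumes "0 \<le> T" and der: "\<And>t. 0 \<le> t \<Longrightarrow> t \<le> T \<Longrightarrow> (g has_real_derivative g' t) (at t)"
    and cont: "continuous_on {0..T} g'"
  shows "(LINT t|lebesgue_on {0<..<T}. g' t) = g T - g 0"
proof -
  have "(g' has_integral (g T - g 0)) {0..T}"
    using assms by (intro fundamental_theorem_of_calculus)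
      (auto simp: has_real_derivative_iff_has_vector_derivative[symmetric] intro: has_field_derivative_at_within)
  then have hi: "(g' has_integral (g T - g 0)) {0<..<T}"
    using has_integral_Icc_iff_Ioo[of g' _ 0 T] by simp
  have "integrable (lebesgue_on {0..T}) g'"
    using cont by (rule continuous_imp_integrable_real)
  then have "integrable lebesgue (\<lambda>t. indicator {0..T} t *\<^sub>R g' t)"
    by (simp add: integrable_restrict_space)
  then have "integrable lebesgue (\<lambda>t. indicator {0<..<T} t *\<^sub>R (indicator {0..T} t *\<^sub>R g' t))"
    by (rule integrable_mult_indicator[rotated]) auto
  moreover have "(\<lambda>t. indicator {0<..<T} t *\<^sub>R (indicator {0..T} t *\<^sub>R g' t)) = (\<lambda>t. indicator {0<..<T} t *\<^sub>R g' t)"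
    by (auto simp: indicator_def)
  ultimately have "integrable (lebesgue_on {0<..<T}) g'"
    by (simp add: integrable_restrict_space)
  then have "(LINT t|lebesgue_on {0<..<T}. g' t) = integral {0<..<T} g'"
    by (rule lebesgue_integral_eq_integral) auto
  then show ?thesis using hi by (simp add: integral_unique)
qed

text \<open>By translation invariance every difference quotient of \<open>F\<close> in direction
  \<open>v\<close> has integral zero. The quotients are bounded by a Lipschitz constant and
  supported in one fixed ball, so dominated convergence passes to the derivative.\<close>

lemma integral_derivative_compact_support:
  fixes F :: "'a::euclidean_space \<Rightarrow> real"
  assumes der: "\<And>x. (F has_derivative D x) (at x)" and cont: "continuous_on UNIV (\<lambda>x. D x v)"
    and K: "compact K" "\<And>x. x \<notin> K \<Longrightarrow> F x = 0"
  shows "(LINT x|lborel. D x v) = 0"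
proof -
  have D0: "D x v = 0" if "x \<notin> K" for x
  proof -
    have "((\<lambda>_. 0) has_derivative (\<lambda>_. 0)) (at x)" by simp
    then have "(F has_derivative (\<lambda>_. 0)) (at x)"
      by (rule has_derivative_transform_within_open[of _ _ _ _ "- K"])
        (use K that in \<open>auto simp: compact_imp_closed open_Compl\<close>)
    from has_derivative_unique[OF der this] show ?thesis by simp
  qed
  have contF: "continuous_on UNIV F"
    using der has_derivative_continuous continuous_at_imp_continuous_on by blast
  obtain B where B: "\<And>x. x \<in> K \<Longrightarrow> \<bar>D x v\<bar> \<le> B" "0 \<le> B"
  proof -
    have "bounded ((\<lambda>x. D x v) ` K)"
      using cont K by (intro compact_imp_bounded compact_continuous_image) (auto intro: continuous_on_subset)
    then show ?thesis using that unfolding bounded_pos by (metis imageI less_imp_le real_norm_def)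
  qed
  have DB: "\<bar>D x v\<bar> \<le> B" for x using B D0[of x] by (cases "x \<in> K") auto
  obtain BF where BF: "\<And>x. x \<in> K \<Longrightarrow> \<bar>F x\<bar> \<le> BF"
  proof -
    have "bounded (F ` K)"
      using contF K by (intro compact_imp_bounded compact_continuous_image) (auto intro: continuous_on_subset)
    then show ?thesis using that unfolding bounded_pos by (metis imageI real_norm_def)
  qed
  obtain R where R: "\<And>x. x \<in> K \<Longrightarrow> norm x \<le> R"
    using compact_imp_bounded[OF K(1)] unfolding bounded_iff by blast
  have Kb: "K \<in> sets borel" using K(1) by (intro borel_closed compact_imp_closed)
  have Kfin: "emeasure lborel K < \<infinity>"
    by (rule emeasure_bounded_finite[OF compact_imp_bounded[OF K(1)]])
  have Fint: "integrable lborel F"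
    by (rule integrableI_bounded_set[where A = K and B = BF])
      (use contF Kb Kfin K(2) BF in \<open>auto intro!: borel_measurable_continuous_onI\<close>)
  have lip: "\<bar>F (x + h *\<^sub>R v) - F x\<bar> \<le> B * \<bar>h\<bar>" for x h
  proof -
    have d: "((\<lambda>t. F (x + t *\<^sub>R v)) has_real_derivative D (x + t *\<^sub>R v) v) (at t)" for t
    proof -
      have "((\<lambda>t. x + t *\<^sub>R v) has_derivative (\<lambda>s. s *\<^sub>R v)) (at t)"
        by (auto intro!: derivative_eq_intros)
      from has_derivative_compose[OF this der]
      have "((\<lambda>t. F (x + t *\<^sub>R v)) has_derivative (\<lambda>s. D (x + t *\<^sub>R v) (s *\<^sub>R v))) (at t)" .
      moreover have "(\<lambda>s. D (x + t *\<^sub>R v) (s *\<^sub>R v)) = (*) (D (x + t *\<^sub>R v) v)"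
        using linear_scale[OF has_derivative_linear[OF der]] by (auto simp: mult.commute)
      ultimately show ?thesis by (simp add: has_field_derivative_def)
    qed
    have "norm (F (x + h *\<^sub>R v) - F (x + 0 *\<^sub>R v)) \<le> B * norm (h - 0)"
      by (rule field_differentiable_bound[where S = UNIV and f = "\<lambda>t. F (x + t *\<^sub>R v)" and f' = "\<lambda>t. D (x + t *\<^sub>R v) v"])
        (use d DB in \<open>auto intro: has_field_derivative_at_within\<close>)
    then show ?thesis by simp
  qed
  define h where "h n = 1 / real (Suc n)" for n
  have h: "0 < h n" "h n \<le> 1" for n by (auto simp: h_def field_simps)
  have h0: "h \<longlonglongrightarrow> 0" unfolding h_def by (rule LIMSEQ_Suc[OF lim_inverse_n'])
  define s where "s n x = (F (x + h n *\<^sub>R v) - F x) / h n" for n x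
  have sint: "integrable lborel (s n) \<and> (LINT x|lborel. s n x) = 0" for n
  proof -
    have meas: "(+) (h n *\<^sub>R v) \<in> measurable lborel borel" by simp
    have dist: "distr lborel borel ((+) (h n *\<^sub>R v)) = lborel" by (rule lborel_distr_plus)
    have Fm: "F \<in> borel_measurable borel" using contF by (rule borel_measurable_continuous_onI)
    have "integrable lborel (\<lambda>x. F (h n *\<^sub>R v + x))"
      using integrable_distr_eq[OF meas Fm] dist Fint by simp
    moreover have "(LINT x|lborel. F (h n *\<^sub>R v + x)) = (LINT x|lborel. F x)"
      using integral_distr[OF meas Fm] dist by simp
    ultimately show ?thesis
      unfolding s_def using Fint by (simp add: add.commute)
  qed
  have "(\<lambda>n. LINT x|lborel. s n x) \<longlonglongrightarrow> (LINT x|lborel. D x v)"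
  proof (rule integral_dominated_convergence[where w = "\<lambda>x. B * indicator (cball 0 (R + norm v)) x"])
    show "(\<lambda>x. D x v) \<in> borel_measurable lborel" using cont by (simp add: borel_measurable_continuous_onI)
    show "s n \<in> borel_measurable lborel" for n
      using borel_measurable_integrable[OF conjunct1[OF sint[of n]]] .
    show "integrable lborel (\<lambda>x. B * indicator (cball (0::'a) (R + norm v)) x)"
      by (intro integrable_mult_right integrable_real_indicator emeasure_bounded_finite) auto
    show "AE x in lborel. (\<lambda>n. s n x) \<longlonglongrightarrow> D x v"
    proof (rule AE_I2)
      fix x
      have "((\<lambda>t. x + t *\<^sub>R v) has_derivative (\<lambda>s. s *\<^sub>R v)) (at 0)"
        by (auto intro!: derivative_eq_intros)
      from has_derivative_compose[OF this, of F "D x"] der[of x]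
      have "((\<lambda>t. F (x + t *\<^sub>R v)) has_derivative (\<lambda>s. D x (s *\<^sub>R v))) (at 0)" by simp
      moreover have "(\<lambda>s. D x (s *\<^sub>R v)) = (*) (D x v)"
        using linear_scale[OF has_derivative_linear[OF der]] by (auto simp: mult.commute)
      ultimately have "((\<lambda>t. F (x + t *\<^sub>R v)) has_real_derivative D x v) (at 0)"
        by (simp add: has_field_derivative_def)
      then have "((\<lambda>t. (F (x + t *\<^sub>R v) - F x) / t) \<longlongrightarrow> D x v) (at 0)"
        by (simp add: DERIV_def)
      moreover have "filterlim h (at 0) sequentially"
        using h0 h by (auto simp: filterlim_at less_imp_neq[symmetric])
      ultimately show "(\<lambda>n. s n x) \<longlonglongrightarrow> D x v"
        unfolding s_def by (rule filterlim_compose)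
    qed
    show "AE x in lborel. norm (s n x) \<le> B * indicator (cball 0 (R + norm v)) x" for n
    proof (rule AE_I2)
      fix x
      have sB: "norm (s n x) \<le> B"
        using lip[of x "h n"] h[of n] by (simp add: s_def divide_le_eq)
      show "norm (s n x) \<le> B * indicator (cball 0 (R + norm v)) x"
      proof (cases "x \<in> cball 0 (R + norm v)")
        case False
        then have x: "R + norm v < norm x" by simp
        moreover have "norm (h n *\<^sub>R v) \<le> 1 * norm v"
          using h[of n] unfolding norm_scaleR by (intro mult_right_mono) auto
        moreover have "norm x \<le> norm (x + h n *\<^sub>R v) + norm (h n *\<^sub>R v)"
          using norm_triangle_ineq4[of "x + h n *\<^sub>R v" "h n *\<^sub>R v"] by simp
        ultimately have "\<not> norm (x + h n *\<^sub>R v) \<le> R" "\<not> norm x \<le> R"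
          using norm_ge_zero[of v] by linarith+
        then have "x + h n *\<^sub>R v \<notin> K" "x \<notin> K" using R by auto
        then show ?thesis using K(2) False by (simp add: s_def)
      qed (use sB in simp)
    qed
  qed
  then show ?thesis using sint LIMSEQ_unique[OF _ tendsto_const[of 0]] by simp
qed

subsection \<open>Weak continuity\<close>

text \<open>The elementary inequality s \<le> 1 + s^p, applied to |f| divided by its norm, serves in
  place of Hoelder's inequality, at the cost of the constant |S| + 1.\<close>

lemma in_Lp_integrable:
  fixes f :: "'a::euclidean_space \<Rightarrow> 'b::euclidean_space"
  assumes p: "1 \<le> p" and S: "S \<in> lmeasurable" and f: "in_Lp p S f"
  shows "integrable (lebesgue_on S) f"
    and "(LINT x|lebesgue_on S. norm (f x)) \<le> (measure lebesgue S + 1) * Lp_norm p S f"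
proof -
  interpret finite_measure "lebesgue_on S" using S by (rule finite_measure_lebesgue_on)
  have fm: "f \<in> borel_measurable (lebesgue_on S)" and fp: "integrable (lebesgue_on S) (\<lambda>x. norm (f x) powr p)"
    using f by (auto simp: in_Lp_def)
  have le: "a \<le> 1 + a powr p" if "0 \<le> a" for a :: real
  proof (cases "a \<le> 1")
    case False
    then have "a powr 1 \<le> a powr p" using p by (intro powr_mono) auto
    then show ?thesis using False by simp
  qed (simp add: add_increasing2)
  show int: "integrable (lebesgue_on S) f"
    by (rule Bochner_Integration.integrable_bound[of _ "\<lambda>x. 1 + norm (f x) powr p"])
      (use fm fp le in \<open>auto intro!: AE_I2\<close>)
  define I where "I = (LINT x|lebesgue_on S. norm (f x) powr p)"
  define N where "N = Lp_norm p S f"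
  have I0: "0 \<le> I" unfolding I_def by (rule integral_nonneg_AE) auto
  have N: "N = I powr (1 / p)" by (simp add: N_def I_def Lp_norm_def)
  have ms: "measure (lebesgue_on S) S = measure lebesgue S"
    using S by (simp add: measure_restrict_space)
  show "(LINT x|lebesgue_on S. norm (f x)) \<le> (measure lebesgue S + 1) * N"
  proof (cases "I = 0")
    case True
    then have "AE x in lebesgue_on S. norm (f x) powr p = 0"
      using fp by (subst (asm) I_def, subst (asm) integral_nonneg_eq_0_iff_AE) auto
    then have "AE x in lebesgue_on S. norm (f x) = 0" by eventually_elim simp
    then have "(LINT x|lebesgue_on S. norm (f x)) = (LINT x|lebesgue_on S. 0)"
      using fm by (intro integral_cong_AE) auto
    then show ?thesis by (simp add: N_def Lp_norm_def)
  next
    case False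
    then have Np: "0 < N" using I0 by (simp add: N)
    have NpI: "N powr p = I" using p I0 False by (simp add: N powr_powr)
    have "(LINT x|lebesgue_on S. norm (f x)) \<le> (LINT x|lebesgue_on S. N * (1 + norm (f x) powr p / I))"
    proof (rule integral_mono)
      show "norm (f x) \<le> N * (1 + norm (f x) powr p / I)" for x
        using le[of "norm (f x) / N"] Np NpI by (simp add: powr_divide field_simps)
    qed (use int fp in auto)
    also have "\<dots> = N * (measure lebesgue S + 1)"
      using fp False by (simp add: I_def[symmetric] ms)
    finally show ?thesis by (simp add: mult.commute)
  qed
qed

lemma integrable_inner_bounded:
  fixes f g :: "'a::euclidean_space \<Rightarrow> 'b::euclidean_space"
  assumes f: "integrable (lebesgue_on S) f" and g: "g \<in> borel_measurable (lebesgue_on S)"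
    and B: "\<And>x. x \<in> S \<Longrightarrow> norm (g x) \<le> B"
  shows "integrable (lebesgue_on S) (\<lambda>x. f x \<bullet> g x)"
    and "\<bar>LINT x|lebesgue_on S. f x \<bullet> g x\<bar> \<le> B * (LINT x|lebesgue_on S. norm (f x))"
proof -
  have le: "\<bar>f x \<bullet> g x\<bar> \<le> B * norm (f x)" if "x \<in> S" for x
    using Cauchy_Schwarz_ineq2[of "f x" "g x"] mult_left_mono[OF B[OF that], of "norm (f x)"]
    by (simp add: mult.commute)
  show int: "integrable (lebesgue_on S) (\<lambda>x. f x \<bullet> g x)"
    by (rule Bochner_Integration.integrable_bound[of _ "\<lambda>x. B * norm (f x)"])
      (use f g le in \<open>auto intro!: AE_I2 intro: order_trans[OF le]\<close>)
  have "\<bar>LINT x|lebesgue_on S. f x \<bullet> g x\<bar> \<le> (LINT x|lebesgue_on S. \<bar>f x \<bullet> g x\<bar>)"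
    by (rule integral_abs_bound)
  also have "\<dots> \<le> (LINT x|lebesgue_on S. B * norm (f x))"
    by (rule integral_mono) (use int f le in auto)
  finally show "\<bar>LINT x|lebesgue_on S. f x \<bullet> g x\<bar> \<le> B * (LINT x|lebesgue_on S. norm (f x))"
    by simp
qed

text \<open>Pairings with bounded fields are the functionals through which the abstract weak
  continuity of the solution becomes continuity of integrals.\<close>

lemma Lp_functional_inner:
  fixes g :: "'a::euclidean_space \<Rightarrow> 'b::euclidean_space"
  assumes p: "1 \<le> p" and S: "S \<in> lmeasurable" and g: "g \<in> borel_measurable (lebesgue_on S)"
    and B: "\<And>x. x \<in> S \<Longrightarrow> norm (g x) \<le> B"
  shows "Lp_functional p S (\<lambda>f. LINT x|lebesgue_on S. f x \<bullet> g x)"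
  unfolding Lp_functional_def
proof (intro conjI allI impI exI)
  note int = integrable_inner_bounded(1)[OF in_Lp_integrable(1)[OF p S] g B]
  show "(LINT x|lebesgue_on S. (f x + h x) \<bullet> g x) = (LINT x|lebesgue_on S. f x \<bullet> g x) + (LINT x|lebesgue_on S. h x \<bullet> g x)"
    if "in_Lp p S f" "in_Lp p S h" for f h
    using int[OF that(1)] int[OF that(2)] by (simp add: inner_add_left)
  show "(LINT x|lebesgue_on S. (a *\<^sub>R f x) \<bullet> g x) = a * (LINT x|lebesgue_on S. f x \<bullet> g x)" for a f
    by simp
  fix f :: "'a \<Rightarrow> 'b" assume f: "in_Lp p S f"
  have "\<bar>LINT x|lebesgue_on S. f x \<bullet> g x\<bar> \<le> \<bar>B\<bar> * (LINT x|lebesgue_on S. norm (f x))"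
    by (rule integrable_inner_bounded(2)[OF in_Lp_integrable(1)[OF p S f] g]) (use B in force)
  also have "\<dots> \<le> \<bar>B\<bar> * ((measure lebesgue S + 1) * Lp_norm p S f)"
    by (intro mult_left_mono in_Lp_integrable(2)[OF p S f]) auto
  finally show "\<bar>LINT x|lebesgue_on S. f x \<bullet> g x\<bar> \<le> (\<bar>B\<bar> * (measure lebesgue S + 1)) * Lp_norm p S f"
    by (simp add: mult.assoc)
qed

lemma weakly_continuous_Lp_inner:
  assumes "weakly_continuous_Lp p T S f" "1 \<le> p" "S \<in> lmeasurable"
    "g \<in> borel_measurable (lebesgue_on S)" "\<And>x. x \<in> S \<Longrightarrow> norm (g x) \<le> B"
  shows "continuous_on {0..T} (\<lambda>t. LINT x|lebesgue_on S. f t x \<bullet> g x)"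
  using assms(1) Lp_functional_inner[OF assms(2-5)] unfolding weakly_continuous_Lp_def by blast

text \<open>The weight now moves with time. Its increment is uniformly small on the compact cylinder
  and is paired with the uniform bound \<open>K\<close> on the L^1 norms; the remaining increment
  has a frozen weight, where weak continuity applies.\<close>

lemma weakly_continuous_Lp_inner_time:
  fixes f g :: "real \<Rightarrow> 'a::euclidean_space \<Rightarrow> 'b::euclidean_space"
  assumes f: "weakly_continuous_Lp p T S f" and p: "1 \<le> p" and S: "open S" "bounded S"
    and K: "\<And>t. t \<in> {0..T} \<Longrightarrow> (LINT x|lebesgue_on S. norm (f t x)) \<le> K"
    and g: "continuous_on ({0..T} \<times> closure S) (\<lambda>(t, x). g t x)"
  shows "continuous_on {0..T} (\<lambda>t. LINT x|lebesgue_on S. f t x \<bullet> g t x)"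
proof -
  have Sm: "S \<in> lmeasurable" using S by (simp add: bounded_set_imp_lmeasurable)
  have comp: "compact ({0..T} \<times> closure S)" using S by (intro compact_Times) (auto simp: compact_closure)
  have gt: "continuous_on (closure S) (g t)" if "t \<in> {0..T}" for t
  proof -
    have "continuous_on (closure S) (\<lambda>x. case (t, x) of (t, x) \<Rightarrow> g t x)"
      by (rule continuous_on_compose2[OF g]) (use that in \<open>auto intro!: continuous_on_Pair\<close>)
    then show ?thesis by simp
  qed
  then have gm: "g t \<in> borel_measurable (lebesgue_on S)" if "t \<in> {0..T}" for t
    using that S continuous_on_subset[OF gt[OF that] closure_subset]
    by (intro continuous_imp_measurable_on_sets_lebesgue) auto
  obtain B where B: "\<And>t x. t \<in> {0..T} \<Longrightarrow> x \<in> S \<Longrightarrow> norm (g t x) \<le> B"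
  proof -
    have "bounded ((\<lambda>(t, x). g t x) ` ({0..T} \<times> closure S))"
      using g comp by (intro compact_imp_bounded compact_continuous_image)
    then obtain B where "\<And>z. z \<in> {0..T} \<times> closure S \<Longrightarrow> norm (case z of (t, x) \<Rightarrow> g t x) \<le> B"
      unfolding bounded_iff by auto
    then show ?thesis using that closure_subset[of S] by (metis (no_types, lifting) case_prod_conv mem_Sigma_iff subsetD)
  qed
  have int: "integrable (lebesgue_on S) (f t)" if "t \<in> {0..T}" for t
    using f that unfolding weakly_continuous_Lp_def by (intro in_Lp_integrable(1)[OF p Sm]) auto
  have intg: "integrable (lebesgue_on S) (\<lambda>x. f t x \<bullet> g s x)" if "t \<in> {0..T}" "s \<in> {0..T}" for t s
    by (rule integrable_inner_bounded(1)[OF int[OF that(1)] gm[OF that(2)] B[OF that(2)]])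
  show ?thesis
    unfolding continuous_on_iff
  proof (intro ballI allI impI)
    fix s e :: real assume s: "s \<in> {0..T}" and e: "0 < e"
    define e' where "e' = e / (2 * (\<bar>K\<bar> + 1))"
    have e': "0 < e'" using e by (simp add: e'_def)
    obtain d1 where d1: "0 < d1"
      "\<And>z z'. z \<in> {0..T} \<times> closure S \<Longrightarrow> z' \<in> {0..T} \<times> closure S \<Longrightarrow> dist z' z < d1 \<Longrightarrow>
        dist (case z' of (t, x) \<Rightarrow> g t x) (case z of (t, x) \<Rightarrow> g t x) < e'"
      using compact_uniformly_continuous[OF g comp] e' unfolding uniformly_continuous_on_def by metis
    obtain d2 where d2: "0 < d2" "\<And>t. t \<in> {0..T} \<Longrightarrow> dist t s < d2 \<Longrightarrow>
        dist (LINT x|lebesgue_on S. f t x \<bullet> g s x) (LINT x|lebesgue_on S. f s x \<bullet> g s x) < e / 2"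
      using weakly_continuous_Lp_inner[OF f p Sm gm[OF s] B[OF s]] s e
      unfolding continuous_on_iff by (metis half_gt_zero)
    have "dist (LINT x|lebesgue_on S. f t x \<bullet> g t x) (LINT x|lebesgue_on S. f s x \<bullet> g s x) < e"
      if t: "t \<in> {0..T}" "dist t s < min d1 d2" for t
    proof -
      have "(LINT x|lebesgue_on S. f t x \<bullet> g t x) - (LINT x|lebesgue_on S. f t x \<bullet> g s x) =
          (LINT x|lebesgue_on S. f t x \<bullet> (g t x - g s x))"
        using intg t s by (simp add: inner_diff_right)
      moreover have "\<bar>LINT x|lebesgue_on S. f t x \<bullet> (g t x - g s x)\<bar> \<le> e' * (LINT x|lebesgue_on S. norm (f t x))"
      proof (rule integrable_inner_bounded(2)[OF int[OF t(1)]])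
        show "(\<lambda>x. g t x - g s x) \<in> borel_measurable (lebesgue_on S)" using gm t s by auto
        show "norm (g t x - g s x) \<le> e'" if "x \<in> S" for x
        proof -
          have "x \<in> closure S" using that closure_subset by blast
          then have "dist (g t x) (g s x) < e'"
            using d1(2)[of "(s, x)" "(t, x)"] t s by (simp add: dist_Pair_Pair)
          then show ?thesis by (simp add: dist_norm)
        qed
      qed
      moreover have "e' * (LINT x|lebesgue_on S. norm (f t x)) \<le> e' * \<bar>K\<bar>"
        using K[OF t(1)] e' by (intro mult_left_mono) auto
      moreover have "e' * \<bar>K\<bar> \<le> e / 2" using e by (simp add: e'_def field_simps)
      moreover have "dist (LINT x|lebesgue_on S. f t x \<bullet> g s x) (LINT x|lebesgue_on S. f s x \<bullet> g s x) < e / 2"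
        using d2(2) t by simp
      ultimately show ?thesis unfolding dist_real_def by linarith
    qed
    then show "\<exists>d>0. \<forall>x'\<in>{0..T}. dist x' s < d \<longrightarrow>
        dist (LINT x|lebesgue_on S. f x' x \<bullet> g x' x) (LINT x|lebesgue_on S. f s x \<bullet> g s x) < e"
      using d1(1) d2(1) by (intro exI[of _ "min d1 d2"]) auto
  qed
qed

subsection \<open>The smooth Euler flow\<close>

lemma has_derivative_slice_space:
  assumes "(F has_derivative D) (at (t, x))"
  shows "((\<lambda>y. F (t, y)) has_derivative (\<lambda>v. D (0, v))) (at x)"
proof -
  have "((\<lambda>y. (t, y)) has_derivative (\<lambda>v. (0, v))) (at x)"
    by (intro has_derivative_Pair has_derivative_const has_derivative_ident)
  from has_derivative_compose[OF this] assms show ?thesis by blast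
qed

lemma has_vector_derivative_slice_time:
  fixes t :: real
  assumes "(F has_derivative D) (at (t, x))"
  shows "((\<lambda>s. F (s, x)) has_vector_derivative D (1, 0)) (at t)"
proof -
  have "((\<lambda>s. (s, x)) has_derivative (\<lambda>s. (s, 0))) (at t)"
    by (intro has_derivative_Pair has_derivative_const has_derivative_ident)
  from has_derivative_compose[OF this] assms
  have "((\<lambda>s. F (s, x)) has_derivative (\<lambda>s. D (s, 0))) (at t)" by blast
  moreover have "(\<lambda>s. D (s, 0)) = (\<lambda>s. s *\<^sub>R D (1, 0))"
  proof
    fix s :: real
    show "D (s, 0) = s *\<^sub>R D (1, 0)"
      using linear_scale[OF has_derivative_linear[OF assms], of s "(1, 0)"] by simp
  qed
  ultimately show ?thesis by (simp add: has_vector_derivative_def)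
qed

lemma linear_axis_sum:
  fixes f :: "real^3 \<Rightarrow> real"
  assumes "linear f"
  shows "(\<Sum>i\<in>UNIV. w $ i * f (axis i 1)) = f w"
proof -
  have "f w = f (\<Sum>j\<in>UNIV. w $ j *\<^sub>R axis j 1)"
    using basis_expansion[of w] by (simp add: scalar_mult_eq_scaleR)
  then show ?thesis by (simp add: linear_sum[OF assms] linear_scale[OF assms])
qed

lemma trace_matrix_scaleR_add:
  fixes f :: "real^3 \<Rightarrow> real"
  assumes "linear f"
  shows "trace (matrix (\<lambda>v. r *\<^sub>R A v + f v *\<^sub>R w)) = r * trace (matrix A) + f w"
proof -
  have "trace (matrix (\<lambda>v. r *\<^sub>R A v + f v *\<^sub>R w)) =
      r * (\<Sum>i\<in>UNIV. A (axis i 1) $ i) + (\<Sum>i\<in>UNIV. w $ i * f (axis i 1))"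
    by (simp add: trace_def matrix_def sum.distrib sum_distrib_left mult.commute)
  then show ?thesis by (simp add: linear_axis_sum[OF assms] trace_def matrix_def)
qed

lemma divergence_eq: "(g has_derivative D) (at x) \<Longrightarrow> divergence g x = trace (matrix D)"
  by (simp add: divergence_def jacobian_def frechet_derivative_eqI)

lemma has_derivative_powr_compose:
  fixes f :: "'a::real_normed_vector \<Rightarrow> real"
  assumes "(f has_derivative D) (at x)" "0 < f x"
  shows "((\<lambda>y. f y powr \<gamma>) has_derivative (\<lambda>v. \<gamma> * f x powr (\<gamma> - 1) * D v)) (at x)"
  using has_derivative_compose[OF assms(1)
      has_real_derivative_powr[OF assms(2), unfolded has_field_derivative_def]] by simp

text \<open>Subtracting the velocity times the mass equation from the conservative momentum equation
  leaves the convective form. It is stated for smooth extensions \<open>R\<close> and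
  \<open>V\<close>, whose derivatives exist jointly in time and space; \<open>\<rho>\<close> and
  \<open>u\<close> inherit theirs by local agreement.\<close>

lemma euler_equations_pointwise:
  fixes R :: "real \<times> (real^3) \<Rightarrow> real" and V :: "real \<times> (real^3) \<Rightarrow> real^3"
  assumes A: "open A" "t \<in> A" and B: "open B" "x \<in> B"
    and DR: "(R has_derivative DR) (at (t, x))" and DV: "(V has_derivative DV) (at (t, x))"
    and eq: "\<And>s y. s \<in> A \<Longrightarrow> y \<in> B \<Longrightarrow> \<rho> s y = R (s, y) \<and> u s y = V (s, y)"
    and pos: "0 < R (t, x)"
    and mass: "mass_residual \<rho> u t x = 0" and mom: "momentum_residual \<gamma> \<rho> u t x = 0"
  shows "DR (1, 0) + DR (0, V (t, x)) + R (t, x) * trace (matrix (\<lambda>v. DV (0, v))) = 0" (is ?mass)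
    and "R (t, x) * ((DV (1, 0) + DV (0, V (t, x))) \<bullet> w) + \<gamma> * R (t, x) powr (\<gamma> - 1) * DR (0, w) = 0" (is ?mom)
proof -
  let ?r = "R (t, x)" and ?v = "V (t, x)" and ?Rx = "\<lambda>v. DR (0, v)" and ?Vx = "\<lambda>v. DV (0, v)"
  have val: "\<rho> t x = ?r" "u t x = ?v" using eq A B by auto
  have \<rho>x: "(\<rho> t has_derivative ?Rx) (at x)"
    by (rule has_derivative_transform_within_open[OF has_derivative_slice_space[OF DR] B]) (use eq A in auto)
  have ux: "(u t has_derivative ?Vx) (at x)"
    by (rule has_derivative_transform_within_open[OF has_derivative_slice_space[OF DV] B]) (use eq A in auto)
  have \<rho>t: "((\<lambda>s. \<rho> s x) has_vector_derivative DR (1, 0)) (at t)"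
    by (rule has_vector_derivative_transform_within_open[OF has_vector_derivative_slice_time[OF DR] A])
      (use eq B in auto)
  have ut: "((\<lambda>s. u s x) has_vector_derivative DV (1, 0)) (at t)"
    by (rule has_vector_derivative_transform_within_open[OF has_vector_derivative_slice_time[OF DV] A])
      (use eq B in auto)
  have linR: "linear ?Rx" using \<rho>x by (rule has_derivative_linear)
  have "((\<lambda>y. \<rho> t y *\<^sub>R u t y) has_derivative (\<lambda>v. \<rho> t x *\<^sub>R ?Vx v + ?Rx v *\<^sub>R u t x)) (at x)"
    using \<rho>x ux by (rule has_derivative_scaleR)
  then have "divergence (\<lambda>y. \<rho> t y *\<^sub>R u t y) x = ?r * trace (matrix ?Vx) + DR (0, ?v)"
    by (simp add: divergence_eq trace_matrix_scaleR_add[OF linR] val)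
  then show m: ?mass
    using mass vector_derivative_at[OF \<rho>t] by (simp add: mass_residual_def)
  have "?r * (DV (1, 0) $ i + DV (0, ?v) $ i) + \<gamma> * ?r powr (\<gamma> - 1) * DR (0, axis i 1) = 0" for i
  proof -
    have "((\<lambda>s. \<rho> s x *\<^sub>R u s x) has_vector_derivative (\<rho> t x *\<^sub>R DV (1, 0) + DR (1, 0) *\<^sub>R u t x)) (at t)"
      using \<rho>t ut by (intro has_vector_derivative_scaleR)
        (simp_all add: has_real_derivative_iff_has_vector_derivative)
    then have a: "vector_derivative (\<lambda>s. \<rho> s x *\<^sub>R u s x) (at t) = ?r *\<^sub>R DV (1, 0) + DR (1, 0) *\<^sub>R ?v"
      by (simp add: vector_derivative_at val)
    have ui: "((\<lambda>y. u t y $ i) has_derivative (\<lambda>v. DV (0, v) $ i)) (at x)"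
      by (rule bounded_linear.has_derivative[OF bounded_linear_vec_nth ux])
    have s: "((\<lambda>y. \<rho> t y * u t y $ i) has_derivative (\<lambda>v. \<rho> t x * DV (0, v) $ i + ?Rx v * u t x $ i)) (at x)"
      using \<rho>x ui by (rule has_derivative_mult)
    then have "((\<lambda>y. (\<rho> t y * u t y $ i) *\<^sub>R u t y) has_derivative
        (\<lambda>v. (\<rho> t x * u t x $ i) *\<^sub>R ?Vx v + (\<rho> t x * DV (0, v) $ i + ?Rx v * u t x $ i) *\<^sub>R u t x)) (at x)"
      using ux by (rule has_derivative_scaleR)
    from divergence_eq[OF this]
    have "divergence (\<lambda>y. (\<rho> t y * u t y $ i) *\<^sub>R u t y) x =
        ?r * ?v $ i * trace (matrix ?Vx) + (?r * DV (0, ?v) $ i + DR (0, ?v) * ?v $ i)"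
      unfolding trace_matrix_scaleR_add[OF has_derivative_linear[OF s]] by (simp add: val)
    moreover have "(\<lambda>y. (\<rho> t y *\<^sub>R outer (u t y) (u t y)) $ i) = (\<lambda>y. (\<rho> t y * u t y $ i) *\<^sub>R u t y)"
      by (auto simp: outer_def vec_eq_iff)
    ultimately have b: "tensor_div (\<lambda>y. \<rho> t y *\<^sub>R outer (u t y) (u t y)) x $ i =
        ?r * ?v $ i * trace (matrix ?Vx) + (?r * DV (0, ?v) $ i + DR (0, ?v) * ?v $ i)"
      by (simp add: tensor_div_def)
    have c: "grad (\<lambda>y. pressure \<gamma> (\<rho> t y)) x $ i = \<gamma> * ?r powr (\<gamma> - 1) * DR (0, axis i 1)"
      using frechet_derivative_eqI[OF has_derivative_powr_compose[OF \<rho>x, of \<gamma>]] pos val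
      by (simp add: grad_def pressure_def)
    have "momentum_residual \<gamma> \<rho> u t x $ i = 0" using mom by simp
    then have "?r * DV (1, 0) $ i + DR (1, 0) * ?v $ i +
        (?r * ?v $ i * trace (matrix ?Vx) + (?r * DV (0, ?v) $ i + DR (0, ?v) * ?v $ i)) +
        \<gamma> * ?r powr (\<gamma> - 1) * DR (0, axis i 1) = 0"
      by (simp add: momentum_residual_def a b c)
    moreover have "(DR (1, 0) + DR (0, ?v) + ?r * trace (matrix ?Vx)) * ?v $ i = 0" using m by simp
    ultimately show ?thesis by (simp add: algebra_simps)
  qed
  then have "(\<Sum>i\<in>UNIV. w $ i * (?r * (DV (1, 0) $ i + DV (0, ?v) $ i) + \<gamma> * ?r powr (\<gamma> - 1) * DR (0, axis i 1))) = 0"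
    by simp
  then have "?r * (\<Sum>i\<in>UNIV. w $ i * (DV (1, 0) + DV (0, ?v)) $ i) +
      \<gamma> * ?r powr (\<gamma> - 1) * (\<Sum>i\<in>UNIV. w $ i * DR (0, axis i 1)) = 0"
    by (simp add: sum.distrib sum_distrib_left algebra_simps)
  then show ?mom
    by (simp add: linear_axis_sum[OF linR] inner_vec_def mult.commute)
qed

lemma smooth_in_bounded:
  assumes F: "smooth_in N F" and K: "compact K" "K \<subseteq> N"
  obtains C where "0 \<le> C" "\<And>z. z \<in> K \<Longrightarrow> norm (F z) \<le> C"
proof -
  have "bounded (F ` K)"
    using smooth_in_continuous_on[OF F K(2)] K(1) by (intro compact_imp_bounded compact_continuous_image)
  then obtain C where "\<And>z. z \<in> K \<Longrightarrow> norm (F z) \<le> C" unfolding bounded_iff by auto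
  then show thesis using that[of "max C 0"] by (simp add: max.coboundedI1)
qed

lemma smooth_in_derivative_bounded:
  fixes F :: "'a::euclidean_space \<Rightarrow> 'b::euclidean_space"
  assumes F: "smooth_in N F" and K: "compact K" "K \<subseteq> N"
  obtains C where "0 \<le> C" "\<And>z w. z \<in> K \<Longrightarrow> norm (frechet_derivative F (at z) w) \<le> C * norm w"
proof -
  have "\<exists>C. 0 \<le> C \<and> (\<forall>z\<in>K. norm (frechet_derivative F (at z) b) \<le> C)" for b
    using smooth_in_bounded[OF smooth_in_frechet_derivative[OF F] K] by metis
  then obtain c where c: "\<And>b. 0 \<le> c b" "\<And>b z. z \<in> K \<Longrightarrow> norm (frechet_derivative F (at z) b) \<le> c b"
    by metis
  show thesis
  proof (rule that)
    show "0 \<le> (\<Sum>b\<in>Basis. c b)" by (intro sum_nonneg c)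
    fix z w assume z: "z \<in> K"
    have lin: "linear (frechet_derivative F (at z))"
      using smooth_in_has_derivative[OF F] z K(2) by (blast intro: has_derivative_linear)
    have "frechet_derivative F (at z) w = frechet_derivative F (at z) (\<Sum>b\<in>Basis. (w \<bullet> b) *\<^sub>R b)"
      by (simp add: euclidean_representation)
    also have "\<dots> = (\<Sum>b\<in>Basis. (w \<bullet> b) *\<^sub>R frechet_derivative F (at z) b)"
      by (simp add: linear_sum[OF lin] linear_scale[OF lin])
    finally have eq: "frechet_derivative F (at z) w = (\<Sum>b\<in>Basis. (w \<bullet> b) *\<^sub>R frechet_derivative F (at z) b)" .
    have "norm (frechet_derivative F (at z) w) \<le> (\<Sum>b\<in>Basis. norm ((w \<bullet> b) *\<^sub>R frechet_derivative F (at z) b))"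
      unfolding eq by (rule norm_sum)
    also have "\<dots> \<le> (\<Sum>b\<in>Basis. c b * norm w)"
      by (rule sum_mono) (use c z Basis_le_norm in \<open>auto simp: mult.commute intro!: mult_mono\<close>)
    finally show "norm (frechet_derivative F (at z) w) \<le> (\<Sum>b\<in>Basis. c b) * norm w"
      by (simp add: sum_distrib_right)
  qed
qed

text \<open>The Euler solution is carried by extensions \<open>R\<close>, \<open>V\<close> to an
  open neighbourhood \<open>N\<close> of the closed cylinder, so that bounds on derivatives hold up
  to the boundary by compactness. \<open>R\<close> is positive on all of \<open>N\<close>, which
  keeps its powers smooth there. The equations are in convective form and are recorded inside the
  cylinder only.\<close>

locale euler_flow =
  fixes \<Omega> :: "(real^3) set" and \<gamma> T m M :: real
    and N :: "(real \<times> (real^3)) set" and R :: "real \<times> (real^3) \<Rightarrow> real" and V :: "real \<times> (real^3) \<Rightarrow> real^3"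
  assumes domain: "smooth_bounded_domain \<Omega>" and \<gamma>: "1 < \<gamma>" and T: "0 < T"
    and R: "smooth_in N R" and V: "smooth_in N V" and N: "{0..T} \<times> closure \<Omega> \<subseteq> N"
    and Rpos: "\<And>z. z \<in> N \<Longrightarrow> 0 < R z" and m: "0 < m"
    and Rm: "\<And>z. z \<in> {0..T} \<times> closure \<Omega> \<Longrightarrow> m \<le> R z"
    and RM: "\<And>z. z \<in> {0..T} \<times> closure \<Omega> \<Longrightarrow> R z \<le> M"
    and mass: "\<And>t x. t \<in> {0<..<T} \<Longrightarrow> x \<in> \<Omega> \<Longrightarrow>
      frechet_derivative R (at (t, x)) (1, 0) + frechet_derivative R (at (t, x)) (0, V (t, x)) +
      R (t, x) * trace (matrix (\<lambda>v. frechet_derivative V (at (t, x)) (0, v))) = 0"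
    and momentum: "\<And>t x w. t \<in> {0<..<T} \<Longrightarrow> x \<in> \<Omega> \<Longrightarrow>
      R (t, x) * ((frechet_derivative V (at (t, x)) (1, 0) + frechet_derivative V (at (t, x)) (0, V (t, x))) \<bullet> w) +
      \<gamma> * R (t, x) powr (\<gamma> - 1) * frechet_derivative R (at (t, x)) (0, w) = 0"
    and impermeable: "\<And>t x. t \<in> {0..T} \<Longrightarrow> x \<in> frontier \<Omega> \<Longrightarrow> V (t, x) \<bullet> outward_normal \<Omega> x = 0"
begin

lemma open_\<Omega>: "open \<Omega>" and bounded_\<Omega>: "bounded \<Omega>" and ne_\<Omega>: "\<Omega> \<noteq> {}"
  using domain by (auto simp: smooth_bounded_domain_def)

lemma compact_cylinder: "compact ({0..T} \<times> closure \<Omega>)"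
  using bounded_\<Omega> by (intro compact_Times) (auto simp: compact_closure)

lemma cylinder_subset: "{0<..<T} \<times> \<Omega> \<subseteq> {0..T} \<times> closure \<Omega>"
  using closure_subset[of \<Omega>] by auto

lemma mM: "m \<le> M"
proof -
  obtain x where "x \<in> \<Omega>" using ne_\<Omega> by blast
  then have "(0, x) \<in> {0..T} \<times> closure \<Omega>" using T closure_subset by auto
  then show ?thesis using Rm RM by fastforce
qed

text \<open>The function (t, x) \<mapsto> D\<psi>(x) V(t, x) is smooth up to the boundary and
  vanishes there by impermeability, so it is bounded by a Lipschitz constant times the distance to
  the nearest boundary point.\<close>

lemma normal_component_bound:
  assumes \<psi>: "smooth_in UNIV \<psi>"
    and tan: "\<And>x v. x \<in> frontier \<Omega> \<Longrightarrow> v \<bullet> outward_normal \<Omega> x = 0 \<Longrightarrow> frechet_derivative \<psi> (at x) v = 0"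
  obtains L where "0 \<le> L"
    "\<And>t x. t \<in> {0..T} \<Longrightarrow> x \<in> \<Omega> \<Longrightarrow> \<bar>frechet_derivative \<psi> (at x) (V (t, x))\<bar> \<le> L * bdist \<Omega> x"
proof -
  \<comment> \<open>Written in coordinates, because the direction of differentiation varies with the
    point.\<close>
  define H where "H z = (\<Sum>j\<in>UNIV. frechet_derivative \<psi> (at (snd z)) (axis j 1) * (V z \<bullet> axis j 1))" for z
  have H_eq: "H (t, x) = frechet_derivative \<psi> (at x) (V (t, x))" for t x
  proof -
    have "linear (frechet_derivative \<psi> (at x))"
      using smooth_in_has_derivative[OF \<psi>] by (blast intro: has_derivative_linear)
    from linear_axis_sum[OF this, of "V (t, x)"] show ?thesis
      by (simp add: H_def inner_axis mult.commute)
  qed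
  have oN: "open N" using R by (rule smooth_in_open)
  have "smooth_in N H"
    unfolding H_def[abs_def]
  proof (rule smooth_in_sum[OF oN], rule smooth_in_mult)
    fix j :: 3
    show "smooth_in N (\<lambda>z. frechet_derivative \<psi> (at (snd z)) (axis j 1))"
      by (rule smooth_in_compose_linear[OF bounded_linear_snd smooth_in_frechet_derivative[OF \<psi>] oN]) simp
    show "smooth_in N (\<lambda>z. V z \<bullet> axis j 1)"
      by (rule smooth_in_inner[OF V smooth_in_const[OF oN]])
  qed
  then obtain L where L: "0 \<le> L"
    "\<And>z w. z \<in> {0..T} \<times> closure \<Omega> \<Longrightarrow> norm (frechet_derivative H (at z) w) \<le> L * norm w"
    using smooth_in_derivative_bounded[OF _ compact_cylinder N] by metis
  show thesis
  proof (rule that[OF L(1)])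
    fix t x assume t: "t \<in> {0..T}" and x: "x \<in> \<Omega>"
    have "frontier \<Omega> \<noteq> {}" using bounded_\<Omega> ne_\<Omega> frontier_eq_empty not_bounded_UNIV by blast
    then obtain y where y: "y \<in> frontier \<Omega>" "bdist \<Omega> x = dist x y"
      using infdist_attains_inf[of "frontier \<Omega>" x] by (auto simp: bdist_def)
    \<comment> \<open>The domain need not be convex: a point of the segment other than y is closer
      to x than the boundary is, and therefore still inside.\<close>
    have seg: "closed_segment x y \<subseteq> closure \<Omega>"
    proof
      fix z assume z: "z \<in> closed_segment x y"
      show "z \<in> closure \<Omega>"
      proof (cases "z = y")
        case True then show ?thesis using y by (simp add: frontier_def)
      next
        case False
        have "dist x z < dist x y"
        proof -
          from z obtain u where u: "0 \<le> u" "u \<le> 1" "z = (1 - u) *\<^sub>R x + u *\<^sub>R y"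
            by (auto simp: in_segment)
          have "u \<noteq> 1" using False u by auto
          have "x - z = u *\<^sub>R (x - y)" using u by (simp add: algebra_simps)
          then have d: "dist x z = u * dist x y" using u by (simp add: dist_norm)
          have "x \<noteq> y" using x y open_\<Omega> by (auto simp: frontier_def interior_open)
          then show ?thesis using d u \<open>u \<noteq> 1\<close> by simp
        qed
        then have "z \<in> \<Omega>" using bdist_le_of_exit[OF x, of z] y(2) by force
        then show ?thesis using closure_subset by blast
      qed
    qed
    have "norm (H (t, x) - H (t, y)) \<le> L * norm ((t, x) - (t, y))"
    proof (rule differentiable_bound[where S = "{t} \<times> closed_segment x y" and f' = "\<lambda>z. frechet_derivative H (at z)"])
      show "convex ({t} \<times> closed_segment x y)" by (intro convex_Times) auto
      fix z assume z: "z \<in> {t} \<times> closed_segment x y"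
      then have zK: "z \<in> {0..T} \<times> closure \<Omega>" using seg t by auto
      then show "(H has_derivative frechet_derivative H (at z)) (at z within {t} \<times> closed_segment x y)"
        using smooth_in_has_derivative[OF \<open>smooth_in N H\<close>] N by (blast intro: has_derivative_at_withinI)
      show "onorm (frechet_derivative H (at z)) \<le> L"
        by (rule onorm_bound[OF L(1) L(2)[OF zK]])
    qed auto
    moreover have "H (t, y) = 0" unfolding H_eq by (rule tan[OF y(1) impermeable[OF t y(1)]])
    ultimately show "\<bar>frechet_derivative \<psi> (at x) (V (t, x))\<bar> \<le> L * bdist \<Omega> x"
      using y(2) by (simp add: H_eq norm_Pair dist_norm)
  qed
qed

text \<open>\<open>W\<close> is a boundary layer of thickness of order \<open>\<delta>\<close> that contains the transition region of
  the cutoff \<open>\<xi>\<close>. The last condition is where the impermeability of the boundary enters: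
  the cutoff varies at scale \<open>\<delta>\<close>, but along \<open>V\<close> only at scale one.\<close>

definition layer_cutoff :: "real \<Rightarrow> real \<Rightarrow> real \<Rightarrow> (real^3 \<Rightarrow> real) \<Rightarrow> (real^3) set \<Rightarrow> bool" where
  "layer_cutoff c C \<delta> \<xi> W \<longleftrightarrow>
     smooth_in UNIV \<xi> \<and> (\<forall>x. 0 \<le> \<xi> x \<and> \<xi> x \<le> 1) \<and>
     (\<exists>K. compact K \<and> K \<subseteq> \<Omega> \<and> (\<forall>x\<in>\<Omega> - K. \<xi> x = 0)) \<and>
     open W \<and> W \<subseteq> boundary_layer \<Omega> (c * \<delta>) \<and> measure lebesgue W \<le> C * \<delta> \<and>
     (\<forall>x\<in>\<Omega> - W. \<xi> x = 1 \<and> (\<forall>v. frechet_derivative \<xi> (at x) v = 0)) \<and>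
     (\<forall>x\<in>W. \<forall>v. \<bar>frechet_derivative \<xi> (at x) v\<bar> \<le> C / \<delta> * norm v) \<and>
     (\<forall>x\<in>W. \<forall>t\<in>{0..T}. \<bar>frechet_derivative \<xi> (at x) (V (t, x))\<bar> \<le> C)"

text \<open>Take \<xi> = \<zeta>(\<psi>/k) with k proportional to \<delta>: on the domain it
  vanishes for \<psi> \<le> k and equals one from \<psi> = 2k on. The chain rule gives a gradient of
  order 1/\<delta>. Along \<open>V\<close> the factor 1/k meets D\<psi>(V), which is at most
  \<open>L\<close> times the distance and hence of order \<delta> on \<open>W\<close>.\<close>

lemma layer_cutoff_exists:
  assumes c: "0 < c"
  obtains C where "0 < C" "\<And>\<delta>. 0 < \<delta> \<Longrightarrow> \<exists>\<xi> W. layer_cutoff c C \<delta> \<xi> W"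
proof -
  obtain \<psi> b Cm where bf: "boundary_function \<Omega> UNIV b Cm \<psi>"
    using boundary_function_global[OF domain] by metis
  have b: "0 < b" and \<psi>: "smooth_in UNIV \<psi>"
    and \<psi>0: "\<And>x. x \<in> \<Omega> \<Longrightarrow> 0 \<le> \<psi> x" and \<psi>b: "\<And>x. x \<in> \<Omega> \<Longrightarrow> b * bdist \<Omega> x \<le> \<psi> x"
    and fr: "\<And>x. x \<in> frontier \<Omega> \<Longrightarrow> \<psi> x = 0"
    and tan: "\<And>x v. x \<in> frontier \<Omega> \<Longrightarrow> v \<bullet> outward_normal \<Omega> x = 0 \<Longrightarrow> frechet_derivative \<psi> (at x) v = 0"
    and meas: "\<And>\<delta>. 0 < \<delta> \<Longrightarrow> measure lebesgue {x\<in>\<Omega>. \<psi> x < \<delta>} \<le> Cm * \<delta>"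
    using bf unfolding boundary_function_def by auto
  obtain L where L: "0 \<le> L"
    "\<And>t x. t \<in> {0..T} \<Longrightarrow> x \<in> \<Omega> \<Longrightarrow> \<bar>frechet_derivative \<psi> (at x) (V (t, x))\<bar> \<le> L * bdist \<Omega> x"
    using normal_component_bound[OF \<psi> tan] by metis
  obtain \<zeta> :: "real \<Rightarrow> real" where \<zeta>: "smooth_in UNIV \<zeta>" "\<And>x. 0 \<le> \<zeta> x" "\<And>x. \<zeta> x \<le> 1"
    "\<And>x. x \<le> 1 \<Longrightarrow> \<zeta> x = 0" "\<And>x. 2 \<le> x \<Longrightarrow> \<zeta> x = 1"
    using smooth_step by metis
  define \<zeta>' where "\<zeta>' s = frechet_derivative \<zeta> (at s) 1" for s
  have \<zeta>D: "(\<zeta> has_real_derivative \<zeta>' s) (at s)" for s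
  proof -
    have d: "(\<zeta> has_derivative frechet_derivative \<zeta> (at s)) (at s)"
      using smooth_in_has_derivative[OF \<zeta>(1)] by simp
    have "frechet_derivative \<zeta> (at s) h = \<zeta>' s * h" for h
      using linear_scale[OF has_derivative_linear[OF d], of h 1] by (simp add: \<zeta>'_def)
    then have "frechet_derivative \<zeta> (at s) = (*) (\<zeta>' s)" by auto
    with d show ?thesis by (simp add: has_field_derivative_def)
  qed
  \<comment> \<open>The endpoints 1 and 2 are included because \<open>\<zeta>\<close> attains its
    extreme values there. So the gradient of the cutoff vanishes on all of the complement of
    \<open>W\<close> in the domain, including the level set \<psi> = 2k.\<close>
  have \<zeta>'0: "\<zeta>' s = 0" if "2 \<le> s \<or> s \<le> 1" for s
  proof (cases "2 \<le> s")
    case True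
    show ?thesis by (rule DERIV_local_max[OF \<zeta>D zero_less_one]) (use \<zeta> True in auto)
  next
    case False
    show ?thesis by (rule DERIV_local_min[OF \<zeta>D zero_less_one]) (use \<zeta> False that in auto)
  qed
  obtain C1 where C1: "0 \<le> C1" "\<And>s. s \<in> {1..2} \<Longrightarrow> norm (\<zeta>' s) \<le> C1"
    using smooth_in_bounded[OF smooth_in_frechet_derivative[OF \<zeta>(1)], of "{1..2}" 1]
    unfolding \<zeta>'_def by auto
  have \<zeta>'B: "\<bar>\<zeta>' s\<bar> \<le> C1" for s using C1 \<zeta>'0[of s] by (cases "s \<in> {1..2}") auto
  obtain C2 where C2: "0 \<le> C2" "\<And>x v. x \<in> closure \<Omega> \<Longrightarrow> norm (frechet_derivative \<psi> (at x) v) \<le> C2 * norm v"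
    using smooth_in_derivative_bounded[OF \<psi>, of "closure \<Omega>"] bounded_\<Omega> by (auto simp: compact_closure)
  \<comment> \<open>On \<open>W\<close> the product of \<open>b\<close> and the distance is below 2k
    = b c \<delta>; this choice of \<kappa> therefore places \<open>W\<close> in the layer of width
    c \<delta>.\<close>
  define \<kappa> where "\<kappa> = b * c / 2"
  have \<kappa>: "0 < \<kappa>" using b c by (simp add: \<kappa>_def)
  \<comment> \<open>One summand for each bound demanded of \<open>C\<close>: the full gradient, the
    derivative along \<open>V\<close>, the volume; the leading 1 makes it positive.\<close>
  define C where "C = 1 + C1 * C2 / \<kappa> + C1 * L * c / \<kappa> + \<bar>Cm\<bar> * (2 * \<kappa>)"
  have parts: "0 \<le> C1 * C2 / \<kappa>" "0 \<le> C1 * L * c / \<kappa>" "0 \<le> \<bar>Cm\<bar> * (2 * \<kappa>)"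
    using C1 C2 L c \<kappa> by auto
  have C: "0 < C" "C1 * C2 / \<kappa> \<le> C" "C1 * L * c / \<kappa> \<le> C" "\<bar>Cm\<bar> * (2 * \<kappa>) \<le> C"
    using parts unfolding C_def by linarith+
  show thesis
  proof (rule that[OF C(1)])
    fix \<delta> :: real assume \<delta>: "0 < \<delta>"
    define k where "k = \<kappa> * \<delta>"
    have k: "0 < k" using \<kappa> \<delta> by (simp add: k_def)
    define \<xi> where "\<xi> x = \<zeta> (1 / k * \<psi> x)" for x
    define W where "W = {x\<in>\<Omega>. \<psi> x < 2 * k}"
    have \<xi>D: "frechet_derivative \<xi> (at x) v = \<zeta>' (1 / k * \<psi> x) * (1 / k * frechet_derivative \<psi> (at x) v)" for x v
    proof -
      have "((\<lambda>x. 1 / k * \<psi> x) has_derivative (\<lambda>v. 1 / k * frechet_derivative \<psi> (at x) v)) (at x)"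
        by (rule has_derivative_mult_right, rule smooth_in_has_derivative[OF \<psi>]) simp
      from has_derivative_compose[OF this \<zeta>D[unfolded has_field_derivative_def]]
      show ?thesis by (simp add: \<xi>_def[abs_def] frechet_derivative_eqI)
    qed
    have "layer_cutoff c C \<delta> \<xi> W"
      unfolding layer_cutoff_def
    proof (intro conjI allI ballI exI)
      show "smooth_in UNIV \<xi>"
        unfolding \<xi>_def[abs_def] by (rule smooth_in_compose_real[OF \<zeta>(1) smooth_in_cmult[OF \<psi>]]) simp
      show "0 \<le> \<xi> x" "\<xi> x \<le> 1" for x using \<zeta> by (auto simp: \<xi>_def)
      define K where "K = closure \<Omega> \<inter> \<psi> -` {k..}"
      have "closed K" unfolding K_def
        by (intro continuous_closed_preimage smooth_in_continuous_on[OF \<psi>]) auto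
      then show "compact K" using bounded_\<Omega> by (auto simp: K_def compact_eq_bounded_closed intro: bounded_subset[OF bounded_closure])
      show "K \<subseteq> \<Omega>" using fr k by (force simp: K_def frontier_def interior_open[OF open_\<Omega>])
      show "\<xi> x = 0" if "x \<in> \<Omega> - K" for x
      proof -
        have "\<psi> x < k" using that closure_subset by (auto simp: K_def)
        then show ?thesis using k by (simp add: \<xi>_def \<zeta>(4))
      qed
      have "open (\<Omega> \<inter> \<psi> -` {..<2 * k})"
        by (intro continuous_open_preimage smooth_in_continuous_on[OF \<psi>] open_\<Omega>) auto
      moreover have "W = \<Omega> \<inter> \<psi> -` {..<2 * k}" by (auto simp: W_def)
      ultimately show "open W" by simp
      have Wd: "bdist \<Omega> x < c * \<delta>" if "x \<in> W" for x
      proof -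
        have "b * bdist \<Omega> x < 2 * k" using \<psi>b[of x] that by (simp add: W_def)
        then have "b * bdist \<Omega> x < b * (c * \<delta>)" by (simp add: k_def \<kappa>_def)
        then show ?thesis using b by (simp only: mult_less_cancel_left_pos)
      qed
      then show "W \<subseteq> boundary_layer \<Omega> (c * \<delta>)" by (auto simp: boundary_layer_def W_def)
      have "measure lebesgue W \<le> Cm * (2 * k)" unfolding W_def by (rule meas) (use k in simp)
      also have "\<dots> \<le> \<bar>Cm\<bar> * (2 * k)" using k by (intro mult_right_mono) auto
      also have "\<dots> = \<bar>Cm\<bar> * (2 * \<kappa>) * \<delta>" by (simp add: k_def)
      also have "\<dots> \<le> C * \<delta>" using C(4) \<delta> by (intro mult_right_mono) auto
      finally show "measure lebesgue W \<le> C * \<delta>" .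
      show "\<xi> x = 1" "frechet_derivative \<xi> (at x) v = 0" if "x \<in> \<Omega> - W" for x v
      proof -
        have "2 \<le> 1 / k * \<psi> x" using that k by (auto simp: W_def field_simps)
        then show "\<xi> x = 1" "frechet_derivative \<xi> (at x) v = 0" by (auto simp: \<xi>_def \<zeta>(5) \<xi>D \<zeta>'0)
      qed
      show "\<bar>frechet_derivative \<xi> (at x) v\<bar> \<le> C / \<delta> * norm v" if "x \<in> W" for x v
      proof -
        have xc: "x \<in> closure \<Omega>" using that closure_subset by (auto simp: W_def)
        have "\<bar>frechet_derivative \<xi> (at x) v\<bar> = \<bar>\<zeta>' (1 / k * \<psi> x)\<bar> * (1 / k * \<bar>frechet_derivative \<psi> (at x) v\<bar>)"
          using k by (simp add: \<xi>D abs_mult)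
        also have "\<dots> \<le> C1 * (1 / k * (C2 * norm v))"
          using \<zeta>'B C2(2)[OF xc, of v] k C1(1) by (intro mult_mono) auto
        also have "\<dots> = C1 * C2 / \<kappa> / \<delta> * norm v" by (simp add: k_def)
        also have "\<dots> \<le> C / \<delta> * norm v"
          using C(2) \<delta> by (intro mult_right_mono divide_right_mono) auto
        finally show ?thesis .
      qed
      show "\<bar>frechet_derivative \<xi> (at x) (V (t, x))\<bar> \<le> C" if "x \<in> W" "t \<in> {0..T}" for x t
      proof -
        have xc: "x \<in> \<Omega>" using that by (auto simp: W_def)
        have "\<bar>frechet_derivative \<xi> (at x) (V (t, x))\<bar> =
            \<bar>\<zeta>' (1 / k * \<psi> x)\<bar> * (1 / k * \<bar>frechet_derivative \<psi> (at x) (V (t, x))\<bar>)"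
          using k by (simp add: \<xi>D abs_mult)
        also have "\<dots> \<le> C1 * (1 / k * (L * bdist \<Omega> x))"
          using \<zeta>'B L(2)[OF that(2) xc] k C1(1) by (intro mult_mono) auto
        also have "\<dots> \<le> C1 * (1 / k * (L * (c * \<delta>)))"
          using Wd[OF that(1)] k C1(1) L(1) by (intro mult_left_mono) auto
        also have "\<dots> = C1 * L * c / \<kappa>" using \<delta> by (simp add: k_def)
        finally show ?thesis using C(3) by linarith
      qed
    qed
    then show "\<exists>\<xi> W. layer_cutoff c C \<delta> \<xi> W" by blast
  qed
qed

end

subsection \<open>Finite energy weak solutions\<close>

text \<open>\<open>D\<close> is symmetric and orthogonal to the identity. Symmetry gives D \<bullet>
  A = D \<bullet> D / 2, and in terms of \<open>D\<close> and the trace both quadratic forms are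
  diagonal.\<close>

lemma stress_inner_self:
  fixes A :: "real^3^3"
  defines "D \<equiv> A + transpose A - (2/3 * trace A) *\<^sub>R mat 1"
  shows "stress \<mu> \<eta> A \<bullet> A = \<mu> / 2 * (D \<bullet> D) + \<eta> * (trace A)\<^sup>2"
    and "stress \<mu> \<eta> A \<bullet> stress \<mu> \<eta> A = \<mu>\<^sup>2 * (D \<bullet> D) + 3 * \<eta>\<^sup>2 * (trace A)\<^sup>2"
proof -
  have AI: "A \<bullet> mat 1 = trace A"
    by (simp add: inner_vec_def mat_def trace_def if_distrib[of "(*) _"] cong: if_cong)
  have AtI: "transpose A \<bullet> mat 1 = trace A"
    by (simp add: inner_vec_def mat_def trace_def transpose_def if_distrib[of "(*) _"] cong: if_cong)
  have II: "mat 1 \<bullet> (mat 1 :: real^3^3) = 3"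
    by (simp add: inner_vec_def mat_def if_distrib[of "(*) _"] cong: if_cong)
  have sw: "transpose A \<bullet> B = A \<bullet> transpose B" for B :: "real^3^3"
    unfolding inner_vec_def transpose_def by (simp, subst sum.swap, simp)
  have AtAt: "transpose A \<bullet> transpose A = A \<bullet> A" using sw[of "transpose A"] by (simp add: transpose_transpose)
  have DI: "D \<bullet> mat 1 = 0" by (simp add: D_def inner_diff_left inner_add_left AI AtI II)
  have DA: "D \<bullet> A = D \<bullet> D / 2"
  proof -
    have "D \<bullet> D = D \<bullet> A + D \<bullet> transpose A - (2/3 * trace A) * (D \<bullet> mat 1)"
      by (subst (2) D_def) (simp add: inner_diff_right inner_add_right)
    moreover have "D \<bullet> transpose A = D \<bullet> A"
    proof -
      have IAt: "mat 1 \<bullet> transpose A = trace A" "mat 1 \<bullet> A = trace A"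
        using AI AtI by (metis inner_commute)+
      have AAt: "A \<bullet> transpose A = transpose A \<bullet> A" by (rule inner_commute)
      show ?thesis
        unfolding D_def inner_diff_left inner_add_left inner_scaleR_left IAt AtAt AAt by simp
    qed
    ultimately show ?thesis by (simp add: DI)
  qed
  have S: "stress \<mu> \<eta> A = \<mu> *\<^sub>R D + (\<eta> * trace A) *\<^sub>R mat 1" by (simp add: stress_def D_def)
  show "stress \<mu> \<eta> A \<bullet> A = \<mu> / 2 * (D \<bullet> D) + \<eta> * (trace A)\<^sup>2"
  proof -
    have IA: "mat 1 \<bullet> A = trace A" using AI by (metis inner_commute)
    show ?thesis unfolding S inner_add_left inner_scaleR_left DA IA by (simp add: power2_eq_square)
  qed
  show "stress \<mu> \<eta> A \<bullet> stress \<mu> \<eta> A = \<mu>\<^sup>2 * (D \<bullet> D) + 3 * \<eta>\<^sup>2 * (trace A)\<^sup>2"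
  proof -
    have ID: "mat 1 \<bullet> D = 0" using DI by (metis inner_commute)
    show ?thesis unfolding S inner_add_left inner_add_right inner_scaleR_left inner_scaleR_right DI ID II
      by (simp add: power2_eq_square)
  qed
qed

text \<open>The second bound lets the dissipation of the energy inequality control the stress on the
  whole cylinder; the third serves in the layer, where the full gradient of the velocity is
  controlled by hypothesis.\<close>

lemma stress_bounds:
  fixes A :: "real^3^3"
  assumes "0 < \<mu>" "0 \<le> \<eta>"
  shows "0 \<le> stress \<mu> \<eta> A \<bullet> A"
    and "(norm (stress \<mu> \<eta> A))\<^sup>2 \<le> (2 * \<mu> + 3 * \<eta>) * (stress \<mu> \<eta> A \<bullet> A)"
    and "norm (stress \<mu> \<eta> A) \<le> (2 * \<mu> + 3 * \<eta>) * norm A"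
proof -
  define D where "D = A + transpose A - (2/3 * trace A) *\<^sub>R mat 1"
  note s = stress_inner_self[of \<mu> \<eta> A, folded D_def]
  have D0: "0 \<le> D \<bullet> D" by simp
  show "0 \<le> stress \<mu> \<eta> A \<bullet> A" unfolding s(1) using assms D0 by simp
  \<comment> \<open>The difference of the two sides of the second bound, after inserting
    \<open>stress_inner_self\<close>.\<close>
  have "0 \<le> 3/2 * \<eta> * \<mu> * (D \<bullet> D) + 2 * \<mu> * \<eta> * (trace A)\<^sup>2" using assms D0 by simp
  then show *: "(norm (stress \<mu> \<eta> A))\<^sup>2 \<le> (2 * \<mu> + 3 * \<eta>) * (stress \<mu> \<eta> A \<bullet> A)"
    unfolding power2_norm_eq_inner s by (simp add: algebra_simps power2_eq_square)
  show "norm (stress \<mu> \<eta> A) \<le> (2 * \<mu> + 3 * \<eta>) * norm A"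
  proof (cases "stress \<mu> \<eta> A = 0")
    case False
    have "norm (stress \<mu> \<eta> A) * norm (stress \<mu> \<eta> A) \<le> (2 * \<mu> + 3 * \<eta>) * (norm (stress \<mu> \<eta> A) * norm A)"
      using order_trans[OF * mult_left_mono[OF norm_cauchy_schwarz[of "stress \<mu> \<eta> A" A]]] assms
      by (simp add: power2_eq_square)
    then have "norm (stress \<mu> \<eta> A) * norm (stress \<mu> \<eta> A) \<le> ((2 * \<mu> + 3 * \<eta>) * norm A) * norm (stress \<mu> \<eta> A)"
      by (simp add: mult_ac)
    moreover have "0 < norm (stress \<mu> \<eta> A)" using False by simp
    ultimately show ?thesis by (rule mult_right_le_imp_le)
  qed (use assms in simp)
qed

definition energy_density :: "real \<Rightarrow> real \<Rightarrow> real^3 \<Rightarrow> real" where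
  "energy_density \<gamma> a w = 1/2 * a * (norm w)\<^sup>2 + a powr \<gamma> / (\<gamma> - 1)"

definition rel_density :: "real \<Rightarrow> real \<Rightarrow> real^3 \<Rightarrow> real \<Rightarrow> real^3 \<Rightarrow> real" where
  "rel_density \<gamma> a w r v = 1/2 * a * (norm (w - v))\<^sup>2 + rel_H \<gamma> a r"

text \<open>Apart from the energy density this is affine in the pair of \<open>a\<close> and a w,
  the density and momentum that the weak equations govern, with coefficients taken from the Euler
  flow.\<close>

lemma rel_density_eq:
  "rel_density \<gamma> a w r v = energy_density \<gamma> a w - a * (w \<bullet> v) +
     a * (1/2 * (v \<bullet> v) - \<gamma> / (\<gamma> - 1) * r powr (\<gamma> - 1)) + r powr \<gamma>"
  by (simp add: rel_density_def energy_density_def rel_H_def power2_norm_eq_inner inner_diff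
      inner_commute algebra_simps)

lemma energy_density_nonneg: "1 < \<gamma> \<Longrightarrow> 0 \<le> a \<Longrightarrow> 0 \<le> energy_density \<gamma> a w"
  by (simp add: energy_density_def)

lemma rel_density_nonneg: "1 < \<gamma> \<Longrightarrow> 0 \<le> a \<Longrightarrow> 0 \<le> r \<Longrightarrow> 0 \<le> rel_density \<gamma> a w r v"
  by (simp add: rel_density_def rel_H_nonneg)

section \<open>A weak solution and its integrated energy bounds\<close>

locale ns_flow = euler_flow +
  fixes \<mu> \<eta> \<nu> :: real and \<rho>0 :: "real^3 \<Rightarrow> real" and u0 :: "real^3 \<Rightarrow> real^3"
    and \<rho> :: "real \<Rightarrow> real^3 \<Rightarrow> real" and u :: "real \<Rightarrow> real^3 \<Rightarrow> real^3"
  assumes \<mu>: "0 < \<mu>" and \<eta>: "0 \<le> \<eta>" and \<nu>: "0 < \<nu>" "\<nu> < 1"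
    and data: "finite_energy_data \<gamma> \<Omega> \<rho>0 u0"
    and sol: "finite_energy_weak_solution \<gamma> \<mu> \<eta> \<nu> T \<Omega> \<rho>0 u0 \<rho> u"
begin

definition Q :: "(real \<times> (real^3)) set" where "Q = {0<..<T} \<times> \<Omega>"
definition dens :: "real \<times> (real^3) \<Rightarrow> real" where "dens z = \<rho> (fst z) (snd z)"
definition vel :: "real \<times> (real^3) \<Rightarrow> real^3" where "vel z = u (fst z) (snd z)"
definition nab :: "real \<times> (real^3) \<Rightarrow> real^3^3" where "nab z = nabla_x T \<Omega> u (fst z) (snd z)"
definition E0 :: real where "E0 = energy \<gamma> \<Omega> \<rho>0 u0"

lemma \<Omega>_lmeasurable: "\<Omega> \<in> lmeasurable"
  using open_\<Omega> bounded_\<Omega> by (simp add: bounded_set_imp_lmeasurable)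

lemma \<Omega>_sets: "\<Omega> \<in> sets lebesgue" using \<Omega>_lmeasurable by blast

lemma open_Q: "open Q" using open_\<Omega> by (simp add: Q_def open_Times)

lemma Q_subset: "Q \<subseteq> {0..T} \<times> closure \<Omega>" "Q \<subseteq> N"
  using cylinder_subset N unfolding Q_def by blast+

lemma Q_lmeasurable: "Q \<in> lmeasurable"
  using open_Q bounded_\<Omega> by (intro bounded_set_imp_lmeasurable) (auto simp: Q_def bounded_Times)

sublocale finQ: finite_measure "lebesgue_on Q"
  using Q_lmeasurable by (rule finite_measure_lebesgue_on)

sublocale fin\<Omega>: finite_measure "lebesgue_on \<Omega>"
  using \<Omega>_lmeasurable by (rule finite_measure_lebesgue_on)

lemma continuous_measurable_Q:
  fixes f :: "real \<times> (real^3) \<Rightarrow> 'b::euclidean_space"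
  assumes "continuous_on Q f" shows "f \<in> borel_measurable (lebesgue_on Q)"
  using continuous_imp_measurable_on_sets_lebesgue[OF assms] Q_lmeasurable by blast

lemma smooth_measurable_Q:
  fixes f :: "real \<times> (real^3) \<Rightarrow> 'b::euclidean_space"
  assumes "smooth_in N f" shows "f \<in> borel_measurable (lebesgue_on Q)"
  by (rule continuous_measurable_Q[OF smooth_in_continuous_on[OF assms Q_subset(2)]])

text \<open>The direction \<open>h\<close> is only measurable, so the derivative is expanded in a
  basis: smooth coefficients times measurable components.\<close>

lemma derivative_measurable_Q:
  fixes f :: "real \<times> (real^3) \<Rightarrow> 'b::euclidean_space"
  assumes f: "smooth_in N f" and h: "h \<in> borel_measurable (lebesgue_on Q)"
  shows "(\<lambda>z. frechet_derivative f (at z) (h z)) \<in> borel_measurable (lebesgue_on Q)"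
proof -
  have "(\<lambda>z. \<Sum>b\<in>Basis. (h z \<bullet> b) *\<^sub>R frechet_derivative f (at z) b) \<in> borel_measurable (lebesgue_on Q)"
    using h smooth_measurable_Q[OF smooth_in_frechet_derivative[OF f]] by measurable
  moreover have "(\<Sum>b\<in>Basis. (h z \<bullet> b) *\<^sub>R frechet_derivative f (at z) b) = frechet_derivative f (at z) (h z)"
    if "z \<in> Q" for z
  proof -
    have lin: "linear (frechet_derivative f (at z))"
      using smooth_in_has_derivative[OF f] that Q_subset(2) by (blast intro: has_derivative_linear)
    show ?thesis
      by (simp add: linear_scale[OF lin, symmetric] linear_sum[OF lin, symmetric] euclidean_representation)
  qed
  ultimately show ?thesis by (subst measurable_cong[symmetric]) auto
qed

text \<open>The membership \<open>in_L2_H10\<close> contained in the notion of solution is what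
  makes the choice in \<open>nabla_x\<close> meaningful.\<close>

lemma nabla_L2: "L2_H10_with_jacobian T \<Omega> u (nabla_x T \<Omega> u)"
proof -
  have "\<exists>G. L2_H10_with_jacobian T \<Omega> u G"
    using sol unfolding finite_energy_weak_solution_def in_L2_H10_def by - (elim conjE, assumption)
  then show ?thesis unfolding nabla_x_def by (rule someI_ex)
qed

lemma dens_measurable: "dens \<in> borel_measurable (lebesgue_on Q)"
  using sol unfolding finite_energy_weak_solution_def Q_def dens_def[abs_def] split_def
  by - (elim conjE, assumption)

lemma vel_measurable: "vel \<in> borel_measurable (lebesgue_on Q)"
  using nabla_L2 unfolding L2_H10_with_jacobian_def in_Lp_def Q_def vel_def[abs_def] split_def
  by - (elim conjE, assumption)

lemma nab_measurable: "nab \<in> borel_measurable (lebesgue_on Q)"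
  using nabla_L2 unfolding L2_H10_with_jacobian_def in_Lp_def Q_def nab_def[abs_def] split_def
  by - (elim conjE, assumption)

lemma nab_square_integrable: "integrable (lebesgue_on Q) (\<lambda>z. (norm (nab z))\<^sup>2)"
proof -
  have "integrable (lebesgue_on Q) (\<lambda>z. norm (nab z) powr 2)"
    using nabla_L2 unfolding L2_H10_with_jacobian_def in_Lp_def Q_def nab_def split_def
    by - (elim conjE, assumption)
  then show ?thesis by (simp add: powr_numeral)
qed

lemma slice_nonneg: "t \<in> {0..T} \<Longrightarrow> AE x in lebesgue_on \<Omega>. 0 \<le> \<rho> t x"
  using sol unfolding finite_energy_weak_solution_def by - (elim conjE, erule bspec, assumption)

lemma dens_nonneg: "AE z in lebesgue_on Q. 0 \<le> dens z"
  unfolding Q_def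
proof (rule AE_lebesgue_on_TimesI[OF _ open_\<Omega>])
  show "AE t in lebesgue_on {0<..<T}. AE x in lebesgue_on \<Omega>. 0 \<le> dens (t, x)"
  proof (rule AE_I2)
    fix t assume "t \<in> space (lebesgue_on {0<..<T})"
    then show "AE x in lebesgue_on \<Omega>. 0 \<le> dens (t, x)"
      using slice_nonneg[of t] by (simp add: dens_def)
  qed
qed (use dens_measurable in \<open>auto simp: Q_def\<close>)

lemma weakly_continuous_dens: "weakly_continuous_Lp \<gamma> T \<Omega> \<rho>"
  and weakly_continuous_mom: "weakly_continuous_Lp (2 * \<gamma> / (\<gamma> + 1)) T \<Omega> (\<lambda>t x. \<rho> t x *\<^sub>R u t x)"
  and weakly_continuous_kin: "weakly_continuous_Lp 1 T \<Omega> (\<lambda>t x. \<rho> t x * (norm (u t x))\<^sup>2)"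
  using sol unfolding finite_energy_weak_solution_def by - (elim conjE, assumption)+

lemma momentum_exponent: "1 \<le> 2 * \<gamma> / (\<gamma> + 1)"
  using \<gamma> by (simp add: field_simps)

lemma slice_integrable:
  assumes t: "t \<in> {0..T}"
  shows "integrable (lebesgue_on \<Omega>) (\<rho> t)"
    and "integrable (lebesgue_on \<Omega>) (\<lambda>x. \<rho> t x powr \<gamma>)"
    and "integrable (lebesgue_on \<Omega>) (\<lambda>x. \<rho> t x *\<^sub>R u t x)"
    and "integrable (lebesgue_on \<Omega>) (\<lambda>x. \<rho> t x * (norm (u t x))\<^sup>2)"
    and "integrable (lebesgue_on \<Omega>) (\<lambda>x. energy_density \<gamma> (\<rho> t x) (u t x))"
proof -
  have L: "in_Lp \<gamma> \<Omega> (\<rho> t)" "in_Lp (2 * \<gamma> / (\<gamma> + 1)) \<Omega> (\<lambda>x. \<rho> t x *\<^sub>R u t x)"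
    "in_Lp 1 \<Omega> (\<lambda>x. \<rho> t x * (norm (u t x))\<^sup>2)"
    using weakly_continuous_dens weakly_continuous_mom weakly_continuous_kin t
    unfolding weakly_continuous_Lp_def by auto
  show "integrable (lebesgue_on \<Omega>) (\<rho> t)"
    by (rule in_Lp_integrable(1)[OF _ \<Omega>_lmeasurable L(1)]) (use \<gamma> in simp)
  show "integrable (lebesgue_on \<Omega>) (\<lambda>x. \<rho> t x *\<^sub>R u t x)"
    by (rule in_Lp_integrable(1)[OF momentum_exponent \<Omega>_lmeasurable L(2)])
  show k: "integrable (lebesgue_on \<Omega>) (\<lambda>x. \<rho> t x * (norm (u t x))\<^sup>2)"
    by (rule in_Lp_integrable(1)[OF _ \<Omega>_lmeasurable L(3)]) simp
  have m: "\<rho> t \<in> borel_measurable (lebesgue_on \<Omega>)"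
    and p: "integrable (lebesgue_on \<Omega>) (\<lambda>x. norm (\<rho> t x) powr \<gamma>)"
    using L(1) by (auto simp: in_Lp_def)
  show p': "integrable (lebesgue_on \<Omega>) (\<lambda>x. \<rho> t x powr \<gamma>)"
    by (rule integrable_cong_AE_imp[OF p]) (use m slice_nonneg[OF t] in \<open>auto elim!: eventually_mono\<close>)
  show "integrable (lebesgue_on \<Omega>) (\<lambda>x. energy_density \<gamma> (\<rho> t x) (u t x))"
    unfolding energy_density_def using k p' by (simp add: mult.assoc)
qed

lemma data_integrable:
  shows "AE x in lebesgue_on \<Omega>. 0 \<le> \<rho>0 x"
    and "\<rho>0 \<in> borel_measurable (lebesgue_on \<Omega>)" and "u0 \<in> borel_measurable (lebesgue_on \<Omega>)"
    and "integrable (lebesgue_on \<Omega>) \<rho>0"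
    and "integrable (lebesgue_on \<Omega>) (\<lambda>x. \<rho>0 x powr \<gamma>)"
    and "integrable (lebesgue_on \<Omega>) (\<lambda>x. \<rho>0 x *\<^sub>R u0 x)"
    and "integrable (lebesgue_on \<Omega>) (\<lambda>x. \<rho>0 x * (norm (u0 x))\<^sup>2)"
    and "integrable (lebesgue_on \<Omega>) (\<lambda>x. energy_density \<gamma> (\<rho>0 x) (u0 x))"
proof -
  show n: "AE x in lebesgue_on \<Omega>. 0 \<le> \<rho>0 x" and u: "u0 \<in> borel_measurable (lebesgue_on \<Omega>)"
    using data by (auto simp: finite_energy_data_def)
  have L: "in_Lp \<gamma> \<Omega> \<rho>0" "in_Lp (2 * \<gamma> / (\<gamma> + 1)) \<Omega> (\<lambda>x. \<rho>0 x *\<^sub>R u0 x)"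
    "in_Lp 1 \<Omega> (\<lambda>x. \<rho>0 x * (norm (u0 x))\<^sup>2)"
    using data by (auto simp: finite_energy_data_def)
  show "integrable (lebesgue_on \<Omega>) \<rho>0"
    by (rule in_Lp_integrable(1)[OF _ \<Omega>_lmeasurable L(1)]) (use \<gamma> in simp)
  show "integrable (lebesgue_on \<Omega>) (\<lambda>x. \<rho>0 x *\<^sub>R u0 x)"
    by (rule in_Lp_integrable(1)[OF momentum_exponent \<Omega>_lmeasurable L(2)])
  show k: "integrable (lebesgue_on \<Omega>) (\<lambda>x. \<rho>0 x * (norm (u0 x))\<^sup>2)"
    by (rule in_Lp_integrable(1)[OF _ \<Omega>_lmeasurable L(3)]) simp
  show m: "\<rho>0 \<in> borel_measurable (lebesgue_on \<Omega>)" using L(1) by (simp add: in_Lp_def)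
  have p: "integrable (lebesgue_on \<Omega>) (\<lambda>x. norm (\<rho>0 x) powr \<gamma>)"
    using L(1) by (simp add: in_Lp_def)
  show p': "integrable (lebesgue_on \<Omega>) (\<lambda>x. \<rho>0 x powr \<gamma>)"
    by (rule integrable_cong_AE_imp[OF p]) (use m n in \<open>auto elim!: eventually_mono\<close>)
  show "integrable (lebesgue_on \<Omega>) (\<lambda>x. energy_density \<gamma> (\<rho>0 x) (u0 x))"
    unfolding energy_density_def using k p' by (simp add: mult.assoc)
qed

lemma energy_eq: "energy \<gamma> \<Omega> r w = (LINT x|lebesgue_on \<Omega>. energy_density \<gamma> (r x) (w x))"
  by (simp add: energy_def energy_density_def)

lemma E0_nonneg: "0 \<le> E0"
  unfolding E0_def energy_eq using data_integrable(1)
  by (intro integral_nonneg_AE) (auto elim!: eventually_mono intro: energy_density_nonneg[OF \<gamma>])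

lemma energy_inequality:
  "AE \<tau> in lebesgue_on {0<..<T}. energy \<gamma> \<Omega> (\<rho> \<tau>) (u \<tau>) +
     \<nu> * (LINT z|lebesgue_on ({0<..<\<tau>} \<times> \<Omega>). stress \<mu> \<eta> (nab z) \<bullet> nab z) \<le> E0"
proof -
  have "AE \<tau> in lebesgue_on {0..T}. energy \<gamma> \<Omega> (\<rho> \<tau>) (u \<tau>) +
     \<nu> * (LINT z|lebesgue_on ({0<..<\<tau>} \<times> \<Omega>). stress \<mu> \<eta> (nab z) \<bullet> nab z) \<le> E0"
    using sol unfolding finite_energy_weak_solution_def E0_def nab_def split_def
    by - (elim conjE, assumption)
  then show ?thesis
    by (simp add: AE_restrict_space_iff) (auto elim!: eventually_mono)
qed

lemma dissipation_nonneg: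
  "0 \<le> \<nu> * (LINT z|lebesgue_on S. stress \<mu> \<eta> (nab z) \<bullet> nab z)"
  using \<nu> stress_bounds(1)[OF \<mu> \<eta>] by (intro mult_nonneg_nonneg integral_nonneg_AE) auto

lemma energy_bound: "AE \<tau> in lebesgue_on {0<..<T}. energy \<gamma> \<Omega> (\<rho> \<tau>) (u \<tau>) \<le> E0"
  using energy_inequality
  by eventually_elim (use dissipation_nonneg in \<open>smt (verit)\<close>)

abbreviation en :: "real \<times> (real^3) \<Rightarrow> real" where "en z \<equiv> energy_density \<gamma> (dens z) (vel z)"

lemma en_measurable: "en \<in> borel_measurable (lebesgue_on Q)"
  unfolding energy_density_def using dens_measurable vel_measurable by measurable

lemma fst_measurable_Q: "continuous_on UNIV k \<Longrightarrow> (\<lambda>z. k (fst z)) \<in> borel_measurable (lebesgue_on Q)"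
  for k :: "real \<Rightarrow> real"
  by (rule continuous_measurable_Q, rule continuous_on_compose2[where t = UNIV and g = k])
    (auto intro: continuous_on_fst continuous_on_id)

text \<open>The energy inequality is available at almost every time, so it is integrated against a
  nonnegative weight in time. Tonelli also yields the integrability of the energy on the cylinder.
  Later the weight is -\<theta>', whose integral is one.\<close>

lemma energy_weighted:
  fixes k :: "real \<Rightarrow> real"
  assumes k: "continuous_on UNIV k" and k0: "\<And>t. 0 \<le> k t"
  shows "integrable (lebesgue_on Q) (\<lambda>z. k (fst z) * en z)"
    and "(LINT z|lebesgue_on Q. k (fst z) * en z) \<le> E0 * (LINT t|lebesgue_on {0<..<T}. k t)"
proof -
  have km: "(\<lambda>z. k (fst z)) \<in> borel_measurable (lebesgue_on Q)" by (rule fst_measurable_Q[OF k])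
  have m: "(\<lambda>z. k (fst z) * en z) \<in> borel_measurable (lebesgue_on Q)"
    using km en_measurable by measurable
  have nn: "AE z in lebesgue_on Q. 0 \<le> k (fst z) * en z"
    using dens_nonneg by eventually_elim (simp add: k0 energy_density_nonneg[OF \<gamma>])
  have ki: "integrable (lebesgue_on {0<..<T}) k"
  proof -
    have "integrable (lebesgue_on {0..T}) k"
      by (rule continuous_imp_integrable_real) (use k continuous_on_subset in blast)
    then have "integrable lebesgue (\<lambda>t. indicator {0..T} t *\<^sub>R k t)"
      by (simp add: integrable_restrict_space)
    then have "integrable lebesgue (\<lambda>t. indicator {0<..<T} t *\<^sub>R (indicator {0..T} t *\<^sub>R k t))"
      by (rule integrable_mult_indicator[rotated]) auto
    moreover have "(\<lambda>t. indicator {0<..<T} t *\<^sub>R (indicator {0..T} t *\<^sub>R k t)) = (\<lambda>t. indicator {0<..<T} t *\<^sub>R k t)"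
      by (auto simp: indicator_def)
    ultimately show ?thesis by (simp add: integrable_restrict_space)
  qed
  have "(\<integral>\<^sup>+z. ennreal (k (fst z) * en z) \<partial>lebesgue_on Q) =
      (\<integral>\<^sup>+t. \<integral>\<^sup>+x. ennreal (k t * en (t, x)) \<partial>lebesgue_on \<Omega> \<partial>lebesgue_on {0<..<T})"
    unfolding Q_def using nn_integral_lebesgue_on_Times[OF _ open_\<Omega>, of "{0<..<T}" "\<lambda>z. ennreal (k (fst z) * en z)"] m
    by (simp add: Q_def)
  also have "\<dots> \<le> (\<integral>\<^sup>+t. ennreal (E0 * k t) \<partial>lebesgue_on {0<..<T})"
  proof (rule nn_integral_mono_AE)
    have "AE t in lebesgue_on {0<..<T}. t \<in> {0<..<T}" by (rule AE_I2) simp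
    with energy_bound show "AE t in lebesgue_on {0<..<T}.
        (\<integral>\<^sup>+x. ennreal (k t * en (t, x)) \<partial>lebesgue_on \<Omega>) \<le> ennreal (E0 * k t)"
    proof eventually_elim
      case (elim t)
      then have t: "t \<in> {0..T}" by auto
      have i: "integrable (lebesgue_on \<Omega>) (\<lambda>x. k t * en (t, x))"
        using slice_integrable(5)[OF t] by (simp add: dens_def vel_def)
      have "(\<integral>\<^sup>+x. ennreal (k t * en (t, x)) \<partial>lebesgue_on \<Omega>) = ennreal (LINT x|lebesgue_on \<Omega>. k t * en (t, x))"
      proof (rule nn_integral_eq_integral[OF i])
        show "AE x in lebesgue_on \<Omega>. 0 \<le> k t * en (t, x)"
          using slice_nonneg[OF t] by eventually_elim (simp add: dens_def k0 energy_density_nonneg[OF \<gamma>])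
      qed
      also have "(LINT x|lebesgue_on \<Omega>. k t * en (t, x)) = k t * energy \<gamma> \<Omega> (\<rho> t) (u t)"
        by (simp add: energy_eq dens_def vel_def)
      also have "\<dots> \<le> k t * E0" using elim k0 by (intro mult_left_mono) auto
      finally show ?case by (simp add: mult.commute ennreal_leI)
    qed
  qed
  also have "\<dots> = ennreal (E0 * (LINT t|lebesgue_on {0<..<T}. k t))"
    using ki k0 E0_nonneg by (subst nn_integral_eq_integral) auto
  finally have le: "(\<integral>\<^sup>+z. ennreal (k (fst z) * en z) \<partial>lebesgue_on Q) \<le> ennreal (E0 * (LINT t|lebesgue_on {0<..<T}. k t))" .
  show int: "integrable (lebesgue_on Q) (\<lambda>z. k (fst z) * en z)"
    by (rule integrableI_nonneg[OF m nn]) (rule order_le_less_trans[OF le], simp)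
  have "ennreal (LINT z|lebesgue_on Q. k (fst z) * en z) \<le> ennreal (E0 * (LINT t|lebesgue_on {0<..<T}. k t))"
    using le nn_integral_eq_integral[OF int nn] by simp
  moreover have "0 \<le> E0 * (LINT t|lebesgue_on {0<..<T}. k t)"
    using E0_nonneg k0 by (intro mult_nonneg_nonneg integral_nonneg_AE) auto
  ultimately show "(LINT z|lebesgue_on Q. k (fst z) * en z) \<le> E0 * (LINT t|lebesgue_on {0<..<T}. k t)"
    using ennreal_le_iff by blast
qed

lemma integrable_Q_bound:
  fixes h :: "real \<times> (real^3) \<Rightarrow> real"
  assumes h: "h \<in> borel_measurable (lebesgue_on Q)"
    and B: "AE z in lebesgue_on Q. 0 \<le> dens z \<longrightarrow> z \<in> Q \<longrightarrow> \<bar>h z\<bar> \<le> B * (1 + en z + (norm (nab z))\<^sup>2)"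
  shows "integrable (lebesgue_on Q) h"
proof (rule Bochner_Integration.integrable_bound[OF _ h])
  have "integrable (lebesgue_on Q) en" using energy_weighted(1)[of "\<lambda>_. 1"] by simp
  then show "integrable (lebesgue_on Q) (\<lambda>z. B * (1 + en z + (norm (nab z))\<^sup>2))"
    using nab_square_integrable by simp
  have "AE z in lebesgue_on Q. z \<in> Q" by (rule AE_I2) simp
  then show "AE z in lebesgue_on Q. norm (h z) \<le> norm (B * (1 + en z + (norm (nab z))\<^sup>2))"
    using B dens_nonneg by eventually_elim auto
qed

end

section \<open>The weak equations tested with the Euler flow\<close>

lemma outer_inner_matrix:
  fixes D :: "real^3 \<Rightarrow> real^3"
  assumes "linear D" shows "outer a b \<bullet> matrix D = a \<bullet> D b"
proof -
  have "(\<Sum>j\<in>UNIV. b $ j * D (axis j 1) $ i) = D b $ i" for i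
    by (rule linear_axis_sum[of "\<lambda>w. D w $ i"])
      (use linear_compose[OF assms bounded_linear.linear[OF bounded_linear_vec_nth]] in \<open>simp add: o_def\<close>)
  then show ?thesis
    by (simp add: inner_vec_def outer_def matrix_def mult.assoc sum_distrib_left[symmetric])
qed

lemma matrix_scaleR: "matrix (\<lambda>w. c *\<^sub>R A w) = c *\<^sub>R matrix A" for A :: "real^3 \<Rightarrow> real^3"
  by (simp add: matrix_def vec_eq_iff)

text \<open>The embedding x \<mapsto> (t, x) is affine rather than linear, so
  \<open>smooth_in_compose_linear\<close> does not cover it. The derivative in direction v is that
  of \<open>F\<close> in the fixed direction (0, v), and the same induction works.\<close>

lemma smooth_in_slice:
  assumes "smooth_in N F" shows "smooth_in {x. (t, x) \<in> N} (\<lambda>x. F (t, x))"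
proof -
  have o: "open {x. (t, x) \<in> N}"
    using open_vimage[OF smooth_in_open[OF assms], of "\<lambda>x. (t, x)"]
    by (simp add: vimage_def continuous_on_Pair)
  have "Ck_on k {x. (t, x) \<in> N} (\<lambda>x. F (t, x))" if "Ck_on k N F" for k and F :: "'a \<times> 'b \<Rightarrow> 'c"
    using that
  proof (induction k arbitrary: F)
    case 0
    then have cF: "continuous_on N F" by simp
    have "continuous_on {x. (t, x) \<in> N} (\<lambda>x. (t, x))"
      by (intro continuous_on_Pair continuous_on_const continuous_on_id)
    from continuous_on_compose2[OF cF this] show ?case by auto
  next
    case (Suc k)
    have "((\<lambda>x. F (t, x)) has_derivative (\<lambda>v. frechet_derivative F (at (t, x)) (0, v))) (at x)"
      if "x \<in> {x. (t, x) \<in> N}" for x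
      using that by (intro has_derivative_slice_space Ck_on_Suc_has_derivative[OF Suc.prems]) simp
    moreover have "Ck_on k {x. (t, x) \<in> N} (\<lambda>x. frechet_derivative F (at (t, x)) (0, v))" for v
      using Suc.IH[of "\<lambda>z. frechet_derivative F (at z) (0, v)"] Suc.prems by simp
    ultimately show ?case by (intro Ck_on_SucI[OF o])
  qed
  then show ?thesis using assms o by (simp add: smooth_in_def)
qed

lemma integrable_continuous_compact_support:
  fixes f :: "'a::euclidean_space \<Rightarrow> real"
  assumes f: "continuous_on UNIV f" and K: "compact K" "\<And>x. x \<notin> K \<Longrightarrow> f x = 0"
  shows "integrable lborel f"
proof -
  have "bounded (f ` K)"
    using f K by (intro compact_imp_bounded compact_continuous_image) (auto intro: continuous_on_subset)
  then obtain B where B: "\<And>x. x \<in> K \<Longrightarrow> norm (f x) \<le> B" unfolding bounded_iff by auto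
  have Kb: "K \<in> sets borel" using K(1) by (intro borel_closed compact_imp_closed)
  have Kfin: "emeasure lborel K < \<infinity>"
    by (rule emeasure_bounded_finite[OF compact_imp_bounded[OF K(1)]])
  show ?thesis
    by (rule integrableI_bounded_set[where A = K and B = B])
      (use f Kb Kfin K(2) B in \<open>auto intro!: borel_measurable_continuous_onI\<close>)
qed

context euler_flow
begin

text \<open>The coefficient |V|^2/2 - H'(R) of the density in \<open>rel_density_eq\<close>, and so
  the function with which the continuity equation is tested.\<close>

definition fE :: "real \<times> (real^3) \<Rightarrow> real" where
  "fE z = 1/2 * (V z \<bullet> V z) - \<gamma> / (\<gamma> - 1) * R z powr (\<gamma> - 1)"
definition pE :: "real \<times> (real^3) \<Rightarrow> real" where "pE z = R z powr \<gamma>"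
definition trV :: "real \<times> (real^3) \<Rightarrow> real" where
  "trV z = trace (matrix (\<lambda>w. frechet_derivative V (at z) (0, w)))"

lemma smooth_R_powr: "smooth_in N (\<lambda>z. R z powr a)"
  by (rule smooth_in_compose_real[OF smooth_in_powr R]) (use Rpos in auto)

lemma smooth_pE: "smooth_in N pE"
  unfolding pE_def[abs_def] by (rule smooth_R_powr)

lemma smooth_fE: "smooth_in N fE"
  unfolding fE_def[abs_def]
  by (rule smooth_in_diff[OF smooth_in_cmult[OF smooth_in_inner[OF V V]] smooth_in_cmult[OF smooth_R_powr]])

lemma open_N: "open N" using R by (rule smooth_in_open)

lemma trV_eq: "trV z = (\<Sum>i\<in>UNIV. frechet_derivative V (at z) (0, axis i 1) \<bullet> axis i 1)"
  by (simp add: trV_def trace_def matrix_def inner_axis)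

lemma smooth_trV: "smooth_in N trV"
  unfolding trV_eq[abs_def]
  by (rule smooth_in_sum[OF open_N], rule smooth_in_inner[OF smooth_in_frechet_derivative[OF V] smooth_in_const[OF open_N]])

lemma frechet_pE: "z \<in> N \<Longrightarrow> frechet_derivative pE (at z) w = \<gamma> * R z powr (\<gamma> - 1) * frechet_derivative R (at z) w"
  unfolding pE_def[abs_def]
  by (subst frechet_derivative_eqI[OF has_derivative_powr_compose[OF smooth_in_has_derivative[OF R]]])
    (use Rpos in auto)

lemma frechet_fE:
  assumes "z \<in> N"
  shows "frechet_derivative fE (at z) w = V z \<bullet> frechet_derivative V (at z) w -
    \<gamma> * R z powr (\<gamma> - 2) * frechet_derivative R (at z) w"
proof -
  note dV = smooth_in_has_derivative[OF V assms]
  note dR = has_derivative_powr_compose[OF smooth_in_has_derivative[OF R assms] Rpos[OF assms], of "\<gamma> - 1"]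
  have "(fE has_derivative (\<lambda>w. 1/2 * (V z \<bullet> frechet_derivative V (at z) w + frechet_derivative V (at z) w \<bullet> V z) -
      \<gamma> / (\<gamma> - 1) * ((\<gamma> - 1) * R z powr (\<gamma> - 1 - 1) * frechet_derivative R (at z) w))) (at z)"
    unfolding fE_def[abs_def]
    by (intro has_derivative_diff has_derivative_mult_right has_derivative_inner dV dR)
  then show ?thesis using \<gamma> by (simp add: frechet_derivative_eqI inner_commute)
qed

lemma cylinder_bounded:
  assumes "smooth_in N (f :: real \<times> (real^3) \<Rightarrow> 'b::euclidean_space)"
  obtains B where "0 \<le> B" "\<And>z. z \<in> {0..T} \<times> closure \<Omega> \<Longrightarrow> norm (f z) \<le> B"
  using smooth_in_bounded[OF assms compact_cylinder N] by metis

lemma frechet_cutoff: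
  assumes "smooth_in UNIV \<xi>"
  shows "smooth_in N (\<lambda>z. \<xi> (snd z))"
    and "((\<lambda>z. \<xi> (snd z)) has_derivative (\<lambda>w. frechet_derivative \<xi> (at (snd z)) (snd w))) (at z)"
proof -
  show "smooth_in N (\<lambda>z. \<xi> (snd z))"
    by (rule smooth_in_compose_linear[OF bounded_linear_snd assms open_N]) simp
  show "((\<lambda>z. \<xi> (snd z)) has_derivative (\<lambda>w. frechet_derivative \<xi> (at (snd z)) (snd w))) (at z)"
    by (rule has_derivative_compose[OF has_derivative_snd[OF has_derivative_ident] smooth_in_has_derivative[OF assms]]) simp
qed

lemma frechet_time:
  fixes \<theta> :: "real \<Rightarrow> real"
  assumes "smooth_in UNIV \<theta>"
  shows "smooth_in N (\<lambda>z. \<theta> (fst z))"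
    and "((\<lambda>z. \<theta> (fst z)) has_derivative (\<lambda>w. frechet_derivative \<theta> (at (fst z)) 1 * fst w)) (at z)"
proof -
  show "smooth_in N (\<lambda>z. \<theta> (fst z))"
    by (rule smooth_in_compose_linear[OF bounded_linear_fst assms open_N]) simp
  have d: "(\<theta> has_derivative frechet_derivative \<theta> (at (fst z))) (at (fst z))"
    by (rule smooth_in_has_derivative[OF assms]) simp
  have "frechet_derivative \<theta> (at (fst z)) s = frechet_derivative \<theta> (at (fst z)) 1 * s" for s
    using linear_scale[OF has_derivative_linear[OF d], of s 1] by simp
  then have "frechet_derivative \<theta> (at (fst z)) = (\<lambda>s. frechet_derivative \<theta> (at (fst z)) 1 * s)" by (rule ext)
  from has_derivative_compose[OF has_derivative_fst[OF has_derivative_ident] has_derivative_eq_rhs[OF d this]]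
  show "((\<lambda>z. \<theta> (fst z)) has_derivative (\<lambda>w. frechet_derivative \<theta> (at (fst z)) 1 * fst w)) (at z)" .
qed

lemma has_derivative_time_scaled:
  fixes F :: "real \<times> (real^3) \<Rightarrow> 'b::euclidean_space"
  assumes \<theta>: "smooth_in UNIV \<theta>" and F: "(F has_derivative D) (at z)"
  shows "((\<lambda>z. \<theta> (fst z) *\<^sub>R F z) has_derivative
    (\<lambda>w. \<theta> (fst z) *\<^sub>R D w + (frechet_derivative \<theta> (at (fst z)) 1 * fst w) *\<^sub>R F z)) (at z)"
  by (rule has_derivative_scaleR[OF frechet_time(2)[OF \<theta>] F])

text \<open>The part of the relative energy that does not involve the weak solution is treated by
  the fundamental theorem of calculus for \<theta> \<open>pE\<close> at each point of space. As
  \<open>\<theta>\<close> runs from one to zero, only the initial value remains.\<close>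

lemma pressure_time_identity:
  assumes \<theta>: "smooth_in UNIV \<theta>" "\<theta> 0 = 1" "\<theta> T = 0"
  shows "(LINT z|lebesgue_on ({0<..<T} \<times> \<Omega>). frechet_derivative \<theta> (at (fst z)) 1 * pE z +
      \<theta> (fst z) * frechet_derivative pE (at z) (1, 0)) = - (LINT x|lebesgue_on \<Omega>. pE (0, x))"
proof -
  define h where "h z = frechet_derivative \<theta> (at (fst z)) 1 * pE z + \<theta> (fst z) * frechet_derivative pE (at z) (1, 0)" for z
  have sh: "smooth_in N h"
    unfolding h_def[abs_def]
    by (rule smooth_in_add[OF smooth_in_mult[OF frechet_time(1)[OF smooth_in_frechet_derivative[OF \<theta>(1)]] smooth_pE]
        smooth_in_mult[OF frechet_time(1)[OF \<theta>(1)] smooth_in_frechet_derivative[OF smooth_pE]]])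
  obtain B where B: "\<And>z. z \<in> {0..T} \<times> closure \<Omega> \<Longrightarrow> norm (h z) \<le> B"
    using cylinder_bounded[OF sh] by metis
  have "(LINT z|lebesgue_on ({0<..<T} \<times> \<Omega>). h z) = (LINT x|lebesgue_on \<Omega>. LINT t|lebesgue_on {0<..<T}. h (t, x))"
  proof (rule Fubini_continuous(3))
    show "continuous_on ({0<..<T} \<times> \<Omega>) h"
      using cylinder_subset N by (intro smooth_in_continuous_on[OF sh]) blast
    show "\<bar>h z\<bar> \<le> B" if "z \<in> {0<..<T} \<times> \<Omega>" for z
      using B[of z] that cylinder_subset by auto
  qed (use open_\<Omega> bounded_\<Omega> in auto)
  also have "\<dots> = (LINT x|lebesgue_on \<Omega>. - pE (0, x))"
  proof (rule Bochner_Integration.integral_cong[OF refl])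
    fix x assume "x \<in> space (lebesgue_on \<Omega>)"
    then have x: "x \<in> closure \<Omega>" using closure_subset by auto
    have "(LINT t|lebesgue_on {0<..<T}. h (t, x)) = \<theta> T *\<^sub>R pE (T, x) - \<theta> 0 *\<^sub>R pE (0, x)"
    proof (rule LINT_FTC)
      fix t assume t: "0 \<le> t" "t \<le> T"
      then have tN: "(t, x) \<in> N" using x N by auto
      show "((\<lambda>t. \<theta> t *\<^sub>R pE (t, x)) has_real_derivative h (t, x)) (at t)"
        using has_vector_derivative_slice_time[OF has_derivative_time_scaled[OF \<theta>(1) smooth_in_has_derivative[OF smooth_pE tN]]]
        by (simp add: h_def has_real_derivative_iff_has_vector_derivative algebra_simps)
    next
      show "continuous_on {0..T} (\<lambda>t. h (t, x))"
        using x N by (intro continuous_on_compose2[OF smooth_in_continuous_on[OF sh subset_refl]])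
          (auto intro!: continuous_on_Pair)
    qed (use T in simp)
    then show "(LINT t|lebesgue_on {0<..<T}. h (t, x)) = - pE (0, x)" using \<theta> by simp
  qed
  finally show ?thesis by (simp add: h_def)
qed

text \<open>The integrand is \<theta> times the divergence of \<xi> \<open>pE\<close> V, a field
  with compact support in the domain. This zero is added to the balance so that the pressure terms
  complete to \<open>rel_H\<close>.\<close>

lemma pressure_space_identity:
  assumes \<theta>: "smooth_in UNIV \<theta>" and \<xi>: "smooth_in UNIV \<xi>"
    and K: "compact K" "K \<subseteq> \<Omega>" "\<And>x. x \<in> \<Omega> - K \<Longrightarrow> \<xi> x = 0"
  shows "(LINT z|lebesgue_on ({0<..<T} \<times> \<Omega>). \<theta> (fst z) * (frechet_derivative \<xi> (at (snd z)) (V z) * pE z +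
      \<xi> (snd z) * (frechet_derivative pE (at z) (0, V z) + pE z * trV z))) = 0"
proof -
  define G where "G j z = \<xi> (snd z) * (pE z * (V z \<bullet> axis j 1))" for j :: 3 and z
  have sG: "smooth_in N (G j)" for j
    unfolding G_def[abs_def]
    by (rule smooth_in_mult[OF frechet_cutoff(1)[OF \<xi>] smooth_in_mult[OF smooth_pE smooth_in_inner[OF V smooth_in_const[OF open_N]]]])
  have DG: "frechet_derivative (G j) (at z) w = \<xi> (snd z) * (pE z * (frechet_derivative V (at z) w \<bullet> axis j 1) +
      frechet_derivative pE (at z) w * (V z \<bullet> axis j 1)) +
      frechet_derivative \<xi> (at (snd z)) (snd w) * (pE z * (V z \<bullet> axis j 1))" if "z \<in> N" for j z w
  proof -
    have "(G j has_derivative (\<lambda>w. \<xi> (snd z) * (pE z * (frechet_derivative V (at z) w \<bullet> axis j 1) +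
      frechet_derivative pE (at z) w * (V z \<bullet> axis j 1)) +
      frechet_derivative \<xi> (at (snd z)) (snd w) * (pE z * (V z \<bullet> axis j 1)))) (at z)"
      unfolding G_def[abs_def]
      by (rule has_derivative_mult[OF frechet_cutoff(2)[OF \<xi>] has_derivative_mult[OF smooth_in_has_derivative[OF smooth_pE that]
          has_derivative_inner_left[OF smooth_in_has_derivative[OF V that]]]])
    then show ?thesis by (simp add: frechet_derivative_eqI)
  qed
  define I where "I z = frechet_derivative \<xi> (at (snd z)) (V z) * pE z +
      \<xi> (snd z) * (frechet_derivative pE (at z) (0, V z) + pE z * trV z)" for z
  have I_eq: "I z = (\<Sum>j\<in>UNIV. frechet_derivative (G j) (at z) (0, axis j 1))" if "z \<in> N" for z
  proof -
    have l1: "linear (frechet_derivative \<xi> (at (snd z)))"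
      using smooth_in_has_derivative[OF \<xi>] by (blast intro: has_derivative_linear)
    have "linear (\<lambda>w. frechet_derivative pE (at z) (0, w))"
    proof -
      have "z = (fst z, snd z)" by simp
      then show ?thesis
        using has_derivative_linear[OF has_derivative_slice_space[of pE "frechet_derivative pE (at z)" "fst z" "snd z"]]
          smooth_in_has_derivative[OF smooth_pE that] by simp
    qed
    note s = linear_axis_sum[OF l1, of "V z"] linear_axis_sum[OF this, of "V z"]
    have "(\<Sum>j\<in>UNIV. frechet_derivative (G j) (at z) (0, axis j 1)) =
      \<xi> (snd z) * (pE z * trV z + (\<Sum>j\<in>UNIV. V z $ j * frechet_derivative pE (at z) (0, axis j 1))) +
      pE z * (\<Sum>j\<in>UNIV. V z $ j * frechet_derivative \<xi> (at (snd z)) (axis j 1))"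
      by (simp add: DG[OF that] trV_eq sum.distrib sum_distrib_left inner_axis algebra_simps)
    then show ?thesis by (simp add: s I_def algebra_simps)
  qed
  have sI: "smooth_in N (\<lambda>z. \<theta> (fst z) * (\<Sum>j\<in>UNIV. frechet_derivative (G j) (at z) (0, axis j 1)))"
    by (rule smooth_in_mult[OF frechet_time(1)[OF \<theta>] smooth_in_sum[OF open_N smooth_in_frechet_derivative[OF sG]]])
  have sI': "smooth_in N (\<lambda>z. \<theta> (fst z) * I z)"
    by (rule smooth_in_cong[OF sI]) (simp add: I_eq)
  obtain B where B: "\<And>z. z \<in> {0..T} \<times> closure \<Omega> \<Longrightarrow> norm (\<theta> (fst z) * I z) \<le> B"
    using cylinder_bounded[OF sI'] by metis
  have zero: "(LINT x|lebesgue_on \<Omega>. I (t, x)) = 0" if t: "t \<in> {0<..<T}" for t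
  proof -
    have xN: "(t, x) \<in> N" if "x \<in> \<Omega>" for x
      using N t that closure_subset[of \<Omega>] by (auto intro!: subsetD[OF N])
    \<comment> \<open>Extension by zero moves the integration to the whole space; it is smooth
      because the cutoff vanishes off a compact subset of the domain.\<close>
    define F where "F j x = (if x \<in> \<Omega> then G j (t, x) else 0)" for j x
    have F0: "F j x = 0" if "x \<notin> K" for j x
      using K(3)[of x] that by (auto simp: F_def G_def)
    have "smooth_in \<Omega> (\<lambda>x. G j (t, x))" for j
      by (rule smooth_in_subset[OF smooth_in_slice[OF sG] open_\<Omega>]) (use xN in auto)
    then have "smooth_in \<Omega> (F j)" for j by (rule smooth_in_cong) (simp add: F_def)
    moreover have "smooth_in (- K) (F j)" for j
      by (rule smooth_in_cong[OF smooth_in_const[of _ 0]]) (use F0 K(1) in \<open>auto simp: open_Compl compact_imp_closed\<close>)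
    ultimately have "smooth_in (\<Omega> \<union> - K) (F j)" for j by (intro smooth_in_Un)
    moreover have "\<Omega> \<union> - K = UNIV" using K(2) by auto
    ultimately have sF: "smooth_in UNIV (F j)" for j by simp
    have DF0: "frechet_derivative (F j) (at x) w = 0" if "x \<notin> K" for j x w
      using frechet_derivative_zero_open[of "- K" x "F j"] F0 that K(1) by (simp add: open_Compl compact_imp_closed)
    have DF: "frechet_derivative (F j) (at x) w = frechet_derivative (G j) (at (t, x)) (0, w)" if "x \<in> \<Omega>" for j x w
    proof -
      have "(F j has_derivative (\<lambda>w. frechet_derivative (G j) (at (t, x)) (0, w))) (at x)"
        by (rule has_derivative_transform_within_open[OF has_derivative_slice_space[OF smooth_in_has_derivative[OF sG xN[OF that]]] open_\<Omega> that])
          (simp add: F_def)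
      then show ?thesis by (simp add: frechet_derivative_eqI)
    qed
    have cont: "continuous_on UNIV (\<lambda>x. frechet_derivative (F j) (at x) w)" for j w
      by (rule smooth_in_continuous_on[OF smooth_in_frechet_derivative[OF sF]]) simp
    have int: "integrable lborel (\<lambda>x. frechet_derivative (F j) (at x) w)" for j w
      by (rule integrable_continuous_compact_support[OF cont K(1)]) (rule DF0)
    have int0: "(LINT x|lborel. frechet_derivative (F j) (at x) w) = 0" for j w
      by (rule integral_derivative_compact_support[where F = "F j" and D = "\<lambda>x. frechet_derivative (F j) (at x)",
            OF smooth_in_has_derivative[OF sF UNIV_I] cont K(1) F0])
    have "(LINT x|lebesgue_on \<Omega>. I (t, x)) = (LINT x|lebesgue. indicator \<Omega> x *\<^sub>R I (t, x))"
      using open_\<Omega> by (simp add: integral_restrict_space)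
    also have "\<dots> = (LINT x|lebesgue. (\<Sum>j\<in>UNIV. frechet_derivative (F j) (at x) (axis j 1)))"
    proof (rule Bochner_Integration.integral_cong[OF refl])
      fix x
      show "indicator \<Omega> x *\<^sub>R I (t, x) = (\<Sum>j\<in>UNIV. frechet_derivative (F j) (at x) (axis j 1))"
      proof (cases "x \<in> \<Omega>")
        case True
        then show ?thesis by (simp add: I_eq[OF xN] DF)
      next
        case False
        then have "x \<notin> K" using K(2) by blast
        then show ?thesis using False by (simp add: DF0)
      qed
    qed
    also have "\<dots> = (LINT x|lborel. (\<Sum>j\<in>UNIV. frechet_derivative (F j) (at x) (axis j 1)))"
      by (rule integral_completion) (simp, intro borel_measurable_continuous_onI continuous_on_sum cont)
    also have "\<dots> = (\<Sum>j\<in>UNIV. LINT x|lborel. frechet_derivative (F j) (at x) (axis j 1))"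
      by (rule Bochner_Integration.integral_sum) (rule int)
    finally show ?thesis by (simp add: int0)
  qed
  have "(LINT z|lebesgue_on ({0<..<T} \<times> \<Omega>). \<theta> (fst z) * I z) =
      (LINT t|lebesgue_on {0<..<T}. LINT x|lebesgue_on \<Omega>. \<theta> (fst (t, x)) * I (t, x))"
  proof (rule Fubini_continuous(2))
    show "continuous_on ({0<..<T} \<times> \<Omega>) (\<lambda>z. \<theta> (fst z) * I z)"
      using cylinder_subset N by (intro smooth_in_continuous_on[OF sI']) blast
    show "\<bar>\<theta> (fst z) * I z\<bar> \<le> B" if "z \<in> {0<..<T} \<times> \<Omega>" for z
      using B[of z] that cylinder_subset by auto
  qed (use open_\<Omega> bounded_\<Omega> in auto)
  also have "\<dots> = (LINT t|lebesgue_on {0<..<T}. 0)"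
    by (rule Bochner_Integration.integral_cong[OF refl]) (simp add: zero)
  finally show ?thesis by (simp add: I_def)
qed

end

context ns_flow
begin

lemma Q_point: "z \<in> Q \<Longrightarrow> z \<in> N" "z \<in> Q \<Longrightarrow> fst z \<in> {0<..<T}" "z \<in> Q \<Longrightarrow> snd z \<in> \<Omega>"
  using Q_subset by (auto simp: Q_def)

text \<open>The continuity equation admits test functions up to the boundary, so \<open>fE\<close>
  enters without cutoff. The value at time T drops out with \<open>\<theta>\<close>.\<close>

lemma continuity_identity:
  assumes \<theta>: "smooth_in UNIV \<theta>" "\<theta> 0 = 1" "\<theta> T = 0"
  shows "(LINT z|lebesgue_on Q. frechet_derivative \<theta> (at (fst z)) 1 * (dens z * fE z) +
      \<theta> (fst z) * (dens z * (frechet_derivative fE (at z) (1, 0) + frechet_derivative fE (at z) (0, vel z)))) =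
    - (LINT x|lebesgue_on \<Omega>. \<rho>0 x * fE (0, x))"
proof -
  define \<Phi> where "\<Phi> z = \<theta> (fst z) *\<^sub>R fE z" for z
  have s\<Phi>: "smooth_in N \<Phi>"
    unfolding \<Phi>_def[abs_def] by (rule smooth_in_scaleR[OF frechet_time(1)[OF \<theta>(1)] smooth_fE])
  then have "smooth_on ({0..T} \<times> closure \<Omega>) (\<lambda>(t, x). \<Phi> (t, x))"
    using smooth_in_imp_smooth_on[OF _ N] by simp
  then have "(LINT x|lebesgue_on \<Omega>. \<rho> T x * \<Phi> (T, x)) - (LINT x|lebesgue_on \<Omega>. \<rho>0 x * \<Phi> (0, x)) =
        (LINT (t, x)|lebesgue_on ({0<..<T} \<times> \<Omega>).
           \<rho> t x * vector_derivative (\<lambda>s. \<Phi> (s, x)) (at t) +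
           (\<rho> t x *\<^sub>R u t x) \<bullet> grad (\<lambda>x. \<Phi> (t, x)) x)"
    using sol unfolding finite_energy_weak_solution_def by - (elim conjE, erule allE[of _ "\<lambda>t x. \<Phi> (t, x)"], erule mp)
  moreover have "(LINT (t, x)|lebesgue_on ({0<..<T} \<times> \<Omega>).
           \<rho> t x * vector_derivative (\<lambda>s. \<Phi> (s, x)) (at t) +
           (\<rho> t x *\<^sub>R u t x) \<bullet> grad (\<lambda>x. \<Phi> (t, x)) x) =
      (LINT z|lebesgue_on Q. frechet_derivative \<theta> (at (fst z)) 1 * (dens z * fE z) +
      \<theta> (fst z) * (dens z * (frechet_derivative fE (at z) (1, 0) + frechet_derivative fE (at z) (0, vel z))))"
    unfolding Q_def[symmetric] split_def
  proof (rule Bochner_Integration.integral_cong[OF refl])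
    fix z assume "z \<in> space (lebesgue_on Q)"
    then have z: "z \<in> N" "z = (fst z, snd z)" using Q_point by auto
    have D: "(\<Phi> has_derivative (\<lambda>w. \<theta> (fst z) *\<^sub>R frechet_derivative fE (at z) w +
        (frechet_derivative \<theta> (at (fst z)) 1 * fst w) *\<^sub>R fE z)) (at (fst z, snd z))"
      unfolding \<Phi>_def[abs_def] using has_derivative_time_scaled[OF \<theta>(1) smooth_in_has_derivative[OF smooth_fE z(1)]] by simp
    have a: "vector_derivative (\<lambda>s. \<Phi> (s, snd z)) (at (fst z)) =
        \<theta> (fst z) * frechet_derivative fE (at z) (1, 0) + frechet_derivative \<theta> (at (fst z)) 1 * fE z"
      using vector_derivative_at[OF has_vector_derivative_slice_time[OF D]] by simp
    have d: "((\<lambda>x. \<Phi> (fst z, x)) has_derivative (\<lambda>v. \<theta> (fst z) * frechet_derivative fE (at z) (0, v))) (at (snd z))"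
      using has_derivative_slice_space[OF D] by simp
    have b: "w \<bullet> grad (\<lambda>x. \<Phi> (fst z, x)) (snd z) = \<theta> (fst z) * frechet_derivative fE (at z) (0, w)" for w
    proof -
      have "(\<lambda>x. \<Phi> (fst z, x)) differentiable (at (snd z))" unfolding differentiable_def using d by blast
      from frechet_derivative_eq_grad[OF this, of w] show ?thesis
        by (simp add: frechet_derivative_eqI[OF d] inner_commute)
    qed
    show "\<rho> (fst z) (snd z) * vector_derivative (\<lambda>s. \<Phi> (s, snd z)) (at (fst z)) +
           (\<rho> (fst z) (snd z) *\<^sub>R u (fst z) (snd z)) \<bullet> grad (\<lambda>x. \<Phi> (fst z, x)) (snd z) =
        frechet_derivative \<theta> (at (fst z)) 1 * (dens z * fE z) +
      \<theta> (fst z) * (dens z * (frechet_derivative fE (at z) (1, 0) + frechet_derivative fE (at z) (0, vel z)))"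
      unfolding inner_scaleR_left unfolding a b by (simp add: dens_def vel_def algebra_simps)
  qed
  ultimately show ?thesis using \<theta> by (simp add: \<Phi>_def)
qed

text \<open>The test field must have compact support, whence \<xi> V in place of V. The product rule
  is written out because the terms containing a derivative of the cutoff are estimated
  separately.\<close>

lemma momentum_identity:
  assumes \<theta>: "smooth_in UNIV \<theta>" "\<theta> 0 = 1" "\<theta> T = 0" and \<xi>: "smooth_in UNIV \<xi>"
    and K: "compact K" "K \<subseteq> \<Omega>" "\<And>x. x \<in> \<Omega> - K \<Longrightarrow> \<xi> x = 0"
  shows "(LINT z|lebesgue_on Q. frechet_derivative \<theta> (at (fst z)) 1 * (dens z * (\<xi> (snd z) * (vel z \<bullet> V z))) +
      \<theta> (fst z) * (dens z * (\<xi> (snd z) * (vel z \<bullet> frechet_derivative V (at z) (1, 0))) +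
        dens z * (frechet_derivative \<xi> (at (snd z)) (vel z) * (vel z \<bullet> V z) +
          \<xi> (snd z) * (vel z \<bullet> frechet_derivative V (at z) (0, vel z))) +
        dens z powr \<gamma> * (frechet_derivative \<xi> (at (snd z)) (V z) + \<xi> (snd z) * trV z) -
        \<nu> * (stress \<mu> \<eta> (nab z) \<bullet> matrix (\<lambda>w. \<xi> (snd z) *\<^sub>R frechet_derivative V (at z) (0, w) +
          frechet_derivative \<xi> (at (snd z)) w *\<^sub>R V z)))) =
    - (LINT x|lebesgue_on \<Omega>. \<rho>0 x * (\<xi> x * (u0 x \<bullet> V (0, x))))"
proof -
  define F where "F z = \<xi> (snd z) *\<^sub>R V z" for z
  define \<Phi> where "\<Phi> z = \<theta> (fst z) *\<^sub>R F z" for z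
  have sF: "smooth_in N F"
    unfolding F_def[abs_def] by (rule smooth_in_scaleR[OF frechet_cutoff(1)[OF \<xi>] V])
  have s\<Phi>: "smooth_in N \<Phi>"
    unfolding \<Phi>_def[abs_def] by (rule smooth_in_scaleR[OF frechet_time(1)[OF \<theta>(1)] sF])
  have "test_function ({0..T} \<times> \<Omega>) \<Phi>"
    unfolding test_function_def
  proof (intro conjI exI ballI)
    show "smooth_on ({0..T} \<times> \<Omega>) \<Phi>"
      by (rule smooth_in_imp_smooth_on[OF s\<Phi>]) (use N closure_subset[of \<Omega>] in blast)
    show "compact ({0..T} \<times> K)" using K(1) by (intro compact_Times) auto
    show "{0..T} \<times> K \<subseteq> {0..T} \<times> \<Omega>" using K(2) by auto
    show "\<Phi> z = 0" if "z \<in> {0..T} \<times> \<Omega> - {0..T} \<times> K" for z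
    proof -
      have "snd z \<in> \<Omega> - K" using that by (cases z) auto
      then show ?thesis by (simp add: \<Phi>_def F_def K(3))
    qed
  qed
  then have "test_function ({0..T} \<times> \<Omega>) (\<lambda>(t, x). \<Phi> (t, x))" by simp
  then have "(LINT x|lebesgue_on \<Omega>. (\<rho> T x *\<^sub>R u T x) \<bullet> \<Phi> (T, x)) -
        (LINT x|lebesgue_on \<Omega>. (\<rho>0 x *\<^sub>R u0 x) \<bullet> \<Phi> (0, x)) =
        (LINT (t, x)|lebesgue_on ({0<..<T} \<times> \<Omega>).
           (\<rho> t x *\<^sub>R u t x) \<bullet> vector_derivative (\<lambda>s. \<Phi> (s, x)) (at t) +
           (\<rho> t x *\<^sub>R outer (u t x) (u t x)) \<bullet> jacobian (\<lambda>x. \<Phi> (t, x)) (at x) +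
           pressure \<gamma> (\<rho> t x) * divergence (\<lambda>x. \<Phi> (t, x)) x -
           \<nu> * (stress \<mu> \<eta> (nabla_x T \<Omega> u t x) \<bullet> jacobian (\<lambda>x. \<Phi> (t, x)) (at x)))"
    using sol unfolding finite_energy_weak_solution_def
    by - (elim conjE, rotate_tac -2, erule allE[of _ "\<lambda>t x. \<Phi> (t, x)"], erule mp)
  moreover have "(LINT (t, x)|lebesgue_on ({0<..<T} \<times> \<Omega>).
           (\<rho> t x *\<^sub>R u t x) \<bullet> vector_derivative (\<lambda>s. \<Phi> (s, x)) (at t) +
           (\<rho> t x *\<^sub>R outer (u t x) (u t x)) \<bullet> jacobian (\<lambda>x. \<Phi> (t, x)) (at x) +
           pressure \<gamma> (\<rho> t x) * divergence (\<lambda>x. \<Phi> (t, x)) x -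
           \<nu> * (stress \<mu> \<eta> (nabla_x T \<Omega> u t x) \<bullet> jacobian (\<lambda>x. \<Phi> (t, x)) (at x))) =
     (LINT z|lebesgue_on Q. frechet_derivative \<theta> (at (fst z)) 1 * (dens z * (\<xi> (snd z) * (vel z \<bullet> V z))) +
      \<theta> (fst z) * (dens z * (\<xi> (snd z) * (vel z \<bullet> frechet_derivative V (at z) (1, 0))) +
        dens z * (frechet_derivative \<xi> (at (snd z)) (vel z) * (vel z \<bullet> V z) +
          \<xi> (snd z) * (vel z \<bullet> frechet_derivative V (at z) (0, vel z))) +
        dens z powr \<gamma> * (frechet_derivative \<xi> (at (snd z)) (V z) + \<xi> (snd z) * trV z) -
        \<nu> * (stress \<mu> \<eta> (nab z) \<bullet> matrix (\<lambda>w. \<xi> (snd z) *\<^sub>R frechet_derivative V (at z) (0, w) +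
          frechet_derivative \<xi> (at (snd z)) w *\<^sub>R V z))))"
    unfolding Q_def[symmetric] split_def
  proof (rule Bochner_Integration.integral_cong[OF refl])
    fix z assume "z \<in> space (lebesgue_on Q)"
    then have z: "z \<in> N" "z = (fst z, snd z)" using Q_point by auto
    define A where "A w = \<xi> (snd z) *\<^sub>R frechet_derivative V (at z) (0, w) +
          frechet_derivative \<xi> (at (snd z)) w *\<^sub>R V z" for w
    have l\<xi>: "linear (frechet_derivative \<xi> (at (snd z)))"
      using smooth_in_has_derivative[OF \<xi>] by (blast intro: has_derivative_linear)
    have DF: "(F has_derivative (\<lambda>w. \<xi> (snd z) *\<^sub>R frechet_derivative V (at z) w +
        frechet_derivative \<xi> (at (snd z)) (snd w) *\<^sub>R V z)) (at z)"
      unfolding F_def[abs_def]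
      by (rule has_derivative_scaleR[OF frechet_cutoff(2)[OF \<xi>] smooth_in_has_derivative[OF V z(1)]])
    have D: "(\<Phi> has_derivative (\<lambda>w. \<theta> (fst z) *\<^sub>R (\<xi> (snd z) *\<^sub>R frechet_derivative V (at z) w +
        frechet_derivative \<xi> (at (snd z)) (snd w) *\<^sub>R V z) +
        (frechet_derivative \<theta> (at (fst z)) 1 * fst w) *\<^sub>R F z)) (at (fst z, snd z))"
      unfolding \<Phi>_def[abs_def] using has_derivative_time_scaled[OF \<theta>(1) DF] by simp
    have a: "vector_derivative (\<lambda>s. \<Phi> (s, snd z)) (at (fst z)) =
        \<theta> (fst z) *\<^sub>R (\<xi> (snd z) *\<^sub>R frechet_derivative V (at z) (1, 0)) + frechet_derivative \<theta> (at (fst z)) 1 *\<^sub>R F z"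
      using vector_derivative_at[OF has_vector_derivative_slice_time[OF D]] linear_0[OF l\<xi>] by simp
    have d: "((\<lambda>x. \<Phi> (fst z, x)) has_derivative (\<lambda>w. \<theta> (fst z) *\<^sub>R A w)) (at (snd z))"
      using has_derivative_slice_space[OF D] by (simp add: A_def)
    have dA: "((\<lambda>x. F (fst z, x)) has_derivative A) (at (snd z))"
    proof -
      have "(F has_derivative (\<lambda>w. \<xi> (snd z) *\<^sub>R frechet_derivative V (at z) w +
          frechet_derivative \<xi> (at (snd z)) (snd w) *\<^sub>R V z)) (at (fst z, snd z))"
        using DF by simp
      from has_derivative_slice_space[OF this] show ?thesis by (simp add: A_def[abs_def])
    qed
    have lA: "linear A" by (rule has_derivative_linear[OF dA])
    have J: "jacobian (\<lambda>x. \<Phi> (fst z, x)) (at (snd z)) = \<theta> (fst z) *\<^sub>R matrix A"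
      by (simp add: jacobian_def frechet_derivative_eqI[OF d] matrix_scaleR)
    have lV: "linear (\<lambda>w. frechet_derivative V (at z) (0, w))"
      using has_derivative_linear[OF has_derivative_slice_space[of V "frechet_derivative V (at z)" "fst z" "snd z"]]
        smooth_in_has_derivative[OF V z(1)] by simp
    have trA: "trace (matrix A) = \<xi> (snd z) * trV z + frechet_derivative \<xi> (at (snd z)) (V z)"
      unfolding A_def[abs_def] trV_def by (rule trace_matrix_scaleR_add[OF l\<xi>])
    have div: "divergence (\<lambda>x. \<Phi> (fst z, x)) (snd z) =
        \<theta> (fst z) * (frechet_derivative \<xi> (at (snd z)) (V z) + \<xi> (snd z) * trV z)"
      unfolding divergence_def J using trA by (simp add: trace_def sum_distrib_left[symmetric])
    have o: "outer a b \<bullet> matrix A = a \<bullet> A b" for a b by (rule outer_inner_matrix[OF lA])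
    have Ab: "a \<bullet> A b = frechet_derivative \<xi> (at (snd z)) b * (a \<bullet> V z) +
        \<xi> (snd z) * (a \<bullet> frechet_derivative V (at z) (0, b))" for a b
      by (simp add: A_def inner_add_right)
    have aF: "a \<bullet> F z = \<xi> (snd z) * (a \<bullet> V z)" for a by (simp add: F_def)
    show "(\<rho> (fst z) (snd z) *\<^sub>R u (fst z) (snd z)) \<bullet> vector_derivative (\<lambda>s. \<Phi> (s, snd z)) (at (fst z)) +
           (\<rho> (fst z) (snd z) *\<^sub>R outer (u (fst z) (snd z)) (u (fst z) (snd z))) \<bullet> jacobian (\<lambda>x. \<Phi> (fst z, x)) (at (snd z)) +
           pressure \<gamma> (\<rho> (fst z) (snd z)) * divergence (\<lambda>x. \<Phi> (fst z, x)) (snd z) -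
           \<nu> * (stress \<mu> \<eta> (nabla_x T \<Omega> u (fst z) (snd z)) \<bullet> jacobian (\<lambda>x. \<Phi> (fst z, x)) (at (snd z))) =
        frechet_derivative \<theta> (at (fst z)) 1 * (dens z * (\<xi> (snd z) * (vel z \<bullet> V z))) +
      \<theta> (fst z) * (dens z * (\<xi> (snd z) * (vel z \<bullet> frechet_derivative V (at z) (1, 0))) +
        dens z * (frechet_derivative \<xi> (at (snd z)) (vel z) * (vel z \<bullet> V z) +
          \<xi> (snd z) * (vel z \<bullet> frechet_derivative V (at z) (0, vel z))) +
        dens z powr \<gamma> * (frechet_derivative \<xi> (at (snd z)) (V z) + \<xi> (snd z) * trV z) -
        \<nu> * (stress \<mu> \<eta> (nab z) \<bullet> matrix (\<lambda>w. \<xi> (snd z) *\<^sub>R frechet_derivative V (at z) (0, w) +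
          frechet_derivative \<xi> (at (snd z)) w *\<^sub>R V z)))"
      unfolding A_def[abs_def, symmetric] dens_def[symmetric] vel_def[symmetric] nab_def[symmetric] pressure_def
        a J div inner_scaleR_left inner_scaleR_right inner_add_right o Ab aF
      by (simp add: algebra_simps)
  qed
  moreover have "(LINT x|lebesgue_on \<Omega>. (\<rho> T x *\<^sub>R u T x) \<bullet> \<Phi> (T, x)) -
        (LINT x|lebesgue_on \<Omega>. (\<rho>0 x *\<^sub>R u0 x) \<bullet> \<Phi> (0, x)) =
      - (LINT x|lebesgue_on \<Omega>. \<rho>0 x * (\<xi> x * (u0 x \<bullet> V (0, x))))"
    using \<theta> by (simp add: \<Phi>_def F_def mult.left_commute)
  ultimately show ?thesis by metis
qed

end

section \<open>The integrand of the relative energy balance\<close>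

lemma balance_sum_le:
  fixes a b p x :: real
  assumes "0 \<le> b" "0 \<le> a" "0 \<le> p" "0 \<le> x"
  shows "b * a + 2 * (b * (a + x)) + b + b * x + b * x + b * p + b + 2 * b \<le> 10 * b * (a + p + x + 1)"
  using assms mult_nonneg_nonneg[of b a] mult_nonneg_nonneg[of b p] mult_nonneg_nonneg[of b x]
  by (simp add: algebra_simps)

context euler_flow
begin

lemma coefficient_bounds:
  obtains B where "1 \<le> B"
    "\<And>z. z \<in> {0..T} \<times> closure \<Omega> \<Longrightarrow> norm (V z) \<le> B"
    "\<And>z. z \<in> {0..T} \<times> closure \<Omega> \<Longrightarrow> \<bar>pE z\<bar> \<le> B"
    "\<And>z. z \<in> {0..T} \<times> closure \<Omega> \<Longrightarrow> \<bar>fE z\<bar> \<le> B"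
    "\<And>z. z \<in> {0..T} \<times> closure \<Omega> \<Longrightarrow> \<bar>trV z\<bar> \<le> B"
    "\<And>z w. z \<in> {0..T} \<times> closure \<Omega> \<Longrightarrow> norm (frechet_derivative V (at z) w) \<le> B * norm w"
    "\<And>z w. z \<in> {0..T} \<times> closure \<Omega> \<Longrightarrow> \<bar>frechet_derivative pE (at z) w\<bar> \<le> B * norm w"
    "\<And>z w. z \<in> {0..T} \<times> closure \<Omega> \<Longrightarrow> \<bar>frechet_derivative fE (at z) w\<bar> \<le> B * norm w"
proof -
  obtain b1 where b1: "0 \<le> b1" "\<And>z. z \<in> {0..T} \<times> closure \<Omega> \<Longrightarrow> norm (V z) \<le> b1"
    using cylinder_bounded[OF V] by metis
  obtain b2 where b2: "0 \<le> b2" "\<And>z. z \<in> {0..T} \<times> closure \<Omega> \<Longrightarrow> norm (pE z) \<le> b2"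
    using cylinder_bounded[OF smooth_pE] by metis
  obtain b3 where b3: "0 \<le> b3" "\<And>z. z \<in> {0..T} \<times> closure \<Omega> \<Longrightarrow> norm (fE z) \<le> b3"
    using cylinder_bounded[OF smooth_fE] by metis
  obtain b4 where b4: "0 \<le> b4" "\<And>z. z \<in> {0..T} \<times> closure \<Omega> \<Longrightarrow> norm (trV z) \<le> b4"
    using cylinder_bounded[OF smooth_trV] by metis
  obtain b5 where b5: "0 \<le> b5" "\<And>z w. z \<in> {0..T} \<times> closure \<Omega> \<Longrightarrow> norm (frechet_derivative V (at z) w) \<le> b5 * norm w"
    using smooth_in_derivative_bounded[OF V compact_cylinder N] by metis
  obtain b6 where b6: "0 \<le> b6" "\<And>z w. z \<in> {0..T} \<times> closure \<Omega> \<Longrightarrow> norm (frechet_derivative pE (at z) w) \<le> b6 * norm w"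
    using smooth_in_derivative_bounded[OF smooth_pE compact_cylinder N] by metis
  obtain b7 where b7: "0 \<le> b7" "\<And>z w. z \<in> {0..T} \<times> closure \<Omega> \<Longrightarrow> norm (frechet_derivative fE (at z) w) \<le> b7 * norm w"
    using smooth_in_derivative_bounded[OF smooth_fE compact_cylinder N] by metis
  define B where "B = 1 + b1 + b2 + b3 + b4 + b5 + b6 + b7"
  have B: "1 \<le> B" "b1 \<le> B" "b2 \<le> B" "b3 \<le> B" "b4 \<le> B" "b5 \<le> B" "b6 \<le> B" "b7 \<le> B"
    using b1(1) b2(1) b3(1) b4(1) b5(1) b6(1) b7(1) by (auto simp: B_def)
  note mono = mult_right_mono[OF _ norm_ge_zero]
  show thesis
  proof (rule that[OF B(1)])
    fix z w assume z: "z \<in> {0..T} \<times> closure \<Omega>"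
    show "norm (V z) \<le> B" using b1(2)[OF z] B by linarith
    show "\<bar>pE z\<bar> \<le> B" using b2(2)[OF z] B by simp
    show "\<bar>fE z\<bar> \<le> B" using b3(2)[OF z] B by simp
    show "\<bar>trV z\<bar> \<le> B" using b4(2)[OF z] B by simp
    show "norm (frechet_derivative V (at z) w) \<le> B * norm w" using b5(2)[OF z, of w] mono[OF B(6), of w] by linarith
    show "\<bar>frechet_derivative pE (at z) w\<bar> \<le> B * norm w" using b6(2)[OF z, of w] mono[OF B(7), of w] by simp
    show "\<bar>frechet_derivative fE (at z) w\<bar> \<le> B * norm w" using b7(2)[OF z, of w] mono[OF B(8), of w] by simp
  qed
qed

text \<open>The spatial integrand of the relative energy balance, for density \<open>a\<close>, velocity \<open>w\<close>, cutoff
  value \<open>s\<close> and directional derivatives \<open>dw\<close>, \<open>dV\<close> of the cutoff along \<open>w\<close> and \<open>V z\<close>.\<close>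

definition balance :: "real \<times> (real^3) \<Rightarrow> real \<Rightarrow> real^3 \<Rightarrow> real \<Rightarrow> real \<Rightarrow> real \<Rightarrow> real" where
  "balance z a w s dw dV =
     a * (frechet_derivative fE (at z) (1, 0) + frechet_derivative fE (at z) (0, w)) +
     frechet_derivative pE (at z) (1, 0) -
     a * (s * (w \<bullet> frechet_derivative V (at z) (1, 0))) -
     a * (dw * (w \<bullet> V z) + s * (w \<bullet> frechet_derivative V (at z) (0, w))) -
     a powr \<gamma> * (dV + s * trV z) +
     (dV * pE z + s * (frechet_derivative pE (at z) (0, V z) + pE z * trV z))"

text \<open>Where the cutoff is one, the Euler equations cancel everything of first order in the
  deviation. What remains is quadratic in w - V and, from the pressure, the relative pressure
  (\<gamma> - 1) \<open>rel_H\<close>. Both are controlled by the relative energy, as Gronwall's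
  argument needs.\<close>

lemma balance_interior:
  assumes z: "z \<in> {0<..<T} \<times> \<Omega>" and a: "0 \<le> a"
  shows "balance z a w 1 0 0 =
    - a * ((w - V z) \<bullet> frechet_derivative V (at z) (0, w - V z)) - (\<gamma> - 1) * rel_H \<gamma> a (R z) * trV z"
proof -
  have zN: "z \<in> N" using z cylinder_subset N by blast
  obtain t x where tx: "z = (t, x)" "t \<in> {0<..<T}" "x \<in> \<Omega>" using z by auto
  \<comment> \<open>All powers of \<open>R\<close> become polynomials in \<open>R\<close> times
    \<open>q\<close>, so that the final cancellation is polynomial algebra.\<close>
  define q where "q = R z powr (\<gamma> - 2)"
  have r: "0 < R z" using Rpos[OF zN] .
  have P1: "R z powr (\<gamma> - 1) = q * R z" and P: "R z powr \<gamma> = q * R z * R z"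
    using r by (simp_all add: q_def powr_diff power2_eq_square powr_numeral)
  define Vx where "Vx w = frechet_derivative V (at z) (0, w)" for w
  have lin: "linear (frechet_derivative V (at z))" "linear (frechet_derivative R (at z))"
    using smooth_in_has_derivative[OF V zN] smooth_in_has_derivative[OF R zN] by (blast intro: has_derivative_linear)+
  have Vx_diff: "Vx (w - V z) = Vx w - Vx (V z)"
    using linear_diff[OF lin(1), of "(0, w)" "(0, V z)"] by (simp add: Vx_def)
  define Rx where "Rx w = frechet_derivative R (at z) (0, w)" for w
  have Rx_diff: "Rx (V z - w) = Rx (V z) - Rx w"
    using linear_diff[OF lin(2), of "(0, V z)" "(0, w)"] by (simp add: Rx_def)
  define Rt where "Rt = frechet_derivative R (at z) (1, 0)"
  define Vt where "Vt = frechet_derivative V (at z) (1, 0)"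
  have mass': "Rt = - Rx (V z) - R z * trV z"
    using mass[OF tx(2,3)] by (simp add: tx(1)[symmetric] Rt_def Rx_def trV_def)
  \<comment> \<open>The momentum equation in direction V - w carries the factor R > 0, which is
    divided out next.\<close>
  have "R z * ((Vt + Vx (V z)) \<bullet> (V z - w)) + \<gamma> * (q * R z) * (Rx (V z) - Rx w) = 0"
    using momentum[OF tx(2,3), of "V z - w"]
    by (simp add: tx(1)[symmetric] Rx_diff[unfolded Rx_def] Vt_def Vx_def Rx_def P1)
  then have "R z * ((Vt + Vx (V z)) \<bullet> (V z - w) + \<gamma> * q * (Rx (V z) - Rx w)) = 0"
    by (simp add: algebra_simps)
  then have "(Vt + Vx (V z)) \<bullet> (V z - w) + \<gamma> * q * (Rx (V z) - Rx w) = 0" using r by simp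
  then have mom': "V z \<bullet> Vt = w \<bullet> Vt - V z \<bullet> Vx (V z) + w \<bullet> Vx (V z) - \<gamma> * q * (Rx (V z) - Rx w)"
    by (simp add: inner_add_left inner_diff_right inner_commute[of Vt "V z"] inner_commute[of Vt w]
        inner_commute[of "Vx (V z)" "V z"] inner_commute[of "Vx (V z)" w])
  have H: "(\<gamma> - 1) * rel_H \<gamma> a (R z) = a powr \<gamma> - \<gamma> * (q * R z) * a + (\<gamma> - 1) * (q * R z * R z)"
    unfolding rel_H_mult[OF \<gamma>] P1 P ..
  have "balance z a w 1 0 0 = a * ((V z \<bullet> Vt - \<gamma> * q * Rt) + (V z \<bullet> Vx w - \<gamma> * q * Rx w)) +
     \<gamma> * (q * R z) * Rt - a * (w \<bullet> Vt) - a * (w \<bullet> Vx w) - a powr \<gamma> * trV z +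
     (\<gamma> * (q * R z) * Rx (V z) + q * R z * R z * trV z)"
    unfolding balance_def frechet_fE[OF zN] frechet_pE[OF zN] pE_def P1 P
    by (simp add: Vt_def Vx_def Rt_def Rx_def q_def)
  also have "\<dots> = - a * ((w - V z) \<bullet> Vx (w - V z)) - (\<gamma> - 1) * rel_H \<gamma> a (R z) * trV z"
    unfolding H Vx_diff mom' mass' inner_diff_left inner_diff_right by (simp add: algebra_simps)
  finally show ?thesis by (simp add: Vx_def)
qed

text \<open>Two bounds of different quality. The first has no constant term, so Gronwall's argument
  can absorb it. The second is crude and meant for the layer, where volume and kinetic energy over
  \<delta> become small after integration. The constant is independent of \<delta> because the
  derivative of the cutoff along \<open>V\<close>, which multiplies the pressure, is bounded by
  \<open>c\<close> and not merely by c/\<delta>.\<close>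

lemma balance_bounds:
  assumes c: "0 \<le> c"
  obtains C where "0 < C"
    "\<And>z a w. z \<in> {0<..<T} \<times> \<Omega> \<Longrightarrow> 0 \<le> a \<Longrightarrow> balance z a w 1 0 0 \<le> C * rel_density \<gamma> a w (R z) (V z)"
    "\<And>z a w s dw dV \<delta>. z \<in> {0<..<T} \<times> \<Omega> \<Longrightarrow> 0 \<le> a \<Longrightarrow> 0 \<le> s \<Longrightarrow> s \<le> 1 \<Longrightarrow> 0 < \<delta> \<Longrightarrow> \<delta> \<le> 1 \<Longrightarrow>
      \<bar>dw\<bar> \<le> c / \<delta> * norm w \<Longrightarrow> \<bar>dV\<bar> \<le> c \<Longrightarrow>
      balance z a w s dw dV \<le> C * (1 + rel_density \<gamma> a w (R z) (V z) + a * (norm w)\<^sup>2 / \<delta>)"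
proof -
  obtain B where B: "1 \<le> B"
    "\<And>z. z \<in> {0..T} \<times> closure \<Omega> \<Longrightarrow> norm (V z) \<le> B"
    "\<And>z. z \<in> {0..T} \<times> closure \<Omega> \<Longrightarrow> \<bar>pE z\<bar> \<le> B"
    "\<And>z. z \<in> {0..T} \<times> closure \<Omega> \<Longrightarrow> \<bar>fE z\<bar> \<le> B"
    "\<And>z. z \<in> {0..T} \<times> closure \<Omega> \<Longrightarrow> \<bar>trV z\<bar> \<le> B"
    "\<And>z w. z \<in> {0..T} \<times> closure \<Omega> \<Longrightarrow> norm (frechet_derivative V (at z) w) \<le> B * norm w"
    "\<And>z w. z \<in> {0..T} \<times> closure \<Omega> \<Longrightarrow> \<bar>frechet_derivative pE (at z) w\<bar> \<le> B * norm w"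
    "\<And>z w. z \<in> {0..T} \<times> closure \<Omega> \<Longrightarrow> \<bar>frechet_derivative fE (at z) w\<bar> \<le> B * norm w"
    using coefficient_bounds by blast
  have M0: "0 < M" using m mM by linarith
  obtain P where P: "1 \<le> P" "\<And>a r. 0 \<le> a \<Longrightarrow> 0 \<le> r \<Longrightarrow> r \<le> M \<Longrightarrow> a powr \<gamma> \<le> P * (1 + rel_H \<gamma> a r)"
    using powr_le_rel_H[OF \<gamma> M0] by metis
  define C1 where "C1 = 2 * B + (\<gamma> - 1) * B"
  define K where "K = 10 * B * B * (1 + c)"
  define C where "C = C1 + 4 * K * P"
  have K: "0 \<le> K" "1 \<le> K" using B(1) c mult_mono[of 1 "10 * B" 1 "B * (1 + c)"] mult_mono[of 1 B 1 "1 + c"]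
    by (auto simp: K_def mult.assoc)
  have C1: "0 < C1" using B(1) \<gamma> by (simp add: C1_def add_pos_nonneg)
  have KP: "0 \<le> K * P" using K P by simp
  have C: "0 < C" "C1 \<le> C" "4 * K * P \<le> C" using C1 KP by (auto simp: C_def)
  show thesis
  proof (rule that[OF C(1)])
    fix z a w assume z: "z \<in> {0<..<T} \<times> \<Omega>" and a: "(0::real) \<le> a"
    have zK: "z \<in> {0..T} \<times> closure \<Omega>" using z cylinder_subset by blast
    have r: "0 \<le> R z" "R z \<le> M" using Rm[OF zK] RM[OF zK] m by linarith+
    note H0 = rel_H_nonneg[OF \<gamma> r(1) a]
    note D0 = rel_density_nonneg[OF \<gamma> a r(1), of w "V z"]
    show "balance z a w 1 0 0 \<le> C * rel_density \<gamma> a w (R z) (V z)"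
    proof -
      have "\<bar>(w - V z) \<bullet> frechet_derivative V (at z) (0, w - V z)\<bar> \<le> norm (w - V z) * (B * norm (w - V z))"
        using Cauchy_Schwarz_ineq2[of "w - V z" "frechet_derivative V (at z) (0, w - V z)"]
          mult_left_mono[OF B(6)[OF zK, of "(0, w - V z)"], of "norm (w - V z)"] by (simp add: norm_Pair)
      then have "- a * ((w - V z) \<bullet> frechet_derivative V (at z) (0, w - V z)) \<le> a * (norm (w - V z) * (B * norm (w - V z)))"
        using mult_left_mono[of "- ((w - V z) \<bullet> frechet_derivative V (at z) (0, w - V z))" _ a] a by simp
      also have "\<dots> = 2 * B * (1/2 * a * (norm (w - V z))\<^sup>2)" by (simp add: power2_eq_square)
      also have "\<dots> \<le> C1 * (1/2 * a * (norm (w - V z))\<^sup>2)"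
        using a \<gamma> B(1) by (intro mult_right_mono) (auto simp: C1_def)
      finally have 1: "- a * ((w - V z) \<bullet> frechet_derivative V (at z) (0, w - V z)) \<le> C1 * (1/2 * a * (norm (w - V z))\<^sup>2)" .
      have "- ((\<gamma> - 1) * rel_H \<gamma> a (R z) * trV z) \<le> (\<gamma> - 1) * rel_H \<gamma> a (R z) * B"
        using mult_left_mono[of "- trV z" B "(\<gamma> - 1) * rel_H \<gamma> a (R z)"] B(5)[OF zK] H0 \<gamma> by simp
      also have "\<dots> \<le> C1 * rel_H \<gamma> a (R z)"
        using H0 B(1) by (simp add: C1_def algebra_simps)
      finally have "balance z a w 1 0 0 \<le> C1 * rel_density \<gamma> a w (R z) (V z)"
        unfolding balance_interior[OF z a] using 1 by (simp add: rel_density_def algebra_simps)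
      also have "\<dots> \<le> C * rel_density \<gamma> a w (R z) (V z)" using C D0 by (intro mult_right_mono)
      finally show ?thesis .
    qed
    fix s dw dV \<delta> :: real
    assume s: "0 \<le> s" "s \<le> 1" and \<delta>: "0 < \<delta>" "\<delta> \<le> 1" and dw: "\<bar>dw\<bar> \<le> c / \<delta> * norm w" and dV: "\<bar>dV\<bar> \<le> c"
    define n where "n = norm w"
    have n0: "0 \<le> n" by (simp add: n_def)
    have n2: "n \<le> 1 + n\<^sup>2" using n0 zero_le_power2[of "n - 1"] by (simp add: power2_eq_square algebra_simps)
    \<comment> \<open>Since \<delta> is at most one, plain quadratic terms are absorbed in those
      divided by \<delta>.\<close>
    have nd: "n\<^sup>2 \<le> n\<^sup>2 / \<delta>" using \<delta> mult_left_mono[of 1 "1 / \<delta>" "n\<^sup>2"] by simp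
    have sB: "\<bar>s * x\<bar> \<le> b" if "\<bar>x\<bar> \<le> b" for x b
      using s that mult_mono[of s 1 "\<bar>x\<bar>" b] by (simp add: abs_mult)
    have f1: "\<bar>frechet_derivative fE (at z) (1, 0) + frechet_derivative fE (at z) (0, w)\<bar> \<le> B + B * n"
      using B(8)[OF zK, of "(1, 0)"] B(8)[OF zK, of "(0, w)"] by (simp add: norm_Pair n_def)
    have f2: "\<bar>frechet_derivative pE (at z) (1, 0)\<bar> \<le> B"
      using B(7)[OF zK, of "(1, 0)"] by (simp add: norm_Pair)
    have f3: "\<bar>s * (w \<bullet> frechet_derivative V (at z) (1, 0))\<bar> \<le> B * n"
      using Cauchy_Schwarz_ineq2[of w "frechet_derivative V (at z) (1, 0)"]
        mult_left_mono[OF B(6)[OF zK, of "(1, 0)"], of n] n0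
      by (intro sB) (simp add: norm_Pair n_def mult.commute)
    have f4: "\<bar>s * (w \<bullet> frechet_derivative V (at z) (0, w))\<bar> \<le> B * n\<^sup>2"
      using Cauchy_Schwarz_ineq2[of w "frechet_derivative V (at z) (0, w)"]
        mult_left_mono[OF B(6)[OF zK, of "(0, w)"], of n] n0
      by (intro sB) (simp add: norm_Pair n_def mult_ac power2_eq_square)
    have f5: "\<bar>dw * (w \<bullet> V z)\<bar> \<le> c * B * (n\<^sup>2 / \<delta>)"
    proof -
      have "\<bar>w \<bullet> V z\<bar> \<le> n * B"
        using Cauchy_Schwarz_ineq2[of w "V z"] mult_left_mono[OF B(2)[OF zK], of n] n0 by (simp add: n_def)
      then have "\<bar>dw\<bar> * \<bar>w \<bullet> V z\<bar> \<le> (c / \<delta> * n) * (n * B)"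
        using dw c \<delta> n0 by (intro mult_mono) (auto simp: n_def)
      then show ?thesis by (simp add: abs_mult power2_eq_square mult_ac)
    qed
    have f6: "\<bar>dV + s * trV z\<bar> \<le> c + B" using dV sB[OF B(5)[OF zK]] by linarith
    have f7: "\<bar>dV * pE z\<bar> \<le> c * B" using mult_mono[OF dV B(3)[OF zK] c] by (simp add: abs_mult)
    have f8: "\<bar>s * (frechet_derivative pE (at z) (0, V z) + pE z * trV z)\<bar> \<le> B * B + B * B"
    proof (rule sB)
      have "\<bar>frechet_derivative pE (at z) (0, V z)\<bar> \<le> B * B"
      proof -
        have "B * norm (V z) \<le> B * B" using B(1) by (intro mult_left_mono B(2)[OF zK]) simp
        then show ?thesis using B(7)[OF zK, of "(0, V z)"] by (simp add: norm_Pair)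
      qed
      moreover have "\<bar>pE z * trV z\<bar> \<le> B * B"
        using mult_mono[OF B(3)[OF zK] B(5)[OF zK]] B(1) by (simp add: abs_mult)
      ultimately show "\<bar>frechet_derivative pE (at z) (0, V z) + pE z * trV z\<bar> \<le> B * B + B * B" by linarith
    qed
    have am: "\<bar>a * x\<bar> \<le> a * b" if "\<bar>x\<bar> \<le> b" for x b
      using that a by (simp add: abs_mult mult_left_mono)
    have pm: "\<bar>a powr \<gamma> * x\<bar> \<le> a powr \<gamma> * b" if "\<bar>x\<bar> \<le> b" for x b
      using that by (simp add: abs_mult mult_left_mono)
    have "balance z a w s dw dV \<le> a * (B + B * n) + B + a * (B * n) + a * (c * B * (n\<^sup>2 / \<delta>) + B * n\<^sup>2) +
        a powr \<gamma> * (c + B) + (c * B + (B * B + B * B))"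
      unfolding balance_def
      using am[OF f1] f2 am[OF f3] am[OF order_trans[OF abs_triangle_ineq add_mono[OF f5 f4]]] pm[OF f6] f7 f8
      by linarith
    also have "\<dots> \<le> K * (a + a powr \<gamma> + a * (n\<^sup>2 / \<delta>) + 1)"
    proof -
      \<comment> \<open>A common bound for all coefficients that occur, as \<open>B\<close> is at
        least one.\<close>
      define b where "b = B * B * (1 + c)"
      have b: "B \<le> b" "c * B \<le> b" "c + B \<le> b" "B * B \<le> b"
      proof -
        have BB1: "B \<le> B * B" using B(1) mult_left_mono[of 1 B B] by simp
        then have BB: "B \<le> B * B" "1 \<le> B * B" using B(1) by linarith+
        have e: "b = B * B + c * (B * B)" by (simp add: b_def algebra_simps)
        have cB: "c * 1 \<le> c * (B * B)" "c * B \<le> c * (B * B)" by (rule mult_left_mono[OF _ c], use BB in simp)+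
        show "B \<le> b" "c * B \<le> b" "c + B \<le> b" "B * B \<le> b"
          unfolding e using BB cB c by linarith+
      qed
      have b0: "0 \<le> b" using b B(1) by linarith
      have X: "0 \<le> a * (n\<^sup>2 / \<delta>)" "0 \<le> a powr \<gamma>" using a \<delta> by auto
      have an: "a * n \<le> a + a * (n\<^sup>2 / \<delta>)"
        using mult_left_mono[OF order_trans[OF n2 add_left_mono[OF nd, of 1]] a] by (simp add: algebra_simps)
      have an2: "a * n\<^sup>2 \<le> a * (n\<^sup>2 / \<delta>)" by (rule mult_left_mono[OF nd a])
      have an0: "0 \<le> a * n" using a n0 by simp
      have "a * (B + B * n) + B + a * (B * n) + a * (c * B * (n\<^sup>2 / \<delta>) + B * n\<^sup>2) +
          a powr \<gamma> * (c + B) + (c * B + (B * B + B * B)) =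
        B * a + 2 * (B * (a * n)) + B + c * B * (a * (n\<^sup>2 / \<delta>)) + B * (a * n\<^sup>2) + (c + B) * a powr \<gamma> + c * B + 2 * (B * B)"
        by (simp add: algebra_simps)
      also have "\<dots> \<le> b * a + 2 * (b * (a + a * (n\<^sup>2 / \<delta>))) + b + b * (a * (n\<^sup>2 / \<delta>)) + b * (a * (n\<^sup>2 / \<delta>)) + b * a powr \<gamma> + b + 2 * b"
      proof -
        have "B * a \<le> b * a" "c * B * (a * (n\<^sup>2 / \<delta>)) \<le> b * (a * (n\<^sup>2 / \<delta>))" "(c + B) * a powr \<gamma> \<le> b * a powr \<gamma>"
          using b X a by (simp_all only: mult_right_mono)
        moreover have "B * (a * n) \<le> b * (a + a * (n\<^sup>2 / \<delta>))" by (rule mult_mono[OF b(1) an b0 an0])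
        moreover have "B * (a * n\<^sup>2) \<le> b * (a * (n\<^sup>2 / \<delta>))" by (rule mult_mono[OF b(1) an2 b0]) (use a in simp)
        ultimately show ?thesis using b(1,2,4) by linarith
      qed
      also have "\<dots> \<le> 10 * b * (a + a powr \<gamma> + a * (n\<^sup>2 / \<delta>) + 1)"
        by (rule balance_sum_le[OF b0 a X(2,1)])
      finally show ?thesis by (simp add: K_def b_def mult.assoc)
    qed
    also have "\<dots> \<le> K * (2 + 2 * (P * (1 + rel_H \<gamma> a (R z))) + a * (n\<^sup>2 / \<delta>))"
    proof (rule mult_left_mono[OF _ K(1)])
      have "a \<le> 1 + a powr \<gamma>" using le_small_powr[OF \<gamma> zero_less_one a] by simp
      then show "a + a powr \<gamma> + a * (n\<^sup>2 / \<delta>) + 1 \<le> 2 + 2 * (P * (1 + rel_H \<gamma> a (R z))) + a * (n\<^sup>2 / \<delta>)"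
        using P(2)[OF a r] by simp
    qed
    also have "\<dots> \<le> K * (4 * P * (1 + rel_density \<gamma> a w (R z) (V z) + a * (n\<^sup>2 / \<delta>)))"
    proof (rule mult_left_mono[OF _ K(1)])
      have e: "0 \<le> a * (n\<^sup>2 / \<delta>)" using a \<delta> by simp
      have "rel_H \<gamma> a (R z) \<le> rel_density \<gamma> a w (R z) (V z)" using a by (simp add: rel_density_def)
      then have "P * (1 + rel_H \<gamma> a (R z)) \<le> P * (1 + rel_density \<gamma> a w (R z) (V z))"
        using P(1) by (intro mult_left_mono) auto
      moreover have "1 * (a * (n\<^sup>2 / \<delta>)) \<le> 4 * P * (a * (n\<^sup>2 / \<delta>))" using P(1) e by (intro mult_right_mono) auto
      moreover have "1 * 1 \<le> P * (1 + rel_density \<gamma> a w (R z) (V z))" using P(1) D0 by (intro mult_mono) auto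
      ultimately show "2 + 2 * (P * (1 + rel_H \<gamma> a (R z))) + a * (n\<^sup>2 / \<delta>) \<le>
          4 * P * (1 + rel_density \<gamma> a w (R z) (V z) + a * (n\<^sup>2 / \<delta>))"
        by (simp add: algebra_simps)
    qed
    also have "\<dots> = 4 * K * P * (1 + rel_density \<gamma> a w (R z) (V z) + a * n\<^sup>2 / \<delta>)" by simp
    also have "\<dots> \<le> C * (1 + rel_density \<gamma> a w (R z) (V z) + a * n\<^sup>2 / \<delta>)"
      using C(3) D0 a \<delta> by (intro mult_right_mono) auto
    finally show "balance z a w s dw dV \<le> C * (1 + rel_density \<gamma> a w (R z) (V z) + a * (norm w)\<^sup>2 / \<delta>)"
      by (simp add: n_def)
  qed
qed

end

section \<open>Lower semicontinuity of the relative energy in time\<close>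

context ns_flow
begin

definition rel_E :: "real \<Rightarrow> real" where
  "rel_E t = (LINT x|lebesgue_on \<Omega>. rel_density \<gamma> (\<rho> t x) (u t x) (R (t, x)) (V (t, x)))"

lemma const_continuous_kin: "continuous_on {0..T} (\<lambda>t. LINT x|lebesgue_on \<Omega>. \<rho> t x * (norm (u t x))\<^sup>2)"
  using weakly_continuous_Lp_inner[OF weakly_continuous_kin _ \<Omega>_lmeasurable, of "\<lambda>_. 1" 1] by simp

lemma const_continuous_mass: "continuous_on {0..T} (\<lambda>t. LINT x|lebesgue_on \<Omega>. \<rho> t x)"
  using weakly_continuous_Lp_inner[OF weakly_continuous_dens _ \<Omega>_lmeasurable, of "\<lambda>_. 1" 1] \<gamma> by simp

lemma integral_norm_dens:
  assumes "t \<in> {0..T}" shows "(LINT x|lebesgue_on \<Omega>. norm (\<rho> t x)) = (LINT x|lebesgue_on \<Omega>. \<rho> t x)"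
proof (rule integral_cong_AE)
  have "\<rho> t \<in> borel_measurable (lebesgue_on \<Omega>)"
    using slice_integrable(1)[OF assms] by (rule borel_measurable_integrable)
  then show "(\<lambda>x. norm (\<rho> t x)) \<in> borel_measurable (lebesgue_on \<Omega>)" "\<rho> t \<in> borel_measurable (lebesgue_on \<Omega>)"
    by auto
  show "AE x in lebesgue_on \<Omega>. norm (\<rho> t x) = \<rho> t x"
    using slice_nonneg[OF assms] by eventually_elim simp
qed

text \<open>A bound at every time, where the energy inequality offers almost every time. Weak
  continuity tested with the constant one makes mass and kinetic energy continuous on a compact
  interval, and the momentum follows from |w| \<le> 1 + |w|^2.\<close>

lemma mass_momentum_bounded:
  obtains K where "\<And>t. t \<in> {0..T} \<Longrightarrow> (LINT x|lebesgue_on \<Omega>. norm (\<rho> t x)) \<le> K"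
    "\<And>t. t \<in> {0..T} \<Longrightarrow> (LINT x|lebesgue_on \<Omega>. norm (\<rho> t x *\<^sub>R u t x)) \<le> K"
proof -
  have comp: "compact {0..T}" "{0..T} \<noteq> {}" using T by auto
  obtain s where s: "\<And>t. t \<in> {0..T} \<Longrightarrow> (LINT x|lebesgue_on \<Omega>. \<rho> t x) \<le> (LINT x|lebesgue_on \<Omega>. \<rho> s x)"
    using continuous_attains_sup[OF comp const_continuous_mass] by blast
  obtain s' where s': "\<And>t. t \<in> {0..T} \<Longrightarrow> (LINT x|lebesgue_on \<Omega>. \<rho> t x * (norm (u t x))\<^sup>2) \<le> (LINT x|lebesgue_on \<Omega>. \<rho> s' x * (norm (u s' x))\<^sup>2)"
    using continuous_attains_sup[OF comp const_continuous_kin] by blast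
  define A where "A = (LINT x|lebesgue_on \<Omega>. \<rho> s x)"
  define A' where "A' = (LINT x|lebesgue_on \<Omega>. \<rho> s' x * (norm (u s' x))\<^sup>2)"
  show thesis
  proof (rule that[of "\<bar>A\<bar> + \<bar>A'\<bar>"])
    fix t assume t: "t \<in> {0..T}"
    show "(LINT x|lebesgue_on \<Omega>. norm (\<rho> t x)) \<le> \<bar>A\<bar> + \<bar>A'\<bar>"
      unfolding integral_norm_dens[OF t] using s[OF t] by (simp add: A_def)
    have "(LINT x|lebesgue_on \<Omega>. norm (\<rho> t x *\<^sub>R u t x)) \<le> (LINT x|lebesgue_on \<Omega>. \<rho> t x + \<rho> t x * (norm (u t x))\<^sup>2)"
    proof (rule integral_mono_AE)
      show "AE x in lebesgue_on \<Omega>. norm (\<rho> t x *\<^sub>R u t x) \<le> \<rho> t x + \<rho> t x * (norm (u t x))\<^sup>2"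
        using slice_nonneg[OF t]
      proof eventually_elim
        case (elim x)
        have "norm (u t x) \<le> 1 + (norm (u t x))\<^sup>2"
        proof -
          have "0 \<le> norm (u t x)" "0 \<le> (norm (u t x) - 1)\<^sup>2" by simp_all
          then show ?thesis unfolding power2_eq_square by (simp only: algebra_simps)
        qed
        from mult_left_mono[OF this elim] elim show ?case by (simp add: algebra_simps)
      qed
      show "integrable (lebesgue_on \<Omega>) (\<lambda>x. norm (\<rho> t x *\<^sub>R u t x))"
        by (rule integrable_norm[OF slice_integrable(3)[OF t]])
    qed (use slice_integrable(1,4)[OF t] in auto)
    also have "\<dots> \<le> \<bar>A\<bar> + \<bar>A'\<bar>"
      using slice_integrable(1,4)[OF t] s[OF t] s'[OF t] by (simp add: A_def A'_def)
    finally show "(LINT x|lebesgue_on \<Omega>. norm (\<rho> t x *\<^sub>R u t x)) \<le> \<bar>A\<bar> + \<bar>A'\<bar>" .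
  qed
qed

lemma smooth_cylinder_continuous:
  "smooth_in N f \<Longrightarrow> continuous_on ({0..T} \<times> closure \<Omega>) (\<lambda>(t, x). f (t, x))"
  using smooth_in_continuous_on[OF _ N] by simp

lemma slice_measurable_bounded:
  fixes f :: "real \<times> (real^3) \<Rightarrow> 'b::euclidean_space"
  assumes f: "smooth_in N f" and t: "t \<in> {0..T}"
  shows "(\<lambda>x. f (t, x)) \<in> borel_measurable (lebesgue_on \<Omega>)"
    and "\<exists>B. \<forall>x\<in>\<Omega>. norm (f (t, x)) \<le> B"
proof -
  have "continuous_on \<Omega> (\<lambda>x. (t, x))"
    by (intro continuous_on_Pair continuous_on_const continuous_on_id)
  moreover have "(\<lambda>x. (t, x)) ` \<Omega> \<subseteq> N" using t N closure_subset[of \<Omega>] by blast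
  ultimately have "continuous_on \<Omega> (\<lambda>x. f (t, x))"
    using continuous_on_compose2[OF smooth_in_continuous_on[OF f subset_refl]] by blast
  then show "(\<lambda>x. f (t, x)) \<in> borel_measurable (lebesgue_on \<Omega>)"
    using continuous_imp_measurable_on_sets_lebesgue \<Omega>_sets by blast
  obtain B where B: "\<And>z. z \<in> {0..T} \<times> closure \<Omega> \<Longrightarrow> norm (f z) \<le> B"
    using cylinder_bounded[OF f] by metis
  have "norm (f (t, x)) \<le> B" if "x \<in> \<Omega>" for x
    using that t closure_subset[of \<Omega>] by (intro B) auto
  then show "\<exists>B. \<forall>x\<in>\<Omega>. norm (f (t, x)) \<le> B" by blast
qed

lemma slice_inner_integrable:
  fixes f :: "real \<times> (real^3) \<Rightarrow> 'b::euclidean_space"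
  assumes "t \<in> {0..T}" "smooth_in N f" "integrable (lebesgue_on \<Omega>) g"
  shows "integrable (lebesgue_on \<Omega>) (\<lambda>x. g x \<bullet> f (t, x))"
  using slice_measurable_bounded[OF assms(2,1)] integrable_inner_bounded(1)[OF assms(3)] by blast

lemma const_weakly_continuous: "weakly_continuous_Lp 1 T \<Omega> (\<lambda>t x. 1::real)"
  by (simp add: weakly_continuous_Lp_def in_Lp_def)

lemma rel_density_integrable:
  assumes t: "t \<in> {0..T}"
    and int: "integrable (lebesgue_on \<Omega>) r" "integrable (lebesgue_on \<Omega>) (\<lambda>x. r x *\<^sub>R w x)"
      "integrable (lebesgue_on \<Omega>) (\<lambda>x. energy_density \<gamma> (r x) (w x))"
  shows "integrable (lebesgue_on \<Omega>) (\<lambda>x. rel_density \<gamma> (r x) (w x) (R (t, x)) (V (t, x)))"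
    and "(LINT x|lebesgue_on \<Omega>. rel_density \<gamma> (r x) (w x) (R (t, x)) (V (t, x))) =
      (LINT x|lebesgue_on \<Omega>. energy_density \<gamma> (r x) (w x)) - (LINT x|lebesgue_on \<Omega>. (r x *\<^sub>R w x) \<bullet> V (t, x)) +
      (LINT x|lebesgue_on \<Omega>. r x \<bullet> fE (t, x)) + (LINT x|lebesgue_on \<Omega>. 1 \<bullet> pE (t, x))"
proof -
  have eq: "rel_density \<gamma> (r x) (w x) (R (t, x)) (V (t, x)) = energy_density \<gamma> (r x) (w x) -
      (r x *\<^sub>R w x) \<bullet> V (t, x) + r x \<bullet> fE (t, x) + 1 \<bullet> pE (t, x)" for x
    by (simp add: rel_density_eq fE_def pE_def)
  note i = slice_inner_integrable[OF t V int(2)] slice_inner_integrable[OF t smooth_fE int(1)]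
    slice_inner_integrable[OF t smooth_pE fin\<Omega>.integrable_const[of 1]]
  show "integrable (lebesgue_on \<Omega>) (\<lambda>x. rel_density \<gamma> (r x) (w x) (R (t, x)) (V (t, x)))"
    unfolding eq using i int(3) by (intro Bochner_Integration.integrable_add Bochner_Integration.integrable_diff)
  show "(LINT x|lebesgue_on \<Omega>. rel_density \<gamma> (r x) (w x) (R (t, x)) (V (t, x))) =
      (LINT x|lebesgue_on \<Omega>. energy_density \<gamma> (r x) (w x)) - (LINT x|lebesgue_on \<Omega>. (r x *\<^sub>R w x) \<bullet> V (t, x)) +
      (LINT x|lebesgue_on \<Omega>. r x \<bullet> fE (t, x)) + (LINT x|lebesgue_on \<Omega>. 1 \<bullet> pE (t, x))"
    unfolding eq using i int(3)
    by (simp only: Bochner_Integration.integral_add Bochner_Integration.integral_diff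
        Bochner_Integration.integrable_add Bochner_Integration.integrable_diff)
qed

text \<open>Convexity: the internal energy lies above its tangent at any reference density, and the
  tangent is an affine functional of the density, hence continuous in time. The reference is the
  density at time \<tau> cut off at height k, because the slope has to be a bounded function; for
  large k the tangent nearly touches at \<tau>.\<close>

lemma internal_energy_lsc:
  assumes \<tau>: "\<tau> \<in> {0..T}" and e: "0 < e"
  obtains d where "0 < d" "\<And>t. t \<in> {0..T} \<Longrightarrow> dist t \<tau> < d \<Longrightarrow>
    (LINT x|lebesgue_on \<Omega>. \<rho> \<tau> x powr \<gamma>) - e \<le> (LINT x|lebesgue_on \<Omega>. \<rho> t x powr \<gamma>)"
proof -
  \<comment> \<open>The maximum with 0 makes the truncation nonnegative everywhere, as the density
    is so only almost everywhere.\<close>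
  define s where "s k x = min (max (\<rho> \<tau> x) 0) (real k)" for k x
  have \<rho>m: "\<rho> \<tau> \<in> borel_measurable (lebesgue_on \<Omega>)"
    using slice_integrable(1)[OF \<tau>] by (rule borel_measurable_integrable)
  have sm: "s k \<in> borel_measurable (lebesgue_on \<Omega>)" for k unfolding s_def[abs_def] using \<rho>m by measurable
  have s0: "0 \<le> s k x" "s k x \<le> real k" for k x by (auto simp: s_def)
  have "(\<lambda>k. LINT x|lebesgue_on \<Omega>. s k x powr \<gamma>) \<longlonglongrightarrow> (LINT x|lebesgue_on \<Omega>. \<rho> \<tau> x powr \<gamma>)"
  proof (rule integral_dominated_convergence[where w = "\<lambda>x. \<rho> \<tau> x powr \<gamma>"])
    show "AE x in lebesgue_on \<Omega>. (\<lambda>k. s k x powr \<gamma>) \<longlonglongrightarrow> \<rho> \<tau> x powr \<gamma>"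
      using slice_nonneg[OF \<tau>]
    proof eventually_elim
      case (elim x)
      have "\<forall>\<^sub>F k in sequentially. s k x powr \<gamma> = \<rho> \<tau> x powr \<gamma>"
        using eventually_ge_at_top[of "nat \<lceil>\<rho> \<tau> x\<rceil>"]
      proof eventually_elim
        case (elim k)
        then have "\<rho> \<tau> x \<le> real k" by linarith
        then show ?case using \<open>0 \<le> \<rho> \<tau> x\<close> by (simp add: s_def)
      qed
      then show ?case by (rule tendsto_eventually)
    qed
    show "AE x in lebesgue_on \<Omega>. norm (s k x powr \<gamma>) \<le> \<rho> \<tau> x powr \<gamma>" for k
      using slice_nonneg[OF \<tau>]
      by eventually_elim (use \<gamma> in \<open>auto simp: s_def intro!: powr_mono2\<close>)
  qed (use sm \<rho>m slice_integrable(2)[OF \<tau>] in measurable)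
  then obtain k where k: "\<bar>(LINT x|lebesgue_on \<Omega>. s k x powr \<gamma>) - (LINT x|lebesgue_on \<Omega>. \<rho> \<tau> x powr \<gamma>)\<bar> < e / 2"
    using e unfolding LIMSEQ_iff real_norm_def by (meson half_gt_zero order_refl)
  define g where "g x = \<gamma> * s k x powr (\<gamma> - 1)" for x
  have gm: "g \<in> borel_measurable (lebesgue_on \<Omega>)" unfolding g_def[abs_def] using sm by measurable
  have gB: "norm (g x) \<le> \<gamma> * real k powr (\<gamma> - 1)" for x
    using s0[where k = k and x = x] \<gamma> by (auto simp: g_def intro!: mult_left_mono powr_mono2)
  have ski: "integrable (lebesgue_on \<Omega>) (\<lambda>x. s k x powr \<gamma>)"
    by (rule fin\<Omega>.integrable_const_bound[where B = "real k powr \<gamma>"])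
      (use sm s0[where k = k] \<gamma> in \<open>auto intro!: powr_mono2\<close>)
  define L where "L t = (LINT x|lebesgue_on \<Omega>. \<rho> t x \<bullet> g x) - (\<gamma> - 1) * (LINT x|lebesgue_on \<Omega>. s k x powr \<gamma>)" for t
  have gi: "integrable (lebesgue_on \<Omega>) (\<lambda>x. \<rho> t x \<bullet> g x)" if "t \<in> {0..T}" for t
    by (rule integrable_inner_bounded(1)[OF slice_integrable(1)[OF that] gm gB])
  \<comment> \<open>The nonnegativity of \<open>rel_H\<close>, read as a tangent inequality for the
    power \<gamma>.\<close>
  have tangent: "\<gamma> * c powr (\<gamma> - 1) * a - (\<gamma> - 1) * c powr \<gamma> \<le> a powr \<gamma>" if "0 \<le> a" "0 \<le> c" for a c
    using rel_H_mult[OF \<gamma>, of a c] rel_H_nonneg[OF \<gamma> that(2,1)] \<gamma> mult_nonneg_nonneg[of "\<gamma> - 1" "rel_H \<gamma> a c"]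
    by linarith
  have low: "L t \<le> (LINT x|lebesgue_on \<Omega>. \<rho> t x powr \<gamma>)" if t: "t \<in> {0..T}" for t
  proof -
    have "L t = (LINT x|lebesgue_on \<Omega>. \<rho> t x \<bullet> g x - (\<gamma> - 1) * s k x powr \<gamma>)"
      unfolding L_def using gi[OF t] ski by simp
    also have "\<dots> \<le> (LINT x|lebesgue_on \<Omega>. \<rho> t x powr \<gamma>)"
    proof (rule integral_mono_AE)
      show "AE x in lebesgue_on \<Omega>. \<rho> t x \<bullet> g x - (\<gamma> - 1) * s k x powr \<gamma> \<le> \<rho> t x powr \<gamma>"
        using slice_nonneg[OF t]
      proof eventually_elim
        case (elim x)
        from tangent[OF elim s0(1)[of k x]] show ?case by (simp add: g_def mult_ac)
      qed
    qed (use gi[OF t] ski slice_integrable(2)[OF t] in auto)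
    finally show ?thesis .
  qed
  \<comment> \<open>At time \<tau> the density dominates its truncation, so the tangent evaluated
    there is at least the truncated energy.\<close>
  have L\<tau>: "(LINT x|lebesgue_on \<Omega>. s k x powr \<gamma>) \<le> L \<tau>"
  proof -
    have "(LINT x|lebesgue_on \<Omega>. s k x powr \<gamma>) \<le> (LINT x|lebesgue_on \<Omega>. \<rho> \<tau> x \<bullet> g x - (\<gamma> - 1) * s k x powr \<gamma>)"
    proof (rule integral_mono_AE)
      show "AE x in lebesgue_on \<Omega>. s k x powr \<gamma> \<le> \<rho> \<tau> x \<bullet> g x - (\<gamma> - 1) * s k x powr \<gamma>"
        using slice_nonneg[OF \<tau>]
      proof eventually_elim
        case (elim x)
        have "s k x powr \<gamma> = s k x * s k x powr (\<gamma> - 1)"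
          using s0(1)[of k x] by (cases "s k x = 0") (auto simp: powr_diff)
        also have "\<dots> \<le> \<rho> \<tau> x * s k x powr (\<gamma> - 1)"
          using elim by (intro mult_right_mono) (auto simp: s_def)
        finally have "\<gamma> * s k x powr \<gamma> \<le> \<gamma> * (\<rho> \<tau> x * s k x powr (\<gamma> - 1))" using \<gamma> by simp
        then show ?case by (simp add: g_def algebra_simps)
      qed
    qed (use gi[OF \<tau>] ski in auto)
    also have "\<dots> = L \<tau>" unfolding L_def using gi[OF \<tau>] ski by simp
    finally show ?thesis .
  qed
  have "continuous_on {0..T} (\<lambda>t. LINT x|lebesgue_on \<Omega>. \<rho> t x \<bullet> g x)"
    by (rule weakly_continuous_Lp_inner[OF weakly_continuous_dens _ \<Omega>_lmeasurable gm gB]) (use \<gamma> in simp)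
  then have "continuous_on {0..T} L" unfolding L_def[abs_def] by (intro continuous_on_diff continuous_on_const)
  then obtain d where d: "0 < d" "\<And>t. t \<in> {0..T} \<Longrightarrow> dist t \<tau> < d \<Longrightarrow> dist (L t) (L \<tau>) < e / 2"
    using \<tau> e unfolding continuous_on_iff by (metis half_gt_zero)
  show thesis
  proof (rule that[OF d(1)])
    fix t assume t: "t \<in> {0..T}" "dist t \<tau> < d"
    show "(LINT x|lebesgue_on \<Omega>. \<rho> \<tau> x powr \<gamma>) - e \<le> (LINT x|lebesgue_on \<Omega>. \<rho> t x powr \<gamma>)"
      using low[OF t(1)] L\<tau> k d(2)[OF t] unfolding dist_real_def by linarith
  qed
qed

text \<open>By \<open>rel_density_eq\<close> all contributions other than the internal energy are
  continuous in time: the kinetic energy because its density is weakly continuous in L^1, the others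
  as pairings of the density, the momentum or the constant one with smooth weights.\<close>

lemma rel_E_lsc:
  assumes \<tau>: "\<tau> \<in> {0..T}" and e: "0 < e"
  obtains d where "0 < d" "\<And>t. t \<in> {0..T} \<Longrightarrow> dist t \<tau> < d \<Longrightarrow> rel_E \<tau> - e \<le> rel_E t"
proof -
  obtain K where K: "\<And>t. t \<in> {0..T} \<Longrightarrow> (LINT x|lebesgue_on \<Omega>. norm (\<rho> t x)) \<le> K"
    "\<And>t. t \<in> {0..T} \<Longrightarrow> (LINT x|lebesgue_on \<Omega>. norm (\<rho> t x *\<^sub>R u t x)) \<le> K"
    using mass_momentum_bounded by blast
  define F where "F t = 1/2 * (LINT x|lebesgue_on \<Omega>. \<rho> t x * (norm (u t x))\<^sup>2) -
      (LINT x|lebesgue_on \<Omega>. (\<rho> t x *\<^sub>R u t x) \<bullet> V (t, x)) +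
      (LINT x|lebesgue_on \<Omega>. \<rho> t x \<bullet> fE (t, x)) + (LINT x|lebesgue_on \<Omega>. 1 \<bullet> pE (t, x))" for t
  have "continuous_on {0..T} (\<lambda>t. LINT x|lebesgue_on \<Omega>. (\<rho> t x *\<^sub>R u t x) \<bullet> V (t, x))"
    by (rule weakly_continuous_Lp_inner_time[OF weakly_continuous_mom momentum_exponent open_\<Omega> bounded_\<Omega> K(2)
          smooth_cylinder_continuous[OF V]])
  moreover have "continuous_on {0..T} (\<lambda>t. LINT x|lebesgue_on \<Omega>. \<rho> t x \<bullet> fE (t, x))"
    by (rule weakly_continuous_Lp_inner_time[OF weakly_continuous_dens _ open_\<Omega> bounded_\<Omega> K(1)
          smooth_cylinder_continuous[OF smooth_fE]]) (use \<gamma> in simp)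
  moreover have "continuous_on {0..T} (\<lambda>t. LINT x|lebesgue_on \<Omega>. 1 \<bullet> pE (t, x))"
    by (rule weakly_continuous_Lp_inner_time[OF const_weakly_continuous order_refl open_\<Omega> bounded_\<Omega> _
          smooth_cylinder_continuous[OF smooth_pE]]) (rule order_refl)
  ultimately have "continuous_on {0..T} F"
    unfolding F_def[abs_def]
    by (intro continuous_on_add continuous_on_diff continuous_on_mult_left const_continuous_kin)
  then obtain d1 where d1: "0 < d1" "\<And>t. t \<in> {0..T} \<Longrightarrow> dist t \<tau> < d1 \<Longrightarrow> dist (F t) (F \<tau>) < e / 2"
    using \<tau> e unfolding continuous_on_iff by (metis half_gt_zero)
  have e': "0 < e * (\<gamma> - 1) / 2" using e \<gamma> by simp
  obtain d2 where d2: "0 < d2" "\<And>t. t \<in> {0..T} \<Longrightarrow> dist t \<tau> < d2 \<Longrightarrow>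
    (LINT x|lebesgue_on \<Omega>. \<rho> \<tau> x powr \<gamma>) - e * (\<gamma> - 1) / 2 \<le> (LINT x|lebesgue_on \<Omega>. \<rho> t x powr \<gamma>)"
    using internal_energy_lsc[OF \<tau> e'] by blast
  have eq: "rel_E t = F t + (LINT x|lebesgue_on \<Omega>. \<rho> t x powr \<gamma>) / (\<gamma> - 1)" if "t \<in> {0..T}" for t
  proof -
    have "(LINT x|lebesgue_on \<Omega>. energy_density \<gamma> (\<rho> t x) (u t x)) =
        1/2 * (LINT x|lebesgue_on \<Omega>. \<rho> t x * (norm (u t x))\<^sup>2) + (LINT x|lebesgue_on \<Omega>. \<rho> t x powr \<gamma>) / (\<gamma> - 1)"
      unfolding energy_density_def using slice_integrable(2,4)[OF that] by (simp add: mult.assoc)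
    then show ?thesis
      unfolding rel_E_def rel_density_integrable(2)[OF that slice_integrable(1,3,5)[OF that]] F_def by simp
  qed
  show thesis
  proof (rule that)
    show "0 < min d1 d2" using d1 d2 by simp
    fix t assume t: "t \<in> {0..T}" "dist t \<tau> < min d1 d2"
    have "((LINT x|lebesgue_on \<Omega>. \<rho> \<tau> x powr \<gamma>) - e * (\<gamma> - 1) / 2) / (\<gamma> - 1) \<le> (LINT x|lebesgue_on \<Omega>. \<rho> t x powr \<gamma>) / (\<gamma> - 1)"
      using d2(2)[OF t(1)] t(2) \<gamma> by (intro divide_right_mono) auto
    then have "(LINT x|lebesgue_on \<Omega>. \<rho> \<tau> x powr \<gamma>) / (\<gamma> - 1) - e / 2 \<le> (LINT x|lebesgue_on \<Omega>. \<rho> t x powr \<gamma>) / (\<gamma> - 1)"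
    proof -
      have "e * (\<gamma> - 1) / 2 / (\<gamma> - 1) = e / 2" using \<gamma> by (simp add: field_simps)
      then show ?thesis using \<open>_ \<le> (LINT x|lebesgue_on \<Omega>. \<rho> t x powr \<gamma>) / (\<gamma> - 1)\<close>
        by (simp only: diff_divide_distrib)
    qed
    moreover have "dist (F t) (F \<tau>) < e / 2" using d1(2)[OF t(1)] t(2) by simp
    ultimately show "rel_E \<tau> - e \<le> rel_E t"
      unfolding eq[OF \<tau>] eq[OF t(1)] dist_real_def by linarith
  qed
qed

end

section \<open>Integrability on the cylinder, layer bounds and weighted dissipation\<close>

lemma energy_density_bounds:
  assumes \<gamma>: "1 < \<gamma>" and a: "0 \<le> a"
  shows "a * (norm w)\<^sup>2 \<le> 2 * energy_density \<gamma> a w"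
    and "a powr \<gamma> \<le> (\<gamma> - 1) * energy_density \<gamma> a w"
    and "a * (1 + (norm w)\<^sup>2) \<le> (\<gamma> + 2) * (1 + energy_density \<gamma> a w)"
proof -
  have p: "0 \<le> a powr \<gamma> / (\<gamma> - 1)" using \<gamma> by simp
  show 1: "a * (norm w)\<^sup>2 \<le> 2 * energy_density \<gamma> a w"
    using p by (simp add: energy_density_def)
  have "(\<gamma> - 1) * energy_density \<gamma> a w = (\<gamma> - 1) * (1/2 * a * (norm w)\<^sup>2) + a powr \<gamma>"
    using \<gamma> by (simp add: energy_density_def distrib_left)
  moreover have "0 \<le> (\<gamma> - 1) * (1/2 * a * (norm w)\<^sup>2)" using \<gamma> a by simp
  ultimately show 2: "a powr \<gamma> \<le> (\<gamma> - 1) * energy_density \<gamma> a w" by linarith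
  have "a \<le> 1 + a powr \<gamma>" using le_small_powr[OF \<gamma> zero_less_one a] by simp
  moreover have "0 \<le> energy_density \<gamma> a w" by (rule energy_density_nonneg[OF \<gamma> a])
  ultimately show "a * (1 + (norm w)\<^sup>2) \<le> (\<gamma> + 2) * (1 + energy_density \<gamma> a w)"
    using 1 2 \<gamma> by (simp add: algebra_simps)
qed

lemma linear_stress: "linear (stress \<mu> \<eta>)"
  unfolding stress_def
  by (rule linearI) (simp_all add: vec_eq_iff transpose_def trace_def sum.distrib sum_distrib_left algebra_simps)

text \<open>The factor 9 counts the entries of the matrix and reappears in the constants of the
  viscous term.\<close>

lemma norm_matrix_le:
  fixes D :: "real^3 \<Rightarrow> real^3"
  assumes "\<And>w. norm (D w) \<le> L * norm w"
  shows "norm (matrix D) \<le> 9 * L"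
proof -
  have "\<bar>matrix D $ i $ j\<bar> \<le> L" for i j
    using order_trans[OF component_le_norm_cart[of "D (axis j 1)" i] assms[of "axis j 1"]]
    by (simp add: matrix_def)
  then have "norm (matrix D $ i) \<le> (\<Sum>j\<in>(UNIV::3 set). L)" for i
    by (intro order_trans[OF norm_le_l1_cart] sum_mono)
  then have row: "norm (matrix D $ i) \<le> 3 * L" for i by simp
  have "norm (matrix D) \<le> (\<Sum>i\<in>UNIV. norm (matrix D $ i))"
    unfolding norm_vec_def by (rule L2_set_le_sum) simp
  also have "\<dots> \<le> (\<Sum>i\<in>(UNIV::3 set). 3 * L)" by (rule sum_mono) (rule row)
  finally show ?thesis by simp
qed

context ns_flow
begin

lemma stress_measurable: "(\<lambda>z. stress \<mu> \<eta> (nab z)) \<in> borel_measurable (lebesgue_on Q)"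
  by (rule measurable_compose[OF nab_measurable borel_measurable_continuous_onI])
    (rule linear_continuous_on[OF linear_conv_bounded_linear[THEN iffD1, OF linear_stress]])

lemma integrable_dens_times:
  assumes X: "X \<in> borel_measurable (lebesgue_on Q)" and b: "\<And>z. z \<in> Q \<Longrightarrow> \<bar>X z\<bar> \<le> b * (1 + (norm (vel z))\<^sup>2)"
  shows "integrable (lebesgue_on Q) (\<lambda>z. dens z * X z)"
proof (rule integrable_Q_bound[where B = "\<bar>b\<bar> * (\<gamma> + 2)"])
  show "(\<lambda>z. dens z * X z) \<in> borel_measurable (lebesgue_on Q)" using X dens_measurable by measurable
  show "AE z in lebesgue_on Q. 0 \<le> dens z \<longrightarrow> z \<in> Q \<longrightarrow> \<bar>dens z * X z\<bar> \<le> \<bar>b\<bar> * (\<gamma> + 2) * (1 + en z + (norm (nab z))\<^sup>2)"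
  proof (rule AE_I2, intro impI)
    fix z assume d: "0 \<le> dens z" and z: "z \<in> Q"
    have "\<bar>X z\<bar> \<le> \<bar>b\<bar> * (1 + (norm (vel z))\<^sup>2)"
    proof -
      have "b * (1 + (norm (vel z))\<^sup>2) \<le> \<bar>b\<bar> * (1 + (norm (vel z))\<^sup>2)" by (rule mult_right_mono) auto
      then show ?thesis using b[OF z] by linarith
    qed
    then have "\<bar>dens z * X z\<bar> \<le> dens z * (\<bar>b\<bar> * (1 + (norm (vel z))\<^sup>2))"
      using d by (simp add: abs_mult mult_left_mono)
    also have "\<dots> = \<bar>b\<bar> * (dens z * (1 + (norm (vel z))\<^sup>2))" by simp
    also have "\<dots> \<le> \<bar>b\<bar> * ((\<gamma> + 2) * (1 + en z))"
      by (intro mult_left_mono energy_density_bounds(3)[OF \<gamma> d]) simp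
    also have "\<dots> \<le> \<bar>b\<bar> * ((\<gamma> + 2) * (1 + en z + (norm (nab z))\<^sup>2))"
      using \<gamma> by (intro mult_left_mono) auto
    finally show "\<bar>dens z * X z\<bar> \<le> \<bar>b\<bar> * (\<gamma> + 2) * (1 + en z + (norm (nab z))\<^sup>2)" by (simp add: mult.assoc)
  qed
qed

lemma integrable_pressure_times:
  assumes X: "X \<in> borel_measurable (lebesgue_on Q)" and b: "\<And>z. z \<in> Q \<Longrightarrow> \<bar>X z\<bar> \<le> b"
  shows "integrable (lebesgue_on Q) (\<lambda>z. dens z powr \<gamma> * X z)"
proof (rule integrable_Q_bound[where B = "\<bar>b\<bar> * (\<gamma> - 1)"])
  show "(\<lambda>z. dens z powr \<gamma> * X z) \<in> borel_measurable (lebesgue_on Q)" using X dens_measurable by measurable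
  show "AE z in lebesgue_on Q. 0 \<le> dens z \<longrightarrow> z \<in> Q \<longrightarrow> \<bar>dens z powr \<gamma> * X z\<bar> \<le> \<bar>b\<bar> * (\<gamma> - 1) * (1 + en z + (norm (nab z))\<^sup>2)"
  proof (rule AE_I2, intro impI)
    fix z assume d: "0 \<le> dens z" and z: "z \<in> Q"
    have "\<bar>dens z powr \<gamma> * X z\<bar> \<le> dens z powr \<gamma> * \<bar>b\<bar>"
      using b[OF z] by (simp add: abs_mult mult_left_mono)
    also have "\<dots> \<le> (\<gamma> - 1) * en z * \<bar>b\<bar>"
      by (intro mult_right_mono energy_density_bounds(2)[OF \<gamma> d]) simp
    also have "\<dots> = \<bar>b\<bar> * (\<gamma> - 1) * en z" by simp
    also have "\<dots> \<le> \<bar>b\<bar> * (\<gamma> - 1) * (1 + en z + (norm (nab z))\<^sup>2)"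
      using \<gamma> by (intro mult_left_mono) auto
    finally show "\<bar>dens z powr \<gamma> * X z\<bar> \<le> \<bar>b\<bar> * (\<gamma> - 1) * (1 + en z + (norm (nab z))\<^sup>2)" .
  qed
qed

lemma integrable_bounded_Q:
  fixes X :: "real \<times> (real^3) \<Rightarrow> real"
  assumes "X \<in> borel_measurable (lebesgue_on Q)" "\<And>z. z \<in> Q \<Longrightarrow> \<bar>X z\<bar> \<le> b"
  shows "integrable (lebesgue_on Q) X"
  by (rule finQ.integrable_const_bound[where B = b]) (use assms in auto)

lemma integrable_stress_inner:
  assumes J: "J \<in> borel_measurable (lebesgue_on Q)" and b: "\<And>z. z \<in> Q \<Longrightarrow> norm (J z) \<le> b"
  shows "integrable (lebesgue_on Q) (\<lambda>z. stress \<mu> \<eta> (nab z) \<bullet> J z)"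
proof (rule Bochner_Integration.integrable_bound)
  define s where "s = 2 * \<mu> + 3 * \<eta>"
  have s: "0 \<le> s" using \<mu> \<eta> by (simp add: s_def)
  show "integrable (lebesgue_on Q) (\<lambda>z. s * \<bar>b\<bar> * (1 + (norm (nab z))\<^sup>2))"
    using nab_square_integrable by simp
  show "(\<lambda>z. stress \<mu> \<eta> (nab z) \<bullet> J z) \<in> borel_measurable (lebesgue_on Q)"
    using stress_measurable J by measurable
  show "AE z in lebesgue_on Q. norm (stress \<mu> \<eta> (nab z) \<bullet> J z) \<le> norm (s * \<bar>b\<bar> * (1 + (norm (nab z))\<^sup>2))"
  proof (rule AE_I2)
    fix z assume "z \<in> space (lebesgue_on Q)"
    then have z: "z \<in> Q" by simp
    have n: "norm (nab z) \<le> 1 + (norm (nab z))\<^sup>2"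
    proof -
      have "0 \<le> norm (nab z)" "0 \<le> (norm (nab z) - 1)\<^sup>2" by simp_all
      then show ?thesis unfolding power2_eq_square by (simp only: algebra_simps)
    qed
    have "\<bar>stress \<mu> \<eta> (nab z) \<bullet> J z\<bar> \<le> norm (stress \<mu> \<eta> (nab z)) * norm (J z)"
      by (rule Cauchy_Schwarz_ineq2)
    also have "\<dots> \<le> (s * norm (nab z)) * \<bar>b\<bar>"
      using stress_bounds(3)[OF \<mu> \<eta>, of "nab z"] b[OF z] s by (intro mult_mono) (auto simp: s_def)
    also have "\<dots> \<le> s * (1 + (norm (nab z))\<^sup>2) * \<bar>b\<bar>"
      using n s by (intro mult_right_mono mult_left_mono) auto
    finally show "norm (stress \<mu> \<eta> (nab z) \<bullet> J z) \<le> norm (s * \<bar>b\<bar> * (1 + (norm (nab z))\<^sup>2))"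
      using s by (simp add: abs_mult mult_ac)
  qed
qed

lemma stress_nab_integrable: "integrable (lebesgue_on Q) (\<lambda>z. stress \<mu> \<eta> (nab z) \<bullet> nab z)"
proof (rule Bochner_Integration.integrable_bound)
  show "integrable (lebesgue_on Q) (\<lambda>z. (2 * \<mu> + 3 * \<eta>) * (norm (nab z))\<^sup>2)"
    using nab_square_integrable by simp
  show "(\<lambda>z. stress \<mu> \<eta> (nab z) \<bullet> nab z) \<in> borel_measurable (lebesgue_on Q)"
    using stress_measurable nab_measurable by measurable
  show "AE z in lebesgue_on Q. norm (stress \<mu> \<eta> (nab z) \<bullet> nab z) \<le> norm ((2 * \<mu> + 3 * \<eta>) * (norm (nab z))\<^sup>2)"
  proof (rule AE_I2)
    fix z
    have "\<bar>stress \<mu> \<eta> (nab z) \<bullet> nab z\<bar> \<le> norm (stress \<mu> \<eta> (nab z)) * norm (nab z)"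
      by (rule Cauchy_Schwarz_ineq2)
    also have "\<dots> \<le> ((2 * \<mu> + 3 * \<eta>) * norm (nab z)) * norm (nab z)"
      by (intro mult_right_mono stress_bounds(3)[OF \<mu> \<eta>]) simp
    finally show "norm (stress \<mu> \<eta> (nab z) \<bullet> nab z) \<le> norm ((2 * \<mu> + 3 * \<eta>) * (norm (nab z))\<^sup>2)"
      using \<mu> \<eta> by (simp add: abs_mult power2_eq_square mult.assoc)
  qed
qed

lemma layer_indicator_measurable:
  assumes "open W" shows "(\<lambda>z. indicator W (snd z) :: real) \<in> borel_measurable (lebesgue_on Q)"
proof -
  have "open (UNIV \<times> W :: (real \<times> (real^3)) set)" using assms by (simp add: open_Times)
  then have "(UNIV \<times> W :: (real \<times> (real^3)) set) \<in> sets lebesgue"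
    by (intro sets_completionI_sets) (simp add: borel_open)
  then have "(indicator (UNIV \<times> W) :: real \<times> (real^3) \<Rightarrow> real) \<in> borel_measurable lebesgue"
    by (rule borel_measurable_indicator)
  then have "(indicator (UNIV \<times> W) :: real \<times> (real^3) \<Rightarrow> real) \<in> borel_measurable (lebesgue_on Q)"
    by (rule measurable_restrict_space1)
  moreover have "(\<lambda>z::real \<times> (real^3). indicator W (snd z) :: real) = indicator (UNIV \<times> W)" by (auto simp: indicator_def)
  ultimately show ?thesis by simp
qed

lemma continuous_integrable_time:
  fixes k :: "real \<Rightarrow> real"
  assumes k: "continuous_on UNIV k" shows "integrable (lebesgue_on {0<..<T}) k"
proof -
  have "integrable (lebesgue_on {0..T}) k"
    by (rule continuous_imp_integrable_real) (rule continuous_on_subset[OF k subset_UNIV])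
  then have "integrable lebesgue (\<lambda>t. indicator {0..T} t *\<^sub>R k t)"
    by (simp add: integrable_restrict_space)
  then have "integrable lebesgue (\<lambda>t. indicator {0<..<T} t *\<^sub>R (indicator {0..T} t *\<^sub>R k t))"
    by (rule integrable_mult_indicator[rotated]) auto
  moreover have "(\<lambda>t. indicator {0<..<T} t *\<^sub>R (indicator {0..T} t *\<^sub>R k t)) = (\<lambda>t. indicator {0<..<T} t *\<^sub>R k t)"
    by (auto simp: indicator_def)
  ultimately show ?thesis by (simp add: integrable_restrict_space)
qed

lemma continuous_bounded_time:
  fixes k :: "real \<Rightarrow> real"
  assumes k: "continuous_on UNIV k"
  obtains b where "0 \<le> b" "\<And>t. t \<in> {0<..<T} \<Longrightarrow> \<bar>k t\<bar> \<le> b"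
proof -
  have "bounded (k ` {0..T})"
    by (intro compact_imp_bounded compact_continuous_image continuous_on_subset[OF k]) auto
  then obtain b where b: "\<forall>x\<in>k ` {0..T}. norm x \<le> b" unfolding bounded_iff by blast
  show thesis
  proof (rule that[of "\<bar>b\<bar>"])
    fix t assume "t \<in> {0<..<T}"
    then have "k t \<in> k ` {0..T}" by auto
    then have "norm (k t) \<le> b" using b by blast
    then show "\<bar>k t\<bar> \<le> \<bar>b\<bar>" by simp
  qed simp
qed

lemma integral_time_layer:
  fixes k :: "real \<Rightarrow> real"
  assumes W: "open W" "W \<subseteq> \<Omega>" and k: "continuous_on UNIV k" "\<And>t. 0 \<le> k t"
  shows "integrable (lebesgue_on Q) (\<lambda>z. k (fst z) * indicator W (snd z))"
    and "(LINT z|lebesgue_on Q. k (fst z) * indicator W (snd z)) = (LINT t|lebesgue_on {0<..<T}. k t) * measure lebesgue W"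
proof -
  have m: "(\<lambda>z. k (fst z) * indicator W (snd z)) \<in> borel_measurable (lebesgue_on Q)"
    using fst_measurable_Q[OF k(1)] layer_indicator_measurable[OF W(1)] by measurable
  obtain b where b: "0 \<le> b" "\<And>t. t \<in> {0<..<T} \<Longrightarrow> \<bar>k t\<bar> \<le> b" using continuous_bounded_time[OF k(1)] by metis
  show int: "integrable (lebesgue_on Q) (\<lambda>z. k (fst z) * indicator W (snd z))"
    by (rule integrable_bounded_Q[OF m, where b = b]) (use b Q_point in \<open>auto simp: indicator_def\<close>)
  have Wl: "W \<in> lmeasurable"
    using W bounded_subset[OF bounded_\<Omega> W(2)] by (simp add: bounded_set_imp_lmeasurable)
  have inner: "(\<integral>\<^sup>+x. ennreal (k t * indicator W x) \<partial>lebesgue_on \<Omega>) = ennreal (k t * measure lebesgue W)" for t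
  proof -
    have "(\<integral>\<^sup>+x. ennreal (k t * indicator W x) \<partial>lebesgue_on \<Omega>) = (\<integral>\<^sup>+x. ennreal (k t) * indicator W x \<partial>lebesgue_on \<Omega>)"
      by (intro nn_integral_cong) (simp add: indicator_def)
    also have "\<dots> = ennreal (k t) * emeasure (lebesgue_on \<Omega>) W"
      using Wl W(2) \<Omega>_sets by (intro nn_integral_cmult_indicator) (auto simp: sets_restrict_space_iff)
    also have "emeasure (lebesgue_on \<Omega>) W = ennreal (measure lebesgue W)"
      using Wl W(2) \<Omega>_sets by (simp add: emeasure_restrict_space emeasure_eq_measure2)
    finally show ?thesis using k(2) by (simp add: ennreal_mult)
  qed
  have "ennreal (LINT z|lebesgue_on Q. k (fst z) * indicator W (snd z)) = (\<integral>\<^sup>+z. ennreal (k (fst z) * indicator W (snd z)) \<partial>lebesgue_on Q)"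
    using nn_integral_eq_integral[OF int] k(2) by simp
  also have "\<dots> = (\<integral>\<^sup>+t. \<integral>\<^sup>+x. ennreal (k t * indicator W x) \<partial>lebesgue_on \<Omega> \<partial>lebesgue_on {0<..<T})"
    unfolding Q_def using nn_integral_lebesgue_on_Times[OF _ open_\<Omega>, of "{0<..<T}" "\<lambda>z. ennreal (k (fst z) * indicator W (snd z))"] m
    by (simp add: Q_def)
  also have "\<dots> = (\<integral>\<^sup>+t. ennreal (k t * measure lebesgue W) \<partial>lebesgue_on {0<..<T})" by (simp only: inner)
  also have "\<dots> = ennreal ((LINT t|lebesgue_on {0<..<T}. k t) * measure lebesgue W)"
    using continuous_integrable_time[OF k(1)] k(2) by (subst nn_integral_eq_integral) auto
  finally show "(LINT z|lebesgue_on Q. k (fst z) * indicator W (snd z)) = (LINT t|lebesgue_on {0<..<T}. k t) * measure lebesgue W"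
    using k(2) by (subst (asm) ennreal_inj) (auto intro!: integral_nonneg_AE mult_nonneg_nonneg)
qed

lemma bdist_pos: "x \<in> \<Omega> \<Longrightarrow> 0 < bdist \<Omega> x"
proof -
  assume x: "x \<in> \<Omega>"
  have ne: "frontier \<Omega> \<noteq> {}" using bounded_\<Omega> ne_\<Omega> frontier_eq_empty not_bounded_UNIV by blast
  have "x \<notin> frontier \<Omega>" using x open_\<Omega> by (simp add: frontier_def interior_open)
  then have "infdist x (frontier \<Omega>) \<noteq> 0" using in_closed_iff_infdist_zero[OF frontier_closed ne] by blast
  then show ?thesis using infdist_nonneg[of x "frontier \<Omega>"] by (simp add: bdist_def)
qed

text \<open>The quantity that tends to zero by hypothesis. It has values in \<open>ennreal\<close>,
  so that no integrability of the singular integrand is presupposed.\<close>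

definition layer_integral :: "real \<Rightarrow> ennreal" where
  "layer_integral c = ennreal \<nu> *
     (\<integral>\<^sup>+ (t, x). ennreal
        (\<rho> t x * (norm (u t x))\<^sup>2 / (bdist \<Omega> x)\<^sup>2 +
         (\<rho> t x)\<^sup>2 * (u t x \<bullet> normal_ext \<Omega> x)\<^sup>2 / (bdist \<Omega> x)\<^sup>2 +
         (norm (nabla_x T \<Omega> u t x))\<^sup>2)
      \<partial>lebesgue_on ({0<..<T} \<times> boundary_layer \<Omega> (c * \<nu>)))"

text \<open>On \<open>W\<close> the distance is below c \<nu>, so the kinetic energy over (c
  \<nu>)^2 together with the squared gradient is at most the singular integrand. The comparison is
  made between nonnegative integrals, before \<open>H\<close> is converted to a Lebesgue
  integral.\<close>

lemma layer_bounds: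
  assumes W: "open W" "W \<subseteq> boundary_layer \<Omega> (c * \<nu>)" and c: "0 < c"
    and L: "layer_integral c \<le> ennreal \<Lambda>" "0 \<le> \<Lambda>"
  shows "integrable (lebesgue_on Q) (\<lambda>z. indicator W (snd z) * (dens z * (norm (vel z))\<^sup>2 / \<nu>))"
    and "integrable (lebesgue_on Q) (\<lambda>z. indicator W (snd z) * (\<nu> * (norm (nab z))\<^sup>2))"
    and "(LINT z|lebesgue_on Q. indicator W (snd z) * (dens z * (norm (vel z))\<^sup>2 / \<nu>)) \<le> c\<^sup>2 * \<Lambda>"
    and "(LINT z|lebesgue_on Q. indicator W (snd z) * (\<nu> * (norm (nab z))\<^sup>2)) \<le> \<Lambda>"
proof -
  let ?i = "\<lambda>z. indicator W (snd z) :: real"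
  note im = layer_indicator_measurable[OF W(1)]
  have ii: "0 \<le> ?i z" "?i z \<le> 1" for z by (auto simp: indicator_def)
  define F where "F z = ?i z * (dens z * (norm (vel z))\<^sup>2)" for z
  define G where "G z = ?i z * (norm (nab z))\<^sup>2" for z
  have Fm: "F \<in> borel_measurable (lebesgue_on Q)" unfolding F_def[abs_def] using im dens_measurable vel_measurable by measurable
  have Gm: "G \<in> borel_measurable (lebesgue_on Q)" unfolding G_def[abs_def] using im nab_measurable by measurable
  have Fi: "integrable (lebesgue_on Q) F"
  proof -
    have "integrable (lebesgue_on Q) (\<lambda>z. dens z * (?i z * (norm (vel z))\<^sup>2))"
      by (rule integrable_dens_times[where b = 1]) (use im vel_measurable in \<open>auto simp: indicator_def\<close>)
    then show ?thesis by (simp add: F_def[abs_def] mult.left_commute)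
  qed
  have Gi: "integrable (lebesgue_on Q) G"
    by (rule Bochner_Integration.integrable_bound[OF nab_square_integrable Gm]) (auto simp: G_def indicator_def)
  have F0: "AE z in lebesgue_on Q. 0 \<le> F z" using dens_nonneg by eventually_elim (simp add: F_def)
  have G0: "0 \<le> G z" for z by (simp add: G_def)
  define H where "H z = F z / (c * \<nu>)\<^sup>2 + G z" for z
  have Hi: "integrable (lebesgue_on Q) H" unfolding H_def[abs_def] using Fi Gi by simp
  have H0: "AE z in lebesgue_on Q. 0 \<le> H z" using F0 by eventually_elim (simp add: H_def G0)
  define \<Gamma> where "\<Gamma> = {0<..<T} \<times> boundary_layer \<Omega> (c * \<nu>)"
  define X where "X z = dens z * (norm (vel z))\<^sup>2 / (bdist \<Omega> (snd z))\<^sup>2 +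
         (dens z)\<^sup>2 * (vel z \<bullet> normal_ext \<Omega> (snd z))\<^sup>2 / (bdist \<Omega> (snd z))\<^sup>2 + (norm (nab z))\<^sup>2" for z
  have "open {x \<in> \<Omega>. bdist \<Omega> x < c * \<nu>}"
  proof -
    have "continuous_on \<Omega> (bdist \<Omega>)" unfolding bdist_def by (intro continuous_intros)
    then have "open (\<Omega> \<inter> bdist \<Omega> -` {..<c * \<nu>})" by (intro continuous_open_preimage open_\<Omega>) auto
    moreover have "\<Omega> \<inter> bdist \<Omega> -` {..<c * \<nu>} = {x \<in> \<Omega>. bdist \<Omega> x < c * \<nu>}" by auto
    ultimately show ?thesis by simp
  qed
  then have \<Gamma>s: "\<Gamma> \<in> sets lebesgue" by (auto simp: \<Gamma>_def boundary_layer_def open_Times)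
  have Qs: "Q \<in> sets lebesgue" using Q_lmeasurable by blast
  have L': "layer_integral c = ennreal \<nu> * (\<integral>\<^sup>+z. ennreal (X z) * indicator \<Gamma> z \<partial>lebesgue)"
    unfolding layer_integral_def X_def dens_def vel_def nab_def \<Gamma>_def[symmetric] split_def
    using \<Gamma>s by (simp add: nn_integral_restrict_space)
  have "(\<integral>\<^sup>+z. ennreal (H z) \<partial>lebesgue_on Q) = (\<integral>\<^sup>+z. ennreal (H z) * indicator Q z \<partial>lebesgue)"
    using Qs by (simp add: nn_integral_restrict_space)
  also have "\<dots> \<le> (\<integral>\<^sup>+z. ennreal (X z) * indicator \<Gamma> z \<partial>lebesgue)"
  proof (rule nn_integral_mono_AE)
    have "AE z in lebesgue. z \<in> Q \<longrightarrow> 0 \<le> dens z" using dens_nonneg Qs by (simp add: AE_restrict_space_iff)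
    then show "AE z in lebesgue. ennreal (H z) * indicator Q z \<le> ennreal (X z) * indicator \<Gamma> z"
    proof eventually_elim
      case (elim z)
      show ?case
      proof (cases "z \<in> Q \<and> snd z \<in> W")
        case False
        then show ?thesis by (auto simp: indicator_def H_def F_def G_def)
      next
        case True
        then have x: "snd z \<in> boundary_layer \<Omega> (c * \<nu>)" using W(2) by blast
        then have d: "bdist \<Omega> (snd z) < c * \<nu>" "0 < bdist \<Omega> (snd z)"
          using bdist_pos by (auto simp: boundary_layer_def)
        have "dens z * (norm (vel z))\<^sup>2 / (c * \<nu>)\<^sup>2 \<le> dens z * (norm (vel z))\<^sup>2 / (bdist \<Omega> (snd z))\<^sup>2"
          using d True elim by (intro divide_left_mono power_mono mult_pos_pos) auto
        moreover have "0 \<le> (dens z)\<^sup>2 * (vel z \<bullet> normal_ext \<Omega> (snd z))\<^sup>2 / (bdist \<Omega> (snd z))\<^sup>2" by simp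
        moreover have "H z = dens z * (norm (vel z))\<^sup>2 / (c * \<nu>)\<^sup>2 + (norm (nab z))\<^sup>2"
          using True by (simp add: H_def F_def G_def)
        ultimately have "H z \<le> X z" unfolding X_def by linarith
        moreover have "z \<in> \<Gamma>" using True x by (cases z) (auto simp: Q_def \<Gamma>_def)
        ultimately show ?thesis using True by (simp add: ennreal_leI)
      qed
    qed
  qed
  finally have "ennreal \<nu> * (\<integral>\<^sup>+z. ennreal (H z) \<partial>lebesgue_on Q) \<le> ennreal \<Lambda>"
    using L(1) unfolding L' by (meson mult_left_mono order_trans zero_le)
  then have "ennreal (\<nu> * (LINT z|lebesgue_on Q. H z)) \<le> ennreal \<Lambda>"
    using nn_integral_eq_integral[OF Hi H0] \<nu> integral_nonneg_AE[OF H0] by (simp add: ennreal_mult)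
  then have HL: "\<nu> * (LINT z|lebesgue_on Q. H z) \<le> \<Lambda>" using L(2) ennreal_le_iff by blast
  have Heq: "(LINT z|lebesgue_on Q. H z) = (LINT z|lebesgue_on Q. F z) / (c * \<nu>)\<^sup>2 + (LINT z|lebesgue_on Q. G z)"
    unfolding H_def[abs_def] using Fi Gi by simp
  have IF: "0 \<le> (LINT z|lebesgue_on Q. F z)" by (rule integral_nonneg_AE[OF F0])
  have IG: "0 \<le> (LINT z|lebesgue_on Q. G z)" by (rule integral_nonneg_AE) (simp add: G0)
  have 1: "\<nu> * (LINT z|lebesgue_on Q. G z) \<le> \<Lambda>"
  proof -
    have "\<nu> * (LINT z|lebesgue_on Q. G z) \<le> \<nu> * (LINT z|lebesgue_on Q. H z)"
      unfolding Heq using IF \<nu> by (intro mult_left_mono) auto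
    then show ?thesis using HL by linarith
  qed
  have 2: "\<nu> * ((LINT z|lebesgue_on Q. F z) / (c * \<nu>)\<^sup>2) \<le> \<Lambda>"
  proof -
    have "\<nu> * ((LINT z|lebesgue_on Q. F z) / (c * \<nu>)\<^sup>2) \<le> \<nu> * (LINT z|lebesgue_on Q. H z)"
      unfolding Heq using IG \<nu> by (intro mult_left_mono) auto
    then show ?thesis using HL by linarith
  qed
  have eF: "(\<lambda>z. ?i z * (dens z * (norm (vel z))\<^sup>2 / \<nu>)) = (\<lambda>z. F z / \<nu>)" by (simp add: F_def)
  have eG: "(\<lambda>z. ?i z * (\<nu> * (norm (nab z))\<^sup>2)) = (\<lambda>z. \<nu> * G z)" by (auto simp: G_def)
  show "integrable (lebesgue_on Q) (\<lambda>z. ?i z * (dens z * (norm (vel z))\<^sup>2 / \<nu>))" unfolding eF using Fi by simp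
  show "integrable (lebesgue_on Q) (\<lambda>z. ?i z * (\<nu> * (norm (nab z))\<^sup>2))" unfolding eG using Gi by simp
  show "(LINT z|lebesgue_on Q. ?i z * (\<nu> * (norm (nab z))\<^sup>2)) \<le> \<Lambda>" unfolding eG using 1 by simp
  \<comment> \<open>The rescaling \<nu>/(c \<nu>)^2 = 1/(c^2 \<nu>) is the origin of the factor
    c^2.\<close>
  have "(LINT z|lebesgue_on Q. F z) / \<nu> = c\<^sup>2 * (\<nu> * ((LINT z|lebesgue_on Q. F z) / (c * \<nu>)\<^sup>2))"
  proof -
    have "x / \<nu> = c\<^sup>2 * (\<nu> * (x / (c * \<nu>)\<^sup>2))" for x
      using c \<nu> by (simp add: power_mult_distrib power2_eq_square)
    then show ?thesis .
  qed
  also have "\<dots> \<le> c\<^sup>2 * \<Lambda>" by (intro mult_left_mono 2) simp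
  finally show "(LINT z|lebesgue_on Q. ?i z * (dens z * (norm (vel z))\<^sup>2 / \<nu>)) \<le> c\<^sup>2 * \<Lambda>"
    unfolding eF by simp
qed

text \<open>A nonempty open interval is not negligible, so it cannot lie in the exceptional null
  set.\<close>

lemma AE_interval_exists:
  assumes "AE t in lebesgue_on {0<..<T}. P t" and s: "s < T"
  obtains t where "s < t" "0 < t" "t < T" "P t"
proof -
  define I where "I = {max s 0<..<T}"
  have "AE t in lebesgue. t \<in> {0<..<T} \<longrightarrow> P t" using assms(1) by (simp add: AE_restrict_space_iff)
  then obtain N' where N': "{t. \<not> (t \<in> {0<..<T} \<longrightarrow> P t)} \<subseteq> N'" "N' \<in> null_sets lebesgue"
    by (auto simp: eventually_ae_filter)
  have "\<not> negligible I" using s T by (intro open_not_negligible) (auto simp: I_def)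
  moreover have "negligible N'" using N'(2) by (simp add: negligible_iff_null_sets)
  ultimately have "\<not> I \<subseteq> N'" using negligible_subset by blast
  then obtain t where "t \<in> I" "t \<notin> N'" by blast
  then show thesis using that N'(1) by (auto simp: I_def)
qed

text \<open>As \<open>\<theta>\<close> vanishes from s < T on and the energy inequality holds at
  some time t strictly between s and T, the weight \<open>\<theta>\<close> is at most the indicator
  of (0, t), for which the dissipation is bounded. This is why the test functions in time vanish
  already before T.\<close>

lemma dissipation_bound:
  assumes \<theta>: "continuous_on UNIV \<theta>" "\<And>t. 0 \<le> \<theta> t" "\<And>t. t \<in> {0<..<T} \<Longrightarrow> \<theta> t \<le> 1" and s: "s < T" "\<And>t. s \<le> t \<Longrightarrow> \<theta> t = 0"
  shows "integrable (lebesgue_on Q) (\<lambda>z. \<theta> (fst z) * (stress \<mu> \<eta> (nab z) \<bullet> nab z))"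
    and "\<nu> * (LINT z|lebesgue_on Q. \<theta> (fst z) * (stress \<mu> \<eta> (nab z) \<bullet> nab z)) \<le> E0"
proof -
  let ?S = "\<lambda>z. stress \<mu> \<eta> (nab z) \<bullet> nab z"
  have S0: "0 \<le> ?S z" for z by (rule stress_bounds(1)[OF \<mu> \<eta>])
  have m: "(\<lambda>z. \<theta> (fst z) * ?S z) \<in> borel_measurable (lebesgue_on Q)"
    using fst_measurable_Q[OF \<theta>(1)] stress_measurable nab_measurable by measurable
  show int: "integrable (lebesgue_on Q) (\<lambda>z. \<theta> (fst z) * ?S z)"
  proof (rule Bochner_Integration.integrable_bound[OF stress_nab_integrable m], rule AE_I2)
    fix z assume "z \<in> space (lebesgue_on Q)"
    then have "fst z \<in> {0<..<T}" using Q_point(2) by simp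
    then have "\<theta> (fst z) * ?S z \<le> ?S z" by (rule mult_left_le_one_le[OF S0 \<theta>(2) \<theta>(3)])
    moreover have "0 \<le> \<theta> (fst z) * ?S z" by (rule mult_nonneg_nonneg[OF \<theta>(2) S0])
    ultimately show "norm (\<theta> (fst z) * ?S z) \<le> norm (?S z)" by simp
  qed
  obtain t where t: "s < t" "0 < t" "t < T"
    "energy \<gamma> \<Omega> (\<rho> t) (u t) + \<nu> * (LINT z|lebesgue_on ({0<..<t} \<times> \<Omega>). ?S z) \<le> E0"
    by (rule AE_interval_exists[OF energy_inequality s(1)], rule that)
  have en0: "0 \<le> energy \<gamma> \<Omega> (\<rho> t) (u t)"
    unfolding energy_eq using slice_nonneg[of t] t
    by (intro integral_nonneg_AE) (auto elim!: eventually_mono intro: energy_density_nonneg[OF \<gamma>])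
  define P where "P = {0<..<t} \<times> \<Omega>"
  have Ps: "P \<in> sets lebesgue" "Q \<in> sets lebesgue" "P \<subseteq> Q"
    using open_\<Omega> open_Q t by (auto simp: P_def Q_def open_Times)
  have iQ: "integrable lebesgue (\<lambda>z. indicator Q z *\<^sub>R (\<theta> (fst z) * ?S z))"
    using int Ps by (simp add: integrable_restrict_space)
  have "integrable lebesgue (\<lambda>z. indicator Q z *\<^sub>R ?S z)"
    using stress_nab_integrable Ps by (simp add: integrable_restrict_space)
  then have "integrable lebesgue (\<lambda>z. indicator P z *\<^sub>R (indicator Q z *\<^sub>R ?S z))"
    by (rule integrable_mult_indicator[OF Ps(1)])
  moreover have "(\<lambda>z. indicator P z *\<^sub>R (indicator Q z *\<^sub>R ?S z)) = (\<lambda>z. indicator P z *\<^sub>R ?S z)"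
    using Ps(3) by (intro ext) (auto split: split_indicator)
  ultimately have iP: "integrable lebesgue (\<lambda>z. indicator P z *\<^sub>R ?S z)" by simp
  have "(LINT z|lebesgue_on Q. \<theta> (fst z) * ?S z) = (LINT z|lebesgue. indicator Q z *\<^sub>R (\<theta> (fst z) * ?S z))"
    using Ps by (simp add: integral_restrict_space)
  also have "\<dots> \<le> (LINT z|lebesgue. indicator P z *\<^sub>R ?S z)"
  proof (rule integral_mono[OF iQ iP])
    fix z
    show "indicator Q z *\<^sub>R (\<theta> (fst z) * ?S z) \<le> indicator P z *\<^sub>R ?S z"
    proof (cases "z \<in> P")
      case True
      then have "z \<in> Q" using Ps(3) by blast
      then show ?thesis using True S0 \<theta>(2) \<theta>(3)[OF Q_point(2)] by (simp add: mult_left_le_one_le)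
    next
      case False
      have "indicator Q z *\<^sub>R (\<theta> (fst z) * ?S z) = 0"
      proof (cases "z \<in> Q")
        case True
        then have "t \<le> fst z" using False by (cases z) (auto simp: P_def Q_def)
        then show ?thesis using s(2)[of "fst z"] t by simp
      qed simp
      then show ?thesis using False by auto
    qed
  qed
  also have "\<dots> = (LINT z|lebesgue_on P. ?S z)" using Ps by (simp add: integral_restrict_space)
  finally have "\<nu> * (LINT z|lebesgue_on Q. \<theta> (fst z) * ?S z) \<le> \<nu> * (LINT z|lebesgue_on P. ?S z)"
    using \<nu> by (intro mult_left_mono) auto
  then show "\<nu> * (LINT z|lebesgue_on Q. \<theta> (fst z) * ?S z) \<le> E0"
    using t(4) en0 by (simp add: P_def)
qed

end

lemma le_one_plus_power2: "x \<le> 1 + x\<^sup>2" for x :: real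
proof -
  have "0 \<le> (x - 1/2)\<^sup>2" by simp
  then show ?thesis by (simp add: power2_eq_square algebra_simps)
qed

text \<open>Young's inequality with a weight. In the viscous estimate \<open>n\<close> is the
  viscosity and \<open>a\<close> a small parameter; the term \<open>a / n\<close> is then integrated
  over a layer of volume of order \<open>n\<close>.\<close>

lemma mult_le_weighted_squares:
  fixes x n :: real
  assumes "0 < n" "0 < a"
  shows "x \<le> n * x\<^sup>2 / a + a / n"
proof -
  have "0 \<le> (n * x / a - 1/2)\<^sup>2" by simp
  then have "n * x / a \<le> (n * x / a)\<^sup>2 + 1"
    using le_one_plus_power2[of "n * x / a"] by simp
  then have "(n * x / a) * (a / n) \<le> ((n * x / a)\<^sup>2 + 1) * (a / n)"
    using assms by (intro mult_right_mono) auto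
  moreover have "(n * x / a) * (a / n) = x" "((n * x / a)\<^sup>2 + 1) * (a / n) = n * x\<^sup>2 / a + a / n"
    using assms by (auto simp: power2_eq_square field_simps)
  ultimately show ?thesis by simp
qed

section \<open>The integrated relative energy inequality\<close>

context ns_flow
begin

definition E0_rel :: real where
  "E0_rel = (LINT x|lebesgue_on \<Omega>. rel_density \<gamma> (\<rho>0 x) (u0 x) (R (0, x)) (V (0, x)))"

abbreviation rel :: "real \<times> (real^3) \<Rightarrow> real" where
  "rel z \<equiv> rel_density \<gamma> (dens z) (vel z) (R z) (V z)"

lemma rel_eq: "rel z = en z - dens z * (vel z \<bullet> V z) + dens z * fE z + pE z"
  by (simp add: rel_density_eq fE_def pE_def)

lemma integrable_time_times:
  fixes k :: "real \<Rightarrow> real" and f :: "real \<times> (real^3) \<Rightarrow> real"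
  assumes k: "continuous_on UNIV k" and f: "integrable (lebesgue_on Q) f"
  shows "integrable (lebesgue_on Q) (\<lambda>z. k (fst z) * f z)"
proof -
  obtain b where b: "0 \<le> b" "\<And>t. t \<in> {0<..<T} \<Longrightarrow> \<bar>k t\<bar> \<le> b"
    by (rule continuous_bounded_time[OF k], rule that)
  show ?thesis
  proof (rule Bochner_Integration.integrable_bound)
    show "integrable (lebesgue_on Q) (\<lambda>z. b * f z)" using f by simp
    show "(\<lambda>z. k (fst z) * f z) \<in> borel_measurable (lebesgue_on Q)"
      using fst_measurable_Q[OF k] borel_measurable_integrable[OF f] by measurable
    show "AE z in lebesgue_on Q. norm (k (fst z) * f z) \<le> norm (b * f z)"
      by (rule AE_I2) (use b Q_point(2) in \<open>auto simp: abs_mult intro!: mult_right_mono\<close>)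
  qed
qed

lemma inner_V_bound:
  assumes "z \<in> Q" "norm (V z) \<le> B"
  shows "\<bar>w \<bullet> V z\<bar> \<le> B * norm w"
  using Cauchy_Schwarz_ineq2[of w "V z"] mult_left_mono[OF assms(2), of "norm w"] by (simp add: mult.commute)

lemma en_integrable: "integrable (lebesgue_on Q) en"
  using energy_weighted(1)[of "\<lambda>_. 1"] by simp

lemma rel_integrable: "integrable (lebesgue_on Q) rel"
proof -
  obtain B where B: "0 \<le> B" "\<And>z. z \<in> {0..T} \<times> closure \<Omega> \<Longrightarrow> norm (V z) \<le> B"
    by (rule cylinder_bounded[OF V], rule that)
  obtain B1 where B1: "0 \<le> B1" "\<And>z. z \<in> {0..T} \<times> closure \<Omega> \<Longrightarrow> norm (fE z) \<le> B1"
    by (rule cylinder_bounded[OF smooth_fE], rule that)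
  obtain B2 where B2: "0 \<le> B2" "\<And>z. z \<in> {0..T} \<times> closure \<Omega> \<Longrightarrow> norm (pE z) \<le> B2"
    by (rule cylinder_bounded[OF smooth_pE], rule that)
  have 1: "integrable (lebesgue_on Q) (\<lambda>z. dens z * (vel z \<bullet> V z))"
  proof (rule integrable_dens_times[where b = B])
    show "(\<lambda>z. vel z \<bullet> V z) \<in> borel_measurable (lebesgue_on Q)"
      using vel_measurable smooth_measurable_Q[OF V] by measurable
    fix z assume z: "z \<in> Q"
    have "\<bar>vel z \<bullet> V z\<bar> \<le> B * norm (vel z)"
      by (rule inner_V_bound[OF z]) (use z B(2) Q_subset(1) in blast)
    also have "\<dots> \<le> B * (1 + (norm (vel z))\<^sup>2)" by (rule mult_left_mono[OF le_one_plus_power2 B(1)])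
    finally show "\<bar>vel z \<bullet> V z\<bar> \<le> B * (1 + (norm (vel z))\<^sup>2)" .
  qed
  have 2: "integrable (lebesgue_on Q) (\<lambda>z. dens z * fE z)"
  proof (rule integrable_dens_times[OF smooth_measurable_Q[OF smooth_fE], where b = B1])
    fix z assume z: "z \<in> Q"
    have "norm (fE z) \<le> B1" using z B1(2) Q_subset(1) by blast
    moreover have "0 \<le> B1 * (norm (vel z))\<^sup>2" using B1(1) by simp
    ultimately show "\<bar>fE z\<bar> \<le> B1 * (1 + (norm (vel z))\<^sup>2)"
      unfolding distrib_left real_norm_def by linarith
  qed
  have 3: "integrable (lebesgue_on Q) pE"
  proof (rule integrable_bounded_Q[OF smooth_measurable_Q[OF smooth_pE], where b = B2])
    fix z assume z: "z \<in> Q"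
    have "norm (pE z) \<le> B2" using z B2(2) Q_subset(1) by blast
    then show "\<bar>pE z\<bar> \<le> B2" by simp
  qed
  show ?thesis unfolding rel_eq
    using en_integrable 1 2 3 by (intro Bochner_Integration.integrable_add Bochner_Integration.integrable_diff)
qed

text \<open>Removing the cutoff costs the momentum in the layer. Splitting b |w| into a small
  multiple \<open>a\<close> of the energy and a constant \<open>A\<close> shows that momentum is
  small on sets of small volume, uniformly over bounded energies.\<close>

lemma initial_layer_estimate:
  assumes \<xi>: "smooth_in UNIV \<xi>" "\<And>x. 0 \<le> \<xi> x" "\<And>x. \<xi> x \<le> 1"
    and W: "open W" "W \<subseteq> \<Omega>" "\<And>x. x \<in> \<Omega> - W \<Longrightarrow> \<xi> x = 1"
    and B: "0 \<le> B" "\<And>z. z \<in> {0..T} \<times> closure \<Omega> \<Longrightarrow> norm (V z) \<le> B"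
    and A: "0 < a" "\<And>b w. 0 \<le> b \<Longrightarrow> b * norm w \<le> a * energy_density \<gamma> b w + A"
  shows "(LINT x|lebesgue_on \<Omega>. (\<rho>0 x *\<^sub>R u0 x) \<bullet> V (0, x)) - (LINT x|lebesgue_on \<Omega>. \<rho>0 x * (\<xi> x * (u0 x \<bullet> V (0, x)))) \<le>
    B * (a * E0 + A * measure lebesgue W)"
proof -
  have t0: "0 \<in> {0..T}" using T by simp
  have Wl: "W \<in> lmeasurable"
    using W bounded_subset[OF bounded_\<Omega> W(2)] by (simp add: bounded_set_imp_lmeasurable)
  have i1: "integrable (lebesgue_on \<Omega>) (\<lambda>x. (\<rho>0 x *\<^sub>R u0 x) \<bullet> V (0, x))"
    by (rule slice_inner_integrable[OF t0 V data_integrable(6)])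
  have i2: "integrable (lebesgue_on \<Omega>) (\<lambda>x. \<rho>0 x * (\<xi> x * (u0 x \<bullet> V (0, x))))"
    using slice_inner_integrable[OF t0 smooth_in_scaleR[OF frechet_cutoff(1)[OF \<xi>(1)] V] data_integrable(6)]
    by (simp add: mult.left_commute)
  have Wm: "W \<in> sets (lebesgue_on \<Omega>)" using Wl W(2) \<Omega>_sets by (auto simp: sets_restrict_space_iff)
  have iW: "integrable (lebesgue_on \<Omega>) (indicator W :: real^3 \<Rightarrow> real)"
    using Wm by (intro integrable_real_indicator) (auto simp: fin\<Omega>.emeasure_eq_measure)
  have LW: "(LINT x|lebesgue_on \<Omega>. indicator W x) = measure lebesgue W"
    using Wl W(2) \<Omega>_sets by (simp add: measure_restrict_space Int_absorb2)
  have "(LINT x|lebesgue_on \<Omega>. (\<rho>0 x *\<^sub>R u0 x) \<bullet> V (0, x)) - (LINT x|lebesgue_on \<Omega>. \<rho>0 x * (\<xi> x * (u0 x \<bullet> V (0, x)))) =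
      (LINT x|lebesgue_on \<Omega>. (\<rho>0 x *\<^sub>R u0 x) \<bullet> V (0, x) - \<rho>0 x * (\<xi> x * (u0 x \<bullet> V (0, x))))"
    using i1 i2 by simp
  also have "\<dots> \<le> (LINT x|lebesgue_on \<Omega>. B * (a * energy_density \<gamma> (\<rho>0 x) (u0 x) + A * indicator W x))"
  proof (rule integral_mono_AE)
    have "AE x in lebesgue_on \<Omega>. x \<in> \<Omega>" by (rule AE_I2) simp
    with data_integrable(1) show "AE x in lebesgue_on \<Omega>. (\<rho>0 x *\<^sub>R u0 x) \<bullet> V (0, x) - \<rho>0 x * (\<xi> x * (u0 x \<bullet> V (0, x))) \<le>
        B * (a * energy_density \<gamma> (\<rho>0 x) (u0 x) + A * indicator W x)"
    proof eventually_elim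
      case (elim x)
      have en: "0 \<le> B * (a * energy_density \<gamma> (\<rho>0 x) (u0 x))"
        using B(1) A(1) energy_density_nonneg[OF \<gamma> elim(1)] by simp
      show ?case
      proof (cases "x \<in> W")
        case False
        then show ?thesis using en elim W(3)[of x] by simp
      next
        case True
        have "norm (V (0, x)) \<le> B" using elim(2) closure_subset[of \<Omega>] T by (intro B(2)) auto
        then have V: "\<bar>u0 x \<bullet> V (0, x)\<bar> \<le> B * norm (u0 x)"
          using Cauchy_Schwarz_ineq2[of "u0 x" "V (0, x)"] mult_left_mono[of "norm (V (0, x))" B "norm (u0 x)"]
          by (simp add: mult.commute)
        have "(\<rho>0 x *\<^sub>R u0 x) \<bullet> V (0, x) - \<rho>0 x * (\<xi> x * (u0 x \<bullet> V (0, x))) = \<rho>0 x * ((1 - \<xi> x) * (u0 x \<bullet> V (0, x)))"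
          by (simp add: algebra_simps)
        also have "\<dots> \<le> \<rho>0 x * (1 * (B * norm (u0 x)))"
        proof (rule mult_left_mono[OF _ elim(1)])
          have "(1 - \<xi> x) * (u0 x \<bullet> V (0, x)) \<le> (1 - \<xi> x) * \<bar>u0 x \<bullet> V (0, x)\<bar>"
            using \<xi>(3)[of x] by (intro mult_left_mono) auto
          also have "\<dots> \<le> 1 * (B * norm (u0 x))"
            using \<xi>(2)[of x] \<xi>(3)[of x] V by (intro mult_mono) auto
          finally show "(1 - \<xi> x) * (u0 x \<bullet> V (0, x)) \<le> 1 * (B * norm (u0 x))" .
        qed
        also have "\<dots> = B * (\<rho>0 x * norm (u0 x))" by simp
        also have "\<dots> \<le> B * (a * energy_density \<gamma> (\<rho>0 x) (u0 x) + A)"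
          by (rule mult_left_mono[OF A(2)[OF elim(1)] B(1)])
        finally show ?thesis using True by simp
      qed
    qed
    show "integrable (lebesgue_on \<Omega>) (\<lambda>x. B * (a * energy_density \<gamma> (\<rho>0 x) (u0 x) + A * indicator W x))"
      using data_integrable(8) iW by (intro integrable_mult_right Bochner_Integration.integrable_add)
  qed (use i1 i2 in simp)
  also have "\<dots> = B * (a * E0 + A * measure lebesgue W)"
    using data_integrable(8) iW LW by (simp add: E0_def energy_eq)
  finally show ?thesis .
qed

text \<open>Each error term has one source. The terms with a E0 + A C0 \<nu> come from removing the
  cutoff in the momentum, once at time 0 and once under \<theta>'. Those with C1 are the crude bound
  of the balance in the layer, namely its volume and its kinetic energy. The term with sqrt \<nu> is
  the stress against \<xi> DV, the last one the stress against the gradient of \<xi>. The parameter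
  \<open>a\<close> stays free, to balance \<Lambda>/a against a.\<close>

lemma relative_energy_estimate:
  fixes \<theta> :: "real \<Rightarrow> real" and \<xi> :: "real^3 \<Rightarrow> real"
  defines "d\<theta> \<equiv> \<lambda>t. frechet_derivative \<theta> (at t) 1" and "Cs \<equiv> 2 * \<mu> + 3 * \<eta>"
  assumes \<theta>: "smooth_in UNIV \<theta>" "\<theta> 0 = 1" "\<theta> T = 0" "\<And>t. 0 \<le> \<theta> t" "\<And>t. t \<in> {0<..<T} \<Longrightarrow> \<theta> t \<le> 1" "\<And>t. d\<theta> t \<le> 0"
    and s: "s < T" "\<And>t. s \<le> t \<Longrightarrow> \<theta> t = 0"
    and LC: "layer_cutoff c C0 \<nu> \<xi> W" and c: "0 < c" and C0: "0 < C0"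
    and B1: "1 \<le> B"
    and BV: "\<And>z. z \<in> {0..T} \<times> closure \<Omega> \<Longrightarrow> norm (V z) \<le> B"
    and Bp: "\<And>z. z \<in> {0..T} \<times> closure \<Omega> \<Longrightarrow> \<bar>pE z\<bar> \<le> B"
    and Bf: "\<And>z. z \<in> {0..T} \<times> closure \<Omega> \<Longrightarrow> \<bar>fE z\<bar> \<le> B"
    and Bt: "\<And>z. z \<in> {0..T} \<times> closure \<Omega> \<Longrightarrow> \<bar>trV z\<bar> \<le> B"
    and BDV: "\<And>z w. z \<in> {0..T} \<times> closure \<Omega> \<Longrightarrow> norm (frechet_derivative V (at z) w) \<le> B * norm w"
    and BDp: "\<And>z w. z \<in> {0..T} \<times> closure \<Omega> \<Longrightarrow> \<bar>frechet_derivative pE (at z) w\<bar> \<le> B * norm w"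
    and BDf: "\<And>z w. z \<in> {0..T} \<times> closure \<Omega> \<Longrightarrow> \<bar>frechet_derivative fE (at z) w\<bar> \<le> B * norm w"
    and C1: "0 < C1"
    and G1: "\<And>z a w. z \<in> {0<..<T} \<times> \<Omega> \<Longrightarrow> 0 \<le> a \<Longrightarrow> balance z a w 1 0 0 \<le> C1 * rel_density \<gamma> a w (R z) (V z)"
    and G2: "\<And>z a w s dw dV \<delta>. z \<in> {0<..<T} \<times> \<Omega> \<Longrightarrow> 0 \<le> a \<Longrightarrow> 0 \<le> s \<Longrightarrow> s \<le> 1 \<Longrightarrow> 0 < \<delta> \<Longrightarrow> \<delta> \<le> 1 \<Longrightarrow>
      \<bar>dw\<bar> \<le> C0 / \<delta> * norm w \<Longrightarrow> \<bar>dV\<bar> \<le> C0 \<Longrightarrow>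
      balance z a w s dw dV \<le> C1 * (1 + rel_density \<gamma> a w (R z) (V z) + a * (norm w)\<^sup>2 / \<delta>)"
    and a: "0 < a" and A: "0 \<le> A" "\<And>b w. 0 \<le> b \<Longrightarrow> b * norm w \<le> a * energy_density \<gamma> b w + A"
    and L: "layer_integral c \<le> ennreal \<Lambda>" "0 \<le> \<Lambda>"
  shows "(LINT z|lebesgue_on Q. (- d\<theta> (fst z) - C1 * \<theta> (fst z)) * rel z) \<le>
    E0_rel + 2 * (B * (a * E0 + A * (C0 * \<nu>))) + C1 * (T * (C0 * \<nu>) + c\<^sup>2 * \<Lambda>) +
    9 * B * sqrt \<nu> * (Cs * E0 + measure lebesgue Q) + 9 * B * C0 * Cs * (\<Lambda> / a + a * (T * C0))"
proof -
  have Wprops: "open W" "W \<subseteq> boundary_layer \<Omega> (c * \<nu>)" "measure lebesgue W \<le> C0 * \<nu>"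
    using LC unfolding layer_cutoff_def by - (elim conjE, assumption)+
  have \<xi>: "smooth_in UNIV \<xi>" "\<And>x. 0 \<le> \<xi> x" "\<And>x. \<xi> x \<le> 1"
    and off: "\<And>x. x \<in> \<Omega> - W \<Longrightarrow> \<xi> x = 1" "\<And>x v. x \<in> \<Omega> - W \<Longrightarrow> frechet_derivative \<xi> (at x) v = 0"
    and on: "\<And>x v. x \<in> W \<Longrightarrow> \<bar>frechet_derivative \<xi> (at x) v\<bar> \<le> C0 / \<nu> * norm v"
      "\<And>x t. x \<in> W \<Longrightarrow> t \<in> {0..T} \<Longrightarrow> \<bar>frechet_derivative \<xi> (at x) (V (t, x))\<bar> \<le> C0"
    and ex: "\<exists>K. compact K \<and> K \<subseteq> \<Omega> \<and> (\<forall>x\<in>\<Omega> - K. \<xi> x = 0)"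
    using LC unfolding layer_cutoff_def by simp_all
  obtain K where K: "compact K" "K \<subseteq> \<Omega>" "\<And>x. x \<in> \<Omega> - K \<Longrightarrow> \<xi> x = 0"
    using ex by blast
  have W\<Omega>: "W \<subseteq> \<Omega>" using Wprops(2) by (auto simp: boundary_layer_def)
  have B0: "0 \<le> B" using B1 by linarith
  have Cs: "0 \<le> Cs" using \<mu> \<eta> by (simp add: Cs_def)
  have QK: "z \<in> {0..T} \<times> closure \<Omega>" if "z \<in> Q" for z using that Q_subset(1) by blast
  have D\<xi>: "\<bar>frechet_derivative \<xi> (at (snd z)) w\<bar> \<le> C0 / \<nu> * norm w" if "z \<in> Q" for z w
  proof (cases "snd z \<in> W")
    case False
    then have "frechet_derivative \<xi> (at (snd z)) w = 0" using Q_point(3)[OF that] by (intro off(2)) blast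
    then show ?thesis using C0 \<nu> by simp
  qed (rule on(1))
  have sV: "smooth_in UNIV (\<lambda>t. frechet_derivative \<theta> (at t) 1)" by (rule smooth_in_frechet_derivative[OF \<theta>(1)])
  have \<theta>c: "continuous_on UNIV \<theta>" and d\<theta>c: "continuous_on UNIV d\<theta>" "continuous_on UNIV (\<lambda>t. - d\<theta> t)"
    using smooth_in_continuous_on[OF \<theta>(1) subset_refl] smooth_in_continuous_on[OF sV subset_refl]
    by (auto simp: d\<theta>_def intro: continuous_on_minus)
  obtain b where b: "0 \<le> b" "\<And>t. t \<in> {0<..<T} \<Longrightarrow> \<bar>d\<theta> t\<bar> \<le> b"
    by (rule continuous_bounded_time[OF d\<theta>c(1)], rule that)
  have \<theta>1: "\<bar>\<theta> (fst z) * x\<bar> \<le> \<bar>x\<bar>" if "z \<in> Q" for z x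
    using \<theta>(4)[of "fst z"] \<theta>(5)[OF Q_point(2)[OF that]] mult_right_mono[of "\<theta> (fst z)" 1 "\<bar>x\<bar>"] by (simp add: abs_mult)
  have d\<theta>1: "\<bar>d\<theta> (fst z) * x\<bar> \<le> b * \<bar>x\<bar>" if "z \<in> Q" for z x
    using b(2)[OF Q_point(2)[OF that]] by (simp add: abs_mult mult_right_mono)
  have \<xi>1: "\<bar>\<xi> y * x\<bar> \<le> \<bar>x\<bar>" for y x
    using \<xi>(2)[of y] \<xi>(3)[of y] mult_right_mono[of "\<xi> y" 1 "\<bar>x\<bar>"] by (simp add: abs_mult)
  note meas_time = fst_measurable_Q[OF \<theta>c] fst_measurable_Q[OF d\<theta>c(1)]
  have meas_\<xi>: "(\<lambda>z. \<xi> (snd z)) \<in> borel_measurable (lebesgue_on Q)"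
    by (rule smooth_measurable_Q[OF frechet_cutoff(1)[OF \<xi>(1)]])
  have meas_D\<xi>: "(\<lambda>z. frechet_derivative \<xi> (at (snd z)) (h z)) \<in> borel_measurable (lebesgue_on Q)"
    if h: "h \<in> borel_measurable (lebesgue_on Q)" for h
  proof -
    have "(\<lambda>z. (0::real, h z)) \<in> borel_measurable (lebesgue_on Q)" using h by (intro borel_measurable_Pair) auto
    from derivative_measurable_Q[OF frechet_cutoff(1)[OF \<xi>(1)] this] show ?thesis
      by (simp add: frechet_derivative_eqI[OF frechet_cutoff(2)[OF \<xi>(1)]])
  qed
  have pair: "(\<lambda>z. (0::real, vel z)) \<in> borel_measurable (lebesgue_on Q)" "(\<lambda>z. (0::real, V z)) \<in> borel_measurable (lebesgue_on Q)"
    using vel_measurable smooth_measurable_Q[OF V] by (auto intro!: borel_measurable_Pair)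
  note meas_sm = smooth_measurable_Q[OF V] smooth_measurable_Q[OF smooth_fE] smooth_measurable_Q[OF smooth_pE]
    smooth_measurable_Q[OF smooth_trV] smooth_measurable_Q[OF smooth_in_frechet_derivative[OF V, of "(1, 0)"]]
    smooth_measurable_Q[OF smooth_in_frechet_derivative[OF smooth_fE, of "(1, 0)"]]
    smooth_measurable_Q[OF smooth_in_frechet_derivative[OF smooth_pE, of "(1, 0)"]]
    derivative_measurable_Q[OF V pair(1)] derivative_measurable_Q[OF smooth_fE pair(1)]
    derivative_measurable_Q[OF smooth_pE pair(2)] meas_D\<xi>[OF vel_measurable] meas_D\<xi>[OF smooth_measurable_Q[OF V]]
    meas_\<xi> meas_time vel_measurable dens_measurable
  define J where "J z = matrix (\<lambda>w. \<xi> (snd z) *\<^sub>R frechet_derivative V (at z) (0, w) +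
          frechet_derivative \<xi> (at (snd z)) w *\<^sub>R V z)" for z
  define F where "F z = \<xi> (snd z) *\<^sub>R V z" for z
  have sF: "smooth_in N F"
    unfolding F_def[abs_def] by (rule smooth_in_scaleR[OF frechet_cutoff(1)[OF \<xi>(1)] V])
  have meas_J: "J \<in> borel_measurable (lebesgue_on Q)"
  proof (rule continuous_measurable_Q)
    have eq: "J z = (\<chi> i j. frechet_derivative F (at z) (0, axis j 1) $ i)" if "z \<in> Q" for z
    proof -
      have "(F has_derivative (\<lambda>w. \<xi> (snd z) *\<^sub>R frechet_derivative V (at z) w +
          frechet_derivative \<xi> (at (snd z)) (snd w) *\<^sub>R V z)) (at z)"
        unfolding F_def[abs_def]
        by (rule has_derivative_scaleR[OF frechet_cutoff(2)[OF \<xi>(1)] smooth_in_has_derivative[OF V Q_point(1)[OF that]]])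
      then show ?thesis by (simp add: J_def matrix_def frechet_derivative_eqI)
    qed
    have "continuous_on Q (\<lambda>z. \<chi> i j. frechet_derivative F (at z) (0, axis j 1) $ i)"
      by (intro continuous_on_vec_lambda continuous_on_component
          smooth_in_continuous_on[OF smooth_in_frechet_derivative[OF sF] Q_subset(2)])
    then show "continuous_on Q J" using eq by (simp cong: continuous_on_cong)
  qed
  have J_bound: "norm (J z) \<le> 9 * (B + C0 / \<nu> * B)" if z: "z \<in> Q" for z
    unfolding J_def
  proof (rule norm_matrix_le)
    fix w
    have "norm (\<xi> (snd z) *\<^sub>R frechet_derivative V (at z) (0, w)) \<le> 1 * (B * norm w)"
      using \<xi> BDV[OF QK[OF z], of "(0, w)"] unfolding norm_scaleR
      by (intro mult_mono) (auto simp: norm_Pair)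
    moreover have "norm (frechet_derivative \<xi> (at (snd z)) w *\<^sub>R V z) \<le> (C0 / \<nu> * norm w) * B"
      using D\<xi>[OF z, of w] BV[OF QK[OF z]] C0 \<nu> unfolding norm_scaleR by (intro mult_mono) auto
    ultimately show "norm (\<xi> (snd z) *\<^sub>R frechet_derivative V (at z) (0, w) + frechet_derivative \<xi> (at (snd z)) w *\<^sub>R V z)
        \<le> (B + C0 / \<nu> * B) * norm w"
      using norm_triangle_ineq[of "\<xi> (snd z) *\<^sub>R frechet_derivative V (at z) (0, w)" "frechet_derivative \<xi> (at (snd z)) w *\<^sub>R V z"]
      by (simp add: algebra_simps)
  qed
  \<comment> \<open>Off the layer the gradient of the cutoff is absent, and with it the factor
    1/\<nu>.\<close>
  have J_bound_off: "norm (J z) \<le> 9 * B" if z: "z \<in> Q" "snd z \<notin> W" for z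
    unfolding J_def
  proof (rule norm_matrix_le)
    fix w
    have "snd z \<in> \<Omega> - W" using Q_point(3)[OF z(1)] z(2) by blast
    then show "norm (\<xi> (snd z) *\<^sub>R frechet_derivative V (at z) (0, w) + frechet_derivative \<xi> (at (snd z)) w *\<^sub>R V z)
        \<le> B * norm w"
      using BDV[OF QK[OF z(1)], of "(0, w)"] by (simp add: off norm_Pair)
  qed
  have DV1: "\<bar>w \<bullet> frechet_derivative V (at z) h\<bar> \<le> B * norm h * norm w" if "z \<in> Q" for z w h
    using Cauchy_Schwarz_ineq2[of w "frechet_derivative V (at z) h"]
      mult_left_mono[OF BDV[OF QK[OF that], of h], of "norm w"] by (simp add: mult_ac)
  \<comment> \<open>Here begin the integrands of four identities: the continuity equation, the
    momentum equation, and the Euler pressure in time and in space.\<close>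
  define Ic where "Ic z = d\<theta> (fst z) * (dens z * fE z) +
      \<theta> (fst z) * (dens z * (frechet_derivative fE (at z) (1, 0) + frechet_derivative fE (at z) (0, vel z)))" for z
  define Im where "Im z = d\<theta> (fst z) * (dens z * (\<xi> (snd z) * (vel z \<bullet> V z))) +
      \<theta> (fst z) * (dens z * (\<xi> (snd z) * (vel z \<bullet> frechet_derivative V (at z) (1, 0))) +
        dens z * (frechet_derivative \<xi> (at (snd z)) (vel z) * (vel z \<bullet> V z) +
          \<xi> (snd z) * (vel z \<bullet> frechet_derivative V (at z) (0, vel z))) +
        dens z powr \<gamma> * (frechet_derivative \<xi> (at (snd z)) (V z) + \<xi> (snd z) * trV z) -
        \<nu> * (stress \<mu> \<eta> (nab z) \<bullet> J z))" for z
  define Ip where "Ip z = d\<theta> (fst z) * pE z + \<theta> (fst z) * frechet_derivative pE (at z) (1, 0)" for z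
  define Id where "Id z = \<theta> (fst z) * (frechet_derivative \<xi> (at (snd z)) (V z) * pE z +
      \<xi> (snd z) * (frechet_derivative pE (at z) (0, V z) + pE z * trV z))" for z
  have LIc: "(LINT z|lebesgue_on Q. Ic z) = - (LINT x|lebesgue_on \<Omega>. \<rho>0 x * fE (0, x))"
    unfolding Ic_def d\<theta>_def by (rule continuity_identity[OF \<theta>(1-3)])
  have LIm: "(LINT z|lebesgue_on Q. Im z) = - (LINT x|lebesgue_on \<Omega>. \<rho>0 x * (\<xi> x * (u0 x \<bullet> V (0, x))))"
    unfolding Im_def d\<theta>_def J_def by (rule momentum_identity[OF \<theta>(1-3) \<xi>(1) K])
  have LIp: "(LINT z|lebesgue_on Q. Ip z) = - (LINT x|lebesgue_on \<Omega>. pE (0, x))"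
    unfolding Ip_def d\<theta>_def Q_def by (rule pressure_time_identity[OF \<theta>(1-3)])
  have LId: "(LINT z|lebesgue_on Q. Id z) = 0"
    unfolding Id_def Q_def by (rule pressure_space_identity[OF \<theta>(1) \<xi>(1) K])
  have n1: "norm (vel z) \<le> 1 + (norm (vel z))\<^sup>2" for z by (rule le_one_plus_power2)
  have IIc: "integrable (lebesgue_on Q) Ic"
  proof -
    have "integrable (lebesgue_on Q) (\<lambda>z. dens z * (d\<theta> (fst z) * fE z +
      \<theta> (fst z) * (frechet_derivative fE (at z) (1, 0) + frechet_derivative fE (at z) (0, vel z))))"
    proof (rule integrable_dens_times[where b = "b * B + B + B"])
      show "(\<lambda>z. d\<theta> (fst z) * fE z +
          \<theta> (fst z) * (frechet_derivative fE (at z) (1, 0) + frechet_derivative fE (at z) (0, vel z))) \<in> borel_measurable (lebesgue_on Q)"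
        using meas_sm by measurable
      fix z assume z: "z \<in> Q"
      let ?n = "1 + (norm (vel z))\<^sup>2"
      have "\<bar>d\<theta> (fst z) * fE z\<bar> \<le> b * B"
        by (rule order_trans[OF d\<theta>1[OF z] mult_left_mono[OF Bf[OF QK[OF z]] b(1)]])
      moreover have "\<bar>\<theta> (fst z) * (frechet_derivative fE (at z) (1, 0) + frechet_derivative fE (at z) (0, vel z))\<bar> \<le> B + B * norm (vel z)"
        using \<theta>1[OF z, of "frechet_derivative fE (at z) (1, 0) + frechet_derivative fE (at z) (0, vel z)"]
          BDf[OF QK[OF z], of "(1, 0)"] BDf[OF QK[OF z], of "(0, vel z)"] by (simp add: norm_Pair)
      moreover have "B * norm (vel z) \<le> B * ?n" by (rule mult_left_mono[OF n1 B0])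
      moreover have "b * B \<le> b * B * ?n" "B \<le> B * ?n"
        using b(1) B0 by (auto simp: distrib_left)
      ultimately show "\<bar>d\<theta> (fst z) * fE z + \<theta> (fst z) * (frechet_derivative fE (at z) (1, 0) + frechet_derivative fE (at z) (0, vel z))\<bar>
          \<le> (b * B + B + B) * ?n"
        unfolding distrib_right[of _ _ ?n] by linarith
    qed
    moreover have "Ic = (\<lambda>z. dens z * (d\<theta> (fst z) * fE z +
      \<theta> (fst z) * (frechet_derivative fE (at z) (1, 0) + frechet_derivative fE (at z) (0, vel z))))"
      by (rule ext) (simp add: Ic_def algebra_simps)
    ultimately show ?thesis by simp
  qed
  have IIm: "integrable (lebesgue_on Q) Im"
  proof -
    let ?X = "\<lambda>z. d\<theta> (fst z) * (\<xi> (snd z) * (vel z \<bullet> V z)) + \<theta> (fst z) * (\<xi> (snd z) * (vel z \<bullet> frechet_derivative V (at z) (1, 0)) +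
        (frechet_derivative \<xi> (at (snd z)) (vel z) * (vel z \<bullet> V z) + \<xi> (snd z) * (vel z \<bullet> frechet_derivative V (at z) (0, vel z))))"
    let ?P = "\<lambda>z. \<theta> (fst z) * (frechet_derivative \<xi> (at (snd z)) (V z) + \<xi> (snd z) * trV z)"
    have 1: "integrable (lebesgue_on Q) (\<lambda>z. dens z * ?X z)"
    proof (rule integrable_dens_times[where b = "b * B + B + C0 / \<nu> * B + B"])
      show "?X \<in> borel_measurable (lebesgue_on Q)" using meas_sm by measurable
      fix z assume z: "z \<in> Q"
      let ?n = "1 + (norm (vel z))\<^sup>2"
      have vV: "\<bar>vel z \<bullet> V z\<bar> \<le> B * norm (vel z)" by (rule inner_V_bound[OF z BV[OF QK[OF z]]])
      have "\<bar>d\<theta> (fst z) * (\<xi> (snd z) * (vel z \<bullet> V z))\<bar> \<le> b * (B * norm (vel z))"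
        by (rule order_trans[OF d\<theta>1[OF z] mult_left_mono[OF order_trans[OF \<xi>1 vV] b(1)]])
      also have "\<dots> \<le> b * (B * ?n)" by (rule mult_left_mono[OF mult_left_mono[OF n1 B0] b(1)])
      finally have x1: "\<bar>d\<theta> (fst z) * (\<xi> (snd z) * (vel z \<bullet> V z))\<bar> \<le> b * B * ?n" by (simp add: mult.assoc)
      have "\<bar>\<xi> (snd z) * (vel z \<bullet> frechet_derivative V (at z) (1, 0))\<bar> \<le> B * norm (vel z)"
        using order_trans[OF \<xi>1 DV1[OF z, of "vel z" "(1, 0)"]] by (simp add: norm_Pair)
      also have "\<dots> \<le> B * ?n" by (rule mult_left_mono[OF n1 B0])
      finally have x2: "\<bar>\<xi> (snd z) * (vel z \<bullet> frechet_derivative V (at z) (1, 0))\<bar> \<le> B * ?n" .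
      have "\<bar>\<xi> (snd z) * (vel z \<bullet> frechet_derivative V (at z) (0, vel z))\<bar> \<le> B * (norm (vel z))\<^sup>2"
        using order_trans[OF \<xi>1 DV1[OF z, of "vel z" "(0, vel z)"]] by (simp add: norm_Pair power2_eq_square mult.assoc)
      also have "\<dots> \<le> B * ?n" using B0 by (intro mult_left_mono) auto
      finally have x3: "\<bar>\<xi> (snd z) * (vel z \<bullet> frechet_derivative V (at z) (0, vel z))\<bar> \<le> B * ?n" .
      have "\<bar>frechet_derivative \<xi> (at (snd z)) (vel z) * (vel z \<bullet> V z)\<bar> \<le> (C0 / \<nu> * norm (vel z)) * (B * norm (vel z))"
        unfolding abs_mult using D\<xi>[OF z, of "vel z"] vV C0 \<nu> by (intro mult_mono) auto
      also have "\<dots> = C0 / \<nu> * B * (norm (vel z))\<^sup>2" by (simp add: power2_eq_square)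
      also have "\<dots> \<le> C0 / \<nu> * B * ?n" using B0 C0 \<nu> by (intro mult_left_mono) auto
      finally have x4: "\<bar>frechet_derivative \<xi> (at (snd z)) (vel z) * (vel z \<bullet> V z)\<bar> \<le> C0 / \<nu> * B * ?n" .
      have "\<bar>?X z\<bar> \<le> \<bar>d\<theta> (fst z) * (\<xi> (snd z) * (vel z \<bullet> V z))\<bar> + \<bar>\<xi> (snd z) * (vel z \<bullet> frechet_derivative V (at z) (1, 0)) +
        (frechet_derivative \<xi> (at (snd z)) (vel z) * (vel z \<bullet> V z) + \<xi> (snd z) * (vel z \<bullet> frechet_derivative V (at z) (0, vel z)))\<bar>"
        by (rule order_trans[OF abs_triangle_ineq add_left_mono[OF \<theta>1[OF z]]])
      then show "\<bar>?X z\<bar> \<le> (b * B + B + C0 / \<nu> * B + B) * ?n"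
        unfolding distrib_right[of _ _ ?n] using x1 x2 x3 x4 by linarith
    qed
    have 2: "integrable (lebesgue_on Q) (\<lambda>z. dens z powr \<gamma> * ?P z)"
    proof (rule integrable_pressure_times[where b = "C0 / \<nu> * B + B"])
      show "?P \<in> borel_measurable (lebesgue_on Q)" using meas_sm by measurable
      fix z assume z: "z \<in> Q"
      have "\<bar>frechet_derivative \<xi> (at (snd z)) (V z)\<bar> \<le> C0 / \<nu> * B"
        using D\<xi>[OF z, of "V z"] mult_left_mono[OF BV[OF QK[OF z]], of "C0 / \<nu>"] C0 \<nu> by simp
      then show "\<bar>?P z\<bar> \<le> C0 / \<nu> * B + B"
        using \<theta>1[OF z, of "frechet_derivative \<xi> (at (snd z)) (V z) + \<xi> (snd z) * trV z"]
          \<xi>1[of "snd z" "trV z"] Bt[OF QK[OF z]] by linarith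
    qed
    have 3: "integrable (lebesgue_on Q) (\<lambda>z. \<theta> (fst z) * (stress \<mu> \<eta> (nab z) \<bullet> J z))"
      by (rule integrable_time_times[OF \<theta>c integrable_stress_inner[OF meas_J J_bound]])
    have "integrable (lebesgue_on Q) (\<lambda>z. dens z * ?X z + dens z powr \<gamma> * ?P z - \<nu> * (\<theta> (fst z) * (stress \<mu> \<eta> (nab z) \<bullet> J z)))"
      using 1 2 3 by (intro Bochner_Integration.integrable_add Bochner_Integration.integrable_diff integrable_mult_right)
    moreover have "Im = (\<lambda>z. dens z * ?X z + dens z powr \<gamma> * ?P z - \<nu> * (\<theta> (fst z) * (stress \<mu> \<eta> (nab z) \<bullet> J z)))"
      by (rule ext) (simp add: Im_def algebra_simps)
    ultimately show ?thesis by simp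
  qed
  have IIp: "integrable (lebesgue_on Q) Ip"
  proof (rule integrable_bounded_Q[where b = "b * B + B"])
    show "Ip \<in> borel_measurable (lebesgue_on Q)" unfolding Ip_def[abs_def] using meas_sm by measurable
    fix z assume z: "z \<in> Q"
    have "\<bar>d\<theta> (fst z) * pE z\<bar> \<le> b * B"
      by (rule order_trans[OF d\<theta>1[OF z] mult_left_mono[OF Bp[OF QK[OF z]] b(1)]])
    then show "\<bar>Ip z\<bar> \<le> b * B + B"
      using \<theta>1[OF z, of "frechet_derivative pE (at z) (1, 0)"] BDp[OF QK[OF z], of "(1, 0)"]
      by (simp add: Ip_def norm_Pair)
  qed
  have IId: "integrable (lebesgue_on Q) Id"
  proof (rule integrable_bounded_Q[where b = "C0 / \<nu> * B * B + (B * B + B * B)"])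
    show "Id \<in> borel_measurable (lebesgue_on Q)" unfolding Id_def[abs_def] using meas_sm by measurable
    fix z assume z: "z \<in> Q"
    have "\<bar>frechet_derivative \<xi> (at (snd z)) (V z)\<bar> \<le> C0 / \<nu> * B"
      using D\<xi>[OF z, of "V z"] mult_left_mono[OF BV[OF QK[OF z]], of "C0 / \<nu>"] C0 \<nu> by simp
    then have y1: "\<bar>frechet_derivative \<xi> (at (snd z)) (V z) * pE z\<bar> \<le> C0 / \<nu> * B * B"
      unfolding abs_mult using Bp[OF QK[OF z]] C0 \<nu> B0 by (intro mult_mono) auto
    have y2: "\<bar>frechet_derivative pE (at z) (0, V z)\<bar> \<le> B * B"
      using BDp[OF QK[OF z], of "(0, V z)"] mult_left_mono[OF BV[OF QK[OF z]] B0] by (simp add: norm_Pair)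
    have y3: "\<bar>pE z * trV z\<bar> \<le> B * B"
      unfolding abs_mult using Bp[OF QK[OF z]] Bt[OF QK[OF z]] B0 by (intro mult_mono) auto
    show "\<bar>Id z\<bar> \<le> C0 / \<nu> * B * B + (B * B + B * B)"
      unfolding Id_def
      using \<theta>1[OF z, of "frechet_derivative \<xi> (at (snd z)) (V z) * pE z +
          \<xi> (snd z) * (frechet_derivative pE (at z) (0, V z) + pE z * trV z)"]
        \<xi>1[of "snd z" "frechet_derivative pE (at z) (0, V z) + pE z * trV z"] y1 y2 y3 by linarith
  qed
  let ?i = "\<lambda>z::real \<times> (real^3). indicator W (snd z) :: real"
  let ?S = "\<lambda>z. stress \<mu> \<eta> (nab z) \<bullet> nab z"
  \<comment> \<open>Five quantities with known bounds for their integrals: energy under -\<theta>',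
    layer volume under -\<theta>', layer kinetic energy over \<nu>, weighted dissipation, and \<nu>
    times the squared gradient in the layer.\<close>
  define X1 where "X1 z = - d\<theta> (fst z) * en z" for z
  define X2 where "X2 z = - d\<theta> (fst z) * ?i z" for z
  define X3 where "X3 z = ?i z * (dens z * (norm (vel z))\<^sup>2 / \<nu>)" for z
  define X4 where "X4 z = \<theta> (fst z) * ?S z" for z
  define X5 where "X5 z = ?i z * (\<nu> * (norm (nab z))\<^sup>2)" for z
  define M5 where "M5 = 9 * B * C0 * Cs"
  define M4 where "M4 = 9 * B * sqrt \<nu>"
  have M45: "0 \<le> M4" "0 \<le> M5" using B0 C0 Cs \<nu> by (auto simp: M4_def M5_def)
  \<comment> \<open>A majorant of the left integrand, built from terms whose integrals are either
    evaluated by the four identities or bounded.\<close>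
  define Y where "Y z = (1 + B * a) * X1 z - (Ic z - Im z + Ip z + Id z) + C1 * (?i z + X3 z) + B * A * X2 z +
      M4 * (Cs * (\<nu> * X4 z) + 1) + M5 * (X5 z / a + a / \<nu> * ?i z)" for z
  have d\<theta>0: "0 \<le> - d\<theta> t" for t using \<theta>(6)[of t] by simp
  have pointwise: "(- d\<theta> (fst z) - C1 * \<theta> (fst z)) * rel z \<le> Y z" if z: "z \<in> Q" and d: "0 \<le> dens z" for z
  proof -
    define bal where "bal = balance z (dens z) (vel z) (\<xi> (snd z)) (frechet_derivative \<xi> (at (snd z)) (vel z)) (frechet_derivative \<xi> (at (snd z)) (V z))"
    define SJ where "SJ = stress \<mu> \<eta> (nab z) \<bullet> J z"
    have zQ: "z \<in> {0<..<T} \<times> \<Omega>" using z by (simp add: Q_def)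
    have \<theta>5: "\<theta> (fst z) \<le> 1" by (rule \<theta>(5)[OF Q_point(2)[OF z]])
    have r0: "0 \<le> R z" using Rpos[OF Q_point(1)[OF z]] by simp
    have rel0: "0 \<le> rel z" by (rule rel_density_nonneg[OF \<gamma> d r0])
    have en0: "0 \<le> en z" by (rule energy_density_nonneg[OF \<gamma> d])
    have S0: "0 \<le> ?S z" by (rule stress_bounds(1)[OF \<mu> \<eta>])
    \<comment> \<open>In this combination the terms with \<theta> assemble into
      \<open>balance\<close> and the stress term. Those with \<theta>' form the relative energy
      without its energy density and with the cutoff still on the momentum.\<close>
    have sum: "Ic z - Im z + Ip z + Id z = d\<theta> (fst z) * (dens z * fE z - \<xi> (snd z) * (dens z * (vel z \<bullet> V z)) + pE z) +
        \<theta> (fst z) * bal + \<theta> (fst z) * (\<nu> * SJ)"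
      by (simp add: Ic_def Im_def Ip_def Id_def bal_def balance_def SJ_def algebra_simps)
    \<comment> \<open>The missing energy density is supplied by \<open>X1\<close>, and the cutoff on
      the momentum is undone in the last term.\<close>
    have split: "(- d\<theta> (fst z) - C1 * \<theta> (fst z)) * rel z = X1 z - (Ic z - Im z + Ip z + Id z) +
        (\<theta> (fst z) * bal - C1 * \<theta> (fst z) * rel z) + \<theta> (fst z) * (\<nu> * SJ) +
        d\<theta> (fst z) * ((1 - \<xi> (snd z)) * (dens z * (vel z \<bullet> V z)))"
      unfolding sum X1_def left_diff_distrib unfolding rel_eq by (simp add: algebra_simps)
    have b1: "\<theta> (fst z) * bal - C1 * \<theta> (fst z) * rel z \<le> C1 * (?i z + X3 z)"
    proof (cases "snd z \<in> W")
      case False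
      then have o: "snd z \<in> \<Omega> - W" using Q_point(3)[OF z] by blast
      have "bal \<le> C1 * rel z"
        unfolding bal_def off(1)[OF o] off(2)[OF o] by (rule G1[OF zQ d])
      then have "\<theta> (fst z) * bal \<le> \<theta> (fst z) * (C1 * rel z)" by (rule mult_left_mono[OF _ \<theta>(4)])
      then show ?thesis using False by (simp add: X3_def mult_ac)
    next
      case True
      have tz: "fst z \<in> {0..T}" using Q_point(2)[OF z] by auto
      have "bal \<le> C1 * (1 + rel z + dens z * (norm (vel z))\<^sup>2 / \<nu>)"
        unfolding bal_def
        by (rule G2[OF zQ d \<xi>(2,3) \<nu>(1) _ on(1)[OF True]]) (use \<nu> on(2)[OF True tz] in auto)
      then have "\<theta> (fst z) * bal \<le> \<theta> (fst z) * (C1 * (1 + rel z + dens z * (norm (vel z))\<^sup>2 / \<nu>))"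
        by (rule mult_left_mono[OF _ \<theta>(4)])
      also have "\<dots> = C1 * \<theta> (fst z) * rel z + \<theta> (fst z) * (C1 * (1 + dens z * (norm (vel z))\<^sup>2 / \<nu>))"
        by (simp add: algebra_simps)
      also have "\<theta> (fst z) * (C1 * (1 + dens z * (norm (vel z))\<^sup>2 / \<nu>)) \<le> C1 * (1 + dens z * (norm (vel z))\<^sup>2 / \<nu>)"
        using C1 d \<nu> by (intro mult_left_le_one_le \<theta>(4) \<theta>5) auto
      finally show ?thesis using True by (simp add: X3_def)
    qed
    have b2: "d\<theta> (fst z) * ((1 - \<xi> (snd z)) * (dens z * (vel z \<bullet> V z))) \<le> B * a * X1 z + B * A * X2 z"
    proof (cases "snd z \<in> W")
      case False
      then have o: "snd z \<in> \<Omega> - W" using Q_point(3)[OF z] by blast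
      have "0 \<le> B * a * X1 z" unfolding X1_def using B0 a d\<theta>0[of "fst z"] en0 by (intro mult_nonneg_nonneg) auto
      then show ?thesis using False off(1)[OF o] by (simp add: X2_def)
    next
      case True
      have "\<bar>(1 - \<xi> (snd z)) * (dens z * (vel z \<bullet> V z))\<bar> \<le> 1 * (dens z * (B * norm (vel z)))"
        unfolding abs_mult using \<xi>(2)[of "snd z"] \<xi>(3)[of "snd z"] d inner_V_bound[OF z BV[OF QK[OF z]], of "vel z"] B0
        by (intro mult_mono) auto
      also have "\<dots> = B * (dens z * norm (vel z))" by simp
      also have "\<dots> \<le> B * (a * en z + A)" by (rule mult_left_mono[OF A(2)[OF d] B0])
      finally have "- ((1 - \<xi> (snd z)) * (dens z * (vel z \<bullet> V z))) \<le> B * (a * en z + A)" by linarith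
      from mult_left_mono[OF this d\<theta>0[of "fst z"]] show ?thesis
        using True by (simp add: X1_def X2_def algebra_simps)
    qed
    have b3: "\<theta> (fst z) * (\<nu> * SJ) \<le> M4 * (Cs * (\<nu> * X4 z) + 1) + M5 * (X5 z / a + a / \<nu> * ?i z)"
    proof -
      define n where "n = norm (stress \<mu> \<eta> (nab z))"
      have n0: "0 \<le> n" by (simp add: n_def)
      have nS: "n\<^sup>2 \<le> Cs * ?S z" unfolding n_def Cs_def by (rule stress_bounds(2)[OF \<mu> \<eta>])
      have ng: "n \<le> Cs * norm (nab z)" unfolding n_def Cs_def by (rule stress_bounds(3)[OF \<mu> \<eta>])
      have Jb: "norm (J z) \<le> 9 * B + ?i z * (9 * (C0 / \<nu> * B))"
        using J_bound[OF z] J_bound_off[OF z] by (cases "snd z \<in> W") (auto simp: algebra_simps)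
      have "SJ \<le> n * norm (J z)" unfolding SJ_def n_def by (rule norm_cauchy_schwarz)
      also have "\<dots> \<le> n * (9 * B + ?i z * (9 * (C0 / \<nu> * B)))" by (rule mult_left_mono[OF Jb n0])
      finally have "\<theta> (fst z) * (\<nu> * SJ) \<le> \<theta> (fst z) * (\<nu> * (n * (9 * B + ?i z * (9 * (C0 / \<nu> * B)))))"
        using \<nu> by (intro mult_left_mono \<theta>(4)) auto
      also have "\<dots> = 9 * B * (\<theta> (fst z) * (\<nu> * n)) + 9 * B * C0 * (\<theta> (fst z) * (?i z * n))"
        using \<nu> by (simp add: algebra_simps)
      also have "9 * B * (\<theta> (fst z) * (\<nu> * n)) \<le> M4 * (Cs * (\<nu> * X4 z) + 1)"
      proof -
        \<comment> \<open>Young's inequality at the scale sqrt \<nu> splits \<nu> n into \<nu> n^2,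
          which the dissipation controls, and a constant, both with the vanishing factor sqrt
          \<nu>.\<close>
        define q where "q = sqrt \<nu>"
        have q: "0 < q" "q * q = \<nu>" using \<nu> by (auto simp: q_def)
        have "\<nu> * n \<le> q * (\<nu> * n\<^sup>2 + 1)"
        proof -
          have "q * n \<le> (q * n)\<^sup>2 + 1" using le_one_plus_power2[of "q * n"] by simp
          then have "q * (q * n) \<le> q * ((q * n)\<^sup>2 + 1)" using q(1) by (intro mult_left_mono) auto
          then show ?thesis by (simp add: q(2)[symmetric] power2_eq_square mult_ac)
        qed
        also have "\<dots> \<le> q * (\<nu> * (Cs * ?S z) + 1)" using q \<nu> nS by (intro mult_left_mono add_right_mono) auto
        finally have "\<theta> (fst z) * (\<nu> * n) \<le> \<theta> (fst z) * (q * (\<nu> * (Cs * ?S z) + 1))" by (rule mult_left_mono[OF _ \<theta>(4)])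
        also have "\<dots> = q * (Cs * (\<nu> * X4 z)) + \<theta> (fst z) * q" by (simp add: X4_def algebra_simps)
        also have "\<theta> (fst z) * q \<le> q" using q by (intro mult_left_le_one_le \<theta>(4) \<theta>5) auto
        finally have "\<theta> (fst z) * (\<nu> * n) \<le> q * (Cs * (\<nu> * X4 z) + 1)" by (simp add: distrib_left)
        from mult_left_mono[OF this, of "9 * B"] B0 show ?thesis by (simp add: M4_def q_def mult.assoc)
      qed
      also have "9 * B * C0 * (\<theta> (fst z) * (?i z * n)) \<le> M5 * (X5 z / a + a / \<nu> * ?i z)"
      proof -
        \<comment> \<open>In the layer the test gradient of order 1/\<nu> cancels the viscosity in
          front of the stress, so \<open>n\<close> itself has to be estimated: the weight
          \<open>a\<close> gives \<Lambda>/a from the layer gradient, and a/\<nu> times a volume of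
          order \<nu>.\<close>
        have "n \<le> Cs * (\<nu> * (norm (nab z))\<^sup>2 / a + a / \<nu>)"
          using ng mult_left_mono[OF mult_le_weighted_squares[OF \<nu>(1) a, of "norm (nab z)"] Cs] by linarith
        then have "?i z * n \<le> ?i z * (Cs * (\<nu> * (norm (nab z))\<^sup>2 / a + a / \<nu>))" by (intro mult_left_mono) auto
        moreover have "\<theta> (fst z) * (?i z * n) \<le> ?i z * n" using n0 by (intro mult_left_le_one_le \<theta>(4) \<theta>5) auto
        ultimately have "\<theta> (fst z) * (?i z * n) \<le> Cs * (X5 z / a + a / \<nu> * ?i z)"
          by (simp add: X5_def algebra_simps)
        from mult_left_mono[OF this, of "9 * B * C0"] B0 C0 show ?thesis by (simp add: M5_def mult.assoc)
      qed
      finally show ?thesis by simp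
    qed
    show ?thesis
      unfolding split Y_def using b1 b2 b3 by (simp add: distrib_right)
  qed
  have iX1: "integrable (lebesgue_on Q) X1" unfolding X1_def[abs_def] by (rule energy_weighted(1)[OF d\<theta>c(2) d\<theta>0])
  have iX2: "integrable (lebesgue_on Q) X2" unfolding X2_def[abs_def] by (rule integral_time_layer(1)[OF Wprops(1) W\<Omega> d\<theta>c(2) d\<theta>0])
  have iX3: "integrable (lebesgue_on Q) X3" unfolding X3_def[abs_def] by (rule layer_bounds(1)[OF Wprops(1,2) c L])
  have iX4: "integrable (lebesgue_on Q) X4" unfolding X4_def[abs_def] by (rule dissipation_bound(1)[OF \<theta>c \<theta>(4,5) s])
  have iX5: "integrable (lebesgue_on Q) X5" unfolding X5_def[abs_def] by (rule layer_bounds(2)[OF Wprops(1,2) c L])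
  have i1: "integrable (lebesgue_on Q) ?i"
    using integral_time_layer(1)[OF Wprops(1) W\<Omega> continuous_on_const[of UNIV 1]] by simp
  have Ld\<theta>: "(LINT t|lebesgue_on {0<..<T}. - d\<theta> t) = 1"
  proof -
    have "(LINT t|lebesgue_on {0<..<T}. d\<theta> t) = \<theta> T - \<theta> 0"
    proof (rule LINT_FTC)
      fix t
      have d: "(\<theta> has_derivative frechet_derivative \<theta> (at t)) (at t)" by (rule smooth_in_has_derivative[OF \<theta>(1)]) simp
      have "frechet_derivative \<theta> (at t) h = d\<theta> t * h" for h
        using linear_scale[OF has_derivative_linear[OF d], of h 1] by (simp add: d\<theta>_def)
      then have "frechet_derivative \<theta> (at t) = (*) (d\<theta> t)" by (rule ext)
      from has_derivative_eq_rhs[OF d this] show "(\<theta> has_real_derivative d\<theta> t) (at t)"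
        by (simp add: has_field_derivative_def)
    qed (use T continuous_on_subset[OF d\<theta>c(1)] in auto)
    then show ?thesis using \<theta> by simp
  qed
  have LX1: "(LINT z|lebesgue_on Q. X1 z) \<le> E0"
    using energy_weighted(2)[OF d\<theta>c(2) d\<theta>0] unfolding Ld\<theta> X1_def mult_1_right .
  have LX2: "(LINT z|lebesgue_on Q. X2 z) \<le> C0 * \<nu>"
    unfolding X2_def integral_time_layer(2)[OF Wprops(1) W\<Omega> d\<theta>c(2) d\<theta>0] Ld\<theta> using Wprops(3) by simp
  have LX3: "(LINT z|lebesgue_on Q. X3 z) \<le> c\<^sup>2 * \<Lambda>" unfolding X3_def by (rule layer_bounds(3)[OF Wprops(1,2) c L])
  have LX4: "\<nu> * (LINT z|lebesgue_on Q. X4 z) \<le> E0" unfolding X4_def by (rule dissipation_bound(2)[OF \<theta>c \<theta>(4,5) s])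
  have LX5: "(LINT z|lebesgue_on Q. X5 z) \<le> \<Lambda>" unfolding X5_def by (rule layer_bounds(4)[OF Wprops(1,2) c L])
  have Li: "(LINT z|lebesgue_on Q. ?i z) \<le> T * (C0 * \<nu>)"
  proof -
    have "(LINT z|lebesgue_on Q. ?i z) = (LINT t|lebesgue_on {0<..<T}. 1) * measure lebesgue W"
      using integral_time_layer(2)[OF Wprops(1) W\<Omega> continuous_on_const[of UNIV 1]] by simp
    also have "(LINT t|lebesgue_on {0<..<T}. 1::real) = T"
      using LINT_FTC[of T "\<lambda>t. t" "\<lambda>_. 1"] T by simp
    finally show ?thesis using mult_left_mono[OF Wprops(3), of T] T by simp
  qed
  have iY: "integrable (lebesgue_on Q) Y"
    unfolding Y_def[abs_def]
    by (intro Bochner_Integration.integrable_add Bochner_Integration.integrable_diff integrable_mult_right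
        integrable_divide_zero iX1 iX2 iX3 iX4 iX5 i1 IIc IIm IIp IId finQ.integrable_const impI)
  have LY: "(LINT z|lebesgue_on Q. Y z) = (1 + B * a) * (LINT z|lebesgue_on Q. X1 z) -
      ((LINT z|lebesgue_on Q. Ic z) - (LINT z|lebesgue_on Q. Im z) + (LINT z|lebesgue_on Q. Ip z) + (LINT z|lebesgue_on Q. Id z)) +
      C1 * ((LINT z|lebesgue_on Q. ?i z) + (LINT z|lebesgue_on Q. X3 z)) + B * A * (LINT z|lebesgue_on Q. X2 z) +
      M4 * (Cs * (\<nu> * (LINT z|lebesgue_on Q. X4 z)) + measure lebesgue Q) +
      M5 * ((LINT z|lebesgue_on Q. X5 z) / a + a / \<nu> * (LINT z|lebesgue_on Q. ?i z))"
  proof -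
    have ms: "measure (lebesgue_on Q) Q = measure lebesgue Q"
      using Q_lmeasurable by (simp add: measure_restrict_space)
    show ?thesis
      unfolding Y_def using iX1 iX2 iX3 iX4 iX5 i1 IIc IIm IIp IId by (simp add: ms)
  qed
  have irel: "integrable (lebesgue_on Q) (\<lambda>z. (- d\<theta> (fst z) - C1 * \<theta> (fst z)) * rel z)"
    by (rule integrable_time_times[OF _ rel_integrable]) (intro continuous_on_diff d\<theta>c(2) continuous_on_mult_left \<theta>c)
  have "(LINT z|lebesgue_on Q. (- d\<theta> (fst z) - C1 * \<theta> (fst z)) * rel z) \<le> (LINT z|lebesgue_on Q. Y z)"
  proof (rule integral_mono_AE[OF irel iY])
    have "AE z in lebesgue_on Q. z \<in> Q" by (rule AE_I2) simp
    with dens_nonneg show "AE z in lebesgue_on Q. (- d\<theta> (fst z) - C1 * \<theta> (fst z)) * rel z \<le> Y z"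
      by eventually_elim (rule pointwise)
  qed
  also have "\<dots> \<le> E0_rel + 2 * (B * (a * E0 + A * (C0 * \<nu>))) + C1 * (T * (C0 * \<nu>) + c\<^sup>2 * \<Lambda>) +
    M4 * (Cs * E0 + measure lebesgue Q) + M5 * (\<Lambda> / a + a * (T * C0))"
  proof -
    have t0: "0 \<in> {0..T}" using T by simp
    \<comment> \<open>At time 0 the identities reproduce the relative initial energy except for the
      cutoff on the momentum, which \<open>initial_layer_estimate\<close> removes.\<close>
    have e: "E0_rel = E0 - (LINT x|lebesgue_on \<Omega>. (\<rho>0 x *\<^sub>R u0 x) \<bullet> V (0, x)) + (LINT x|lebesgue_on \<Omega>. \<rho>0 x * fE (0, x)) + (LINT x|lebesgue_on \<Omega>. pE (0, x))"
      using rel_density_integrable(2)[OF t0 data_integrable(4,6,8)] by (simp add: E0_rel_def E0_def energy_eq)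
    have "(LINT x|lebesgue_on \<Omega>. (\<rho>0 x *\<^sub>R u0 x) \<bullet> V (0, x)) - (LINT x|lebesgue_on \<Omega>. \<rho>0 x * (\<xi> x * (u0 x \<bullet> V (0, x)))) \<le>
        B * (a * E0 + A * measure lebesgue W)"
      by (rule initial_layer_estimate[OF \<xi> Wprops(1) W\<Omega> off(1) B0 BV a A(2)])
    also have "\<dots> \<le> B * (a * E0 + A * (C0 * \<nu>))"
      using Wprops(3) by (intro mult_left_mono add_left_mono A(1) B0)
    finally have i0: "(LINT x|lebesgue_on \<Omega>. (\<rho>0 x *\<^sub>R u0 x) \<bullet> V (0, x)) - (LINT x|lebesgue_on \<Omega>. \<rho>0 x * (\<xi> x * (u0 x \<bullet> V (0, x)))) \<le>
        B * (a * E0 + A * (C0 * \<nu>))" .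
    have t1: "(1 + B * a) * (LINT z|lebesgue_on Q. X1 z) \<le> E0 + B * (a * E0)"
      using mult_left_mono[OF LX1, of "1 + B * a"] B0 a by (simp add: algebra_simps)
    have t2: "B * A * (LINT z|lebesgue_on Q. X2 z) \<le> B * (A * (C0 * \<nu>))"
      using mult_left_mono[OF LX2, of "B * A"] B0 A(1) by (simp add: mult.assoc)
    have t3: "C1 * ((LINT z|lebesgue_on Q. ?i z) + (LINT z|lebesgue_on Q. X3 z)) \<le> C1 * (T * (C0 * \<nu>) + c\<^sup>2 * \<Lambda>)"
      using Li LX3 C1 by (intro mult_left_mono add_mono) auto
    have t4: "M4 * (Cs * (\<nu> * (LINT z|lebesgue_on Q. X4 z)) + measure lebesgue Q) \<le> M4 * (Cs * E0 + measure lebesgue Q)"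
      by (intro mult_left_mono add_right_mono LX4 Cs M45)
    have t5: "M5 * ((LINT z|lebesgue_on Q. X5 z) / a + a / \<nu> * (LINT z|lebesgue_on Q. ?i z)) \<le> M5 * (\<Lambda> / a + a * (T * C0))"
    proof (intro mult_left_mono add_mono M45)
      show "(LINT z|lebesgue_on Q. X5 z) / a \<le> \<Lambda> / a" using LX5 a by (intro divide_right_mono) auto
      have "a / \<nu> * (LINT z|lebesgue_on Q. ?i z) \<le> a / \<nu> * (T * (C0 * \<nu>))" using Li a \<nu> by (intro mult_left_mono) auto
      then show "a / \<nu> * (LINT z|lebesgue_on Q. ?i z) \<le> a * (T * C0)" using \<nu> by simp
    qed
    show ?thesis
      unfolding LY LIc LIm LIp LId e using i0 t1 t2 t3 t4 t5 by (simp only: distrib_left)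
  qed
  finally show ?thesis by (simp add: M4_def M5_def)
qed

end

section \<open>Gronwall's argument, from weighted averages in time to single times\<close>

context ns_flow
begin

lemma rel_slice_integrable:
  assumes "t \<in> {0..T}"
  shows "integrable (lebesgue_on \<Omega>) (\<lambda>x. rel (t, x))"
  unfolding dens_def vel_def fst_conv snd_conv
  by (rule rel_density_integrable(1)[OF assms slice_integrable(1,3,5)[OF assms]])

lemma rel_slice_nonneg:
  assumes "t \<in> {0..T}"
  shows "AE x in lebesgue_on \<Omega>. 0 \<le> rel (t, x)"
proof -
  have "AE x in lebesgue_on \<Omega>. x \<in> \<Omega>" by (rule AE_I2) simp
  with slice_nonneg[OF assms] show ?thesis
  proof eventually_elim
    case (elim x)
    have "(t, x) \<in> N" using elim assms N closure_subset[of \<Omega>] by blast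
    then have "0 \<le> R (t, x)" using Rpos[of "(t, x)"] by simp
    then show ?case using elim by (intro rel_density_nonneg[OF \<gamma>]) (auto simp: dens_def)
  qed
qed

text \<open>Tonelli turns the weighted integral over the cylinder into one over time slices, each of
  which carries at least \<open>X\<close> wherever the weight is not zero.\<close>

lemma rel_weighted_ge:
  assumes k: "continuous_on UNIV k" "\<And>t. 0 \<le> k t"
    and X: "0 \<le> X" "\<And>t. t \<in> {0<..<T} \<Longrightarrow> k t \<noteq> 0 \<Longrightarrow> X \<le> rel_E t"
  shows "X * (LINT t|lebesgue_on {0<..<T}. k t) \<le> (LINT z|lebesgue_on Q. k (fst z) * rel z)"
proof -
  have int: "integrable (lebesgue_on Q) (\<lambda>z. k (fst z) * rel z)"
    by (rule integrable_time_times[OF k(1) rel_integrable])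
  have Qae: "AE z in lebesgue_on Q. z \<in> Q" by (rule AE_I2) simp
  have nn: "AE z in lebesgue_on Q. 0 \<le> k (fst z) * rel z"
    using dens_nonneg Qae
  proof eventually_elim
    case (elim z)
    have "0 \<le> R z" using Rpos[of z] Q_subset(2) elim by force
    then show ?case using elim k(2) by (intro mult_nonneg_nonneg rel_density_nonneg[OF \<gamma>]) auto
  qed
  have "ennreal (X * (LINT t|lebesgue_on {0<..<T}. k t)) = (\<integral>\<^sup>+t. ennreal (X * k t) \<partial>lebesgue_on {0<..<T})"
    using continuous_integrable_time[OF k(1)] k(2) X(1) by (subst nn_integral_eq_integral) auto
  also have "\<dots> \<le> (\<integral>\<^sup>+t. \<integral>\<^sup>+x. ennreal (k t * rel (t, x)) \<partial>lebesgue_on \<Omega> \<partial>lebesgue_on {0<..<T})"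
  proof (rule nn_integral_mono)
    fix t assume "t \<in> space (lebesgue_on {0<..<T})"
    then have t: "t \<in> {0<..<T}" "t \<in> {0..T}" by auto
    have i: "integrable (lebesgue_on \<Omega>) (\<lambda>x. k t * rel (t, x))"
      using rel_slice_integrable[OF t(2)] by (rule integrable_mult_right)
    have "X * k t \<le> k t * rel_E t"
    proof (cases "k t = 0")
      case False
      from mult_left_mono[OF X(2)[OF t(1) False] k(2)] show ?thesis by (simp add: mult.commute)
    qed simp
    also have "k t * rel_E t = (LINT x|lebesgue_on \<Omega>. k t * rel (t, x))"
      by (simp add: rel_E_def dens_def vel_def)
    finally have "ennreal (X * k t) \<le> ennreal (LINT x|lebesgue_on \<Omega>. k t * rel (t, x))" by (rule ennreal_leI)
    also have "\<dots> = (\<integral>\<^sup>+x. ennreal (k t * rel (t, x)) \<partial>lebesgue_on \<Omega>)"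
    proof (rule nn_integral_eq_integral[OF i, symmetric])
      show "AE x in lebesgue_on \<Omega>. 0 \<le> k t * rel (t, x)"
        using rel_slice_nonneg[OF t(2)] by eventually_elim (use k(2) in simp)
    qed
    finally show "ennreal (X * k t) \<le> (\<integral>\<^sup>+x. ennreal (k t * rel (t, x)) \<partial>lebesgue_on \<Omega>)" .
  qed
  also have "\<dots> = (\<integral>\<^sup>+z. ennreal (k (fst z) * rel z) \<partial>lebesgue_on Q)"
    unfolding Q_def
    using nn_integral_lebesgue_on_Times[OF open_greaterThanLessThan open_\<Omega>,
        of "\<lambda>z. ennreal (k (fst z) * rel z)" 0 T] borel_measurable_integrable[OF int]
    by (simp add: Q_def)
  also have "\<dots> = ennreal (LINT z|lebesgue_on Q. k (fst z) * rel z)"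
    by (rule nn_integral_eq_integral[OF int nn])
  finally show ?thesis
    using integral_nonneg_AE[OF nn] by (simp add: ennreal_le_iff)
qed

text \<open>Choose \<theta>(t) = exp(-C1 t) w(t), where w falls smoothly from 1 to 0 in a window
  around \<tau>. The exponential cancels the Gronwall term and leaves the weight -exp(-C1 t) w'(t),
  which is nonnegative, lives in the window and has mass at least exp(-C1 T). Lower semicontinuity
  bounds the relative energy in the window from below by its value at \<tau> up to e, so the
  integral bound becomes a bound at \<tau> itself.\<close>

lemma rel_E_le_of_weighted:
  assumes \<tau>: "\<tau> \<in> {0<..<T}" and C1: "0 \<le> C1" and X: "0 \<le> X"
    and est: "\<And>\<theta> s. smooth_in UNIV \<theta> \<Longrightarrow> \<theta> 0 = 1 \<Longrightarrow> \<theta> T = 0 \<Longrightarrow> (\<And>t. 0 \<le> \<theta> t) \<Longrightarrow>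
      (\<And>t. t \<in> {0<..<T} \<Longrightarrow> \<theta> t \<le> 1) \<Longrightarrow> (\<And>t. frechet_derivative \<theta> (at t) 1 \<le> 0) \<Longrightarrow>
      s < T \<Longrightarrow> (\<And>t. s \<le> t \<Longrightarrow> \<theta> t = 0) \<Longrightarrow>
      (LINT z|lebesgue_on Q. (- frechet_derivative \<theta> (at (fst z)) 1 - C1 * \<theta> (fst z)) * rel z) \<le> X"
  shows "rel_E \<tau> \<le> exp (C1 * T) * X"
proof (rule field_le_epsilon)
  fix e :: real assume e: "0 < e"
  show "rel_E \<tau> \<le> exp (C1 * T) * X + e"
  proof (cases "rel_E \<tau> - e \<le> 0")
    case True
    moreover have "0 \<le> exp (C1 * T) * X" using X by simp
    ultimately show ?thesis by linarith
  next
    case False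
    have \<tau>': "\<tau> \<in> {0..T}" using \<tau> by auto
    obtain d where d: "0 < d" "\<And>t. t \<in> {0..T} \<Longrightarrow> dist t \<tau> < d \<Longrightarrow> rel_E \<tau> - e \<le> rel_E t"
      by (rule rel_E_lsc[OF \<tau>' e], rule that)
    \<comment> \<open>The window of half-width \<open>h\<close> lies in (0, T) and in the
      neighbourhood given by lower semicontinuity; it ends before T, as the estimate assumed in
      \<open>est\<close> requires of \<open>s\<close>.\<close>
    obtain h where h: "0 < h" "h < d" "h < \<tau>" "\<tau> + h < T"
    proof -
      have "0 < min d (min \<tau> (T - \<tau>))" using d(1) \<tau> by simp
      from dense[OF this] obtain h where "0 < h" "h < min d (min \<tau> (T - \<tau>))" by blast
      then show thesis by (intro that[of h]) auto
    qed
    obtain \<zeta> :: "real \<Rightarrow> real" where \<zeta>: "smooth_in UNIV \<zeta>" "mono \<zeta>" "\<And>x. 0 \<le> \<zeta> x" "\<And>x. \<zeta> x \<le> 1"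
      "\<And>x. x \<le> 1 \<Longrightarrow> \<zeta> x = 0" "\<And>x. 2 \<le> x \<Longrightarrow> \<zeta> x = 1"
      by (rule smooth_step, rule that)
    \<comment> \<open>The affine argument maps \<tau> - h to 1 and \<tau> + h to 2, the ends of the
      transition of \<open>\<zeta>\<close>.\<close>
    define w where "w t = 1 - \<zeta> (1 + (t - (\<tau> - h)) / (2 * h))" for t
    define g where "g t = - C1 * t" for t :: real
    define \<theta> where "\<theta> t = exp (g t) * w t" for t
    have lin: "smooth_in UNIV (\<lambda>t::real. a * t)" for a
      by (rule smooth_in_linear[OF open_UNIV bounded_linear_mult_right])
    have "smooth_in UNIV (\<lambda>t. 1 + (1 / (2 * h) * t + (- (\<tau> - h) / (2 * h))))"
      by (intro smooth_in_add smooth_in_const lin open_UNIV)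
    from smooth_in_diff[OF smooth_in_const[OF open_UNIV, of 1] smooth_in_compose_real[OF \<zeta>(1) this subset_UNIV]]
    have "smooth_in UNIV (\<lambda>t. 1 - \<zeta> (1 + (1 / (2 * h) * t + (- (\<tau> - h) / (2 * h)))))" .
    moreover have "1 / (2 * h) * t + (- (\<tau> - h) / (2 * h)) = (t - (\<tau> - h)) / (2 * h)" for t
      using h by (simp add: field_simps)
    ultimately have w: "smooth_in UNIV w" unfolding w_def[abs_def] by simp
    have g: "smooth_in UNIV g" unfolding g_def[abs_def] by (rule lin)
    have \<theta>: "smooth_in UNIV \<theta>" unfolding \<theta>_def[abs_def]
      by (rule smooth_in_mult[OF smooth_in_compose_real[OF smooth_in_exp g subset_UNIV] w])
    define w' where "w' t = frechet_derivative w (at t) 1" for t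
    have Dw: "(w has_real_derivative w' t) (at t)" for t
    proof -
      have D: "(w has_derivative frechet_derivative w (at t)) (at t)"
        by (rule smooth_in_has_derivative[OF w UNIV_I])
      have "frechet_derivative w (at t) s = w' t * s" for s
        using linear_scale[OF has_derivative_linear[OF D], of s 1] by (simp add: w'_def)
      then have "frechet_derivative w (at t) = (*) (w' t)" by (intro ext)
      with D show ?thesis unfolding has_field_derivative_def by metis
    qed
    have w'c: "continuous_on UNIV w'" unfolding w'_def[abs_def]
      by (rule smooth_in_continuous_on[OF smooth_in_frechet_derivative[OF w] subset_refl])
    have D\<theta>: "frechet_derivative \<theta> (at t) 1 = exp (g t) * w' t - C1 * \<theta> t" for t
    proof -
      have "(g has_real_derivative - C1) (at t)" unfolding g_def[abs_def]
        using DERIV_cmult[OF DERIV_ident, of "- C1" t] by simp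
      from DERIV_mult[OF DERIV_chain2[OF DERIV_exp this] Dw]
      have "(\<theta> has_real_derivative exp (g t) * - C1 * w t + w' t * exp (g t)) (at t)"
        unfolding \<theta>_def[abs_def] .
      from frechet_derivative_eqI[OF this[unfolded has_field_derivative_def]]
      show ?thesis by (simp add: \<theta>_def algebra_simps)
    qed
    have w0: "w t = 1" if "t \<le> \<tau> - h" for t
      using that h by (simp add: w_def \<zeta>(5) divide_le_0_iff)
    have w1: "w t = 0" if "\<tau> + h \<le> t" for t
    proof -
      have "1 \<le> (t - (\<tau> - h)) / (2 * h)" using that h by (simp add: le_divide_eq)
      then show ?thesis by (simp add: w_def \<zeta>(6))
    qed
    have w01: "0 \<le> w t" "w t \<le> 1" for t using \<zeta>(3,4) by (auto simp: w_def)
    have anti: "w y \<le> w x" if "x \<le> y" for x y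
    proof -
      have "1 + (x - (\<tau> - h)) / (2 * h) \<le> 1 + (y - (\<tau> - h)) / (2 * h)"
        using that h by (intro add_left_mono divide_right_mono) auto
      from monoD[OF \<zeta>(2) this] show ?thesis by (simp add: w_def)
    qed
    have w'le: "w' t \<le> 0" for t
    proof -
      have "mono_on UNIV (\<lambda>t. - w t)" using anti by (auto intro: mono_onI)
      from mono_on_imp_deriv_nonneg[OF this DERIV_minus[OF Dw]] show ?thesis by simp
    qed
    have w'0: "w' t = 0" if "t < \<tau> - h \<or> \<tau> + h < t" for t
      using that
    proof
      assume t: "t < \<tau> - h"
      have "((\<lambda>_. 1) has_real_derivative 0) (at t)" by simp
      then have "(w has_real_derivative 0) (at t)"
        by (rule has_field_derivative_transform_within_open[where S = "{..<\<tau> - h}"])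
          (use t w0 in auto)
      from DERIV_unique[OF Dw this] show ?thesis .
    next
      assume t: "\<tau> + h < t"
      have "((\<lambda>_. 0) has_real_derivative 0) (at t)" by simp
      then have "(w has_real_derivative 0) (at t)"
        by (rule has_field_derivative_transform_within_open[where S = "{\<tau> + h<..}"])
          (use t w1 in auto)
      from DERIV_unique[OF Dw this] show ?thesis .
    qed
    define k where "k t = exp (g t) * - w' t" for t
    have gc: "continuous_on UNIV (\<lambda>t. exp (g t))" unfolding g_def by (intro continuous_intros)
    have kc: "continuous_on UNIV k" unfolding k_def[abs_def]
      by (intro continuous_on_mult gc continuous_on_minus w'c)
    have k0: "0 \<le> k t" for t using w'le[of t] by (simp add: k_def mult_nonneg_nonpos)
    have key: "(rel_E \<tau> - e) * (LINT t|lebesgue_on {0<..<T}. k t) \<le> (LINT z|lebesgue_on Q. k (fst z) * rel z)"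
    proof (rule rel_weighted_ge[OF kc k0])
      fix t assume t: "t \<in> {0<..<T}" "k t \<noteq> 0"
      then have "\<not> (t < \<tau> - h \<or> \<tau> + h < t)" using w'0[of t] by (auto simp: k_def)
      then show "rel_E \<tau> - e \<le> rel_E t"
        using t h by (intro d(2)) (auto simp: dist_real_def)
    qed (use False in simp)
    have keq: "k t = - frechet_derivative \<theta> (at t) 1 - C1 * \<theta> t" for t by (simp add: D\<theta> k_def)
    have "(LINT z|lebesgue_on Q. k (fst z) * rel z) \<le> X"
      unfolding keq
    proof (rule est[OF \<theta>, of "\<tau> + h"])
      show "\<theta> 0 = 1" using w0[of 0] h by (simp add: \<theta>_def g_def)
      show "\<theta> T = 0" using w1[of T] h by (simp add: \<theta>_def)
      show "0 \<le> \<theta> t" for t using w01 by (simp add: \<theta>_def)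
      show "\<theta> t \<le> 1" if "t \<in> {0<..<T}" for t
        using w01[of t] that C1 unfolding \<theta>_def g_def by (intro mult_le_one) (auto simp: mult_nonneg_nonneg)
      show "frechet_derivative \<theta> (at t) 1 \<le> 0" for t
      proof -
        have "exp (g t) * w' t \<le> 0" using w'le by (intro mult_nonneg_nonpos) auto
        moreover have "0 \<le> C1 * \<theta> t" using C1 w01 by (simp add: \<theta>_def)
        ultimately show ?thesis by (simp add: D\<theta>)
      qed
      show "\<theta> t = 0" if "\<tau> + h \<le> t" for t using w1[OF that] by (simp add: \<theta>_def)
    qed (use h in simp)
    with key have le: "(rel_E \<tau> - e) * (LINT t|lebesgue_on {0<..<T}. k t) \<le> X" by linarith
    have "(LINT t|lebesgue_on {0<..<T}. w' t) = w T - w 0"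
      by (rule LINT_FTC) (use T Dw continuous_on_subset[OF w'c subset_UNIV] in auto)
    then have Iw: "(LINT t|lebesgue_on {0<..<T}. - w' t) = 1" using w0[of 0] w1[of T] h by simp
    \<comment> \<open>As -w' has mass one, the mass of the weight is at least its smallest
      exponential factor.\<close>
    have "exp (- C1 * T) = (LINT t|lebesgue_on {0<..<T}. exp (- C1 * T) * - w' t)"
      using Iw by (simp only: integral_mult_right_zero)
    also have "\<dots> \<le> (LINT t|lebesgue_on {0<..<T}. k t)"
    proof (rule integral_mono)
      show "integrable (lebesgue_on {0<..<T}) (\<lambda>t. exp (- C1 * T) * - w' t)"
        by (rule continuous_integrable_time) (intro continuous_on_mult continuous_on_const continuous_on_minus w'c)
      show "integrable (lebesgue_on {0<..<T}) k" by (rule continuous_integrable_time[OF kc])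
      fix t assume "t \<in> space (lebesgue_on {0<..<T})"
      then have "- C1 * T \<le> g t" using C1 by (auto simp: g_def intro: mult_left_mono)
      then show "exp (- C1 * T) * - w' t \<le> k t" unfolding k_def
        using w'le[of t] by (intro mult_right_mono) auto
    qed
    finally have "exp (- C1 * T) \<le> (LINT t|lebesgue_on {0<..<T}. k t)" .
    moreover have "0 \<le> rel_E \<tau> - e" using False by simp
    ultimately have "(rel_E \<tau> - e) * exp (- C1 * T) \<le> (rel_E \<tau> - e) * (LINT t|lebesgue_on {0<..<T}. k t)"
      by (rule mult_left_mono)
    with le have "(rel_E \<tau> - e) * exp (- C1 * T) \<le> X" by linarith
    from mult_left_mono[OF this, of "exp (C1 * T)"]
    have "(rel_E \<tau> - e) * (exp (C1 * T) * exp (- C1 * T)) \<le> exp (C1 * T) * X" by (simp add: mult_ac)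
    then show ?thesis by (simp add: exp_add[symmetric])
  qed
qed

end

subsection \<open>The vanishing viscosity limit\<close>

text \<open>Momentum is of lower order than the energy: Young's inequality for the velocity leaves a
  multiple of the density, and \<gamma> > 1 absorbs it in the internal energy up to a constant.
  \<open>A\<close> depends on \<open>a\<close> and \<gamma> only, hence not on the solution.\<close>

lemma mult_norm_le_energy_density:
  assumes \<gamma>: "1 < \<gamma>" and a: "0 < a"
  obtains A where "0 \<le> A" "\<And>b w. 0 \<le> b \<Longrightarrow> b * norm w \<le> a * energy_density \<gamma> b w + A"
proof -
  \<comment> \<open>Chosen so that (4/a) \<kappa> = a/(\<gamma> - 1), the admissible factor of the
    power of the density.\<close>
  define \<kappa> where "\<kappa> = a\<^sup>2 / (4 * (\<gamma> - 1))"
  have \<kappa>: "0 < \<kappa>" using assms by (simp add: \<kappa>_def)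
  define A where "A = 4 / a * \<kappa> powr (- 1 / (\<gamma> - 1))"
  show thesis
  proof (rule that)
    show "0 \<le> A" using a by (simp add: A_def)
    fix b :: real and w :: "real^3" assume b: "0 \<le> b"
    have "norm w \<le> a * (norm w)\<^sup>2 / 4 + 4 / a" by (rule mult_le_weighted_squares) (use a in auto)
    from mult_left_mono[OF this b] have 1: "b * norm w \<le> a / 2 * (1 / 2 * b * (norm w)\<^sup>2) + 4 / a * b"
      by (simp add: algebra_simps)
    have "4 / a * b \<le> 4 / a * (\<kappa> * b powr \<gamma> + \<kappa> powr (- 1 / (\<gamma> - 1)))"
      by (rule mult_left_mono[OF le_small_powr[OF \<gamma> \<kappa> b]]) (use a in simp)
    also have "\<dots> = a * (b powr \<gamma> / (\<gamma> - 1)) + A"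
      using a \<gamma> by (simp add: A_def \<kappa>_def field_simps power2_eq_square)
    finally have 2: "4 / a * b \<le> a * (b powr \<gamma> / (\<gamma> - 1)) + A" .
    have "0 \<le> a * (1 / 2 * b * (norm w)\<^sup>2)" using a b by simp
    with 1 2 show "b * norm w \<le> a * energy_density \<gamma> b w + A"
      unfolding energy_density_def distrib_left by linarith
  qed
qed

text \<open>Each \<open>x i\<close> is at most the full sum, so finitely many constants merge into
  one factor.\<close>

lemma weighted_sum_le:
  fixes e :: real
  assumes "0 \<le> e" "\<And>i. i \<in> I \<Longrightarrow> 0 \<le> k i" "\<And>i. i \<in> I \<Longrightarrow> 0 \<le> x i" "finite I"
  shows "e + (\<Sum>i\<in>I. k i * x i) \<le> (1 + sum k I) * (e + sum x I)"
proof -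
  have "(\<Sum>i\<in>I. k i * x i) \<le> (\<Sum>i\<in>I. k i * sum x I)"
    using assms by (intro sum_mono mult_left_mono member_le_sum) auto
  moreover have "(1 + sum k I) * (e + sum x I) = e + sum k I * sum x I + (sum x I + sum k I * e)"
    by (simp add: algebra_simps)
  moreover have "0 \<le> sum x I + sum k I * e" using assms by (intro add_nonneg_nonneg mult_nonneg_nonneg sum_nonneg) auto
  ultimately show ?thesis by (simp add: sum_distrib_right)
qed

context euler_flow
begin

text \<open>The total initial energy occurs in the error terms. This bound replaces it by one plus
  the relative initial energy, so that the constants become uniform in the viscosity.\<close>

lemma energy_density_le_rel_density:
  obtains K where "0 \<le> K" "\<And>z a w. z \<in> {0..T} \<times> closure \<Omega> \<Longrightarrow> 0 \<le> a \<Longrightarrow>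
    energy_density \<gamma> a w \<le> K * (1 + rel_density \<gamma> a w (R z) (V z))"
proof -
  obtain B where B: "1 \<le> B" "\<And>z. z \<in> {0..T} \<times> closure \<Omega> \<Longrightarrow> norm (V z) \<le> B"
    by (rule coefficient_bounds, rule that)
  have M0: "0 < M" using m mM by simp
  obtain C where C: "1 \<le> C" "\<And>a r. 0 \<le> a \<Longrightarrow> 0 \<le> r \<Longrightarrow> r \<le> M \<Longrightarrow> a powr \<gamma> \<le> C * (1 + rel_H \<gamma> a r)"
    by (rule powr_le_rel_H[OF \<gamma> M0], rule that)
  define K where "K = 2 + B\<^sup>2 + (B\<^sup>2 + 1 / (\<gamma> - 1)) * C"
  have q: "0 \<le> (B\<^sup>2 + 1 / (\<gamma> - 1)) * C" using C \<gamma> by simp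
  show thesis
  proof (rule that)
    show K0: "0 \<le> K" using q by (simp add: K_def)
    fix z and a :: real and w :: "real^3" assume z: "z \<in> {0..T} \<times> closure \<Omega>" and a: "0 \<le> a"
    have r: "0 \<le> R z" "R z \<le> M" using Rpos[of z] N z RM[OF z] by force+
    have H: "0 \<le> rel_H \<gamma> a (R z)" by (rule rel_H_nonneg[OF \<gamma> r(1) a])
    have "norm w \<le> norm (w - V z) + norm (V z)" using norm_triangle_ineq[of "w - V z" "V z"] by simp
    then have "(norm w)\<^sup>2 \<le> (norm (w - V z) + norm (V z))\<^sup>2" by (intro power_mono) auto
    also have "\<dots> \<le> 2 * (norm (w - V z))\<^sup>2 + 2 * (norm (V z))\<^sup>2"
      using sum_squares_ge_zero[of "norm (w - V z) - norm (V z)" 0] by (simp add: power2_eq_square algebra_simps)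
    also have "\<dots> \<le> 2 * (norm (w - V z))\<^sup>2 + 2 * B\<^sup>2"
      using B(2)[OF z] by (intro add_left_mono mult_left_mono power_mono) auto
    finally have "1 / 2 * a * (norm w)\<^sup>2 \<le> 1 / 2 * a * (2 * (norm (w - V z))\<^sup>2 + 2 * B\<^sup>2)"
      using a by (intro mult_left_mono) auto
    then have 1: "1 / 2 * a * (norm w)\<^sup>2 \<le> a * (norm (w - V z))\<^sup>2 + B\<^sup>2 * a" by (simp add: algebra_simps)
    have "a \<le> 1 + a powr \<gamma>"
      using le_small_powr[OF \<gamma>, of 1 a] a by simp
    then have 2: "B\<^sup>2 * a \<le> B\<^sup>2 + B\<^sup>2 * a powr \<gamma>" using mult_left_mono[of a "1 + a powr \<gamma>" "B\<^sup>2"] by (simp add: distrib_left)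
    have "(B\<^sup>2 + 1 / (\<gamma> - 1)) * a powr \<gamma> \<le> (B\<^sup>2 + 1 / (\<gamma> - 1)) * (C * (1 + rel_H \<gamma> a (R z)))"
      using C(2)[OF a r] \<gamma> by (intro mult_left_mono) auto
    then have 3: "B\<^sup>2 * a powr \<gamma> + a powr \<gamma> / (\<gamma> - 1) \<le> (B\<^sup>2 + 1 / (\<gamma> - 1)) * C * (1 + rel_H \<gamma> a (R z))"
      by (simp add: algebra_simps)
    define D where "D = rel_density \<gamma> a w (R z) (V z)"
    define S where "S = a * (norm (w - V z))\<^sup>2"
    define q where "q = (B\<^sup>2 + 1 / (\<gamma> - 1)) * C"
    have S: "0 \<le> S" using a by (simp add: S_def)
    have D: "2 * D = S + 2 * rel_H \<gamma> a (R z)" by (simp add: D_def S_def rel_density_def)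
    have "q * (1 + rel_H \<gamma> a (R z)) \<le> q * (1 + D)"
      using S D q by (intro mult_left_mono) (auto simp: q_def)
    moreover have "0 \<le> B\<^sup>2 * D" using S D H by simp
    moreover have "S \<le> 2 * D" using H D by linarith
    ultimately have "S + B\<^sup>2 + q * (1 + rel_H \<gamma> a (R z)) \<le> (2 + B\<^sup>2 + q) * (1 + D)"
      by (simp only: distrib_left distrib_right)
    with 1 2 3 show "energy_density \<gamma> a w \<le> K * (1 + rel_density \<gamma> a w (R z) (V z))"
      unfolding energy_density_def K_def S_def D_def q_def by linarith
  qed
qed

text \<open>The constant is fixed before the viscosity, the solution and the parameters
  \<open>a\<close>, \<open>A\<close>, \<Lambda>. These stay free because the final choice takes
  \<open>a\<close> small first, then \<open>A\<close> depending on it, and only then the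
  viscosity.\<close>

lemma relative_energy_uniform:
  assumes c: "0 < c" and \<mu>: "0 < \<mu>" and \<eta>: "0 \<le> \<eta>"
  obtains K where "0 \<le> K"
    "\<And>\<nu> \<rho>0 u0 \<rho> u a A \<Lambda> \<tau>. ns_flow \<Omega> \<gamma> T m M N R V \<mu> \<eta> \<nu> \<rho>0 u0 \<rho> u \<Longrightarrow> 0 < a \<Longrightarrow> 0 \<le> A \<Longrightarrow>
      (\<forall>b\<ge>0. \<forall>w. b * norm w \<le> a * energy_density \<gamma> b w + A) \<Longrightarrow>
      ns_flow.layer_integral \<Omega> T \<nu> \<rho> u c \<le> ennreal \<Lambda> \<Longrightarrow> 0 \<le> \<Lambda> \<Longrightarrow> \<tau> \<in> {0<..<T} \<Longrightarrow>
      ns_flow.rel_E \<Omega> \<gamma> R V \<rho> u \<tau> \<le> K * (ns_flow.E0_rel \<Omega> \<gamma> R V \<rho>0 u0 +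
        (a * (1 + ns_flow.E0_rel \<Omega> \<gamma> R V \<rho>0 u0) + A * \<nu> + \<nu> + \<Lambda> +
         sqrt \<nu> * (1 + ns_flow.E0_rel \<Omega> \<gamma> R V \<rho>0 u0) + \<Lambda> / a + a))"
proof -
  obtain C0 where C0: "0 < C0" "\<And>\<delta>. 0 < \<delta> \<Longrightarrow> \<exists>\<xi> W. layer_cutoff c C0 \<delta> \<xi> W"
    by (rule layer_cutoff_exists[OF c], rule that)
  obtain B where B: "1 \<le> B"
    "\<And>z. z \<in> {0..T} \<times> closure \<Omega> \<Longrightarrow> norm (V z) \<le> B"
    "\<And>z. z \<in> {0..T} \<times> closure \<Omega> \<Longrightarrow> \<bar>pE z\<bar> \<le> B"
    "\<And>z. z \<in> {0..T} \<times> closure \<Omega> \<Longrightarrow> \<bar>fE z\<bar> \<le> B"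
    "\<And>z. z \<in> {0..T} \<times> closure \<Omega> \<Longrightarrow> \<bar>trV z\<bar> \<le> B"
    "\<And>z w. z \<in> {0..T} \<times> closure \<Omega> \<Longrightarrow> norm (frechet_derivative V (at z) w) \<le> B * norm w"
    "\<And>z w. z \<in> {0..T} \<times> closure \<Omega> \<Longrightarrow> \<bar>frechet_derivative pE (at z) w\<bar> \<le> B * norm w"
    "\<And>z w. z \<in> {0..T} \<times> closure \<Omega> \<Longrightarrow> \<bar>frechet_derivative fE (at z) w\<bar> \<le> B * norm w"
    by (rule coefficient_bounds, rule that)
  have C0': "0 \<le> C0" using C0(1) by simp
  obtain C1 where C1: "0 < C1"
    and G1: "\<And>z a w. z \<in> {0<..<T} \<times> \<Omega> \<Longrightarrow> 0 \<le> a \<Longrightarrow> balance z a w 1 0 0 \<le> C1 * rel_density \<gamma> a w (R z) (V z)"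
    and G2: "\<And>z a w s dw dV \<delta>. z \<in> {0<..<T} \<times> \<Omega> \<Longrightarrow> 0 \<le> a \<Longrightarrow> 0 \<le> s \<Longrightarrow> s \<le> 1 \<Longrightarrow> 0 < \<delta> \<Longrightarrow> \<delta> \<le> 1 \<Longrightarrow>
      \<bar>dw\<bar> \<le> C0 / \<delta> * norm w \<Longrightarrow> \<bar>dV\<bar> \<le> C0 \<Longrightarrow>
      balance z a w s dw dV \<le> C1 * (1 + rel_density \<gamma> a w (R z) (V z) + a * (norm w)\<^sup>2 / \<delta>)"
    by (rule balance_bounds[OF C0'], rule that)
  obtain K0 where K0: "0 \<le> K0" "\<And>z a w. z \<in> {0..T} \<times> closure \<Omega> \<Longrightarrow> 0 \<le> a \<Longrightarrow>
      energy_density \<gamma> a w \<le> K0 * (1 + rel_density \<gamma> a w (R z) (V z))"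
    by (rule energy_density_le_rel_density, rule that)
  define G where "G = K0 * (1 + measure lebesgue \<Omega>)"
  define Cs where "Cs = 2 * \<mu> + 3 * \<eta>"
  define P where "P = measure lebesgue ({0<..<T} \<times> \<Omega>)"
  have P: "0 \<le> P" by (simp add: P_def)
  have G: "0 \<le> G" using K0 by (simp add: G_def)
  have Cs: "0 \<le> Cs" using \<mu> \<eta> by (simp add: Cs_def)
  have B0: "0 \<le> B" using B(1) by simp
  \<comment> \<open>The constants of the seven error terms, in the order of the list
    \<open>x\<close> below.\<close>
  define k where "k = (!) [2 * B * G, 2 * B * C0, C1 * (T * C0), C1 * c\<^sup>2, 9 * B * (Cs * G + P), 9 * B * C0 * Cs,
    9 * B * C0 * Cs * (T * C0)]"
  have lt7: "{..<7::nat} = {0, 1, 2, 3, 4, 5, 6}" by auto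
  have k0: "0 \<le> k i" if "i \<in> {..<7}" for i
    using that B0 G C0' C1 T Cs P unfolding lt7 by (auto simp: k_def)
  define K1 where "K1 = 1 + sum k {..<7}"
  have K1: "0 \<le> K1" using k0 unfolding K1_def by (intro add_nonneg_nonneg sum_nonneg) auto
  show thesis
  proof (rule that)
    show "0 \<le> exp (C1 * T) * K1" using K1 by simp
    fix \<nu> \<rho>0 u0 \<rho> u a A \<Lambda> \<tau>
    assume ns: "ns_flow \<Omega> \<gamma> T m M N R V \<mu> \<eta> \<nu> \<rho>0 u0 \<rho> u" and a: "0 < a" and A0: "0 \<le> A"
      "\<forall>b\<ge>0. \<forall>w. b * norm w \<le> a * energy_density \<gamma> b w + A"
      and L: "ns_flow.layer_integral \<Omega> T \<nu> \<rho> u c \<le> ennreal \<Lambda>" "0 \<le> \<Lambda>" and \<tau>: "\<tau> \<in> {0<..<T}"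
    have A: "0 \<le> A" "\<And>b w. 0 \<le> b \<Longrightarrow> b * norm w \<le> a * energy_density \<gamma> b w + A"
      using A0 by auto
    interpret ns: ns_flow \<Omega> \<gamma> T m M N R V \<mu> \<eta> \<nu> \<rho>0 u0 \<rho> u by (rule ns)
    note \<nu> = ns.\<nu>(1)
    obtain \<xi> W where LC: "layer_cutoff c C0 \<nu> \<xi> W" using C0(2)[OF \<nu>] by blast
    have t0: "0 \<in> {0..T}" using T by simp
    have rel0: "AE x in lebesgue_on \<Omega>. 0 \<le> rel_density \<gamma> (\<rho>0 x) (u0 x) (R (0, x)) (V (0, x)) \<and>
      energy_density \<gamma> (\<rho>0 x) (u0 x) \<le> K0 * (1 + rel_density \<gamma> (\<rho>0 x) (u0 x) (R (0, x)) (V (0, x)))"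
    proof -
      have "AE x in lebesgue_on \<Omega>. x \<in> \<Omega>" by (rule AE_I2) simp
      with ns.data_integrable(1) show ?thesis
      proof eventually_elim
        case (elim x)
        have z: "(0, x) \<in> {0..T} \<times> closure \<Omega>" using elim t0 closure_subset[of \<Omega>] by blast
        then have "0 \<le> R (0, x)" using Rpos[of "(0, x)"] N by force
        with K0(2)[OF z elim(1)] show ?case using elim(1) by (auto intro: rel_density_nonneg[OF \<gamma>])
      qed
    qed
    note reli = ns.rel_density_integrable(1)[OF t0 ns.data_integrable(4,6,8)]
    have E: "0 \<le> ns.E0_rel" unfolding ns.E0_rel_def
      by (rule integral_nonneg_AE, use rel0 in eventually_elim) simp
    have "ns.E0 \<le> (LINT x|lebesgue_on \<Omega>. K0 * (1 + rel_density \<gamma> (\<rho>0 x) (u0 x) (R (0, x)) (V (0, x))))"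
      unfolding ns.E0_def ns.energy_eq
    proof (rule integral_mono_AE[OF ns.data_integrable(8)])
      show "integrable (lebesgue_on \<Omega>) (\<lambda>x. K0 * (1 + rel_density \<gamma> (\<rho>0 x) (u0 x) (R (0, x)) (V (0, x))))"
        using reli by simp
    qed (use rel0 in eventually_elim, simp)
    also have "\<dots> = K0 * (measure lebesgue \<Omega> + ns.E0_rel)"
      using reli ns.\<Omega>_sets by (simp add: ns.E0_rel_def measure_restrict_space)
    also have "\<dots> \<le> K0 * ((1 + measure lebesgue \<Omega>) * (1 + ns.E0_rel))"
      using E K0(1) by (intro mult_left_mono) (auto simp: algebra_simps)
    finally have E0: "ns.E0 \<le> G * (1 + ns.E0_rel)" by (simp add: G_def)
    define X where "X = ns.E0_rel + 2 * (B * (a * ns.E0 + A * (C0 * \<nu>))) + C1 * (T * (C0 * \<nu>) + c\<^sup>2 * \<Lambda>) +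
      9 * B * sqrt \<nu> * (Cs * ns.E0 + P) + 9 * B * C0 * Cs * (\<Lambda> / a + a * (T * C0))"
    have X0: "0 \<le> X" unfolding X_def
      using E B0 a ns.E0_nonneg A(1) C0' \<nu> C1 T L(2) Cs P by simp
    have "ns.rel_E \<tau> \<le> exp (C1 * T) * X"
    proof (rule ns.rel_E_le_of_weighted[OF \<tau> less_imp_le[OF C1] X0])
      fix \<theta> :: "real \<Rightarrow> real" and s
      assume \<theta>: "smooth_in UNIV \<theta>" "\<theta> 0 = 1" "\<theta> T = 0" "\<And>t. 0 \<le> \<theta> t"
        "\<And>t. t \<in> {0<..<T} \<Longrightarrow> \<theta> t \<le> 1" "\<And>t. frechet_derivative \<theta> (at t) 1 \<le> 0"
        "s < T" "\<And>t. s \<le> t \<Longrightarrow> \<theta> t = 0"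
      show "(LINT z|lebesgue_on ns.Q. (- frechet_derivative \<theta> (at (fst z)) 1 - C1 * \<theta> (fst z)) *
          rel_density \<gamma> (ns.dens z) (ns.vel z) (R z) (V z)) \<le> X"
        unfolding X_def Cs_def P_def ns.Q_def[symmetric]
        by (rule ns.relative_energy_estimate[OF \<theta> LC c C0(1) B C1 G1 G2 a A L])
    qed
    also have "\<dots> \<le> exp (C1 * T) * (K1 * (ns.E0_rel +
        (a * (1 + ns.E0_rel) + A * \<nu> + \<nu> + \<Lambda> + sqrt \<nu> * (1 + ns.E0_rel) + \<Lambda> / a + a)))"
    proof (rule mult_left_mono)
      define x where "x = (!) [a * (1 + ns.E0_rel), A * \<nu>, \<nu>, \<Lambda>, sqrt \<nu> * (1 + ns.E0_rel), \<Lambda> / a, a]"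
      have x0: "0 \<le> x i" if "i \<in> {..<7}" for i
        using that a E A(1) \<nu> L(2) unfolding lt7 by (auto simp: x_def)
      have sums: "sum x {..<7} = a * (1 + ns.E0_rel) + A * \<nu> + \<nu> + \<Lambda> + sqrt \<nu> * (1 + ns.E0_rel) + \<Lambda> / a + a"
        "(\<Sum>i\<in>{..<7}. k i * x i) = 2 * B * G * (a * (1 + ns.E0_rel)) + 2 * B * C0 * (A * \<nu>) + C1 * (T * C0) * \<nu> +
          C1 * c\<^sup>2 * \<Lambda> + 9 * B * (Cs * G + P) * (sqrt \<nu> * (1 + ns.E0_rel)) + 9 * B * C0 * Cs * (\<Lambda> / a) +
          9 * B * C0 * Cs * (T * C0) * a"
        unfolding lt7 by (simp_all add: x_def k_def)
      have 1: "2 * (B * (a * ns.E0 + A * (C0 * \<nu>))) \<le> 2 * B * G * (a * (1 + ns.E0_rel)) + 2 * B * C0 * (A * \<nu>)"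
      proof -
        have "2 * B * a * ns.E0 \<le> 2 * B * a * (G * (1 + ns.E0_rel))"
          using E0 B0 a by (intro mult_left_mono) auto
        then show ?thesis by (simp add: algebra_simps)
      qed
      have 2: "9 * B * sqrt \<nu> * (Cs * ns.E0 + P) \<le> 9 * B * (Cs * G + P) * (sqrt \<nu> * (1 + ns.E0_rel))"
      proof -
        have "Cs * ns.E0 + P \<le> Cs * (G * (1 + ns.E0_rel)) + P * (1 + ns.E0_rel)"
          using E0 Cs P E by (intro add_mono mult_left_mono) (auto simp: algebra_simps)
        from mult_left_mono[OF this, of "9 * B * sqrt \<nu>"] show ?thesis using B0 \<nu> by (simp add: algebra_simps)
      qed
      have 3: "C1 * (T * (C0 * \<nu>) + c\<^sup>2 * \<Lambda>) = C1 * (T * C0) * \<nu> + C1 * c\<^sup>2 * \<Lambda>" by (simp add: algebra_simps)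
      have 4: "9 * B * C0 * Cs * (\<Lambda> / a + a * (T * C0)) = 9 * B * C0 * Cs * (\<Lambda> / a) + 9 * B * C0 * Cs * (T * C0) * a"
        by (simp add: algebra_simps)
      have "X \<le> ns.E0_rel + (\<Sum>i\<in>{..<7}. k i * x i)"
        unfolding X_def sums(2) using 1 2 3 4 by linarith
      also have "\<dots> \<le> K1 * (ns.E0_rel + sum x {..<7})"
        unfolding K1_def by (rule weighted_sum_le[OF E k0 x0]) auto
      finally show "X \<le> K1 * (ns.E0_rel + (a * (1 + ns.E0_rel) + A * \<nu> + \<nu> + \<Lambda> + sqrt \<nu> * (1 + ns.E0_rel) + \<Lambda> / a + a))"
        unfolding sums .
    qed simp
    finally show "ns.rel_E \<tau> \<le> exp (C1 * T) * K1 * (ns.E0_rel +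
        (a * (1 + ns.E0_rel) + A * \<nu> + \<nu> + \<Lambda> + sqrt \<nu> * (1 + ns.E0_rel) + \<Lambda> / a + a))"
      by (simp only: mult.assoc)
  qed
qed

end

section \<open>The relative energy compared with the norms of the theorem\<close>

context ns_flow
begin

text \<open>The slice is generic, as the comparison is needed both for the initial data and for the
  solution at later times.\<close>

context
  fixes t :: real and r :: "real^3 \<Rightarrow> real" and w :: "real^3 \<Rightarrow> real^3"
  assumes t: "t \<in> {0..T}" and nonneg: "AE x in lebesgue_on \<Omega>. 0 \<le> r x"
    and int: "integrable (lebesgue_on \<Omega>) r" "integrable (lebesgue_on \<Omega>) (\<lambda>x. r x *\<^sub>R w x)"
      "integrable (lebesgue_on \<Omega>) (\<lambda>x. r x * (norm (w x))\<^sup>2)"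
      "integrable (lebesgue_on \<Omega>) (\<lambda>x. energy_density \<gamma> (r x) (w x))"
begin

lemma slice_point: "AE x in lebesgue_on \<Omega>. 0 \<le> r x \<and> m \<le> R (t, x) \<and> R (t, x) \<le> M \<and> 0 \<le> rel_H \<gamma> (r x) (R (t, x))"
proof -
  have "AE x in lebesgue_on \<Omega>. x \<in> \<Omega>" by (rule AE_I2) simp
  with nonneg show ?thesis
  proof eventually_elim
    case (elim x)
    have z: "(t, x) \<in> {0..T} \<times> closure \<Omega>" using elim t closure_subset[of \<Omega>] by blast
    show ?case using elim Rm[OF z] RM[OF z] m by (auto intro: rel_H_nonneg[OF \<gamma>])
  qed
qed

lemma rel_slice_integrable': "integrable (lebesgue_on \<Omega>) (\<lambda>x. rel_density \<gamma> (r x) (w x) (R (t, x)) (V (t, x)))"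
  by (rule rel_density_integrable(1)[OF t int(1,2,4)])

lemma kinetic_integrable: "integrable (lebesgue_on \<Omega>) (\<lambda>x. r x * (norm (w x - V (t, x)))\<^sup>2)"
proof -
  have "integrable (lebesgue_on \<Omega>) (\<lambda>x. r x * (norm (w x))\<^sup>2 - 2 * ((r x *\<^sub>R w x) \<bullet> V (t, x)) + r x \<bullet> (V (t, x) \<bullet> V (t, x)))"
    by (intro Bochner_Integration.integrable_add Bochner_Integration.integrable_diff integrable_mult_right int
        slice_inner_integrable[OF t V int(2)] slice_inner_integrable[OF t smooth_in_inner[OF V V] int(1)])
  then show ?thesis
    by (simp add: power2_norm_eq_inner inner_diff inner_commute algebra_simps)
qed

lemma kinetic_le: "(LINT x|lebesgue_on \<Omega>. r x * (norm (w x - V (t, x)))\<^sup>2) \<le>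
    2 * (LINT x|lebesgue_on \<Omega>. rel_density \<gamma> (r x) (w x) (R (t, x)) (V (t, x)))"
proof -
  have "(LINT x|lebesgue_on \<Omega>. r x * (norm (w x - V (t, x)))\<^sup>2) \<le>
      (LINT x|lebesgue_on \<Omega>. 2 * rel_density \<gamma> (r x) (w x) (R (t, x)) (V (t, x)))"
    by (rule integral_mono_AE[OF kinetic_integrable integrable_mult_right[OF rel_slice_integrable']],
        use slice_point in eventually_elim) (simp add: rel_density_def)
  then show ?thesis by simp
qed

lemma powr_diff_le:
  assumes C: "0 \<le> C" "\<And>a r. 0 \<le> a \<Longrightarrow> m \<le> r \<Longrightarrow> r \<le> M \<Longrightarrow> \<bar>a - r\<bar> powr \<gamma> \<le> \<delta> + C * rel_H \<gamma> a r"
  shows "integrable (lebesgue_on \<Omega>) (\<lambda>x. \<bar>r x - R (t, x)\<bar> powr \<gamma>)"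
    and "(LINT x|lebesgue_on \<Omega>. \<bar>r x - R (t, x)\<bar> powr \<gamma>) \<le> \<delta> * measure lebesgue \<Omega> +
      C * (LINT x|lebesgue_on \<Omega>. rel_density \<gamma> (r x) (w x) (R (t, x)) (V (t, x)))"
proof -
  let ?rel = "\<lambda>x. rel_density \<gamma> (r x) (w x) (R (t, x)) (V (t, x))"
  have i: "integrable (lebesgue_on \<Omega>) (\<lambda>x. \<delta> + C * ?rel x)"
    using rel_slice_integrable' by simp
  have le: "AE x in lebesgue_on \<Omega>. \<bar>r x - R (t, x)\<bar> powr \<gamma> \<le> \<delta> + C * ?rel x"
    using slice_point
  proof eventually_elim
    case (elim x)
    have "C * rel_H \<gamma> (r x) (R (t, x)) \<le> C * ?rel x"
      using elim C(1) by (intro mult_left_mono) (auto simp: rel_density_def)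
    with C(2)[of "r x" "R (t, x)"] elim show ?case by simp
  qed
  have mR: "(\<lambda>x. R (t, x)) \<in> borel_measurable (lebesgue_on \<Omega>)" by (rule slice_measurable_bounded(1)[OF R t])
  show j: "integrable (lebesgue_on \<Omega>) (\<lambda>x. \<bar>r x - R (t, x)\<bar> powr \<gamma>)"
  proof (rule Bochner_Integration.integrable_bound[OF i])
    show "(\<lambda>x. \<bar>r x - R (t, x)\<bar> powr \<gamma>) \<in> borel_measurable (lebesgue_on \<Omega>)"
      using mR borel_measurable_integrable[OF int(1)] by measurable
    show "AE x in lebesgue_on \<Omega>. norm (\<bar>r x - R (t, x)\<bar> powr \<gamma>) \<le> norm (\<delta> + C * ?rel x)"
      using le by eventually_elim simp
  qed
  have "(LINT x|lebesgue_on \<Omega>. \<bar>r x - R (t, x)\<bar> powr \<gamma>) \<le> (LINT x|lebesgue_on \<Omega>. \<delta> + C * ?rel x)"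
    by (rule integral_mono_AE[OF j i le])
  also have "\<dots> = \<delta> * measure lebesgue \<Omega> + C * (LINT x|lebesgue_on \<Omega>. ?rel x)"
    using rel_slice_integrable' \<Omega>_sets by (simp add: measure_restrict_space)
  finally show "(LINT x|lebesgue_on \<Omega>. \<bar>r x - R (t, x)\<bar> powr \<gamma>) \<le> \<delta> * measure lebesgue \<Omega> + C * (LINT x|lebesgue_on \<Omega>. ?rel x)" .
qed

lemma relative_energy_le:
  assumes C: "0 \<le> C" "\<And>a r. 0 \<le> a \<Longrightarrow> m \<le> r \<Longrightarrow> r \<le> M \<Longrightarrow> rel_H \<gamma> a r \<le> \<delta> + C * \<bar>a - r\<bar> powr \<gamma>"
  shows "(LINT x|lebesgue_on \<Omega>. rel_density \<gamma> (r x) (w x) (R (t, x)) (V (t, x))) \<le>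
    1 / 2 * (LINT x|lebesgue_on \<Omega>. r x * (norm (w x - V (t, x)))\<^sup>2) + \<delta> * measure lebesgue \<Omega> +
    C * (LINT x|lebesgue_on \<Omega>. \<bar>r x - R (t, x)\<bar> powr \<gamma>)"
proof -
  let ?rel = "\<lambda>x. rel_density \<gamma> (r x) (w x) (R (t, x)) (V (t, x))"
  \<comment> \<open>This cruder comparison supplies the integrability of the power on the right-hand
    side.\<close>
  obtain C' where C': "0 \<le> C'" "\<And>a r. 0 \<le> a \<Longrightarrow> m \<le> r \<Longrightarrow> r \<le> M \<Longrightarrow> \<bar>a - r\<bar> powr \<gamma> \<le> 1 + C' * rel_H \<gamma> a r"
    by (rule powr_abs_diff_le_rel_H[OF \<gamma> m mM zero_less_one], rule that)
  note j = powr_diff_le(1)[OF C']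
  have i: "integrable (lebesgue_on \<Omega>) (\<lambda>x. 1 / 2 * (r x * (norm (w x - V (t, x)))\<^sup>2) + (\<delta> + C * \<bar>r x - R (t, x)\<bar> powr \<gamma>))"
    using kinetic_integrable j by simp
  have "(LINT x|lebesgue_on \<Omega>. ?rel x) \<le> (LINT x|lebesgue_on \<Omega>. 1 / 2 * (r x * (norm (w x - V (t, x)))\<^sup>2) + (\<delta> + C * \<bar>r x - R (t, x)\<bar> powr \<gamma>))"
  proof (rule integral_mono_AE[OF rel_slice_integrable' i], use slice_point in eventually_elim)
    case (elim x)
    then show ?case using C(2)[of "r x" "R (t, x)"] by (simp add: rel_density_def)
  qed
  also have "\<dots> = 1 / 2 * (LINT x|lebesgue_on \<Omega>. r x * (norm (w x - V (t, x)))\<^sup>2) + \<delta> * measure lebesgue \<Omega> +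
      C * (LINT x|lebesgue_on \<Omega>. \<bar>r x - R (t, x)\<bar> powr \<gamma>)"
    using kinetic_integrable j \<Omega>_sets by (simp add: measure_restrict_space)
  finally show ?thesis .
qed

end

end

text \<open>Three limits are chained: from norms of the initial deviation to the relative initial
  energy, then to the relative energy at all times by \<open>relative_energy_uniform\<close>, then
  back to norms. In each comparison the small additive error is fixed before its constant, and
  smallness of the viscosity is asked last.\<close>

lemma (in euler_flow) vanishing_viscosity_limit:
  assumes c: "0 < c" and \<mu>: "0 < \<mu>" and \<eta>: "0 \<le> \<eta>"
    and data: "\<And>\<nu>. \<nu> \<in> {0<..<1} \<Longrightarrow> finite_energy_data \<gamma> \<Omega> (\<rho>0 \<nu>) (u0 \<nu>)"
    and sol: "\<And>\<nu>. \<nu> \<in> {0<..<1} \<Longrightarrow> finite_energy_weak_solution \<gamma> \<mu> \<eta> \<nu> T \<Omega> (\<rho>0 \<nu>) (u0 \<nu>) (\<rho> \<nu>) (u \<nu>)"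
    and init: "((\<lambda>\<nu>. Lp_norm \<gamma> \<Omega> (\<lambda>x. \<rho>0 \<nu> x - R (0, x)) +
        (LINT x|lebesgue_on \<Omega>. \<rho>0 \<nu> x * (norm (u0 \<nu> x - V (0, x)))\<^sup>2)) \<longlongrightarrow> 0) (at_right 0)"
    and layer: "((\<lambda>\<nu>. ns_flow.layer_integral \<Omega> T \<nu> (\<rho> \<nu>) (u \<nu>) c) \<longlongrightarrow> 0) (at_right 0)"
  shows "((\<lambda>\<nu>. SUP t\<in>{0<..<T}. ennreal (Lp_norm \<gamma> \<Omega> (\<lambda>x. \<rho> \<nu> t x - R (t, x)) +
        (LINT x|lebesgue_on \<Omega>. \<rho> \<nu> t x * (norm (u \<nu> t x - V (t, x)))\<^sup>2))) \<longlongrightarrow> 0) (at_right 0)"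
proof -
  have ev: "\<forall>\<^sub>F \<nu> in at_right 0. \<nu> \<in> {0<..<1::real}"
    by (rule eventually_at_right_real) simp
  have ns: "ns_flow \<Omega> \<gamma> T m M N R V \<mu> \<eta> \<nu> (\<rho>0 \<nu>) (u0 \<nu>) (\<rho> \<nu>) (u \<nu>)" if "\<nu> \<in> {0<..<1}" for \<nu>
    using \<mu> \<eta> that data[OF that] sol[OF that]
    by (intro ns_flow.intro euler_flow_axioms ns_flow_axioms.intro) auto
  have t0: "0 \<in> {0..T}" using T by simp
  define kin0 where "kin0 \<nu> = (LINT x|lebesgue_on \<Omega>. \<rho>0 \<nu> x * (norm (u0 \<nu> x - V (0, x)))\<^sup>2)" for \<nu>
  define pow0 where "pow0 \<nu> = (LINT x|lebesgue_on \<Omega>. \<bar>\<rho>0 \<nu> x - R (0, x)\<bar> powr \<gamma>)" for \<nu>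
  define E where "E \<nu> = ns_flow.E0_rel \<Omega> \<gamma> R V (\<rho>0 \<nu>) (u0 \<nu>)" for \<nu>
  have pow0: "0 \<le> pow0 \<nu>" for \<nu> unfolding pow0_def by simp
  have kin0: "0 \<le> kin0 \<nu>" if "\<nu> \<in> {0<..<1}" for \<nu>
  proof -
    interpret ns: ns_flow \<Omega> \<gamma> T m M N R V \<mu> \<eta> \<nu> "\<rho>0 \<nu>" "u0 \<nu>" "\<rho> \<nu>" "u \<nu>" by (rule ns[OF that])
    show ?thesis unfolding kin0_def
      by (rule integral_nonneg_AE, use ns.data_integrable(1) in eventually_elim) simp
  qed
  have E0: "0 \<le> E \<nu>" if "\<nu> \<in> {0<..<1}" for \<nu>
  proof -
    interpret ns: ns_flow \<Omega> \<gamma> T m M N R V \<mu> \<eta> \<nu> "\<rho>0 \<nu>" "u0 \<nu>" "\<rho> \<nu>" "u \<nu>" by (rule ns[OF that])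
    show ?thesis unfolding E_def ns.E0_rel_def
      by (rule integral_nonneg_AE, use ns.slice_point[OF t0 ns.data_integrable(1,4,6,7,8)] in eventually_elim)
        (simp add: rel_density_def)
  qed
  have sum0: "((\<lambda>\<nu>. pow0 \<nu> powr (1 / \<gamma>) + kin0 \<nu>) \<longlongrightarrow> 0) (at_right 0)"
    using init by (simp add: Lp_norm_def pow0_def kin0_def)
  \<comment> \<open>For viscosities in (0, 1) both summands are nonnegative, so each of them is
    squeezed by the sum.\<close>
  have kin_lim: "(kin0 \<longlongrightarrow> 0) (at_right 0)"
    by (rule tendsto_sandwich[OF _ _ tendsto_const sum0]; use ev in eventually_elim) (use kin0 in auto)
  have Lp_lim: "((\<lambda>\<nu>. pow0 \<nu> powr (1 / \<gamma>)) \<longlongrightarrow> 0) (at_right 0)"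
    by (rule tendsto_sandwich[OF _ _ tendsto_const sum0]; use ev in eventually_elim) (use kin0 in auto)
  have "((\<lambda>\<nu>. (pow0 \<nu> powr (1 / \<gamma>)) powr \<gamma>) \<longlongrightarrow> 0) (at_right 0)"
    by (rule tendsto_zero_powrI[OF Lp_lim tendsto_const]) (use \<gamma> in auto)
  then have pow_lim: "(pow0 \<longlongrightarrow> 0) (at_right 0)"
    using \<gamma> pow0 by (simp add: powr_powr)
  have E_lim: "(E \<longlongrightarrow> 0) (at_right 0)"
  proof (rule order_tendstoI)
    fix y :: real assume y: "y < 0"
    show "\<forall>\<^sub>F \<nu> in at_right 0. y < E \<nu>"
      using ev by eventually_elim (rule less_le_trans[OF y E0])
  next
    fix e :: real assume e: "0 < e"
    \<comment> \<open>Half of \<open>e\<close> pays for the additive error integrated over the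
      domain; the summand 1 makes the denominator positive outright.\<close>
    define \<delta> where "\<delta> = e / (2 * (1 + measure lebesgue \<Omega>))"
    have \<delta>: "0 < \<delta>" using e by (simp add: \<delta>_def add_pos_nonneg)
    have "\<delta> * (1 + measure lebesgue \<Omega>) = e / 2"
      using add_pos_nonneg[of 1 "measure lebesgue \<Omega>"] by (simp add: \<delta>_def field_simps)
    then have \<delta>e: "\<delta> * measure lebesgue \<Omega> \<le> e / 2" using \<delta> by (simp add: distrib_left)
    obtain C where C: "0 \<le> C" "\<And>a r. 0 \<le> a \<Longrightarrow> m \<le> r \<Longrightarrow> r \<le> M \<Longrightarrow> rel_H \<gamma> a r \<le> \<delta> + C * \<bar>a - r\<bar> powr \<gamma>"
      by (rule rel_H_le_powr_abs_diff[OF \<gamma> m mM \<delta>], rule that)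
    have "((\<lambda>\<nu>. 1 / 2 * kin0 \<nu> + C * pow0 \<nu>) \<longlongrightarrow> 1 / 2 * 0 + C * 0) (at_right 0)"
      by (intro tendsto_intros kin_lim pow_lim)
    then have "\<forall>\<^sub>F \<nu> in at_right 0. 1 / 2 * kin0 \<nu> + C * pow0 \<nu> < e / 2"
      by (rule order_tendstoD(2)) (use e in simp)
    then show "\<forall>\<^sub>F \<nu> in at_right 0. E \<nu> < e" using ev
    proof eventually_elim
      case (elim \<nu>)
      interpret ns: ns_flow \<Omega> \<gamma> T m M N R V \<mu> \<eta> \<nu> "\<rho>0 \<nu>" "u0 \<nu>" "\<rho> \<nu>" "u \<nu>" by (rule ns[OF elim(2)])
      have "E \<nu> \<le> 1 / 2 * kin0 \<nu> + \<delta> * measure lebesgue \<Omega> + C * pow0 \<nu>"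
        unfolding E_def ns.E0_rel_def kin0_def pow0_def
        by (rule ns.relative_energy_le[OF t0 ns.data_integrable(1,4,6,7,8) C])
      then show ?case using elim(1) \<delta>e by linarith
    qed
  qed
  obtain K where K: "0 \<le> K"
    "\<And>\<nu> \<rho>0 u0 \<rho> u a A \<Lambda> \<tau>. ns_flow \<Omega> \<gamma> T m M N R V \<mu> \<eta> \<nu> \<rho>0 u0 \<rho> u \<Longrightarrow> 0 < a \<Longrightarrow> 0 \<le> A \<Longrightarrow>
      (\<forall>b\<ge>0. \<forall>w. b * norm w \<le> a * energy_density \<gamma> b w + A) \<Longrightarrow>
      ns_flow.layer_integral \<Omega> T \<nu> \<rho> u c \<le> ennreal \<Lambda> \<Longrightarrow> 0 \<le> \<Lambda> \<Longrightarrow> \<tau> \<in> {0<..<T} \<Longrightarrow>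
      ns_flow.rel_E \<Omega> \<gamma> R V \<rho> u \<tau> \<le> K * (ns_flow.E0_rel \<Omega> \<gamma> R V \<rho>0 u0 +
        (a * (1 + ns_flow.E0_rel \<Omega> \<gamma> R V \<rho>0 u0) + A * \<nu> + \<nu> + \<Lambda> +
         sqrt \<nu> * (1 + ns_flow.E0_rel \<Omega> \<gamma> R V \<rho>0 u0) + \<Lambda> / a + a))"
    by (rule relative_energy_uniform[OF c \<mu> \<eta>], rule that)
  have uniform: "\<forall>\<^sub>F \<nu> in at_right 0. \<forall>\<tau>\<in>{0<..<T}. ns_flow.rel_E \<Omega> \<gamma> R V (\<rho> \<nu>) (u \<nu>) \<tau> < e" if e: "0 < e" for e
  proof -
    \<comment> \<open>With the layer quantity bounded by \<Lambda> = a^2, the limit leaves the four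
      terms a, a^2, a^2/a and a, each at most \<open>a\<close>. The factor \<open>K\<close> in front
      makes 4 K a < e the requirement.\<close>
    define a where "a = min 1 (e / (4 * K + 4))"
    have a: "0 < a" "a \<le> 1" using e K(1) by (auto simp: a_def)
    have "a * (4 * K + 4) \<le> e"
      using mult_right_mono[of a "e / (4 * K + 4)" "4 * K + 4"] K(1) by (simp add: a_def)
    then have Ka: "K * (4 * a) < e" using a by (simp add: algebra_simps)
    obtain A where A: "0 \<le> A" "\<forall>b\<ge>0. \<forall>w. b * norm w \<le> a * energy_density \<gamma> b w + A"
      by (rule mult_norm_le_energy_density[OF \<gamma> a(1)]) (rule that, auto)
    have "\<forall>\<^sub>F \<nu> in at_right 0. ns_flow.layer_integral \<Omega> T \<nu> (\<rho> \<nu>) (u \<nu>) c < ennreal (a\<^sup>2)"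
      using layer by (rule order_tendstoD(2)) (use a in simp)
    moreover have "\<forall>\<^sub>F \<nu> in at_right 0. K * (E \<nu> +
        (a * (1 + E \<nu>) + A * \<nu> + \<nu> + a\<^sup>2 + sqrt \<nu> * (1 + E \<nu>) + a\<^sup>2 / a + a)) < e"
    proof (rule order_tendstoD(2))
      show "((\<lambda>\<nu>. K * (E \<nu> + (a * (1 + E \<nu>) + A * \<nu> + \<nu> + a\<^sup>2 + sqrt \<nu> * (1 + E \<nu>) + a\<^sup>2 / a + a))) \<longlongrightarrow>
          K * (0 + (a * (1 + 0) + A * 0 + 0 + a\<^sup>2 + sqrt 0 * (1 + 0) + a\<^sup>2 / a + a))) (at_right 0)"
        by (intro tendsto_intros E_lim)
      have "a\<^sup>2 / a = a" using a by (simp add: power2_eq_square)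
      moreover have "a\<^sup>2 \<le> a" using a by (simp add: power2_eq_square mult_left_le)
      ultimately have "K * (0 + (a * (1 + 0) + A * 0 + 0 + a\<^sup>2 + sqrt 0 * (1 + 0) + a\<^sup>2 / a + a)) \<le> K * (4 * a)"
        using K(1) by (intro mult_left_mono) auto
      then show "K * (0 + (a * (1 + 0) + A * 0 + 0 + a\<^sup>2 + sqrt 0 * (1 + 0) + a\<^sup>2 / a + a)) < e" using Ka by linarith
    qed
    ultimately show ?thesis using ev
    proof eventually_elim
      case (elim \<nu>)
      show ?case
      proof
        fix \<tau> assume \<tau>: "\<tau> \<in> {0<..<T}"
        show "ns_flow.rel_E \<Omega> \<gamma> R V (\<rho> \<nu>) (u \<nu>) \<tau> < e"
          using K(2)[OF ns[OF elim(3)] a(1) A less_imp_le[OF elim(1)] zero_le_power2 \<tau>] elim(2)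
          unfolding E_def by linarith
      qed
    qed
  qed
  show ?thesis
  proof (rule order_tendstoI)
    fix y :: ennreal assume y: "0 < y"
    obtain e :: real where e: "0 < e" "ennreal e < y"
    proof -
      obtain z where z: "0 < z" "z < y" using dense[OF y] by blast
      then show thesis by (cases z) (use that in auto)
    qed
    \<comment> \<open>An integral of at most \<open>s\<close> makes the norm at most e/2; the other
      half of \<open>e\<close> is for the kinetic part.\<close>
    define s where "s = (e / 2) powr \<gamma>"
    have s: "0 < s" "s powr (1 / \<gamma>) = e / 2" using e \<gamma> by (auto simp: s_def powr_powr)
    define \<delta> where "\<delta> = s / (2 * (1 + measure lebesgue \<Omega>))"
    have \<delta>: "0 < \<delta>" using s by (simp add: \<delta>_def add_pos_nonneg)
    have "\<delta> * (1 + measure lebesgue \<Omega>) = s / 2"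
      using add_pos_nonneg[of 1 "measure lebesgue \<Omega>"] by (simp add: \<delta>_def field_simps)
    then have \<delta>s: "\<delta> * measure lebesgue \<Omega> \<le> s / 2" using \<delta> by (simp add: distrib_left)
    obtain C where C: "0 \<le> C" "\<And>a r. 0 \<le> a \<Longrightarrow> m \<le> r \<Longrightarrow> r \<le> M \<Longrightarrow> \<bar>a - r\<bar> powr \<gamma> \<le> \<delta> + C * rel_H \<gamma> a r"
      by (rule powr_abs_diff_le_rel_H[OF \<gamma> m mM \<delta>], rule that)
    \<comment> \<open>The bound asked of the relative energy: twice it stays within e/2, and
      \<open>C\<close> times it within s/2.\<close>
    define d where "d = min (e / 4) (s / (2 * (C + 1)))"
    have d: "0 < d" using e(1) s(1) C(1) by (simp add: d_def)
    have "d \<le> s / (2 * (C + 1))" unfolding d_def by (rule min.cobounded2)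
    then have "d * (2 * (C + 1)) \<le> s" using C(1) by (subst (asm) pos_le_divide_eq) auto
    then have "2 * (C * d) \<le> s" using d unfolding distrib_left by (simp add: mult_ac)
    moreover have "d \<le> e / 4" unfolding d_def by (rule min.cobounded1)
    ultimately have Cd: "C * d \<le> s / 2" "2 * d \<le> e / 2" by auto
    show "\<forall>\<^sub>F \<nu> in at_right 0. (SUP t\<in>{0<..<T}. ennreal (Lp_norm \<gamma> \<Omega> (\<lambda>x. \<rho> \<nu> t x - R (t, x)) +
        (LINT x|lebesgue_on \<Omega>. \<rho> \<nu> t x * (norm (u \<nu> t x - V (t, x)))\<^sup>2))) < y"
      using uniform[OF d] ev
    proof eventually_elim
      case (elim \<nu>)
      interpret ns: ns_flow \<Omega> \<gamma> T m M N R V \<mu> \<eta> \<nu> "\<rho>0 \<nu>" "u0 \<nu>" "\<rho> \<nu>" "u \<nu>" by (rule ns[OF elim(2)])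
      have "(SUP t\<in>{0<..<T}. ennreal (Lp_norm \<gamma> \<Omega> (\<lambda>x. \<rho> \<nu> t x - R (t, x)) +
          (LINT x|lebesgue_on \<Omega>. \<rho> \<nu> t x * (norm (u \<nu> t x - V (t, x)))\<^sup>2))) \<le> ennreal e"
      proof (rule SUP_least, rule ennreal_leI)
        fix t assume t: "t \<in> {0<..<T}"
        then have t': "t \<in> {0..T}" by auto
        note slice = t' ns.slice_nonneg[OF t'] ns.slice_integrable(1,3,4,5)[OF t']
        have rel: "ns.rel_E t < d" using elim(1) t by blast
        have "(LINT x|lebesgue_on \<Omega>. \<bar>\<rho> \<nu> t x - R (t, x)\<bar> powr \<gamma>) \<le> \<delta> * measure lebesgue \<Omega> + C * ns.rel_E t"
          unfolding ns.rel_E_def by (rule ns.powr_diff_le(2)[OF slice C])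
        also have "C * ns.rel_E t \<le> C * d" using rel C(1) by (intro mult_left_mono) auto
        finally have "(LINT x|lebesgue_on \<Omega>. \<bar>\<rho> \<nu> t x - R (t, x)\<bar> powr \<gamma>) \<le> s" using \<delta>s Cd by linarith
        then have "Lp_norm \<gamma> \<Omega> (\<lambda>x. \<rho> \<nu> t x - R (t, x)) \<le> s powr (1 / \<gamma>)"
          unfolding Lp_norm_def real_norm_def using \<gamma> by (intro powr_mono2) auto
        moreover have "(LINT x|lebesgue_on \<Omega>. \<rho> \<nu> t x * (norm (u \<nu> t x - V (t, x)))\<^sup>2) \<le> 2 * ns.rel_E t"
          unfolding ns.rel_E_def by (rule ns.kinetic_le[OF slice])
        ultimately show "Lp_norm \<gamma> \<Omega> (\<lambda>x. \<rho> \<nu> t x - R (t, x)) +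
            (LINT x|lebesgue_on \<Omega>. \<rho> \<nu> t x * (norm (u \<nu> t x - V (t, x)))\<^sup>2) \<le> e"
          using s(2) rel Cd by linarith
      qed
      then show ?case using e(2) by (rule order_le_less_trans)
    qed
  qed simp
qed

text \<open>The positive infimum over the open cylinder carries over to the closed one by
  continuity. The neighbourhood is then shrunk to the open set where the extended density is
  positive, which still contains the closed cylinder.\<close>

lemma smooth_euler_flow:
  assumes domain: "smooth_bounded_domain \<Omega>" and \<gamma>: "1 < \<gamma>" and T: "0 < T"
    and euler: "smooth_euler_solution \<gamma> T \<Omega> \<rho>E uE"
    and pos: "0 < (INF (t, x)\<in>{0<..<T} \<times> \<Omega>. \<rho>E t x)"
  obtains m M N R V where "euler_flow \<Omega> \<gamma> T m M N R V"
    "\<And>t x. t \<in> {0..T} \<Longrightarrow> x \<in> closure \<Omega> \<Longrightarrow> R (t, x) = \<rho>E t x \<and> V (t, x) = uE t x"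
proof -
  let ?K = "{0..T} \<times> closure \<Omega>" and ?Q = "{0<..<T} \<times> \<Omega>"
  have \<Omega>: "open \<Omega>" "bounded \<Omega>" using domain by (auto simp: smooth_bounded_domain_def)
  have K: "compact ?K" using \<Omega> by (intro compact_Times) (auto simp: compact_closure)
  have QK: "?Q \<subseteq> ?K" using closure_subset[of \<Omega>] by auto
  have clQ: "closure ?Q = ?K" using T by (simp add: closure_Times)
  obtain N1 R where R: "smooth_in N1 R" "?K \<subseteq> N1" "\<And>z. z \<in> ?K \<Longrightarrow> R z = (\<lambda>(t, x). \<rho>E t x) z"
    using smooth_onE[of ?K "\<lambda>(t, x). \<rho>E t x"] euler unfolding smooth_euler_solution_def by metis
  obtain N2 V where V: "smooth_in N2 V" "?K \<subseteq> N2" "\<And>z. z \<in> ?K \<Longrightarrow> V z = (\<lambda>(t, x). uE t x) z"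
    using smooth_onE[of ?K "\<lambda>(t, x). uE t x"] euler unfolding smooth_euler_solution_def by metis
  have ext: "R (t, x) = \<rho>E t x \<and> V (t, x) = uE t x" if "t \<in> {0..T}" "x \<in> closure \<Omega>" for t x
    using R(3)[of "(t, x)"] V(3)[of "(t, x)"] that by simp
  define m where "m = (INF (t, x)\<in>?Q. \<rho>E t x)"
  have cont: "continuous_on ?K R" by (rule smooth_in_continuous_on[OF R(1,2)])
  obtain M where M: "\<And>z. z \<in> ?K \<Longrightarrow> norm (R z) \<le> M"
    by (rule smooth_in_bounded[OF R(1) K R(2)], rule that)
  have Req: "R z = (case z of (t, x) \<Rightarrow> \<rho>E t x)" if "z \<in> ?Q" for z using R(3)[of z] that QK by auto
  have mQ: "m \<le> R z" if "z \<in> ?Q" for z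
  proof -
    \<comment> \<open>A real infimum is a lower bound only for a set that is bounded below;
      compactness of the closed cylinder provides this.\<close>
    have "bdd_below ((\<lambda>(t, x). \<rho>E t x) ` ?Q)"
    proof (rule bdd_belowI2)
      fix w assume "w \<in> ?Q"
      then show "- M \<le> (\<lambda>(t, x). \<rho>E t x) w" using M[of w] Req[of w] QK by force
    qed
    then show ?thesis unfolding m_def Req[OF that] using that by (rule cINF_lower)
  qed
  have mK: "m \<le> R z" if "z \<in> ?K" for z
    by (rule continuous_ge_on_closure[of ?Q R]) (use cont that mQ in \<open>simp_all add: clQ\<close>)
  define N where "N = (N1 \<inter> R -` {0<..}) \<inter> N2"
  have oN: "open N" unfolding N_def
    using smooth_in_open[OF R(1)] smooth_in_open[OF V(1)] smooth_in_continuous_on[OF R(1) subset_refl]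
    by (intro open_Int continuous_open_preimage) auto
  have KN: "?K \<subseteq> N" using R(2) V(2) mK pos by (force simp: N_def m_def)
  have RN: "smooth_in N R" by (rule smooth_in_subset[OF R(1) oN]) (auto simp: N_def)
  have VN: "smooth_in N V" by (rule smooth_in_subset[OF V(1) oN]) (auto simp: N_def)
  have ev: "open {0<..<T}" by simp
  have eq: "\<And>s y. s \<in> {0<..<T} \<Longrightarrow> y \<in> \<Omega> \<Longrightarrow> \<rho>E s y = R (s, y) \<and> uE s y = V (s, y)"
    using ext closure_subset[of \<Omega>] by auto
  have "euler_flow \<Omega> \<gamma> T m M N R V"
  proof
    fix t x assume t: "t \<in> {0<..<T}" and x: "x \<in> \<Omega>"
    have z: "(t, x) \<in> N" using t x QK KN by blast
    have res: "mass_residual \<rho>E uE t x = 0" "momentum_residual \<gamma> \<rho>E uE t x = 0"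
      using euler t x by (auto simp: smooth_euler_solution_def)
    have p: "0 < R (t, x)" using z by (simp add: N_def)
    note e = euler_equations_pointwise[OF ev t \<Omega>(1) x smooth_in_has_derivative[OF RN z]
        smooth_in_has_derivative[OF VN z] eq p res]
    show "frechet_derivative R (at (t, x)) (1, 0) + frechet_derivative R (at (t, x)) (0, V (t, x)) +
        R (t, x) * trace (matrix (\<lambda>v. frechet_derivative V (at (t, x)) (0, v))) = 0"
      by (rule e(1))
    fix w
    show "R (t, x) * ((frechet_derivative V (at (t, x)) (1, 0) + frechet_derivative V (at (t, x)) (0, V (t, x))) \<bullet> w) +
        \<gamma> * R (t, x) powr (\<gamma> - 1) * frechet_derivative R (at (t, x)) (0, w) = 0"
      by (rule e(2))
  next
    fix t x assume tx: "t \<in> {0..T}" "x \<in> frontier \<Omega>"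
    then have "V (t, x) = uE t x" using ext[of t x] by (simp add: frontier_def)
    then show "V (t, x) \<bullet> outward_normal \<Omega> x = 0"
      using euler tx by (auto simp: smooth_euler_solution_def)
  next
    show "0 < R z" if "z \<in> N" for z using that by (simp add: N_def)
    show "0 < m" using pos by (simp add: m_def)
    show "R z \<le> M" if "z \<in> {0..T} \<times> closure \<Omega>" for z using M[OF that] by simp
  qed (use domain \<gamma> T RN VN KN mK in auto)
  then show thesis by (rule that[OF _ ext])
qed

theorem theorem3:
  fixes \<Omega> :: "(real^3) set"
    and \<gamma> \<mu> \<eta> c T :: real
    and \<rho>E :: "real \<Rightarrow> real^3 \<Rightarrow> real" and uE :: "real \<Rightarrow> real^3 \<Rightarrow> real^3"
    and \<rho>E0 :: "real^3 \<Rightarrow> real" and uE0 :: "real^3 \<Rightarrow> real^3"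
    and \<rho>0 :: "real \<Rightarrow> real^3 \<Rightarrow> real" and u0 :: "real \<Rightarrow> real^3 \<Rightarrow> real^3"
    and \<rho> :: "real \<Rightarrow> real \<Rightarrow> real^3 \<Rightarrow> real" and u :: "real \<Rightarrow> real \<Rightarrow> real^3 \<Rightarrow> real^3"
  assumes "smooth_bounded_domain \<Omega>"
    and "\<gamma> > 3/2" and "\<mu> > 0" and "\<eta> \<ge> 0" and "c > 0" and "T > 0"
    and "smooth_on (closure \<Omega>) \<rho>E0" and "smooth_on (closure \<Omega>) uE0"
    and "euler_compatible \<gamma> \<Omega> \<rho>E0 uE0"
    and "0 < (INF x\<in>\<Omega>. \<rho>E0 x)" and "bdd_above (\<rho>E0 ` \<Omega>)"
    and "smooth_euler_solution \<gamma> T \<Omega> \<rho>E uE"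
    and "\<forall>x\<in>closure \<Omega>. \<rho>E 0 x = \<rho>E0 x \<and> uE 0 x = uE0 x"
    and "0 < (INF (t, x)\<in>{0<..<T} \<times> \<Omega>. \<rho>E t x)"
    and "bdd_above ((\<lambda>(t, x). \<rho>E t x) ` ({0<..<T} \<times> \<Omega>))"
    and "\<And>\<epsilon>. \<epsilon> \<in> {0<..<1} \<Longrightarrow> finite_energy_data \<gamma> \<Omega> (\<rho>0 \<epsilon>) (u0 \<epsilon>)"
    and "\<And>\<epsilon>. \<epsilon> \<in> {0<..<1} \<Longrightarrow>
           finite_energy_weak_solution \<gamma> \<mu> \<eta> \<epsilon> T \<Omega> (\<rho>0 \<epsilon>) (u0 \<epsilon>) (\<rho> \<epsilon>) (u \<epsilon>)"
    and "((\<lambda>\<epsilon>. Lp_norm \<gamma> \<Omega> (\<lambda>x. \<rho>0 \<epsilon> x - \<rho>E0 x) +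
               (LINT x|lebesgue_on \<Omega>. \<rho>0 \<epsilon> x * (norm (u0 \<epsilon> x - uE0 x))\<^sup>2))
            \<longlongrightarrow> 0) (at_right 0)"
    and "((\<lambda>\<epsilon>. ennreal \<epsilon> *
               (\<integral>\<^sup>+ (t, x). ennreal
                  (\<rho> \<epsilon> t x * (norm (u \<epsilon> t x))\<^sup>2 / (bdist \<Omega> x)\<^sup>2 +
                   (\<rho> \<epsilon> t x)\<^sup>2 * (u \<epsilon> t x \<bullet> normal_ext \<Omega> x)\<^sup>2 / (bdist \<Omega> x)\<^sup>2 +
                   (norm (nabla_x T \<Omega> (u \<epsilon>) t x))\<^sup>2)
                \<partial>lebesgue_on ({0<..<T} \<times> boundary_layer \<Omega> (c * \<epsilon>))))
            \<longlongrightarrow> 0) (at_right 0)"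
  shows "((\<lambda>\<epsilon>. SUP t\<in>{0<..<T}. ennreal
             (Lp_norm \<gamma> \<Omega> (\<lambda>x. \<rho> \<epsilon> t x - \<rho>E t x) +
              (LINT x|lebesgue_on \<Omega>. \<rho> \<epsilon> t x * (norm (u \<epsilon> t x - uE t x))\<^sup>2)))
            \<longlongrightarrow> 0) (at_right 0)"
proof -
  note H = assms
  have \<gamma>: "1 < \<gamma>" using H(2) by simp
  obtain m M N R V where flow: "euler_flow \<Omega> \<gamma> T m M N R V"
    and ext: "\<And>t x. t \<in> {0..T} \<Longrightarrow> x \<in> closure \<Omega> \<Longrightarrow> R (t, x) = \<rho>E t x \<and> V (t, x) = uE t x"
    by (rule smooth_euler_flow[OF H(1) \<gamma> H(6) H(12) H(14)], rule that)
  interpret euler_flow \<Omega> \<gamma> T m M N R V by (rule flow)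
  have ext': "R (t, x) = \<rho>E t x" "V (t, x) = uE t x" if "t \<in> {0..T}" "x \<in> \<Omega>" for t x
    using ext[OF that(1)] that(2) closure_subset[of \<Omega>] by auto
  have ext0: "R (0, x) = \<rho>E0 x" "V (0, x) = uE0 x" if "x \<in> \<Omega>" for x
    using ext'[of 0 x] that H(6) H(13) closure_subset[of \<Omega>] by auto
  have Lp: "Lp_norm \<gamma> \<Omega> f = Lp_norm \<gamma> \<Omega> g" if "\<And>x. x \<in> \<Omega> \<Longrightarrow> f x = g x" for f g :: "real^3 \<Rightarrow> real"
    unfolding Lp_norm_def using that
    by (intro arg_cong[where f = "\<lambda>x. x powr (1 / \<gamma>)"] Bochner_Integration.integral_cong) auto
  have int: "(LINT x|lebesgue_on \<Omega>. f x) = (LINT x|lebesgue_on \<Omega>. g x)"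
    if "\<And>x. x \<in> \<Omega> \<Longrightarrow> f x = g x" for f g :: "real^3 \<Rightarrow> real"
    using that by (intro Bochner_Integration.integral_cong) auto
  \<comment> \<open>\<open>layer_integral\<close> lives in the locale \<open>ns_flow\<close>, so its
    defining equation is obtained from an interpretation, which requires \<epsilon> in (0, 1). The
    limit at zero sees only such values.\<close>
  have layer: "ns_flow.layer_integral \<Omega> T \<epsilon> (\<rho> \<epsilon>) (u \<epsilon>) c = ennreal \<epsilon> *
      (\<integral>\<^sup>+ (t, x). ennreal
         (\<rho> \<epsilon> t x * (norm (u \<epsilon> t x))\<^sup>2 / (bdist \<Omega> x)\<^sup>2 +
          (\<rho> \<epsilon> t x)\<^sup>2 * (u \<epsilon> t x \<bullet> normal_ext \<Omega> x)\<^sup>2 / (bdist \<Omega> x)\<^sup>2 +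
          (norm (nabla_x T \<Omega> (u \<epsilon>) t x))\<^sup>2)
       \<partial>lebesgue_on ({0<..<T} \<times> boundary_layer \<Omega> (c * \<epsilon>)))"
    if "\<epsilon> \<in> {0<..<1}" for \<epsilon>
  proof -
    interpret ns_flow \<Omega> \<gamma> T m M N R V \<mu> \<eta> \<epsilon> "\<rho>0 \<epsilon>" "u0 \<epsilon>" "\<rho> \<epsilon>" "u \<epsilon>"
      using H(3,4) that H(16,17)[OF that] by (intro ns_flow.intro flow ns_flow_axioms.intro) auto
    show ?thesis by (rule layer_integral_def)
  qed
  have ev: "\<forall>\<^sub>F \<epsilon> in at_right 0. \<epsilon> \<in> {0<..<1::real}"
    by (rule eventually_at_right_real) simp
  have "((\<lambda>\<epsilon>. SUP t\<in>{0<..<T}. ennreal (Lp_norm \<gamma> \<Omega> (\<lambda>x. \<rho> \<epsilon> t x - R (t, x)) +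
      (LINT x|lebesgue_on \<Omega>. \<rho> \<epsilon> t x * (norm (u \<epsilon> t x - V (t, x)))\<^sup>2))) \<longlongrightarrow> 0) (at_right 0)"
  proof (rule vanishing_viscosity_limit[OF H(5) H(3) H(4) H(16) H(17)])
    have "Lp_norm \<gamma> \<Omega> (\<lambda>x. \<rho>0 \<epsilon> x - R (0, x)) = Lp_norm \<gamma> \<Omega> (\<lambda>x. \<rho>0 \<epsilon> x - \<rho>E0 x)" for \<epsilon>
      by (rule Lp) (simp add: ext0)
    moreover have "(LINT x|lebesgue_on \<Omega>. \<rho>0 \<epsilon> x * (norm (u0 \<epsilon> x - V (0, x)))\<^sup>2) =
        (LINT x|lebesgue_on \<Omega>. \<rho>0 \<epsilon> x * (norm (u0 \<epsilon> x - uE0 x))\<^sup>2)" for \<epsilon>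
      by (rule int) (simp add: ext0)
    ultimately show "((\<lambda>\<epsilon>. Lp_norm \<gamma> \<Omega> (\<lambda>x. \<rho>0 \<epsilon> x - R (0, x)) +
        (LINT x|lebesgue_on \<Omega>. \<rho>0 \<epsilon> x * (norm (u0 \<epsilon> x - V (0, x)))\<^sup>2)) \<longlongrightarrow> 0) (at_right 0)"
      using H(18) by simp
    show "((\<lambda>\<epsilon>. ns_flow.layer_integral \<Omega> T \<epsilon> (\<rho> \<epsilon>) (u \<epsilon>) c) \<longlongrightarrow> 0) (at_right 0)"
      by (rule Lim_transform_eventually[OF H(19)], use ev in eventually_elim) (rule layer[symmetric])
  qed
  moreover have "(SUP t\<in>{0<..<T}. ennreal (Lp_norm \<gamma> \<Omega> (\<lambda>x. \<rho> \<epsilon> t x - R (t, x)) +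
      (LINT x|lebesgue_on \<Omega>. \<rho> \<epsilon> t x * (norm (u \<epsilon> t x - V (t, x)))\<^sup>2))) =
    (SUP t\<in>{0<..<T}. ennreal (Lp_norm \<gamma> \<Omega> (\<lambda>x. \<rho> \<epsilon> t x - \<rho>E t x) +
      (LINT x|lebesgue_on \<Omega>. \<rho> \<epsilon> t x * (norm (u \<epsilon> t x - uE t x))\<^sup>2)))" for \<epsilon>
  proof (rule SUP_cong[OF refl])
    fix t assume "t \<in> {0<..<T}"
    then have t: "t \<in> {0..T}" by simp
    have "Lp_norm \<gamma> \<Omega> (\<lambda>x. \<rho> \<epsilon> t x - R (t, x)) = Lp_norm \<gamma> \<Omega> (\<lambda>x. \<rho> \<epsilon> t x - \<rho>E t x)"
      by (rule Lp) (simp add: ext'[OF t])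
    moreover have "(LINT x|lebesgue_on \<Omega>. \<rho> \<epsilon> t x * (norm (u \<epsilon> t x - V (t, x)))\<^sup>2) =
        (LINT x|lebesgue_on \<Omega>. \<rho> \<epsilon> t x * (norm (u \<epsilon> t x - uE t x))\<^sup>2)"
      by (rule int) (simp add: ext'[OF t])
    ultimately show "ennreal (Lp_norm \<gamma> \<Omega> (\<lambda>x. \<rho> \<epsilon> t x - R (t, x)) +
        (LINT x|lebesgue_on \<Omega>. \<rho> \<epsilon> t x * (norm (u \<epsilon> t x - V (t, x)))\<^sup>2)) =
      ennreal (Lp_norm \<gamma> \<Omega> (\<lambda>x. \<rho> \<epsilon> t x - \<rho>E t x) +
        (LINT x|lebesgue_on \<Omega>. \<rho> \<epsilon> t x * (norm (u \<epsilon> t x - uE t x))\<^sup>2))" by simp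
  qed
  ultimately show ?thesis by simp
qed

end
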